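(* There are embeddings of Lie superalgebras $K(3)\subset\widehat{K(4)}\subset CK(6)$ such that, for every $u\in\mathbb C$: as a $\widehat{K(4)}$-module, $$T(u)=S^+(u)\oplus S^-(u)$$ (up to parity change of the summands), and, as $K(3)$-modules, $S^{\pm}(u)\simeq S(u)$ up to parity change.
   Context: All vector spaces are over $\mathbb C$; $D=t\frac{d}{dt}$; $\mathrm{Vir}=\mathrm{Der}\,\mathbb C[t,t^{-1}]=\{fD\}$. All algebras and modules below are graded by degree in $t$. $K(N)$, $N=2m$ or $2m+1$: $\mathrm{Grass}(N)=\bigoplus_k\mathrm{Grass}_k(N)$ is the Grassmann algebra on odd variables $\zeta_1,\eta_1,\dots,\zeta_m,\eta_m$ (and $\xi$ if $N=2m+1$) with Poisson superbracket determined by $[\zeta_i,\eta_i]=1$, $[\xi,\xi]=1$, other brackets of generators zero. $K(N;D)=\mathrm{Grass}(N)\otimes\mathbb C[t,t^{-1}]$, elements $a(f)=a\otimes f$, bracket for $a\in\mathrm{Grass}_k$, $b\in\mathrm{Grass}_l$: $[a(f),b(g)]=ab(\frac{2-k}2fD(g)-\frac{2-l}2gD(f))+[a,b](fg)$. $K(3)=K(3;D)$, $K(4)=[K(4;D),K(4;D)]$. $\mathrm{Vir}$ is embedded by $fD\mapsto1(f)$. For $K(3)$: $H=\mathbb C\zeta_1\eta_1$, $F=2\zeta_1\eta_1$. $\widehat{K(4)}=K(4)\oplus\mathbb Cc$, $c$ central, bracket $[x,y]+\psi(x,y)c$ with $\psi(a(t^n),b(t^m))=\frac{2-k}2\delta_{n+m,0}\mathrm{Tr}(ab)$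 for $a\in\mathrm{Grass}_k(4)$; $\mathrm{Tr}(\zeta_1\eta_1\zeta_2\eta_2)=1$, $\mathrm{Tr}=0$ on $\mathrm{Grass}_k$, $k\ne4$. $H=\mathbb C\zeta_1\eta_1\oplus\mathbb C\zeta_2\eta_2\oplus\mathbb Cc$, weights written $(\lambda_1,\lambda_2,\lambda_c)$ with $\lambda_i=\lambda(\zeta_i\eta_i)$, $\lambda_c=\lambda(c)$; $F=2\zeta_1\eta_1+4\zeta_2\eta_2$; put $c(t^n)=n\,\zeta_1\eta_1\zeta_2\eta_2(t^n)$ for $n\neq0$, $c(1)=c$. $CK(6)$: $V=\mathbb C^4$ with basis $x_1,\dots,x_4$, $\mathbf V$ the superspace with even part $V$, odd part $V^*$; $\phi:\mathrm{Skew}(V^*,V)\to\mathrm{Skew}(V,V^* )$ linear with $\phi(s)s=\mathrm{Pf}(s)\mathrm{Id}$, $s\phi(s)=\mathrm{Pf}(s)\mathrm{Id}$. $CK(6)$ is the Lie superalgebra of operators $\begin{pmatrix}A&B\\C&E\end{pmatrix}$ on $\mathbf V\otimes\mathbb C[t,t^{-1}]$ with $A=a+(fD+\frac{D(f)}4)\mathrm{Id}_V$, $E=-a^T+(fD+\frac{3D(f)}4)\mathrm{Id}_{V^*}$, $B\in\mathrm{Skew}(V^*,V)\otimes\mathbb C[t,t^{-1}]$, $C=S+\phi(B)D+\frac12D(\phi(B))$, $f\in\mathbb C[t,t^{-1}]$, $a\in\mathfrak{sl}(V)\otimes\mathbb C[t,t^{-1}]$, $S\in\mathrm{Sym}(V,V^*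 )\otimes\mathbb C[t,t^{-1}]$. $\mathrm{Vir}$ is the set of elements with $a=B=S=0$; $H\subset\mathfrak{sl}(V)$ the traceless diagonal matrices; with $w_i$ the weight of $x_i$, $\epsilon_1=w_1+w_4,\epsilon_2=w_1+w_3,\epsilon_3=w_1+w_2$, weights written $(\lambda_1,\lambda_2,\lambda_3)=\sum\lambda_i\epsilon_i$; $F\in H$ is given by $\epsilon_1(F)=2,\epsilon_2(F)=4,\epsilon_3(F)=8$. Modules. For $L$ one of these three algebras, $\mathrm{ad}(F)$ is diagonalizable with integer eigenvalues and $L^\pm$ denotes the sum of eigenspaces of positive/negative eigenvalue; $L=L^+\oplus C_L(F)\oplus L^-$. For $L=\widehat{K(4)}$, $CK(6)$: $C_L(F)=\mathrm{Vir}\ltimes H\otimes\mathbb C[t,t^{-1}]$, and $\mathrm{Tens}(\lambda,\delta,u)$ is $\mathbb C[t,t^{-1}]$ with $fD$ acting by $g\mapsto fD(g)+\delta D(f)g+ufg$ and $h\otimes f$ by $g\mapsto\lambda(h)fg$. For $L=K(3)$: $C_L(F)=K(1)\ltimes H\otimes\mathbb C[t,t^{-1},\xi]$, where $1(f)+\xi(g)\in K(1)$ corresponds to the derivation $\partial=(f+\frac{g\xi}2)D+(\frac{D(f)}2\xi+g)\frac{\partial}{\partial\xi}$, $h\otimes f$ to $h(f)$ and $h\otimes g\xi$ to $h\xi(g)$; $\mathrm{Tens}(\lambda,\delta,u)$ is $\mathbb C[t,t^{-1},\xi]$ with $\partial$ acting by $\partial+\delta D(f+\xi g)+u(f+\frac{g\xi}2)$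 and $h\otimes p$ by multiplication by $\lambda(h)p$. Letting $L^+$ act by zero, $V(\lambda,\delta,u)$ is the unique simple quotient of $\mathrm{Ind}_{C_L(F)\oplus L^+}^L\mathrm{Tens}(\lambda,\delta,u)$. Define the $K(3)$-module $S(u)=V((\frac12),\frac14,u)$ (i.e. $\lambda(\zeta_1\eta_1)=\frac12$); the $\widehat{K(4)}$-modules $S^+(u)=V((\frac12,\frac12,1),\frac14,u)$ and $S^-(u)=V((\frac12,\frac12,-1),\frac34,u)$; the $CK(6)$-module $T(u)=V((\frac12,\frac12,\frac12),\frac14,u)$. *)

theory Defs
  imports
    "HOL-Analysis.Determinants"
    "HOL-Library.Poly_Mapping"
    "HOL-Algebra.Module"
    "HOL-Algebra.AbelCoset"
begin

section \<open>Graded superspaces, Lie superalgebras and their modules\<close>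

definition complex_ring :: "complex ring" where
  "complex_ring = \<lparr>carrier = UNIV, mult = (*), one = 1, zero = 0, add = (+)\<rparr>"

text \<open>
  Superspaces graded by degree in $t$ are complex module records; \<open>hom_part M p n\<close> is the
  homogeneous component of parity \<open>p\<close> (\<open>True\<close> means odd) and degree \<open>n\<close>. The fields \<open>mult\<close> and
  \<open>one\<close> inherited from rings play no role.
\<close>

record 'v sspace = "(complex, 'v) module" +
  hom_part :: "bool \<Rightarrow> int \<Rightarrow> 'v set"

record 'v slie = "'v sspace" +
  bracket :: "'v \<Rightarrow> 'v \<Rightarrow> 'v"

record ('l, 'v) smodule = "'v sspace" +
  action :: "'l \<Rightarrow> 'v \<Rightarrow> 'v"

definition lin_span :: "(complex, 'v, 'z) module_scheme \<Rightarrow> 'v set \<Rightarrow> 'v set" where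
  "lin_span M X = \<Inter> {N. submodule N complex_ring M \<and> X \<subseteq> N}"

definition graded_submodule :: "'l slie \<Rightarrow> ('l, 'v) smodule \<Rightarrow> 'v set \<Rightarrow> bool" where
  "graded_submodule L M N \<longleftrightarrow>
     submodule N complex_ring M \<and>
     N = lin_span M (\<Union>p n. N \<inter> hom_part M p n) \<and>
     (\<forall>x\<in>carrier L. \<forall>v\<in>N. action M x v \<in> N)"

definition simple_smodule :: "'l slie \<Rightarrow> ('l, 'v) smodule \<Rightarrow> bool" where
  "simple_smodule L M \<longleftrightarrow>
     carrier M \<noteq> {\<zero>\<^bsub>M\<^esub>} \<and>
     (\<forall>N. graded_submodule L M N \<longrightarrow> N = {\<zero>\<^bsub>M\<^esub>} \<or> N = carrier M)"

definition quot_smodule :: "('l, 'v) smodule \<Rightarrow> 'v set \<Rightarrow> ('l, 'v set) smodule" where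
  "quot_smodule M N =
     \<lparr>carrier = a_rcosets\<^bsub>M\<^esub> N, mult = undefined, one = undefined,
      zero = N, add = (\<lambda>X Y. X <+>\<^bsub>M\<^esub> Y),
      smult = (\<lambda>c X. N <+>\<^bsub>M\<^esub> ((\<lambda>v. c \<odot>\<^bsub>M\<^esub> v) ` X)),
      hom_part = (\<lambda>p n. (\<lambda>v. N +>\<^bsub>M\<^esub> v) ` hom_part M p n),
      action = (\<lambda>x X. N <+>\<^bsub>M\<^esub> (action M x ` X))\<rparr>"

definition simple_quotient :: "'l slie \<Rightarrow> ('l, 'v) smodule \<Rightarrow> ('l, 'v set) smodule" where
  "simple_quotient L M =
     quot_smodule M (THE N. graded_submodule L M N \<and> simple_smodule L (quot_smodule M N))"

definition direct_sum :: "('l, 'v) smodule \<Rightarrow> ('l, 'w) smodule \<Rightarrow> ('l, 'v \<times> 'w) smodule" where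
  "direct_sum M N =
     \<lparr>carrier = carrier M \<times> carrier N, mult = undefined, one = undefined,
      zero = (\<zero>\<^bsub>M\<^esub>, \<zero>\<^bsub>N\<^esub>),
      add = (\<lambda>(v, w) (v', w'). (v \<oplus>\<^bsub>M\<^esub> v', w \<oplus>\<^bsub>N\<^esub> w')),
      smult = (\<lambda>c (v, w). (c \<odot>\<^bsub>M\<^esub> v, c \<odot>\<^bsub>N\<^esub> w)),
      hom_part = (\<lambda>p n. hom_part M p n \<times> hom_part N p n),
      action = (\<lambda>x (v, w). (action M x v, action N x w))\<rparr>"

text \<open>
  \<open>parity_shift True\<close> exchanges the even and the odd part. The operators are left unchanged;
  the variant in which an odd \<open>x\<close> acts by \<open>- action M x\<close> is isomorphic via $v \mapsto (-1)^{|v|} v$.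
\<close>

definition parity_shift :: "bool \<Rightarrow> ('l, 'v) smodule \<Rightarrow> ('l, 'v) smodule" where
  "parity_shift s M = M\<lparr>hom_part := (\<lambda>p n. hom_part M (p \<noteq> s) n)\<rparr>"

definition restrict_along :: "('k \<Rightarrow> 'l) \<Rightarrow> ('l, 'v) smodule \<Rightarrow> ('k, 'v) smodule" where
  "restrict_along \<phi> M =
     \<lparr>carrier = carrier M, mult = mult M, one = one M, zero = zero M, add = add M,
      smult = smult M, hom_part = hom_part M, action = (\<lambda>x. action M (\<phi> x))\<rparr>"

definition smodule_isomorphic ::
    "'l slie \<Rightarrow> ('l, 'v) smodule \<Rightarrow> ('l, 'w) smodule \<Rightarrow> bool" where
  "smodule_isomorphic L M N \<longleftrightarrow>
     (\<exists>h. bij_betw h (carrier M) (carrier N) \<and>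
        (\<forall>v\<in>carrier M. \<forall>w\<in>carrier M. h (v \<oplus>\<^bsub>M\<^esub> w) = h v \<oplus>\<^bsub>N\<^esub> h w) \<and>
        (\<forall>c. \<forall>v\<in>carrier M. h (c \<odot>\<^bsub>M\<^esub> v) = c \<odot>\<^bsub>N\<^esub> h v) \<and>
        (\<forall>p n. h ` hom_part M p n = hom_part N p n) \<and>
        (\<forall>x\<in>carrier L. \<forall>v\<in>carrier M. h (action M x v) = action N x (h v)))"

definition lie_superalgebra_embedding :: "'k slie \<Rightarrow> 'l slie \<Rightarrow> ('k \<Rightarrow> 'l) \<Rightarrow> bool" where
  "lie_superalgebra_embedding K L \<phi> \<longleftrightarrow>
     inj_on \<phi> (carrier K) \<and> \<phi> ` carrier K \<subseteq> carrier L \<and>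
     (\<forall>x\<in>carrier K. \<forall>y\<in>carrier K. \<phi> (x \<oplus>\<^bsub>K\<^esub> y) = \<phi> x \<oplus>\<^bsub>L\<^esub> \<phi> y) \<and>
     (\<forall>c. \<forall>x\<in>carrier K. \<phi> (c \<odot>\<^bsub>K\<^esub> x) = c \<odot>\<^bsub>L\<^esub> \<phi> x) \<and>
     (\<forall>p n. \<phi> ` hom_part K p n \<subseteq> hom_part L p n) \<and>
     (\<forall>x\<in>carrier K. \<forall>y\<in>carrier K. \<phi> (bracket K x y) = bracket L (\<phi> x) (\<phi> y))"

definition derived_algebra :: "'l slie \<Rightarrow> 'l slie" where
  "derived_algebra L =
     (let L' = lin_span L {bracket L x y | x y. x \<in> carrier L \<and> y \<in> carrier L}
      in L\<lparr>carrier := L', hom_part := (\<lambda>p n. hom_part L p n \<inter> L')\<rparr>)"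

subsection \<open>Induced modules\<close>

text \<open>
  $T(L) \otimes M$, and hence its quotient $U(L) \otimes_{U(B)} M$, is presented by generators
  \<open>word xs v\<close>, standing for $x_1 \cdots x_k \otimes v$. The first three families of relations say
  that \<open>word\<close> is multilinear, the next one is $xy - (-1)^{|x||y|} yx = [x, y]$, and the last one
  is $\mathit{xs}\, b \otimes v = \mathit{xs} \otimes b v$ for \<open>b\<close> in the subalgebra \<open>B\<close>.
\<close>

definition word :: "'l list \<Rightarrow> 'v \<Rightarrow> ('l list \<times> 'v) \<Rightarrow>\<^sub>0 complex" where
  "word xs v = Poly_Mapping.single (xs, v) 1"

definition scale_pm :: "complex \<Rightarrow> ('a \<Rightarrow>\<^sub>0 complex) \<Rightarrow> ('a \<Rightarrow>\<^sub>0 complex)" where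
  "scale_pm c = Poly_Mapping.map ((*) c)"

fun word_homogeneous ::
    "'l slie \<Rightarrow> ('l, 'v) smodule \<Rightarrow> bool \<Rightarrow> int \<Rightarrow> 'l list \<Rightarrow> 'v \<Rightarrow> bool" where
  "word_homogeneous L M p n [] v \<longleftrightarrow> v \<in> hom_part M p n"
| "word_homogeneous L M p n (x # xs) v \<longleftrightarrow>
     (\<exists>q m. x \<in> hom_part L q m \<and> word_homogeneous L M (p \<noteq> q) (n - m) xs v)"

definition free_smodule ::
    "'l slie \<Rightarrow> ('l, 'v) smodule \<Rightarrow> ('l, ('l list \<times> 'v) \<Rightarrow>\<^sub>0 complex) smodule" where
  "free_smodule L M =
     \<lparr>carrier = {X. Poly_Mapping.keys X \<subseteq> lists (carrier L) \<times> carrier M},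
      mult = undefined, one = undefined, zero = 0, add = (+), smult = scale_pm,
      hom_part = (\<lambda>p n. {X. \<forall>(xs, v) \<in> Poly_Mapping.keys X.
         xs \<in> lists (carrier L) \<and> v \<in> carrier M \<and> word_homogeneous L M p n xs v}),
      action = (\<lambda>x X. \<Sum>(xs, v) \<in> Poly_Mapping.keys X.
         scale_pm (Poly_Mapping.lookup X (xs, v)) (word (x # xs) v))\<rparr>"

inductive_set induction_relations ::
    "'l slie \<Rightarrow> 'l set \<Rightarrow> ('l, 'v) smodule \<Rightarrow> (('l list \<times> 'v) \<Rightarrow>\<^sub>0 complex) set"
  for L :: "'l slie" and B :: "'l set" and M :: "('l, 'v) smodule" where
  add_slot:
    "\<lbrakk>xs \<in> lists (carrier L); ys \<in> lists (carrier L); x \<in> carrier L; y \<in> carrier L;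
      v \<in> carrier M\<rbrakk> \<Longrightarrow>
     word (xs @ (x \<oplus>\<^bsub>L\<^esub> y) # ys) v - word (xs @ x # ys) v - word (xs @ y # ys) v
       \<in> induction_relations L B M"
| scale_slot:
    "\<lbrakk>xs \<in> lists (carrier L); ys \<in> lists (carrier L); x \<in> carrier L; v \<in> carrier M\<rbrakk> \<Longrightarrow>
     word (xs @ (c \<odot>\<^bsub>L\<^esub> x) # ys) v - scale_pm c (word (xs @ x # ys) v)
       \<in> induction_relations L B M"
| add_vector:
    "\<lbrakk>xs \<in> lists (carrier L); v \<in> carrier M; w \<in> carrier M\<rbrakk> \<Longrightarrow>
     word xs (v \<oplus>\<^bsub>M\<^esub> w) - word xs v - word xs w \<in> induction_relations L B M"
| scale_vector:
    "\<lbrakk>xs \<in> lists (carrier L); v \<in> carrier M\<rbrakk> \<Longrightarrow>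
     word xs (c \<odot>\<^bsub>M\<^esub> v) - scale_pm c (word xs v) \<in> induction_relations L B M"
| commutator:
    "\<lbrakk>xs \<in> lists (carrier L); ys \<in> lists (carrier L); x \<in> carrier L; y \<in> carrier L;
      x \<in> hom_part L p m; y \<in> hom_part L q n; v \<in> carrier M\<rbrakk> \<Longrightarrow>
     word (xs @ x # y # ys) v - scale_pm (if p \<and> q then - 1 else 1) (word (xs @ y # x # ys) v)
       - word (xs @ bracket L x y # ys) v \<in> induction_relations L B M"
| balanced:
    "\<lbrakk>xs \<in> lists (carrier L); b \<in> B; v \<in> carrier M\<rbrakk> \<Longrightarrow>
     word (xs @ [b]) v - word xs (action M b v) \<in> induction_relations L B M"

definition Ind ::
    "'l slie \<Rightarrow> 'l set \<Rightarrow> ('l, 'v) smodule \<Rightarrow> ('l, (('l list \<times> 'v) \<Rightarrow>\<^sub>0 complex) set) smodule"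
  where
  "Ind L B M =
     quot_smodule (free_smodule L M) (lin_span (free_smodule L M) (induction_relations L B M))"

subsection \<open>The decomposition defined by \<open>F\<close>\<close>

definition ad_eigenspace :: "'l slie \<Rightarrow> 'l \<Rightarrow> int \<Rightarrow> 'l set" where
  "ad_eigenspace L F k = {x \<in> carrier L. bracket L F x = of_int k \<odot>\<^bsub>L\<^esub> x}"

definition centralizer :: "'l slie \<Rightarrow> 'l \<Rightarrow> 'l set" where
  "centralizer L F = {x \<in> carrier L. bracket L F x = \<zero>\<^bsub>L\<^esub>}"

definition pos_part :: "'l slie \<Rightarrow> 'l \<Rightarrow> 'l set" where
  "pos_part L F = lin_span L (\<Union>k\<in>{1..}. ad_eigenspace L F k)"

definition highest_quotient ::
    "'l slie \<Rightarrow> 'l \<Rightarrow> ('l, 'v) smodule \<Rightarrow> ('l, (('l list \<times> 'v) \<Rightarrow>\<^sub>0 complex) set set) smodule"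
  where
  "highest_quotient L F M =
     simple_quotient L (Ind L (centralizer L F <+>\<^bsub>L\<^esub> pos_part L F) M)"

section \<open>Laurent polynomials\<close>

text \<open>$\mathbb{C}[t, t^{-1}]$ is the group algebra of the integers.\<close>

type_synonym laurent = "int \<Rightarrow>\<^sub>0 complex"

definition lconst :: "complex \<Rightarrow> laurent" where
  "lconst c = Poly_Mapping.single 0 c"

definition lD :: "laurent \<Rightarrow> laurent" where
  "lD f = Poly_Mapping.mapp (\<lambda>n c. of_int n * c) f"

definition lhom :: "int \<Rightarrow> laurent set" where
  "lhom n = {f. Poly_Mapping.keys f \<subseteq> {n}}"

text \<open>The underlying space of \<open>Tens\<close> in the two cases without $\xi$.\<close>

definition laurent_module :: "('l \<Rightarrow> laurent \<Rightarrow> laurent) \<Rightarrow> ('l, laurent) smodule" where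
  "laurent_module act =
     \<lparr>carrier = UNIV, mult = undefined, one = undefined, zero = 0, add = (+),
      smult = (\<lambda>c f. lconst c * f),
      hom_part = (\<lambda>p n. if p then {0} else lhom n), action = act\<rparr>"

definition vir_density :: "complex \<Rightarrow> complex \<Rightarrow> laurent \<Rightarrow> laurent \<Rightarrow> laurent" where
  "vir_density \<delta> u f g = f * lD g + lconst \<delta> * lD f * g + lconst u * f * g"

section \<open>Grassmann algebras and contact superalgebras\<close>

text \<open>
  The odd generators of $\mathrm{Grass}(N)$ are numbered $0, \dots, N - 1$: number $2i$ is
  $\zeta_{i+1}$, number $2i+1$ is $\eta_{i+1}$, and for odd $N$ the last one is $\xi$. The key
  \<open>S\<close> stands for the product of the generators in \<open>S\<close> in increasing order.
\<close>

type_synonym 'r grass = "nat set \<Rightarrow>\<^sub>0 'r"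

definition gmon :: "nat set \<Rightarrow> complex grass" where
  "gmon S = Poly_Mapping.single S 1"

definition gmul :: "complex grass \<Rightarrow> complex grass \<Rightarrow> complex grass" where
  "gmul a b = (\<Sum>S\<in>Poly_Mapping.keys a. \<Sum>T\<in>Poly_Mapping.keys b.
     if S \<inter> T = {}
     then Poly_Mapping.single (S \<union> T)
            ((- 1) ^ card {(i, j). i \<in> S \<and> j \<in> T \<and> j < i}
             * Poly_Mapping.lookup a S * Poly_Mapping.lookup b T)
     else 0)"

definition gderiv_left :: "nat \<Rightarrow> complex grass \<Rightarrow> complex grass" where
  "gderiv_left i a = (\<Sum>S\<in>Poly_Mapping.keys a.
     if i \<in> S
     then Poly_Mapping.single (S - {i}) ((- 1) ^ card {j\<in>S. j < i} * Poly_Mapping.lookup a S)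
     else 0)"

definition gderiv_right :: "nat \<Rightarrow> complex grass \<Rightarrow> complex grass" where
  "gderiv_right i a = (\<Sum>S\<in>Poly_Mapping.keys a.
     if i \<in> S
     then Poly_Mapping.single (S - {i}) ((- 1) ^ card {j\<in>S. i < j} * Poly_Mapping.lookup a S)
     else 0)"

definition gen_bracket :: "nat \<Rightarrow> nat \<Rightarrow> nat \<Rightarrow> complex" where
  "gen_bracket N i j =
     (if i \<noteq> j \<and> i div 2 = j div 2 then 1
      else if i = j \<and> odd N \<and> i = N - 1 then 1 else 0)"

text \<open>
  The biderivation with these values on generators, that is, the bracket satisfying
  $[a, bc] = [a, b]c + (-1)^{|a||b|} b[a, c]$ and $[ab, c] = a[b, c] + (-1)^{|b||c|} [a, c]b$.
\<close>

definition poisson :: "nat \<Rightarrow> complex grass \<Rightarrow> complex grass \<Rightarrow> complex grass" where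
  "poisson N a b = (\<Sum>i<N. \<Sum>j<N.
     scale_pm (gen_bracket N i j) (gmul (gderiv_right i a) (gderiv_left j b)))"

text \<open>\<open>gtens a f\<close> is $a(f) = a \otimes f$.\<close>

definition gtens :: "complex grass \<Rightarrow> laurent \<Rightarrow> laurent grass" where
  "gtens a f = Poly_Mapping.map (\<lambda>c. lconst c * f) a"

definition K_bracket :: "nat \<Rightarrow> laurent grass \<Rightarrow> laurent grass \<Rightarrow> laurent grass" where
  "K_bracket N x y = (\<Sum>S\<in>Poly_Mapping.keys x. \<Sum>T\<in>Poly_Mapping.keys y.
     let f = Poly_Mapping.lookup x S; g = Poly_Mapping.lookup y T in
       gtens (gmul (gmon S) (gmon T))
         (lconst ((2 - of_nat (card S)) / 2) * f * lD g
          - lconst ((2 - of_nat (card T)) / 2) * g * lD f)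
       + gtens (poisson N (gmon S) (gmon T)) (f * g))"

definition K_carrier :: "nat \<Rightarrow> laurent grass set" where
  "K_carrier N = {x. \<forall>S\<in>Poly_Mapping.keys x. S \<subseteq> {..<N}}"

definition K_D :: "nat \<Rightarrow> laurent grass slie" where
  "K_D N =
     \<lparr>carrier = K_carrier N, mult = undefined, one = undefined, zero = 0, add = (+),
      smult = (\<lambda>c. Poly_Mapping.map ((*) (lconst c))),
      hom_part = (\<lambda>p n. {x \<in> K_carrier N. \<forall>S\<in>Poly_Mapping.keys x.
         odd (card S) = p \<and> Poly_Mapping.lookup x S \<in> lhom n}),
      bracket = K_bracket N\<rparr>"

subsection \<open>\<open>K(3)\<close>\<close>

definition K3 :: "laurent grass slie" where
  "K3 = K_D 3"

definition K3_F :: "laurent grass" where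
  "K3_F = gtens (gmon {0, 1}) (lconst 2)"

text \<open>$\mathbb{C}[t, t^{-1}, \xi]$: the pair \<open>(p, q)\<close> stands for $p + \xi q$.\<close>

type_synonym slaurent = "laurent \<times> laurent"

definition smul :: "slaurent \<Rightarrow> slaurent \<Rightarrow> slaurent" where
  "smul a b = (fst a * fst b, fst a * snd b + snd a * fst b)"

definition sD :: "slaurent \<Rightarrow> slaurent" where
  "sD a = (lD (fst a), lD (snd a))"

definition s_dxi :: "slaurent \<Rightarrow> slaurent" where
  "s_dxi a = (snd a, 0)"

definition K3_tens_formula ::
    "complex \<Rightarrow> complex \<Rightarrow> complex \<Rightarrow> laurent \<Rightarrow> laurent \<Rightarrow> slaurent \<Rightarrow> slaurent \<Rightarrow> slaurent" where
  "K3_tens_formula l \<delta> u f g h v =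
     smul (f, lconst (1/2) * g) (sD v) + smul (g, lconst (1/2) * lD f) (s_dxi v)
     + smul (lconst \<delta> * lD f, lconst \<delta> * lD g) v
     + smul (lconst u * f, lconst (u/2) * g) v
     + smul (lconst l * fst h, lconst l * snd h) v"

text \<open>
  The element $1(f) + \xi(g) + \zeta_1\eta_1(h_0) + \zeta_1\eta_1\xi(h_1)$ of the centralizer acts
  by \<open>K3_tens_formula\<close> with \<open>h = (h\<^sub>0, h\<^sub>1)\<close>, and the positive part acts by zero; as the sum
  of the centralizer and the positive part is direct, the description is unique. The other two
  \<open>tens\<close> modules below follow the same pattern.
\<close>

definition K3_tens_action ::
    "complex \<Rightarrow> complex \<Rightarrow> complex \<Rightarrow> laurent grass \<Rightarrow> slaurent \<Rightarrow> slaurent" where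
  "K3_tens_action l \<delta> u x v = (THE r. \<exists>f g h. \<exists>y\<in>pos_part K3 K3_F.
     x = gtens (gmon {}) f + gtens (gmon {2}) g
         + gtens (gmon {0, 1}) (fst h) + gtens (gmon {0, 1, 2}) (snd h) + y \<and>
     r = K3_tens_formula l \<delta> u f g h v)"

definition K3_tens :: "complex \<Rightarrow> complex \<Rightarrow> complex \<Rightarrow> (laurent grass, slaurent) smodule" where
  "K3_tens l \<delta> u =
     \<lparr>carrier = UNIV, mult = undefined, one = undefined, zero = 0, add = (+),
      smult = (\<lambda>c v. (lconst c * fst v, lconst c * snd v)),
      hom_part = (\<lambda>p n. if p then {0} \<times> lhom n else lhom n \<times> {0}),
      action = K3_tens_action l \<delta> u\<rparr>"

definition K3_V where
  "K3_V l \<delta> u = highest_quotient K3 K3_F (K3_tens l \<delta> u)"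

subsection \<open>The central extension of \<open>K(4)\<close>\<close>

definition K4 :: "laurent grass slie" where
  "K4 = derived_algebra (K_D 4)"

definition gTr :: "complex grass \<Rightarrow> complex" where
  "gTr a = Poly_Mapping.lookup a {0, 1, 2, 3}"

text \<open>The constant coefficient of $fg$ is the bilinear extension of $(t^n, t^m) \mapsto \delta_{n+m,0}$.\<close>

definition K4_cocycle :: "laurent grass \<Rightarrow> laurent grass \<Rightarrow> complex" where
  "K4_cocycle x y = (\<Sum>S\<in>Poly_Mapping.keys x. \<Sum>T\<in>Poly_Mapping.keys y.
     (2 - of_nat (card S)) / 2 * gTr (gmul (gmon S) (gmon T))
     * Poly_Mapping.lookup (Poly_Mapping.lookup x S * Poly_Mapping.lookup y T) 0)"

definition K4hat :: "(laurent grass \<times> complex) slie" where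
  "K4hat =
     \<lparr>carrier = carrier K4 \<times> UNIV, mult = undefined, one = undefined, zero = 0, add = (+),
      smult = (\<lambda>c (x, a). (c \<odot>\<^bsub>K4\<^esub> x, c * a)),
      hom_part = (\<lambda>p n. hom_part K4 p n \<times> (if \<not> p \<and> n = 0 then UNIV else {0})),
      bracket = (\<lambda>(x, a) (y, b). (bracket K4 x y, K4_cocycle x y))\<rparr>"

definition K4hat_F :: "laurent grass \<times> complex" where
  "K4hat_F = (gtens (gmon {0, 1}) (lconst 2) + gtens (gmon {2, 3}) (lconst 4), 0)"

text \<open>The linear map with $t^n \mapsto n\,\zeta_1\eta_1\zeta_2\eta_2(t^n)$ for $n \neq 0$ and $1 \mapsto c$.\<close>

definition K4hat_c :: "laurent \<Rightarrow> laurent grass \<times> complex" where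
  "K4hat_c f = (gtens (gmon {0, 1, 2, 3}) (lD f), Poly_Mapping.lookup f 0)"

definition K4hat_tens_action ::
    "complex \<Rightarrow> complex \<Rightarrow> complex \<Rightarrow> complex \<Rightarrow> complex \<Rightarrow>
     laurent grass \<times> complex \<Rightarrow> laurent \<Rightarrow> laurent" where
  "K4hat_tens_action l1 l2 lc \<delta> u x v = (THE r. \<exists>f h1 h2 h3. \<exists>y\<in>pos_part K4hat K4hat_F.
     x = (gtens (gmon {}) f + gtens (gmon {0, 1}) h1 + gtens (gmon {2, 3}) h2, 0)
         + K4hat_c h3 + y \<and>
     r = vir_density \<delta> u f v + (lconst l1 * h1 + lconst l2 * h2 + lconst lc * h3) * v)"

definition K4hat_V where
  "K4hat_V l1 l2 lc \<delta> u =
     highest_quotient K4hat K4hat_F (laurent_module (K4hat_tens_action l1 l2 lc \<delta> u))"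

section \<open>\<open>CK(6)\<close>\<close>

text \<open>
  The basis vectors $x_1, \dots, x_4$ have the indices \<open>1, 2, 3, 4\<close> of the numeral type \<open>4\<close> (in
  which \<open>4 = 0\<close>). A pair \<open>(v, w)\<close> is an element of
  $V \otimes \mathbb{C}[t, t^{-1}] \oplus V^* \otimes \mathbb{C}[t, t^{-1}]$.
\<close>

type_synonym lvec = "laurent ^ 4"
type_synonym lmat = "laurent ^ 4 ^ 4"
type_synonym ck_operator = "lvec \<times> lvec \<Rightarrow> lvec \<times> lvec"

definition Pf4 :: "'r::comm_ring_1 ^ 4 ^ 4 \<Rightarrow> 'r" where
  "Pf4 s = s $ 1 $ 2 * s $ 3 $ 4 - s $ 1 $ 3 * s $ 2 $ 4 + s $ 1 $ 4 * s $ 2 $ 3"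

definition ck_phi :: "'r::comm_ring_1 ^ 4 ^ 4 \<Rightarrow> 'r ^ 4 ^ 4" where
  "ck_phi s = vector
     [vector [0, - s $ 3 $ 4, s $ 2 $ 4, - s $ 2 $ 3],
      vector [s $ 3 $ 4, 0, - s $ 1 $ 4, s $ 1 $ 3],
      vector [- s $ 2 $ 4, s $ 1 $ 4, 0, - s $ 1 $ 2],
      vector [s $ 2 $ 3, - s $ 1 $ 3, s $ 1 $ 2, 0]]"

lemma vector_4_nth:
  "(vector [a, b, c, d] :: 'a::zero ^ 4) $ 1 = a"
  "(vector [a, b, c, d] :: 'a::zero ^ 4) $ 2 = b"
  "(vector [a, b, c, d] :: 'a::zero ^ 4) $ 3 = c"
  "(vector [a, b, c, d] :: 'a::zero ^ 4) $ 4 = d"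
  by (simp_all add: vector_def)

lemma ck_phi_characterization:
  fixes s :: "complex ^ 4 ^ 4"
  assumes "transpose s = - s"
  shows "ck_phi s ** s = mat (Pf4 s)" and "s ** ck_phi s = mat (Pf4 s)"
    and "transpose (ck_phi s) = - ck_phi s"
proof -
  have sk: "s $ j $ i = - s $ i $ j" for i j
    using arg_cong[OF assms, of "\<lambda>m. m $ i $ j"] by (simp add: transpose_def)
  have d: "s $ i $ i = 0" for i
    using sk[of i i] by simp
  note e = d sk[of 1 2] sk[of 1 3] sk[of 1 4] sk[of 2 3] sk[of 2 4] sk[of 3 4]
  show "ck_phi s ** s = mat (Pf4 s)" "s ** ck_phi s = mat (Pf4 s)"
    by (simp_all add: vec_eq_iff forall_4 matrix_matrix_mult_def sum_4 mat_def Pf4_def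
        ck_phi_def vector_4_nth e algebra_simps)
  show "transpose (ck_phi s) = - ck_phi s"
    by (simp add: vec_eq_iff forall_4 transpose_def ck_phi_def vector_4_nth)
qed

definition vec_D :: "lvec \<Rightarrow> lvec" where
  "vec_D v = (\<chi> i. lD (v $ i))"

definition mat_D :: "lmat \<Rightarrow> lmat" where
  "mat_D X = (\<chi> i j. lD (X $ i $ j))"

definition ck_op :: "laurent \<Rightarrow> lmat \<Rightarrow> lmat \<Rightarrow> lmat \<Rightarrow> ck_operator" where
  "ck_op f a B S = (\<lambda>(v, w).
     (a *v v + f *s vec_D v + (lconst (1/4) * lD f) *s v + B *v w,
      S *v v + ck_phi B *v vec_D v + lconst (1/2) *s (mat_D (ck_phi B) *v v)
      - transpose a *v w + f *s vec_D w + (lconst (3/4) * lD f) *s w))"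

definition ck_params :: "(laurent \<times> lmat \<times> lmat \<times> lmat) set" where
  "ck_params = {(f, a, B, S). trace a = 0 \<and> transpose B = - B \<and> transpose S = S}"

definition mat_lhom :: "int \<Rightarrow> lmat set" where
  "mat_lhom n = {X. \<forall>i j. X $ i $ j \<in> lhom n}"

definition op_part :: "bool \<Rightarrow> ck_operator \<Rightarrow> ck_operator" where
  "op_part p X = (\<lambda>(v, w).
     if p then (fst (X (0, w)), snd (X (v, 0))) else (fst (X (v, 0)), snd (X (0, w))))"

definition op_bracket :: "ck_operator \<Rightarrow> ck_operator \<Rightarrow> ck_operator" where
  "op_bracket X Y = (\<lambda>v. \<Sum>p\<in>UNIV. \<Sum>q\<in>UNIV.
     if p \<and> q then op_part p X (op_part q Y v) + op_part q Y (op_part p X v)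
     else op_part p X (op_part q Y v) - op_part q Y (op_part p X v))"

definition CK6 :: "ck_operator slie" where
  "CK6 =
     \<lparr>carrier = {ck_op f a B S | f a B S. (f, a, B, S) \<in> ck_params},
      mult = undefined, one = undefined, zero = (\<lambda>v. 0), add = (\<lambda>X Y v. X v + Y v),
      smult = (\<lambda>c X v. (lconst c *s fst (X v), lconst c *s snd (X v))),
      hom_part = (\<lambda>p n. {ck_op f a B S | f a B S. (f, a, B, S) \<in> ck_params \<and>
         f \<in> lhom n \<and> a \<in> mat_lhom n \<and> B \<in> mat_lhom n \<and> S \<in> mat_lhom n \<and>
         (if p then f = 0 \<and> a = 0 else B = 0 \<and> S = 0)}),
      bracket = op_bracket\<rparr>"

definition diag_mat :: "lvec \<Rightarrow> lmat" where
  "diag_mat h = (\<chi> i j. if i = j then h $ i else 0)"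

text \<open>
  The solution of $w_1 + w_4 = 2$, $w_1 + w_3 = 4$, $w_1 + w_2 = 8$ and $w_1 + w_2 + w_3 + w_4 = 0$.
\<close>

definition CK6_F :: ck_operator where
  "CK6_F = ck_op 0 (diag_mat (vector [lconst 7, lconst 1, lconst (- 3), lconst (- 5)])) 0 0"

definition CK6_tens_action ::
    "complex \<Rightarrow> complex \<Rightarrow> complex \<Rightarrow> complex \<Rightarrow> complex \<Rightarrow> ck_operator \<Rightarrow> laurent \<Rightarrow> laurent" where
  "CK6_tens_action l1 l2 l3 \<delta> u x v = (THE r. \<exists>f h. \<exists>y\<in>pos_part CK6 CK6_F.
     (\<Sum>i\<in>UNIV. h $ i) = 0 \<and>
     x = ck_op f (diag_mat h) 0 0 \<oplus>\<^bsub>CK6\<^esub> y \<and>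
     r = vir_density \<delta> u f v
         + (lconst l1 * (h $ 1 + h $ 4) + lconst l2 * (h $ 1 + h $ 3)
            + lconst l3 * (h $ 1 + h $ 2)) * v)"

definition CK6_V where
  "CK6_V l1 l2 l3 \<delta> u =
     highest_quotient CK6 CK6_F (laurent_module (CK6_tens_action l1 l2 l3 \<delta> u))"

section \<open>The modules \<open>S(u)\<close>, \<open>S\<^sup>\<plusminus>(u)\<close> and \<open>T(u)\<close>\<close>

definition S_K3 where "S_K3 u = K3_V (1/2) (1/4) u"
definition S_plus where "S_plus u = K4hat_V (1/2) (1/2) 1 (1/4) u"
definition S_minus where "S_minus u = K4hat_V (1/2) (1/2) (- 1) (3/4) u"
definition T_CK6 where "T_CK6 u = CK6_V (1/2) (1/2) (1/2) (1/4) u"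

end

theory Submission
  imports Defs
begin

text \<open>
  \<open>CK(6)\<close> acts on $\mathbf V \otimes \mathbb{C}[t, t^{-1}]$ by definition, and conjugation by the
  formal function $t^u$, which replaces $D$ by $D + u$, turns this into a family of modules
  $\mathrm{Nat}(u)$. All modules in the theorem live inside $\mathrm{Nat}(u)$.

  \<^item> On $\mathrm{Nat}(u)$ the element $F$ has the eigenvalues $7, 1, -3, -5$ on $V$ and their
    negatives on $V^*$. The top eigenspace is $x_1 \otimes \mathbb{C}[t, t^{-1}]$, which is
    \<open>Tens\<close> with the parameters of $T(u)$, and $\mathrm{Nat}(u)$ is simple and generated by it.
    Hence $T(u) = \mathrm{Nat}(u)$.

  \<^item> The parameters $(f, a, B, S)$ of \<open>CK(6)\<close> for which $a$ is block diagonal with respect to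
    $V = \langle x_1, x_2\rangle \oplus \langle x_3, x_4\rangle$, while $B$ and $S$ are block
    off-diagonal, form a subalgebra. It has sixteen free Laurent polynomials, as many as there are
    monomials in $\mathrm{Grass}(4)$, and it is the image of $\widehat{K(4)}$: a linear function in
    the odd variables goes to $B$, a cubic one to $S$, a quadratic one to $\mathfrak{sl}_2 \oplus
    \mathfrak{sl}_2$, and $c(t^n)$ goes to $t^n\,\mathrm{diag}(1, 1, -1, -1)$, so the integration
    that turns $D(h)$ into $h$ is what makes the central extension necessary.

  \<^item> The block structure splits $\mathrm{Nat}(u)$ into
    $\langle x_1, x_2, x_3^*, x_4^*\rangle \otimes \mathbb{C}[t, t^{-1}]$ and
    $\langle x_3, x_4, x_1^*, x_2^*\rangle \otimes \mathbb{C}[t, t^{-1}]$. For $F \in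
    \widehat{K(4)}$ their top eigenspaces are spanned by $x_1$ and by $x_2^*$, and reading off the
    weights and densities identifies them with $S^+(u)$ and, as $x_2^*$ is odd, with the parity
    shift of $S^-(u)$.

  \<^item> $K(3)$ is embedded in $\widehat{K(4)}$ by $\xi \mapsto (\zeta_2 + \eta_2)/\sqrt 2$. The symmetry
    $\zeta_2 \leftrightarrow \eta_2$, which fixes $K(3)$, interchanges the two halves: a signed
    permutation of coordinates is an isomorphism of $K(3)$-modules between them. Each half is
    already simple over $K(3)$, and this gives simplicity over $\widehat{K(4)}$ as well.

  The four identifications with a module of the form $V(\lambda, \delta, u)$ use one criterion
  (\<open>highest_quotient_isomorphic\<close>): a simple module $N$ that contains the given $C_L(F)$-module $M$ as
  its top $F$-eigenspace and is generated by it is the unique simple quotient of the module induced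
  from $M$. The proof rests on two facts: ordered words span the induced module, and $F$
  separates the component $M$ from everything of lower weight.

  The embedding theorems (\<open>kap_embedding\<close>, \<open>iota_embedding\<close>) are proved in coordinates: the bracket of
  \<open>CK(6)\<close> is written out once in terms of the parameters $(f, a, B, S)$ (\<open>ck_bracket\<close>), the contact
  bracket once in terms of the coefficients of the Grassmann monomials (\<open>K_bracket_lookup\<close>), and the
  two are compared coefficient by coefficient.
\<close>

section \<open>Complex vector spaces as module records\<close>

lemma cring_complex_ring: "cring complex_ring"
  unfolding complex_ring_def
  by (rule cringI; (rule abelian_groupI comm_monoidI)?;
      auto simp: algebra_simps intro: exI[of _ "- x" for x])

lemma complex_ring_simps [simp]:
  "carrier complex_ring = UNIV" "x \<otimes>\<^bsub>complex_ring\<^esub> y = x * y" "\<one>\<^bsub>complex_ring\<^esub> = 1"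
  "\<zero>\<^bsub>complex_ring\<^esub> = 0" "x \<oplus>\<^bsub>complex_ring\<^esub> y = x + y"
  by (simp_all add: complex_ring_def)

text \<open>The negatives are \<open>(-1) \<odot> x\<close>, by distributivity and \<open>0 \<odot> x =
  \<zero>\<close>.\<close>

lemma vector_spaceI:
  fixes M :: "(complex, 'v, 'z) module_scheme"
  assumes "\<zero>\<^bsub>M\<^esub> \<in> carrier M"
    and "\<And>x y. x \<in> carrier M \<Longrightarrow> y \<in> carrier M \<Longrightarrow> x \<oplus>\<^bsub>M\<^esub> y \<in> carrier M"
    and "\<And>c x. x \<in> carrier M \<Longrightarrow> c \<odot>\<^bsub>M\<^esub> x \<in> carrier M"
    and "\<And>x y z. x \<in> carrier M \<Longrightarrow> y \<in> carrier M \<Longrightarrow> z \<in> carrier M \<Longrightarrow>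
      (x \<oplus>\<^bsub>M\<^esub> y) \<oplus>\<^bsub>M\<^esub> z = x \<oplus>\<^bsub>M\<^esub> (y \<oplus>\<^bsub>M\<^esub> z)"
    and "\<And>x y. x \<in> carrier M \<Longrightarrow> y \<in> carrier M \<Longrightarrow> x \<oplus>\<^bsub>M\<^esub> y = y \<oplus>\<^bsub>M\<^esub> x"
    and "\<And>x. x \<in> carrier M \<Longrightarrow> \<zero>\<^bsub>M\<^esub> \<oplus>\<^bsub>M\<^esub> x = x"
    and "\<And>c x y. x \<in> carrier M \<Longrightarrow> y \<in> carrier M \<Longrightarrow>
      c \<odot>\<^bsub>M\<^esub> (x \<oplus>\<^bsub>M\<^esub> y) = c \<odot>\<^bsub>M\<^esub> x \<oplus>\<^bsub>M\<^esub> c \<odot>\<^bsub>M\<^esub> y"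
    and d: "\<And>c d x. x \<in> carrier M \<Longrightarrow> (c + d) \<odot>\<^bsub>M\<^esub> x = c \<odot>\<^bsub>M\<^esub> x \<oplus>\<^bsub>M\<^esub> d \<odot>\<^bsub>M\<^esub> x"
    and "\<And>c d x. x \<in> carrier M \<Longrightarrow> (c * d) \<odot>\<^bsub>M\<^esub> x = c \<odot>\<^bsub>M\<^esub> (d \<odot>\<^bsub>M\<^esub> x)"
    and o: "\<And>x. x \<in> carrier M \<Longrightarrow> 1 \<odot>\<^bsub>M\<^esub> x = x"
    and z: "\<And>x. x \<in> carrier M \<Longrightarrow> 0 \<odot>\<^bsub>M\<^esub> x = \<zero>\<^bsub>M\<^esub>"
  shows "module complex_ring M"
proof (rule moduleI)
  show "abelian_group M"
  proof (rule abelian_groupI)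
    fix x assume x: "x \<in> carrier M"
    have "(-1) \<odot>\<^bsub>M\<^esub> x \<oplus>\<^bsub>M\<^esub> x = \<zero>\<^bsub>M\<^esub>"
      using d[OF x, of "-1" 1] o[OF x] z[OF x] by simp
    then show "\<exists>y\<in>carrier M. y \<oplus>\<^bsub>M\<^esub> x = \<zero>\<^bsub>M\<^esub>"
      using assms(3)[OF x] by blast
  qed (use assms in auto)
qed (use assms cring_complex_ring in auto)

text \<open>The subspaces of a complex vector space, without the subgroup formulation of
  \<open>submodule\<close>; see \<open>submodule_iff_subsp\<close>.\<close>

definition subsp :: "(complex, 'v, 'z) module_scheme \<Rightarrow> 'v set \<Rightarrow> bool" where
  "subsp M N \<longleftrightarrow> N \<subseteq> carrier M \<and> \<zero>\<^bsub>M\<^esub> \<in> N \<and> (\<forall>x\<in>N. \<forall>y\<in>N. x \<oplus>\<^bsub>M\<^esub> y \<in> N) \<and>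
     (\<forall>c. \<forall>x\<in>N. c \<odot>\<^bsub>M\<^esub> x \<in> N)"

lemma subspD:
  assumes "subsp M N"
  shows "x \<in> N \<Longrightarrow> x \<in> carrier M" "\<zero>\<^bsub>M\<^esub> \<in> N" "x \<in> N \<Longrightarrow> y \<in> N \<Longrightarrow> x \<oplus>\<^bsub>M\<^esub> y \<in> N"
    "x \<in> N \<Longrightarrow> c \<odot>\<^bsub>M\<^esub> x \<in> N"
  using assms by (auto simp: subsp_def)

context
  fixes M :: "(complex, 'v, 'z) module_scheme"
  assumes M: "module complex_ring M"
begin

interpretation module complex_ring M by (rule M)

lemma vs_neg:
  assumes x: "x \<in> carrier M"
  shows "(-1) \<odot>\<^bsub>M\<^esub> x = \<ominus>\<^bsub>M\<^esub> x"
proof -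
  have "(-1) \<odot>\<^bsub>M\<^esub> x \<oplus>\<^bsub>M\<^esub> x = \<zero>\<^bsub>M\<^esub>"
    using smult_l_distr[of "-1" 1 x] smult_l_null[OF x] smult_one[OF x] x by simp
  then show ?thesis
    using M.minus_equality[of "(-1) \<odot>\<^bsub>M\<^esub> x" x] x by simp
qed

lemma submodule_iff_subsp: "submodule N complex_ring M \<longleftrightarrow> subsp M N"
proof
  assume N: "submodule N complex_ring M"
  show "subsp M N"
    unfolding subsp_def using submoduleE[OF N] submodule.smult_closed[OF N]
      subgroup.one_closed[OF submodule.axioms(1)[OF N]] by auto
next
  assume N: "subsp M N"
  show "submodule N complex_ring M"
  proof (rule submoduleI)
    show "\<ominus>\<^bsub>M\<^esub> a \<in> N" if "a \<in> N" for a
      using subspD(4)[OF N that, of "-1"] vs_neg subspD(1)[OF N that] by simp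
  qed (use N in \<open>auto simp: subsp_def\<close>)
qed

lemma subsp_carrier: "subsp M (carrier M)"
  by (simp add: subsp_def)

lemma lin_span_eq: "lin_span M X = \<Inter> {N. subsp M N \<and> X \<subseteq> N}"
  by (simp add: lin_span_def submodule_iff_subsp)

lemma lin_span_least: "subsp M N \<Longrightarrow> X \<subseteq> N \<Longrightarrow> lin_span M X \<subseteq> N"
  by (auto simp: lin_span_eq)

lemma lin_span_superset: "X \<subseteq> lin_span M X"
  by (auto simp: lin_span_eq)

lemma subsp_lin_span:
  assumes "X \<subseteq> carrier M" shows "subsp M (lin_span M X)"
  using subsp_carrier assms unfolding lin_span_eq subsp_def[of M "\<Inter> _"]
  by (auto simp: subsp_def)

lemma lin_span_mono: "X \<subseteq> lin_span M Y \<Longrightarrow> Y \<subseteq> carrier M \<Longrightarrow> lin_span M X \<subseteq> lin_span M Y"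
  by (intro lin_span_least subsp_lin_span)

end

lemma lin_span_induct [consumes 3, case_names base zero add smult]:
  fixes M :: "(complex, 'v, 'z) module_scheme"
  assumes M: "module complex_ring M" and "x \<in> lin_span M X" "X \<subseteq> carrier M"
    and "\<And>x. x \<in> X \<Longrightarrow> P x" "P \<zero>\<^bsub>M\<^esub>"
    and "\<And>x y. x \<in> carrier M \<Longrightarrow> y \<in> carrier M \<Longrightarrow> P x \<Longrightarrow> P y \<Longrightarrow> P (x \<oplus>\<^bsub>M\<^esub> y)"
    and "\<And>c x. x \<in> carrier M \<Longrightarrow> P x \<Longrightarrow> P (c \<odot>\<^bsub>M\<^esub> x)"
  shows "P x"
proof -
  have "subsp M {x \<in> carrier M. P x}"
    using assms subspD[OF subsp_carrier[OF M]] by (auto simp: subsp_def)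
  then have "lin_span M X \<subseteq> {x \<in> carrier M. P x}"
    by (rule lin_span_least[OF M]) (use assms in auto)
  then show ?thesis using assms(2) by auto
qed

section \<open>Graded modules and their homomorphisms\<close>

text \<open>Graded spaces with linear operators indexed by \<open>L\<close>: this is all that graded
  submodules and homomorphisms refer to.\<close>

definition smod :: "'l slie \<Rightarrow> ('l, 'v) smodule \<Rightarrow> bool" where
  "smod L M \<longleftrightarrow> module complex_ring M \<and> (\<forall>p n. hom_part M p n \<subseteq> carrier M) \<and>
     (\<forall>x\<in>carrier L. \<forall>v\<in>carrier M. action M x v \<in> carrier M \<and>
        (\<forall>w\<in>carrier M. action M x (v \<oplus>\<^bsub>M\<^esub> w) = action M x v \<oplus>\<^bsub>M\<^esub> action M x w) \<and>
        (\<forall>c. action M x (c \<odot>\<^bsub>M\<^esub> v) = c \<odot>\<^bsub>M\<^esub> action M x v))"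

text \<open>Surjective homomorphisms that are surjective on every homogeneous component, so that they
  behave like quotient maps of graded modules.\<close>

definition epi :: "'l slie \<Rightarrow> ('l, 'v) smodule \<Rightarrow> ('l, 'w) smodule \<Rightarrow> ('v \<Rightarrow> 'w) \<Rightarrow> bool" where
  "epi L M N q \<longleftrightarrow> q ` carrier M = carrier N \<and> q \<zero>\<^bsub>M\<^esub> = \<zero>\<^bsub>N\<^esub> \<and>
     (\<forall>v\<in>carrier M. \<forall>w\<in>carrier M. q (v \<oplus>\<^bsub>M\<^esub> w) = q v \<oplus>\<^bsub>N\<^esub> q w) \<and>
     (\<forall>c. \<forall>v\<in>carrier M. q (c \<odot>\<^bsub>M\<^esub> v) = c \<odot>\<^bsub>N\<^esub> q v) \<and>
     (\<forall>p n. q ` hom_part M p n = hom_part N p n) \<and>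
     (\<forall>x\<in>carrier L. \<forall>v\<in>carrier M. q (action M x v) = action N x (q v))"

lemma epiD:
  assumes "epi L M N q"
  shows "q ` carrier M = carrier N" "q \<zero>\<^bsub>M\<^esub> = \<zero>\<^bsub>N\<^esub>" "q ` hom_part M p n = hom_part N p n"
    "v \<in> carrier M \<Longrightarrow> w \<in> carrier M \<Longrightarrow> q (v \<oplus>\<^bsub>M\<^esub> w) = q v \<oplus>\<^bsub>N\<^esub> q w"
    "v \<in> carrier M \<Longrightarrow> q (c \<odot>\<^bsub>M\<^esub> v) = c \<odot>\<^bsub>N\<^esub> q v"
    "x \<in> carrier L \<Longrightarrow> v \<in> carrier M \<Longrightarrow> q (action M x v) = action N x (q v)"
    "v \<in> carrier M \<Longrightarrow> q v \<in> carrier N"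
    "u \<in> carrier N \<Longrightarrow> \<exists>v\<in>carrier M. u = q v"
  using assms by (auto simp: epi_def)

lemma smodD:
  assumes "smod L M"
  shows "module complex_ring M" "hom_part M p n \<subseteq> carrier M"
    "x \<in> carrier L \<Longrightarrow> v \<in> carrier M \<Longrightarrow> action M x v \<in> carrier M"
    "x \<in> carrier L \<Longrightarrow> v \<in> carrier M \<Longrightarrow> w \<in> carrier M \<Longrightarrow>
      action M x (v \<oplus>\<^bsub>M\<^esub> w) = action M x v \<oplus>\<^bsub>M\<^esub> action M x w"
    "x \<in> carrier L \<Longrightarrow> v \<in> carrier M \<Longrightarrow> action M x (c \<odot>\<^bsub>M\<^esub> v) = c \<odot>\<^bsub>M\<^esub> action M x v"
  using assms by (auto simp: smod_def)

lemma vs_facts: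
  fixes M :: "(complex, 'v, 'z) module_scheme"
  assumes "module complex_ring M"
  shows "\<zero>\<^bsub>M\<^esub> \<in> carrier M"
    "x \<in> carrier M \<Longrightarrow> y \<in> carrier M \<Longrightarrow> x \<oplus>\<^bsub>M\<^esub> y \<in> carrier M"
    "x \<in> carrier M \<Longrightarrow> c \<odot>\<^bsub>M\<^esub> x \<in> carrier M"
    "x \<in> carrier M \<Longrightarrow> 0 \<odot>\<^bsub>M\<^esub> x = \<zero>\<^bsub>M\<^esub>"
    "x \<in> carrier M \<Longrightarrow> 1 \<odot>\<^bsub>M\<^esub> x = x"
    "c \<odot>\<^bsub>M\<^esub> \<zero>\<^bsub>M\<^esub> = \<zero>\<^bsub>M\<^esub>"
    "x \<in> carrier M \<Longrightarrow> (c * d) \<odot>\<^bsub>M\<^esub> x = c \<odot>\<^bsub>M\<^esub> (d \<odot>\<^bsub>M\<^esub> x)"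
    "x \<in> carrier M \<Longrightarrow> (c + d) \<odot>\<^bsub>M\<^esub> x = c \<odot>\<^bsub>M\<^esub> x \<oplus>\<^bsub>M\<^esub> d \<odot>\<^bsub>M\<^esub> x"
    "x \<in> carrier M \<Longrightarrow> y \<in> carrier M \<Longrightarrow>
       c \<odot>\<^bsub>M\<^esub> (x \<oplus>\<^bsub>M\<^esub> y) = c \<odot>\<^bsub>M\<^esub> x \<oplus>\<^bsub>M\<^esub> c \<odot>\<^bsub>M\<^esub> y"
    "x \<in> carrier M \<Longrightarrow> \<zero>\<^bsub>M\<^esub> \<oplus>\<^bsub>M\<^esub> x = x" "x \<in> carrier M \<Longrightarrow> x \<oplus>\<^bsub>M\<^esub> \<zero>\<^bsub>M\<^esub> = x"
    "x \<in> carrier M \<Longrightarrow> x \<oplus>\<^bsub>M\<^esub> (-1) \<odot>\<^bsub>M\<^esub> x = \<zero>\<^bsub>M\<^esub>"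
    "x \<in> carrier M \<Longrightarrow> y \<in> carrier M \<Longrightarrow> x \<oplus>\<^bsub>M\<^esub> y = y \<oplus>\<^bsub>M\<^esub> x"
    "x \<in> carrier M \<Longrightarrow> y \<in> carrier M \<Longrightarrow> z \<in> carrier M \<Longrightarrow>
      (x \<oplus>\<^bsub>M\<^esub> y) \<oplus>\<^bsub>M\<^esub> z = x \<oplus>\<^bsub>M\<^esub> (y \<oplus>\<^bsub>M\<^esub> z)"
proof -
  interpret module complex_ring M by (rule assms)
  show "\<zero>\<^bsub>M\<^esub> \<in> carrier M" by simp
  show "x \<in> carrier M \<Longrightarrow> y \<in> carrier M \<Longrightarrow> x \<oplus>\<^bsub>M\<^esub> y \<in> carrier M" by simp
  show "x \<in> carrier M \<Longrightarrow> c \<odot>\<^bsub>M\<^esub> x \<in> carrier M" by simp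
  show "x \<in> carrier M \<Longrightarrow> 0 \<odot>\<^bsub>M\<^esub> x = \<zero>\<^bsub>M\<^esub>" using smult_l_null[of x] by simp
  show "x \<in> carrier M \<Longrightarrow> 1 \<odot>\<^bsub>M\<^esub> x = x" using smult_one[of x] by simp
  show "c \<odot>\<^bsub>M\<^esub> \<zero>\<^bsub>M\<^esub> = \<zero>\<^bsub>M\<^esub>" using smult_r_null[of c] by simp
  show "x \<in> carrier M \<Longrightarrow> (c * d) \<odot>\<^bsub>M\<^esub> x = c \<odot>\<^bsub>M\<^esub> (d \<odot>\<^bsub>M\<^esub> x)"
    using smult_assoc1[of c d x] by simp
  show "x \<in> carrier M \<Longrightarrow> (c + d) \<odot>\<^bsub>M\<^esub> x = c \<odot>\<^bsub>M\<^esub> x \<oplus>\<^bsub>M\<^esub> d \<odot>\<^bsub>M\<^esub> x"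
    using smult_l_distr[of c d x] by simp
  show "x \<in> carrier M \<Longrightarrow> y \<in> carrier M \<Longrightarrow>
       c \<odot>\<^bsub>M\<^esub> (x \<oplus>\<^bsub>M\<^esub> y) = c \<odot>\<^bsub>M\<^esub> x \<oplus>\<^bsub>M\<^esub> c \<odot>\<^bsub>M\<^esub> y"
    using smult_r_distr[of c x y] by simp
  show "x \<in> carrier M \<Longrightarrow> \<zero>\<^bsub>M\<^esub> \<oplus>\<^bsub>M\<^esub> x = x" by simp
  show "x \<in> carrier M \<Longrightarrow> x \<oplus>\<^bsub>M\<^esub> \<zero>\<^bsub>M\<^esub> = x" by simp
  show "x \<in> carrier M \<Longrightarrow> x \<oplus>\<^bsub>M\<^esub> (-1) \<odot>\<^bsub>M\<^esub> x = \<zero>\<^bsub>M\<^esub>"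
    by (simp add: vs_neg[OF assms] M.r_neg)
  show "x \<in> carrier M \<Longrightarrow> y \<in> carrier M \<Longrightarrow> x \<oplus>\<^bsub>M\<^esub> y = y \<oplus>\<^bsub>M\<^esub> x" by (rule M.a_comm)
  show "x \<in> carrier M \<Longrightarrow> y \<in> carrier M \<Longrightarrow> z \<in> carrier M \<Longrightarrow>
      (x \<oplus>\<^bsub>M\<^esub> y) \<oplus>\<^bsub>M\<^esub> z = x \<oplus>\<^bsub>M\<^esub> (y \<oplus>\<^bsub>M\<^esub> z)" by (rule M.a_assoc)
qed

lemma epi_smod:
  assumes M: "smod L M" and q: "epi L M N q"
  shows "smod L N"
proof -
  note f = vs_facts[OF smodD(1)[OF M]] and e = epiD[OF q]
  have "module complex_ring N"
  proof (rule vector_spaceI)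
    show "\<zero>\<^bsub>N\<^esub> \<in> carrier N" using f(1) e(2,7) by metis
  next
    fix x y z c d
    assume "x \<in> carrier N"
    then obtain x' where x: "x = q x'" "x' \<in> carrier M" using e(8) by blast
    show "c \<odot>\<^bsub>N\<^esub> x \<in> carrier N" "\<zero>\<^bsub>N\<^esub> \<oplus>\<^bsub>N\<^esub> x = x" "1 \<odot>\<^bsub>N\<^esub> x = x" "0 \<odot>\<^bsub>N\<^esub> x = \<zero>\<^bsub>N\<^esub>"
      "(c + d) \<odot>\<^bsub>N\<^esub> x = c \<odot>\<^bsub>N\<^esub> x \<oplus>\<^bsub>N\<^esub> d \<odot>\<^bsub>N\<^esub> x"
      "(c * d) \<odot>\<^bsub>N\<^esub> x = c \<odot>\<^bsub>N\<^esub> (d \<odot>\<^bsub>N\<^esub> x)"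
      using x f e by (metis)+
    assume "y \<in> carrier N"
    then obtain y' where y: "y = q y'" "y' \<in> carrier M" using e(8) by blast
    show "x \<oplus>\<^bsub>N\<^esub> y \<in> carrier N" using x y f(2) e by metis
    show "x \<oplus>\<^bsub>N\<^esub> y = y \<oplus>\<^bsub>N\<^esub> x" using x y f(13) e(4) by metis
    show "c \<odot>\<^bsub>N\<^esub> (x \<oplus>\<^bsub>N\<^esub> y) = c \<odot>\<^bsub>N\<^esub> x \<oplus>\<^bsub>N\<^esub> c \<odot>\<^bsub>N\<^esub> y"
      using x y f(2,3,9) e(4,5) by metis
    assume "z \<in> carrier N"
    then obtain z' where z: "z = q z'" "z' \<in> carrier M" using e(8) by blast
    show "x \<oplus>\<^bsub>N\<^esub> y \<oplus>\<^bsub>N\<^esub> z = x \<oplus>\<^bsub>N\<^esub> (y \<oplus>\<^bsub>N\<^esub> z)"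
      using x y z f(2,14) e(4) by metis
  qed
  moreover have "hom_part N p n \<subseteq> carrier N" for p n
    using e(1) e(3)[of p n] smodD(2)[OF M, of p n] by blast
  moreover have "action N x v \<in> carrier N" if a: "x \<in> carrier L" "v \<in> carrier N" for x v
  proof -
    obtain v' where "v = q v'" "v' \<in> carrier M" using a e(8) by blast
    then show ?thesis using a(1) e(6,7) smodD(3)[OF M] by metis
  qed
  moreover have "action N x (v \<oplus>\<^bsub>N\<^esub> w) = action N x v \<oplus>\<^bsub>N\<^esub> action N x w"
    if a: "x \<in> carrier L" "v \<in> carrier N" "w \<in> carrier N" for x v w
  proof -
    obtain v' w' where "v = q v'" "v' \<in> carrier M" "w = q w'" "w' \<in> carrier M"
      using a e(8) by blast
    then show ?thesis using a(1) e(4,6) f(2) smodD(3,4)[OF M] by metis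
  qed
  moreover have "action N x (c \<odot>\<^bsub>N\<^esub> v) = c \<odot>\<^bsub>N\<^esub> action N x v"
    if a: "x \<in> carrier L" "v \<in> carrier N" for x v c
  proof -
    obtain v' where "v = q v'" "v' \<in> carrier M" using a e(8) by blast
    then show ?thesis using a(1) e(5,6) f(3) smodD(3,5)[OF M] by metis
  qed
  ultimately show ?thesis by (auto simp: smod_def)
qed

lemma epi_lin_span:
  assumes "smod L M" "epi L M N q" "X \<subseteq> carrier M"
  shows "q ` lin_span M X = lin_span N (q ` X)"
proof
  note M = smodD(1)[OF assms(1)] and e = epiD[OF assms(2)]
  note N = smodD(1)[OF epi_smod[OF assms(1,2)]]
  note f = vs_facts[OF M]
  have c: "q ` X \<subseteq> carrier N" using e(7) assms(3) by auto
  note s = subspD[OF subsp_lin_span[OF M assms(3)]] and s' = subspD[OF subsp_lin_span[OF N c]]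
  have "q x \<in> lin_span N (q ` X)" if "x \<in> lin_span M X" for x
    using M that assms(3)
  proof (induction rule: lin_span_induct)
    case (base x) then show ?case using lin_span_superset[OF N] by blast
  next
    case zero then show ?case using s'(2) e(2) by simp
  next
    case (add x y) then show ?case using s'(3) e(4) by simp
  next
    case (smult c x) then show ?case using s'(4) e(5) by simp
  qed
  then show "q ` lin_span M X \<subseteq> lin_span N (q ` X)" by auto
  have "subsp N (q ` lin_span M X)"
    unfolding subsp_def
  proof (safe)
    show "x \<in> lin_span M X \<Longrightarrow> q x \<in> carrier N" for x using e(7) s(1) by auto
    show "\<zero>\<^bsub>N\<^esub> \<in> q ` lin_span M X" using e(2) s(2) by (metis imageI)
    show "q x \<oplus>\<^bsub>N\<^esub> q y \<in> q ` lin_span M X" if "x \<in> lin_span M X" "y \<in> lin_span M X" for x y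
      using e(4) s(1,3) that by (metis imageI)
    show "c \<odot>\<^bsub>N\<^esub> q x \<in> q ` lin_span M X" if "x \<in> lin_span M X" for x c
      using e(5) s(1,4) that by (metis imageI)
  qed
  then show "lin_span N (q ` X) \<subseteq> q ` lin_span M X"
    by (rule lin_span_least[OF N]) (use lin_span_superset[OF M] in auto)
qed

lemma graded_submodule_iff:
  assumes "smod L M"
  shows "graded_submodule L M P \<longleftrightarrow> subsp M P \<and> P \<subseteq> lin_span M (\<Union>p n. P \<inter> hom_part M p n) \<and>
    (\<forall>x\<in>carrier L. \<forall>v\<in>P. action M x v \<in> P)"
proof -
  note M = smodD(1)[OF assms]
  have "lin_span M (\<Union>p n. P \<inter> hom_part M p n) \<subseteq> P" if "subsp M P"
    by (rule lin_span_least[OF M that]) auto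
  then show ?thesis unfolding graded_submodule_def submodule_iff_subsp[OF M] by blast
qed

lemma graded_submodule_image:
  assumes M: "smod L M" and q: "epi L M N q" and P: "graded_submodule L M P"
  shows "graded_submodule L N (q ` P)"
proof -
  note N = epi_smod[OF M q] and e = epiD[OF q]
  have P': "subsp M P" "P = lin_span M (\<Union>p n. P \<inter> hom_part M p n)"
    "\<And>x v. x \<in> carrier L \<Longrightarrow> v \<in> P \<Longrightarrow> action M x v \<in> P"
    using P submodule_iff_subsp[OF smodD(1)[OF M]] unfolding graded_submodule_def by blast+
  note s = subspD[OF P'(1)]
  have c: "q ` P \<subseteq> carrier N" using s(1) e(7) by auto
  have X: "(\<Union>p n. P \<inter> hom_part M p n) \<subseteq> carrier M" using s(1) by auto
  have "q ` P = q ` lin_span M (\<Union>p n. P \<inter> hom_part M p n)" by (rule arg_cong[OF P'(2)])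
  also have "\<dots> = lin_span N (q ` (\<Union>p n. P \<inter> hom_part M p n))" by (rule epi_lin_span[OF M q X])
  also have "\<dots> \<subseteq> lin_span N (\<Union>p n. q ` P \<inter> hom_part N p n)"
  proof (rule lin_span_mono[OF smodD(1)[OF N]])
    have "q ` (\<Union>p n. P \<inter> hom_part M p n) \<subseteq> (\<Union>p n. q ` P \<inter> hom_part N p n)"
      by (auto simp: e(3)[symmetric])
    then show "q ` (\<Union>p n. P \<inter> hom_part M p n) \<subseteq> lin_span N (\<Union>p n. q ` P \<inter> hom_part N p n)"
      using lin_span_superset[OF smodD(1)[OF N]] by (rule order_trans)
    show "(\<Union>p n. q ` P \<inter> hom_part N p n) \<subseteq> carrier N" using c by auto
  qed
  finally have "q ` P \<subseteq> lin_span N (\<Union>p n. q ` P \<inter> hom_part N p n)" .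
  moreover have "subsp N (q ` P)"
    unfolding subsp_def
  proof (safe)
    show "x \<in> P \<Longrightarrow> q x \<in> carrier N" for x using c by auto
    show "\<zero>\<^bsub>N\<^esub> \<in> q ` P" using e(2) s(2) by (metis imageI)
    show "q x \<oplus>\<^bsub>N\<^esub> q y \<in> q ` P" if "x \<in> P" "y \<in> P" for x y
      using e(4) s(1,3) that by (metis imageI)
    show "c \<odot>\<^bsub>N\<^esub> q x \<in> q ` P" if "x \<in> P" for x c
      using e(5) s(1,4) that by (metis imageI)
  qed
  moreover have "action N x v \<in> q ` P" if x: "x \<in> carrier L" and v: "v \<in> q ` P" for x v
  proof -
    obtain v' where v': "v' \<in> P" "v = q v'" using v by blast
    have "q (action M x v') \<in> q ` P" by (rule imageI) (rule P'(3)[OF x v'(1)])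
    then show ?thesis by (simp only: e(6)[OF x s(1)[OF v'(1)]] v'(2))
  qed
  ultimately show ?thesis unfolding graded_submodule_iff[OF N] by (intro conjI ballI)
qed

lemma epi_factor:
  assumes "epi L M N q" "epi L M K r"
    and k: "\<And>v w. v \<in> carrier M \<Longrightarrow> w \<in> carrier M \<Longrightarrow> q v = q w \<Longrightarrow> r v = r w"
    and M: "smod L M"
  obtains h where "epi L N K h" "\<And>v. v \<in> carrier M \<Longrightarrow> h (q v) = r v"
proof -
  note e = epiD[OF assms(1)] and e' = epiD[OF assms(2)]
  note f = vs_facts[OF smodD(1)[OF M]]
  define h where "h w = r (SOME v. v \<in> carrier M \<and> q v = w)" for w
  have h: "h (q v) = r v" if "v \<in> carrier M" for v
  proof -
    have "(SOME v'. v' \<in> carrier M \<and> q v' = q v) \<in> carrier M \<and> q (SOME v'. v' \<in> carrier M \<and> q v' = q v) = q v"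
      by (rule someI[of _ v]) (use that in auto)
    then show ?thesis unfolding h_def using k that by blast
  qed
  have c: "h ` carrier N = carrier K"
    using e(1) e'(1) h by (metis (no_types, lifting) image_cong image_image)
  have "epi L N K h"
    unfolding epi_def
  proof (intro conjI allI ballI)
    show "h ` carrier N = carrier K" by (rule c)
    show "h \<zero>\<^bsub>N\<^esub> = \<zero>\<^bsub>K\<^esub>" using h[OF f(1)] e(2) e'(2) by simp
    show "h ` hom_part N p n = hom_part K p n" for p n
    proof -
      have "h ` hom_part N p n = h ` q ` hom_part M p n" using e(3) by simp
      also have "\<dots> = r ` hom_part M p n"
        using h smodD(2)[OF M, of p n] by (force simp: image_image)
      finally show ?thesis using e'(3) by simp
    qed
    fix x c assume "x \<in> carrier N"
    then obtain x' where x: "x = q x'" "x' \<in> carrier M" using e(8) by blast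
    show "h (c \<odot>\<^bsub>N\<^esub> x) = c \<odot>\<^bsub>K\<^esub> h x" using x h e(5) e'(5) f(3) by metis
    show "h (action N z x) = action K z (h x)" if "z \<in> carrier L" for z
      using x h e(6) e'(6) smodD(3)[OF M] that by metis
    fix y assume "y \<in> carrier N"
    then obtain y' where y: "y = q y'" "y' \<in> carrier M" using e(8) by blast
    show "h (x \<oplus>\<^bsub>N\<^esub> y) = h x \<oplus>\<^bsub>K\<^esub> h y" using x y h e(4) e'(4) f(2) by metis
  qed
  then show ?thesis using h that by blast
qed

text \<open>Two epimorphisms with the same kernel have isomorphic targets. Every isomorphism in this
  development between a quotient and a concrete module comes from here.\<close>

lemma epi_same_kernel:
  assumes "epi L M N q" "epi L M K r"
    and k: "\<And>v w. v \<in> carrier M \<Longrightarrow> w \<in> carrier M \<Longrightarrow> q v = q w \<longleftrightarrow> r v = r w"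
    and M: "smod L M"
  shows "\<exists>h. bij_betw h (carrier N) (carrier K) \<and> epi L N K h \<and> (\<forall>v\<in>carrier M. h (q v) = r v)"
proof -
  obtain h where h: "epi L N K h" "\<And>v. v \<in> carrier M \<Longrightarrow> h (q v) = r v"
    by (rule epi_factor[OF assms(1,2) _ M]) (use k in blast)+
  have "inj_on h (carrier N)"
  proof (rule inj_onI)
    fix x y assume a: "x \<in> carrier N" "y \<in> carrier N" "h x = h y"
    then obtain x' y' where "x = q x'" "x' \<in> carrier M" "y = q y'" "y' \<in> carrier M"
      using epiD(8)[OF assms(1)] by meson
    then show "x = y" using a h(2) k by metis
  qed
  then show ?thesis using h epiD(1)[OF h(1)] by (auto simp: bij_betw_def)
qed

lemma epi_bij_iso:
  assumes "bij_betw h (carrier N) (carrier K)" "epi L N K h"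
  shows "smodule_isomorphic L N K"
  unfolding smodule_isomorphic_def
  by (rule exI[of _ h]) (use assms in \<open>auto simp: epi_def\<close>)

lemma iso_epi:
  assumes "smodule_isomorphic L N K" "smod L N" "smod L K"
  obtains h where "bij_betw h (carrier N) (carrier K)" "epi L N K h"
proof -
  from assms(1) obtain h where h: "bij_betw h (carrier N) (carrier K)"
    "\<And>v w. v\<in>carrier N \<Longrightarrow> w\<in>carrier N \<Longrightarrow> h (v \<oplus>\<^bsub>N\<^esub> w) = h v \<oplus>\<^bsub>K\<^esub> h w"
    "\<And>c v. v\<in>carrier N \<Longrightarrow> h (c \<odot>\<^bsub>N\<^esub> v) = c \<odot>\<^bsub>K\<^esub> h v"
    "\<And>p n. h ` hom_part N p n = hom_part K p n"
    "\<And>x v. x\<in>carrier L \<Longrightarrow> v\<in>carrier N \<Longrightarrow> h (action N x v) = action K x (h v)"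
    unfolding smodule_isomorphic_def by auto
  note f = vs_facts[OF smodD(1)[OF assms(2)]] and f' = vs_facts[OF smodD(1)[OF assms(3)]]
  have "h \<zero>\<^bsub>N\<^esub> \<in> carrier K" using h(1) f(1) bij_betwE by blast
  then have "h \<zero>\<^bsub>N\<^esub> = \<zero>\<^bsub>K\<^esub>" using h(3)[OF f(1), of 0] f(4)[OF f(1)] f'(4) by simp
  then have "epi L N K h" using h by (auto simp: epi_def bij_betw_def)
  then show ?thesis using that h(1) by blast
qed

lemma epi_inverse:
  assumes h: "bij_betw h (carrier N) (carrier K)" and e: "epi L N K h" and N: "smod L N"
  obtains g where "bij_betw g (carrier K) (carrier N)" "epi L K N g"
    "\<And>v. v \<in> carrier N \<Longrightarrow> g (h v) = v"
proof -
  have "epi L N N id" by (auto simp: epi_def)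
  moreover have "h v = h w \<longleftrightarrow> id v = id w" if "v \<in> carrier N" "w \<in> carrier N" for v w
    using h that by (auto simp: bij_betw_def inj_on_def)
  ultimately show ?thesis using epi_same_kernel[OF e _ _ N, of N id] that by auto
qed

lemma iso_simple:
  assumes h: "bij_betw h (carrier N) (carrier K)" and e: "epi L N K h" and N: "smod L N"
    and K: "simple_smodule L K"
  shows "simple_smodule L N"
proof -
  have inj: "inj_on h (carrier N)" and sur: "h ` carrier N = carrier K"
    using h by (auto simp: bij_betw_def)
  note f = vs_facts[OF smodD(1)[OF N]]
  show ?thesis
    unfolding simple_smodule_def
  proof (intro conjI allI impI)
    show "carrier N \<noteq> {\<zero>\<^bsub>N\<^esub>}"
      using K sur epiD(2)[OF e] by (auto simp: simple_smodule_def)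
    fix P assume P: "graded_submodule L N P"
    then have P': "subsp N P" by (simp add: graded_submodule_iff[OF N])
    have "h ` P = {\<zero>\<^bsub>K\<^esub>} \<or> h ` P = carrier K"
      using graded_submodule_image[OF N e P] K by (auto simp: simple_smodule_def)
    then show "P = {\<zero>\<^bsub>N\<^esub>} \<or> P = carrier N"
    proof
      assume a: "h ` P = {\<zero>\<^bsub>K\<^esub>}"
      have "x = \<zero>\<^bsub>N\<^esub>" if x: "x \<in> P" for x
      proof (rule inj_onD[OF inj])
        have "h x \<in> {\<zero>\<^bsub>K\<^esub>}" unfolding a[symmetric] using x by (rule imageI)
        then show "h x = h \<zero>\<^bsub>N\<^esub>" by (simp add: epiD(2)[OF e])
      qed (use x subspD(1)[OF P'] f(1) in auto)
      then have "P = {\<zero>\<^bsub>N\<^esub>}" using subspD(2)[OF P'] by blast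
      then show ?thesis ..
    next
      assume "h ` P = carrier K"
      then have "h ` P = h ` carrier N" using sur by simp
      then have "P = carrier N"
        using inj_on_image_eq_iff[OF inj, of P "carrier N"] P' by (simp add: subsp_def)
      then show ?thesis by simp
    qed
  qed
qed

lemma quot_epi:
  assumes M: "smod L M" and N: "subsp M N"
    and inv: "\<And>x v. x \<in> carrier L \<Longrightarrow> v \<in> N \<Longrightarrow> action M x v \<in> N"
  shows "epi L M (quot_smodule M N) (\<lambda>v. N +>\<^bsub>M\<^esub> v)"
    and "\<And>v w. v \<in> carrier M \<Longrightarrow> w \<in> carrier M \<Longrightarrow>
      N +>\<^bsub>M\<^esub> v = N +>\<^bsub>M\<^esub> w \<longleftrightarrow> v \<oplus>\<^bsub>M\<^esub> (-1) \<odot>\<^bsub>M\<^esub> w \<in> N"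
proof -
  interpret module complex_ring M by (rule smodD(1)[OF M])
  note V = smodD(1)[OF M]
  have "submodule N complex_ring M" using submodule_iff_subsp[OF V] N by simp
  then have "additive_subgroup N M"
    by (simp add: additive_subgroup_def submodule_def)
  then interpret N: abelian_subgroup N M
    by (rule abelian_subgroupI3) (rule abelian_group_axioms)
  note s = subspD[OF N] and f = vs_facts[OF V]
  have co: "N +>\<^bsub>M\<^esub> v = {n \<oplus>\<^bsub>M\<^esub> v |n. n \<in> N}" for v
    by (auto simp: a_r_coset_def')
  have mem: "v \<in> N +>\<^bsub>M\<^esub> v" if "v \<in> carrier M" for v
    by (rule N.a_rcos_self[OF that])
  have key: "N <+>\<^bsub>M\<^esub> (g ` (N +>\<^bsub>M\<^esub> v)) = N +>\<^bsub>M\<^esub> g v"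
    if v: "v \<in> carrier M" and c: "\<And>w. w \<in> carrier M \<Longrightarrow> g w \<in> carrier M"
      and a: "\<And>x y. x \<in> carrier M \<Longrightarrow> y \<in> carrier M \<Longrightarrow> g (x \<oplus>\<^bsub>M\<^esub> y) = g x \<oplus>\<^bsub>M\<^esub> g y"
      and i: "\<And>w. w \<in> N \<Longrightarrow> g w \<in> N" for g v
  proof
    show "N <+>\<^bsub>M\<^esub> (g ` (N +>\<^bsub>M\<^esub> v)) \<subseteq> N +>\<^bsub>M\<^esub> g v"
    proof
      fix x assume "x \<in> N <+>\<^bsub>M\<^esub> (g ` (N +>\<^bsub>M\<^esub> v))"
      then obtain n m where n: "n \<in> N" "m \<in> N" "x = n \<oplus>\<^bsub>M\<^esub> g (m \<oplus>\<^bsub>M\<^esub> v)"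
        by (auto simp: set_add_def' co)
      then have "x = (n \<oplus>\<^bsub>M\<^esub> g m) \<oplus>\<^bsub>M\<^esub> g v"
        using a s(1) v c f(14) by simp
      then show "x \<in> N +>\<^bsub>M\<^esub> g v" unfolding co using s(3) n i by blast
    qed
    show "N +>\<^bsub>M\<^esub> g v \<subseteq> N <+>\<^bsub>M\<^esub> (g ` (N +>\<^bsub>M\<^esub> v))"
      using mem[OF v] by (auto simp: set_add_def' co)
  qed
  show "epi L M (quot_smodule M N) (\<lambda>v. N +>\<^bsub>M\<^esub> v)"
    unfolding epi_def
  proof (intro conjI allI ballI)
    show "(+>\<^bsub>M\<^esub>) N ` carrier M = carrier (quot_smodule M N)"
      by (auto simp: quot_smodule_def A_RCOSETS_def')
    show "N +>\<^bsub>M\<^esub> \<zero>\<^bsub>M\<^esub> = \<zero>\<^bsub>quot_smodule M N\<^esub>"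
      using N.a_subset by (simp add: quot_smodule_def)
    show "(+>\<^bsub>M\<^esub>) N ` hom_part M p n = hom_part (quot_smodule M N) p n" for p n
      by (simp add: quot_smodule_def)
    fix v assume v: "v \<in> carrier M"
    show "N +>\<^bsub>M\<^esub> (v \<oplus>\<^bsub>M\<^esub> w) = (N +>\<^bsub>M\<^esub> v) \<oplus>\<^bsub>quot_smodule M N\<^esub> (N +>\<^bsub>M\<^esub> w)" if "w \<in> carrier M" for w
      using N.a_rcos_sum[OF v that] by (simp add: quot_smodule_def)
    show "N +>\<^bsub>M\<^esub> c \<odot>\<^bsub>M\<^esub> v = c \<odot>\<^bsub>quot_smodule M N\<^esub> (N +>\<^bsub>M\<^esub> v)" for c
      using key[OF v, of "\<lambda>v. c \<odot>\<^bsub>M\<^esub> v"] s(4) f(3,9) by (simp add: quot_smodule_def)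
    show "N +>\<^bsub>M\<^esub> action M x v = action (quot_smodule M N) x (N +>\<^bsub>M\<^esub> v)" if x: "x \<in> carrier L" for x
      using key[OF v, of "action M x"] smodD(3,4)[OF M x] inv[OF x] by (simp add: quot_smodule_def)
  qed
  fix v w assume v: "v \<in> carrier M" "w \<in> carrier M"
  have nw: "(-1) \<odot>\<^bsub>M\<^esub> w \<in> carrier M" using v f(3) by simp
  show "N +>\<^bsub>M\<^esub> v = N +>\<^bsub>M\<^esub> w \<longleftrightarrow> v \<oplus>\<^bsub>M\<^esub> (-1) \<odot>\<^bsub>M\<^esub> w \<in> N"
  proof
    assume "N +>\<^bsub>M\<^esub> v = N +>\<^bsub>M\<^esub> w"
    then have "v \<in> N +>\<^bsub>M\<^esub> w" using mem[OF v(1)] by simp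
    then obtain n where n: "n \<in> N" "v = n \<oplus>\<^bsub>M\<^esub> w" by (auto simp: co)
    then have "v \<oplus>\<^bsub>M\<^esub> (-1) \<odot>\<^bsub>M\<^esub> w = n"
      using f(12)[OF v(2)] f(14)[of n w "(-1) \<odot>\<^bsub>M\<^esub> w"] s(1) v(2) nw by simp
    then show "v \<oplus>\<^bsub>M\<^esub> (-1) \<odot>\<^bsub>M\<^esub> w \<in> N" using n by simp
  next
    assume a: "v \<oplus>\<^bsub>M\<^esub> (-1) \<odot>\<^bsub>M\<^esub> w \<in> N"
    have "v = (v \<oplus>\<^bsub>M\<^esub> (-1) \<odot>\<^bsub>M\<^esub> w) \<oplus>\<^bsub>M\<^esub> w"
      using f(12)[OF v(2)] f(14)[of v "(-1) \<odot>\<^bsub>M\<^esub> w" w] v nw f(13)[of w "(-1) \<odot>\<^bsub>M\<^esub> w"] by simp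
    then have "v \<in> N +>\<^bsub>M\<^esub> w" unfolding co using a by blast
    then show "N +>\<^bsub>M\<^esub> v = N +>\<^bsub>M\<^esub> w"
      using N.a_repr_independence'[of v w] v by simp
  qed
qed

section \<open>The free module on words\<close>

lemma lookup_scale_pm [simp]: "Poly_Mapping.lookup (scale_pm c X) k = c * Poly_Mapping.lookup X k"
  by (simp add: scale_pm_def Poly_Mapping.map.rep_eq when_def)

lemma scale_pm_simps:
  "scale_pm c (X + Y) = scale_pm c X + scale_pm c Y"
  "scale_pm c (X - Y) = scale_pm c X - scale_pm c Y"
  "scale_pm (c + d) X = scale_pm c X + scale_pm d X"
  "scale_pm c (scale_pm d X) = scale_pm (c * d) X"
  "scale_pm 1 X = X" "scale_pm 0 X = 0" "scale_pm c 0 = 0" "scale_pm (-1) X = - X"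
  by (rule poly_mapping_eqI; simp add: lookup_add lookup_minus algebra_simps)+

lemma scale_pm_sum: "scale_pm c (sum f A) = (\<Sum>x\<in>A. scale_pm c (f x))"
  by (induction A rule: infinite_finite_induct) (simp_all add: scale_pm_simps)

lemma keys_word [simp]: "Poly_Mapping.keys (word xs v) = {(xs, v)}"
  by (simp add: word_def)

lemma keys_scale_pm: "Poly_Mapping.keys (scale_pm c X) \<subseteq> Poly_Mapping.keys X"
  by (auto simp: in_keys_iff)

lemma sum_of_words:
  "X = (\<Sum>k\<in>Poly_Mapping.keys X. scale_pm (Poly_Mapping.lookup X k) (word (fst k) (snd k)))"
proof (rule poly_mapping_eqI)
  fix k
  have "Poly_Mapping.lookup (\<Sum>k\<in>Poly_Mapping.keys X.
      scale_pm (Poly_Mapping.lookup X k) (word (fst k) (snd k))) k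
    = (\<Sum>i\<in>Poly_Mapping.keys X. if i = k then Poly_Mapping.lookup X k else 0)"
    unfolding lookup_sum by (rule sum.cong) (auto simp: word_def lookup_single when_def)
  then show "Poly_Mapping.lookup X k = Poly_Mapping.lookup (\<Sum>k\<in>Poly_Mapping.keys X.
      scale_pm (Poly_Mapping.lookup X k) (word (fst k) (snd k))) k"
    by (simp add: in_keys_iff)
qed

lemma free_simps [simp]:
  "\<zero>\<^bsub>free_smodule L M\<^esub> = 0" "X \<oplus>\<^bsub>free_smodule L M\<^esub> Y = X + Y"
  "c \<odot>\<^bsub>free_smodule L M\<^esub> X = scale_pm c X"
  by (simp_all add: free_smodule_def)

lemma free_carrier: "X \<in> carrier (free_smodule L M) \<longleftrightarrow>
    Poly_Mapping.keys X \<subseteq> lists (carrier L) \<times> carrier M"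
  by (simp add: free_smodule_def)

lemma free_carrier_closed:
  "0 \<in> carrier (free_smodule L M)"
  "X \<in> carrier (free_smodule L M) \<Longrightarrow> Y \<in> carrier (free_smodule L M) \<Longrightarrow> X + Y \<in> carrier (free_smodule L M)"
  "X \<in> carrier (free_smodule L M) \<Longrightarrow> scale_pm c X \<in> carrier (free_smodule L M)"
  "X \<in> carrier (free_smodule L M) \<Longrightarrow> Y \<in> carrier (free_smodule L M) \<Longrightarrow> X - Y \<in> carrier (free_smodule L M)"
  "word xs v \<in> carrier (free_smodule L M) \<longleftrightarrow> xs \<in> lists (carrier L) \<and> v \<in> carrier M"
proof -
  let ?S = "lists (carrier L) \<times> carrier M"
  have "Poly_Mapping.keys (X + Y) \<subseteq> ?S" "Poly_Mapping.keys (X - Y) \<subseteq> ?S"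
    if "Poly_Mapping.keys X \<subseteq> ?S" "Poly_Mapping.keys Y \<subseteq> ?S"
    using order_trans[OF Poly_Mapping.keys_add Un_least[OF that]]
      order_trans[OF Poly_Mapping.keys_diff Un_least[OF that]] .
  then show "X \<in> carrier (free_smodule L M) \<Longrightarrow> Y \<in> carrier (free_smodule L M) \<Longrightarrow> X + Y \<in> carrier (free_smodule L M)"
    "X \<in> carrier (free_smodule L M) \<Longrightarrow> Y \<in> carrier (free_smodule L M) \<Longrightarrow> X - Y \<in> carrier (free_smodule L M)"
    by (simp_all only: free_carrier)
  show "X \<in> carrier (free_smodule L M) \<Longrightarrow> scale_pm c X \<in> carrier (free_smodule L M)"
    unfolding free_carrier by (rule order_trans[OF keys_scale_pm])
  show "0 \<in> carrier (free_smodule L M)"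
    "word xs v \<in> carrier (free_smodule L M) \<longleftrightarrow> xs \<in> lists (carrier L) \<and> v \<in> carrier M"
    by (simp_all add: free_carrier)
qed

text \<open>A linear property of the free module has to be checked on words only.\<close>

lemma free_induct [consumes 1, case_names word zero add scale]:
  assumes X: "X \<in> carrier (free_smodule L M)"
    and w: "\<And>xs v. xs \<in> lists (carrier L) \<Longrightarrow> v \<in> carrier M \<Longrightarrow> P (word xs v)"
    and z: "P 0"
    and a: "\<And>X Y. X \<in> carrier (free_smodule L M) \<Longrightarrow> Y \<in> carrier (free_smodule L M) \<Longrightarrow>
      P X \<Longrightarrow> P Y \<Longrightarrow> P (X + Y)"
    and s: "\<And>c X. X \<in> carrier (free_smodule L M) \<Longrightarrow> P X \<Longrightarrow> P (scale_pm c X)"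
  shows "P X"
proof -
  have "P (\<Sum>k\<in>A. scale_pm (Poly_Mapping.lookup X k) (word (fst k) (snd k))) \<and>
     (\<Sum>k\<in>A. scale_pm (Poly_Mapping.lookup X k) (word (fst k) (snd k))) \<in> carrier (free_smodule L M)"
    if "finite A" "A \<subseteq> lists (carrier L) \<times> carrier M" for A
    using that
  proof (induction A rule: finite_induct)
    case empty then show ?case using z free_carrier_closed(1) by simp
  next
    case (insert k A)
    have k: "fst k \<in> lists (carrier L)" "snd k \<in> carrier M" using insert.prems by auto
    let ?y = "scale_pm (Poly_Mapping.lookup X k) (word (fst k) (snd k))"
    have y0: "word (fst k) (snd k) \<in> carrier (free_smodule L M)"
      using k by (simp add: free_carrier_closed)
    note y = free_carrier_closed(3)[OF y0] s[OF y0 w[OF k]]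
    show ?case using a[OF y(1) _ y(2)] y free_carrier_closed(2)[OF y(1)] insert by simp
  qed
  from this[OF finite_keys, of X] X show ?thesis
    using sum_of_words[of X] by (simp add: free_carrier)
qed

lemma action_word: "action (free_smodule L M) x (word xs v) = word (x # xs) v"
  by (simp add: free_smodule_def word_def scale_pm_simps)

lemma action_add:
  "action (free_smodule L M) x (X + Y) = action (free_smodule L M) x X + action (free_smodule L M) x Y"
  using Poly_Mapping.setsum_keys_plus_distrib[of "\<lambda>k c. scale_pm c (word (x # fst k) (snd k))" X Y]
  by (simp add: free_smodule_def scale_pm_simps case_prod_unfold)

lemma action_scale:
  "action (free_smodule L M) x (scale_pm c X) = scale_pm c (action (free_smodule L M) x X)"
proof -
  have "action (free_smodule L M) x (scale_pm c X) =
      (\<Sum>k\<in>Poly_Mapping.keys X. scale_pm (c * Poly_Mapping.lookup X k) (word (x # fst k) (snd k)))"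
    unfolding free_smodule_def
    by (simp add: case_prod_unfold)
      (intro sum.mono_neutral_left, use keys_scale_pm[of c X] in \<open>auto simp: in_keys_iff scale_pm_simps\<close>)
  then show ?thesis
    by (simp add: free_smodule_def case_prod_unfold scale_pm_sum scale_pm_simps)
qed

lemma action_zero: "action (free_smodule L M) x 0 = 0"
  by (simp add: free_smodule_def)

lemma action_diff:
  "action (free_smodule L M) x (X - Y) = action (free_smodule L M) x X - action (free_smodule L M) x Y"
  using action_add[of L M x "X - Y" Y] by simp

lemma action_closed:
  assumes "x \<in> carrier L" "X \<in> carrier (free_smodule L M)"
  shows "action (free_smodule L M) x X \<in> carrier (free_smodule L M)"
  using assms(2)
proof (induction rule: free_induct)
  case (word xs v) then show ?case using assms by (simp add: action_word free_carrier_closed)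
qed (simp_all add: action_add action_scale action_zero free_carrier_closed)

lemma word_homogeneous_closed:
  assumes "\<And>p n. hom_part L p n \<subseteq> carrier L" "\<And>p n. hom_part M p n \<subseteq> carrier M"
  shows "word_homogeneous L M p n xs v \<Longrightarrow> xs \<in> lists (carrier L) \<and> v \<in> carrier M"
  by (induction xs arbitrary: p n) (use assms in \<open>fastforce+\<close>)

text \<open>The free module carries a plain action by prefixing letters; only the quotient by the
  relations sees the bracket of \<open>L\<close>.\<close>

lemma free_smod: "smod L (free_smodule L M)"
proof -
  have "module complex_ring (free_smodule L M)"
    by (rule vector_spaceI) (auto simp: free_carrier_closed scale_pm_simps algebra_simps)
  moreover have "hom_part (free_smodule L M) p n \<subseteq> carrier (free_smodule L M)" for p n
    by (auto simp: free_smodule_def)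
  ultimately show ?thesis
    by (auto simp: smod_def action_add action_scale action_closed)
qed

lemma free_hom_subsp: "subsp (free_smodule L M) (hom_part (free_smodule L M) p n)"
proof -
  define S where "S = {k. fst k \<in> lists (carrier L) \<and> snd k \<in> carrier M \<and> word_homogeneous L M p n (fst k) (snd k)}"
  have h: "hom_part (free_smodule L M) p n = {X. Poly_Mapping.keys X \<subseteq> S}"
    by (auto simp: free_smodule_def S_def)
  have "Poly_Mapping.keys (X + Y) \<subseteq> S"
    if "Poly_Mapping.keys X \<subseteq> S" "Poly_Mapping.keys Y \<subseteq> S" for X Y :: "_ \<Rightarrow>\<^sub>0 complex"
    by (rule order_trans[OF Poly_Mapping.keys_add Un_least[OF that]])
  moreover have "Poly_Mapping.keys (scale_pm c X) \<subseteq> S" if "Poly_Mapping.keys X \<subseteq> S" for c X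
    by (rule order_trans[OF keys_scale_pm that])
  ultimately show ?thesis
    unfolding subsp_def free_simps
    using smodD(2)[OF free_smod, of L M p n] unfolding h by simp
qed

lemma free_hom_word:
  "word xs v \<in> hom_part (free_smodule L M) p n \<longleftrightarrow>
     xs \<in> lists (carrier L) \<and> v \<in> carrier M \<and> word_homogeneous L M p n xs v"
  by (simp add: free_smodule_def)

section \<open>Recognising the simple quotient of an induced module\<close>

text \<open>\<open>N\<close> is a module with no \<open>F\<close>-weight above \<open>d\<close>, and
  \<open>j\<close> embeds \<open>M\<close> into its eigenspace of weight \<open>d\<close>. The algebra
  \<open>L\<close> is spanned by homogeneous weight vectors.\<close>

locale weight_setting =
  fixes L :: "'l slie" and F :: 'l and M :: "('l, 'v) smodule"
    and N :: "('l, 'w::ab_group_add) smodule" and j :: "'v \<Rightarrow> 'w" and d :: int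
  assumes L_module: "module complex_ring L"
    and L_hom: "hom_part L p n \<subseteq> carrier L"
    and F_hom: "F \<in> hom_part L False 0"
    and F_bracket: "bracket L F F = \<zero>\<^bsub>L\<^esub>" "bracket L F \<zero>\<^bsub>L\<^esub> = \<zero>\<^bsub>L\<^esub>"
    and L_span: "carrier L \<subseteq> lin_span L (\<Union>p n k. hom_part L p n \<inter> ad_eigenspace L F k)"
    and L_bracket: "x \<in> hom_part L p m \<Longrightarrow> y \<in> hom_part L q n \<Longrightarrow> bracket L x y \<in> carrier L"
    and N_smod: "smod L N" and N_add: "add N = (+)" and N_zero: "zero N = 0"
    and N_act_add: "x \<in> carrier L \<Longrightarrow> y \<in> carrier L \<Longrightarrow> w \<in> carrier N \<Longrightarrow>
      action N (x \<oplus>\<^bsub>L\<^esub> y) w = action N x w + action N y w"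
    and N_act_smult: "x \<in> carrier L \<Longrightarrow> w \<in> carrier N \<Longrightarrow>
      action N (c \<odot>\<^bsub>L\<^esub> x) w = c \<odot>\<^bsub>N\<^esub> action N x w"
    and N_comm: "x \<in> hom_part L p m \<Longrightarrow> y \<in> hom_part L q n \<Longrightarrow> w \<in> carrier N \<Longrightarrow>
      action N x (action N y w) =
        (if p \<and> q then -1 else 1) \<odot>\<^bsub>N\<^esub> action N y (action N x w) + action N (bracket L x y) w"
    and N_F: "x \<in> carrier L \<Longrightarrow> w \<in> carrier N \<Longrightarrow>
      action N F (action N x w) = action N x (action N F w) + action N (bracket L F x) w"
    and N_hom: "subsp N (hom_part N p n)"
    and N_act_hom: "x \<in> hom_part L q m \<Longrightarrow> w \<in> hom_part N p n \<Longrightarrow>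
      action N x w \<in> hom_part N (p \<noteq> q) (n + m)"
    and N_top: "w \<in> carrier N \<Longrightarrow> action N F w = of_int (d + k) \<odot>\<^bsub>N\<^esub> w \<Longrightarrow> k \<ge> 1 \<Longrightarrow> w = 0"
    and M_module: "module complex_ring M"
    and M_hom: "hom_part M p n \<subseteq> carrier M"
    and j_add: "u \<in> carrier M \<Longrightarrow> v \<in> carrier M \<Longrightarrow> j (u \<oplus>\<^bsub>M\<^esub> v) = j u + j v"
    and j_smult: "v \<in> carrier M \<Longrightarrow> j (c \<odot>\<^bsub>M\<^esub> v) = c \<odot>\<^bsub>N\<^esub> j v"
    and j_carrier: "v \<in> carrier M \<Longrightarrow> j v \<in> carrier N"
    and j_inj: "inj_on j (carrier M)"
    and j_hom: "v \<in> hom_part M p n \<Longrightarrow> j v \<in> hom_part N p n"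
    and F_j: "v \<in> carrier M \<Longrightarrow> action N F (j v) = of_int d \<odot>\<^bsub>N\<^esub> j v"
begin

lemmas L_facts = vs_facts[OF L_module]
lemmas M_facts = vs_facts[OF M_module]
lemmas N_facts = vs_facts[OF smodD(1)[OF N_smod], unfolded N_add N_zero]
lemmas N_act = smodD(3-5)[OF N_smod, unfolded N_add N_zero]

lemma eigen_UN_carrier: "(\<Union>k\<in>K. ad_eigenspace L F k) \<subseteq> carrier L"
  by (auto simp: ad_eigenspace_def)

lemma F_carrier: "F \<in> carrier L"
  using F_hom L_hom by blast

lemma act_zero_L: "w \<in> carrier N \<Longrightarrow> action N \<zero>\<^bsub>L\<^esub> w = 0"
  using N_act_smult[of "\<zero>\<^bsub>L\<^esub>" w 0] L_facts(1,6) N_facts(4) N_act(1) by simp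

lemma subsp_pos_part: "subsp L (pos_part L F)"
  unfolding pos_part_def by (rule subsp_lin_span[OF L_module eigen_UN_carrier])

text \<open>An eigenvector of \<open>ad F\<close> with eigenvalue \<open>k \<ge> 1\<close> raises the
  \<open>F\<close>-weight by \<open>k\<close>, and \<open>N\<close> has no weights above
  \<open>d\<close>.\<close>

lemma pos_part_annihilates:
  assumes "x \<in> pos_part L F" and v: "v \<in> carrier M"
  shows "action N x (j v) = 0"
  using L_module assms(1)[unfolded pos_part_def] eigen_UN_carrier
proof (induction rule: lin_span_induct)
  case (base x)
  then obtain k where k: "k \<ge> 1" "x \<in> carrier L" "bracket L F x = of_int k \<odot>\<^bsub>L\<^esub> x"
    by (auto simp: ad_eigenspace_def)
  have c: "action N x (j v) \<in> carrier N" by (rule N_act(1)[OF k(2) j_carrier[OF v]])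
  have "action N F (action N x (j v)) =
      action N x (of_int d \<odot>\<^bsub>N\<^esub> j v) + action N (of_int k \<odot>\<^bsub>L\<^esub> x) (j v)"
    using N_F[OF k(2) j_carrier[OF v]] F_j[OF v] k(3) by simp
  also have "\<dots> = of_int d \<odot>\<^bsub>N\<^esub> action N x (j v) + of_int k \<odot>\<^bsub>N\<^esub> action N x (j v)"
    using N_act(3)[OF k(2) j_carrier[OF v]] N_act_smult[OF k(2) j_carrier[OF v]] by simp
  also have "\<dots> = of_int (d + k) \<odot>\<^bsub>N\<^esub> action N x (j v)"
    using N_facts(8)[OF c] by simp
  finally show ?case by (rule N_top[OF c _ k(1)])
next
  case zero show ?case by (rule act_zero_L[OF j_carrier[OF v]])
next
  case (add x y) then show ?case using N_act_add[OF _ _ j_carrier[OF v]] by simp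
next
  case (smult c x) then show ?case using N_act_smult[OF _ j_carrier[OF v]] N_facts(6) by simp
qed

end

text \<open>The additional data say that \<open>j\<close> is a homomorphism for $B = C_L(F) \oplus L^+$,
  that \<open>M\<close> is cyclic over \<open>B\<close>, and that \<open>N\<close> is simple and generated
  by \<open>j M\<close>. The maps \<open>pr\<close> are the projections to the homogeneous components of
  \<open>N\<close>.\<close>

locale highest_weight_model = weight_setting L F M N j d
  for L :: "'l slie" and F :: 'l and M :: "('l, 'v) smodule"
    and N :: "('l, 'w::ab_group_add) smodule" and j :: "'v \<Rightarrow> 'w" and d :: int +
  fixes pr :: "bool \<Rightarrow> int \<Rightarrow> 'w \<Rightarrow> 'w" and m0 :: 'v
  assumes M_span: "carrier M \<subseteq> lin_span M (\<Union>p n. hom_part M p n)"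
    and M_action: "b \<in> centralizer L F <+>\<^bsub>L\<^esub> pos_part L F \<Longrightarrow> v \<in> carrier M \<Longrightarrow> action M b v \<in> carrier M"
    and m0: "m0 \<in> carrier M"
    and M_gen: "v \<in> carrier M \<Longrightarrow> \<exists>b\<in>centralizer L F <+>\<^bsub>L\<^esub> pos_part L F. v = action M b m0"
    and j_action: "b \<in> centralizer L F <+>\<^bsub>L\<^esub> pos_part L F \<Longrightarrow> v \<in> carrier M \<Longrightarrow>
      j (action M b v) = action N b (j v)"
    and N_simple: "simple_smodule L N"
    and N_span: "carrier N \<subseteq> lin_span N (\<Union>p n. hom_part N p n)"
    and pr_add: "pr p n (w + w') = pr p n w + pr p n w'"
    and pr_same: "w \<in> hom_part N p n \<Longrightarrow> pr p n w = w"
    and pr_other: "w \<in> hom_part N q m \<Longrightarrow> (q, m) \<noteq> (p, n) \<Longrightarrow> pr p n w = 0"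
    and N_hom_gen: "hom_part N p n \<subseteq> lin_span N (j ` hom_part M p n \<union>
      {action N x (j v) | x v q m. x \<in> hom_part L q m \<and> v \<in> hom_part M (p \<noteq> q) (n - m)})"
begin

abbreviation "B \<equiv> centralizer L F <+>\<^bsub>L\<^esub> pos_part L F"
abbreviation "FM \<equiv> free_smodule L M"
abbreviation "act \<equiv> action FM"
abbreviation "Rel \<equiv> induction_relations L B M"
abbreviation "R \<equiv> lin_span FM Rel"

lemmas FM_module = smodD(1)[OF free_smod[of L M]]
lemmas FMc = free_carrier_closed[where L = L and M = M]

lemma B_carrier: "B \<subseteq> carrier L"
  using L_facts(2) subspD(1)[OF subsp_pos_part] by (auto simp: set_add_def' centralizer_def)

lemma eigen_in_B:
  assumes "x \<in> ad_eigenspace L F k" "k \<ge> 0" shows "x \<in> B"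
proof -
  have x: "x \<in> carrier L" "bracket L F x = of_int k \<odot>\<^bsub>L\<^esub> x" using assms by (auto simp: ad_eigenspace_def)
  show ?thesis
  proof (cases "k = 0")
    case True
    then have "x \<in> centralizer L F" using x L_facts(4) by (simp add: centralizer_def)
    then have "x \<oplus>\<^bsub>L\<^esub> \<zero>\<^bsub>L\<^esub> \<in> B" using subspD(2)[OF subsp_pos_part] by (auto simp: set_add_def')
    then show ?thesis using L_facts(11)[OF x(1)] by simp
  next
    case False
    then have "x \<in> pos_part L F" unfolding pos_part_def
      using assms lin_span_superset[OF L_module, of "\<Union>k\<in>{1..}. ad_eigenspace L F k"] by force
    moreover have "\<zero>\<^bsub>L\<^esub> \<in> centralizer L F" using F_bracket L_facts(1) by (simp add: centralizer_def)
    ultimately have "\<zero>\<^bsub>L\<^esub> \<oplus>\<^bsub>L\<^esub> x \<in> B" by (auto simp: set_add_def')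
    then show ?thesis using L_facts(10)[OF x(1)] by simp
  qed
qed

lemma rel_carrier: "X \<in> Rel \<Longrightarrow> X \<in> carrier FM"
proof (induction rule: induction_relations.induct)
  case (commutator xs ys x y p m q n v)
  then show ?case using L_bracket[OF commutator(5,6)] by (auto intro!: FMc(2-4) simp: FMc(5))
next
  case (balanced xs b v)
  then show ?case using B_carrier M_action by (auto intro!: FMc(2-4) simp: FMc(5))
qed (use L_facts M_facts in \<open>auto intro!: FMc(2-4) simp: FMc(5)\<close>)

lemma Rel_carrier: "Rel \<subseteq> carrier FM"
  using rel_carrier by blast

text \<open>All six families of relations are closed under a prefix \<open>xs\<close>, so adding a
  letter in front gives a relation of the same family.\<close>

lemma rel_act:
  assumes x: "x \<in> carrier L"
  shows "X \<in> Rel \<Longrightarrow> act x X \<in> Rel"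
proof (induction rule: induction_relations.induct)
  case (add_slot xs ys y z v)
  then show ?case using induction_relations.add_slot[of "x # xs" L ys y z v M B] x
    by (simp add: action_diff action_word)
next
  case (scale_slot xs ys y v c)
  then show ?case using induction_relations.scale_slot[of "x # xs" L ys y v M c B] x
    by (simp add: action_diff action_word action_scale)
next
  case (add_vector xs v w)
  then show ?case using induction_relations.add_vector[of "x # xs" L v M w B] x
    by (simp add: action_diff action_word)
next
  case (scale_vector xs v c)
  then show ?case using induction_relations.scale_vector[of "x # xs" L v M c B] x
    by (simp add: action_diff action_word action_scale)
next
  case (commutator xs ys y z p m q n v)
  then show ?case using induction_relations.commutator[of "x # xs" L ys y z p m q n v M B] x
    by (simp add: action_diff action_word action_scale)
next
  case (balanced xs b v)
  then show ?case using induction_relations.balanced[of "x # xs" L b B v M] x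
    by (simp add: action_diff action_word action_scale)
qed

lemma R_subsp: "subsp FM R"
  by (rule subsp_lin_span[OF FM_module Rel_carrier])

lemmas R_facts = subspD[OF R_subsp, simplified]

lemma R_uminus: "X \<in> R \<Longrightarrow> - X \<in> R"
  using R_facts(4)[of X "-1"] by (simp add: scale_pm_simps)

lemma R_diff: "X \<in> R \<Longrightarrow> Y \<in> R \<Longrightarrow> X - Y \<in> R"
  using R_facts(3)[of X "- Y"] R_uminus[of Y] by simp

lemma Rel_R: "X \<in> Rel \<Longrightarrow> X \<in> R"
  using lin_span_superset[OF FM_module, of Rel] by blast

lemma R_act: "x \<in> carrier L \<Longrightarrow> X \<in> R \<Longrightarrow> act x X \<in> R"
proof -
  assume x: "x \<in> carrier L" and "X \<in> R"
  from FM_module this(2) Rel_carrier show "act x X \<in> R"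
  proof (induction rule: lin_span_induct)
    case (base X) then show ?case using rel_act[OF x] Rel_R by blast
  next
    case zero then show ?case using R_facts(2) by (simp add: action_zero)
  next
    case (add X Y) then show ?case using R_facts(3) by (simp add: action_add)
  next
    case (smult c X) then show ?case using R_facts(4) by (simp add: action_scale)
  qed
qed

subsection \<open>The Lie algebra acts modulo the relations\<close>

lemma act_L_add:
  assumes x: "x \<in> carrier L" and y: "y \<in> carrier L" and "X \<in> carrier FM"
  shows "act (x \<oplus>\<^bsub>L\<^esub> y) X - act x X - act y X \<in> R"
  using assms(3)
proof (induction rule: free_induct)
  case (word xs v)
  then show ?case using Rel_R[OF induction_relations.add_slot[of "[]" L xs x y v M B]] x y
    by (simp add: action_word)
next
  case zero then show ?case by (simp add: action_zero R_facts)
next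
  case (add X Y)
  then show ?case using R_facts(3)[OF add(3,4)] by (simp add: action_add algebra_simps)
next
  case (scale c X)
  then show ?case using R_facts(4)[OF scale(2), of c] by (simp add: action_scale scale_pm_simps)
qed

lemma act_L_smult:
  assumes x: "x \<in> carrier L" and "X \<in> carrier FM"
  shows "act (c \<odot>\<^bsub>L\<^esub> x) X - scale_pm c (act x X) \<in> R"
  using assms(2)
proof (induction rule: free_induct)
  case (word xs v)
  then show ?case using Rel_R[OF induction_relations.scale_slot[of "[]" L xs x v M c B]] x
    by (simp add: action_word)
next
  case zero then show ?case by (simp add: action_zero R_facts scale_pm_simps)
next
  case (add X Y)
  then show ?case using R_facts(3)[OF add(3,4)] by (simp add: action_add scale_pm_simps algebra_simps)
next
  case (scale a X)
  then show ?case using R_facts(4)[OF scale(2), of a]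
    by (simp add: action_scale scale_pm_simps mult.commute)
qed

text \<open>The commutator relation with empty prefix: modulo relations the prefix action satisfies the
  superbracket identity.\<close>

lemma act_L_comm_word:
  assumes "x \<in> hom_part L p m" "y \<in> hom_part L q n" "xs \<in> lists (carrier L)" "v \<in> carrier M"
  shows "word (x # y # xs) v - scale_pm (if p \<and> q then -1 else 1) (word (y # x # xs) v)
     - word (bracket L x y # xs) v \<in> R"
  using Rel_R[OF induction_relations.commutator[of "[]" L xs x y p m q n v M B]] assms L_hom
  by (simp add: subset_iff)

lemma word_balanced:
  assumes "b \<in> B" "v \<in> carrier M"
  shows "word [b] v - word [] (action M b v) \<in> R"
  using Rel_R[OF induction_relations.balanced[of "[]" L b B v M]] assms by simp

subsection \<open>Triangular decomposition\<close>

text \<open>\<open>Wgen n\<close> consists, modulo relations, of the words of length at most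
  \<open>n\<close> with letters of negative weight. The letters of \<open>Gpos\<close> lie in
  \<open>B\<close>.\<close>

definition "Gneg = (\<Union>p n. \<Union>k\<in>{..<0}. hom_part L p n \<inter> ad_eigenspace L F k)"
definition "Gpos = (\<Union>p n. \<Union>k\<in>{0..}. hom_part L p n \<inter> ad_eigenspace L F k)"
definition "Wgen n = R \<union> {word ys v | ys v. set ys \<subseteq> Gneg \<and> length ys \<le> n \<and> v \<in> carrier M}"
definition "W n = lin_span FM (Wgen n)"

lemma Gneg_carrier: "Gneg \<subseteq> carrier L" and Gpos_carrier: "Gpos \<subseteq> carrier L"
  using L_hom by (auto simp: Gneg_def Gpos_def)

lemma lists_Gneg: "set ys \<subseteq> Gneg \<Longrightarrow> ys \<in> lists (carrier L)"
  using Gneg_carrier by auto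

lemma Gpos_B: "g \<in> Gpos \<Longrightarrow> g \<in> B"
  using eigen_in_B by (auto simp: Gpos_def)

lemma Wgen_carrier: "Wgen n \<subseteq> carrier FM"
  using R_facts(1) lists_Gneg by (auto simp: Wgen_def FMc(5))

lemmas W_subsp = subsp_lin_span[OF FM_module Wgen_carrier, folded W_def]
lemmas W_facts = subspD[OF W_subsp, simplified]

lemma W_word: "set ys \<subseteq> Gneg \<Longrightarrow> length ys \<le> n \<Longrightarrow> v \<in> carrier M \<Longrightarrow> word ys v \<in> W n"
  using subsetD[OF lin_span_superset[OF FM_module, of "Wgen n"], of "word ys v"]
  unfolding W_def by (auto simp: Wgen_def)

lemma R_W: "X \<in> R \<Longrightarrow> X \<in> W n"
  using subsetD[OF lin_span_superset[OF FM_module, of "Wgen n"], of X]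
  unfolding W_def by (auto simp: Wgen_def)

lemma W_mod: "X - Y \<in> R \<Longrightarrow> Y \<in> W n \<Longrightarrow> X \<in> W n"
  using W_facts(3)[OF R_W, of "X - Y" Y n] by simp

lemma W_mono: "n \<le> m \<Longrightarrow> W n \<subseteq> W m"
  unfolding W_def
  by (rule lin_span_mono[OF FM_module order_trans[OF _ lin_span_superset[OF FM_module]] Wgen_carrier])
    (fastforce simp: Wgen_def)

text \<open>Reduction of a statement about the action on \<open>W n\<close> to ordered words.\<close>

lemma W_act:
  assumes z: "z \<in> carrier L" and X: "X \<in> W n"
    and w: "\<And>ys v. set ys \<subseteq> Gneg \<Longrightarrow> length ys \<le> n \<Longrightarrow> v \<in> carrier M \<Longrightarrow> word (z # ys) v \<in> W m"
  shows "act z X \<in> W m"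
  using FM_module X[unfolded W_def] Wgen_carrier
proof (induction rule: lin_span_induct)
  case (base X)
  then show ?case using w R_W[OF R_act[OF z]] by (auto simp: Wgen_def action_word)
next
  case zero then show ?case using W_facts(2) by (simp add: action_zero)
next
  case (add X Y) then show ?case using W_facts(3) by (simp add: action_add)
next
  case (smult c X) then show ?case using W_facts(4) by (simp add: action_scale)
qed

lemma eigen_hom_UN_carrier: "(\<Union>p n k. hom_part L p n \<inter> ad_eigenspace L F k) \<subseteq> carrier L"
  using L_hom by blast

text \<open>A letter of negative weight lengthens a word by one, and letters of non-negative weight are
  assumed not to lengthen it. This is the inductive step shared by \<open>Gpos_W\<close> and
  \<open>word_in_W\<close>.\<close>

lemma act_W_Suc:
  assumes pos: "\<And>g X. g \<in> Gpos \<Longrightarrow> X \<in> W n \<Longrightarrow> act g X \<in> W n"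
    and z: "z \<in> carrier L" and X: "X \<in> W n"
  shows "act z X \<in> W (Suc n)"
proof -
  have Xc: "X \<in> carrier FM" by (rule W_facts(1)[OF X])
  have "z \<in> lin_span L (\<Union>p n k. hom_part L p n \<inter> ad_eigenspace L F k)" using z L_span by blast
  from L_module this eigen_hom_UN_carrier show ?thesis
  proof (induction rule: lin_span_induct)
    case (base g)
    then obtain p m k where g: "g \<in> hom_part L p m" "g \<in> ad_eigenspace L F k" by blast
    show ?case
    proof (cases "k < 0")
      case True
      then have G: "g \<in> Gneg" using g by (auto simp: Gneg_def)
      show ?thesis
        by (rule W_act[OF _ X]) (use G Gneg_carrier W_word[of "g # ys" "Suc n" for ys] in auto)
    next
      case False
      then have "g \<in> Gpos" using g by (auto simp: Gpos_def)
      then show ?thesis using pos[OF _ X] W_mono[of n "Suc n"] by auto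
    qed
  next
    case zero
    have "act (0 \<odot>\<^bsub>L\<^esub> \<zero>\<^bsub>L\<^esub>) X - scale_pm 0 (act \<zero>\<^bsub>L\<^esub> X) \<in> R"
      by (rule act_L_smult[OF L_facts(1) Xc])
    then show ?case using R_W by (simp add: L_facts(6) scale_pm_simps)
  next
    case (add x y)
    have "act (x \<oplus>\<^bsub>L\<^esub> y) X - (act x X + act y X) \<in> R"
      using act_L_add[OF add(1,2) Xc] by (simp add: diff_diff_eq)
    then show ?case by (rule W_mod) (rule W_facts(3)[OF add(3,4)])
  next
    case (smult c x)
    show ?case by (rule W_mod[OF act_L_smult[OF smult(1) Xc] W_facts(4)[OF smult(2)]])
  qed
qed

text \<open>A letter of non-negative weight is moved to the right through the word. Each commutator with
  a letter is shorter by one, and at the right end the letter lies in \<open>B\<close> and is absorbed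
  into \<open>M\<close>. The induction is on the length. The bracket may have a weight of either sign:
  this is why \<open>act_W_Suc\<close> allows an arbitrary \<open>z\<close>.\<close>

lemma Gpos_W: "g \<in> Gpos \<Longrightarrow> X \<in> W n \<Longrightarrow> act g X \<in> W n"
proof (induction n arbitrary: g X)
  case (0 g X)
  have gB: "g \<in> B" by (rule Gpos_B[OF 0(1)])
  show ?case
  proof (rule W_act[OF _ 0(2)])
    show "g \<in> carrier L" using 0(1) Gpos_carrier by auto
    fix ys v assume "set ys \<subseteq> Gneg" "length ys \<le> 0" "v \<in> carrier M"
    then show "word (g # ys) v \<in> W 0"
      using W_mod[OF word_balanced[OF gB] W_word[OF _ _ M_action[OF gB]]] by simp
  qed
next
  case (Suc n g X)
  note pos = Suc(1)
  have gB: "g \<in> B" by (rule Gpos_B[OF Suc(2)])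
  have gc: "g \<in> carrier L" using Suc(2) Gpos_carrier by auto
  show ?case
  proof (rule W_act[OF gc Suc(3)])
    fix ys v assume ys: "set ys \<subseteq> Gneg" "length ys \<le> Suc n" and v: "v \<in> carrier M"
    show "word (g # ys) v \<in> W (Suc n)"
    proof (cases ys)
      case Nil
      then show ?thesis using W_mod[OF word_balanced[OF gB v] W_word[OF _ _ M_action[OF gB v]]] by simp
    next
      case (Cons y zs)
      have zs: "set zs \<subseteq> Gneg" "length zs \<le> n" and y: "y \<in> Gneg" using ys Cons by auto
      have yc: "y \<in> carrier L" using y Gneg_carrier by auto
      have w: "word zs v \<in> W n" by (rule W_word[OF zs v])
      from y obtain p m where yh: "y \<in> hom_part L p m" by (auto simp: Gneg_def)
      from Suc(2) obtain q l where gh: "g \<in> hom_part L q l" by (auto simp: Gpos_def)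
      let ?s = "if q \<and> p then -1 else 1 :: complex"
      have "word (y # g # zs) v \<in> W (Suc n)"
        using act_W_Suc[OF pos yc pos[OF Suc(2) w]] by (simp add: action_word)
      moreover have "word (bracket L g y # zs) v \<in> W (Suc n)"
        using act_W_Suc[OF pos L_bracket[OF gh yh] w] by (simp add: action_word)
      ultimately have "scale_pm ?s (word (y # g # zs) v) + word (bracket L g y # zs) v \<in> W (Suc n)"
        by (intro W_facts(3,4))
      then have "word (g # y # zs) v \<in> W (Suc n)"
        by (rule W_mod[rotated])
          (use act_L_comm_word[OF gh yh lists_Gneg[OF zs(1)] v] in \<open>simp only: diff_diff_eq\<close>)
      then show ?thesis using Cons by simp
    qed
  qed
qed

text \<open>The spanning half of the Poincare-Birkhoff-Witt theorem for \<open>L = L\<^sup>- \<oplus>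
  B\<close>.\<close>

lemma word_in_W:
  assumes "xs \<in> lists (carrier L)" "v \<in> carrier M"
  shows "\<exists>n. word xs v \<in> W n"
  using assms(1)
proof (induction xs)
  case Nil then show ?case using W_word[of "[]" 0 v] assms(2) by auto
next
  case (Cons x xs)
  then obtain n where "word xs v \<in> W n" "x \<in> carrier L" by auto
  then have "act x (word xs v) \<in> W (Suc n)" by (intro act_W_Suc Gpos_W)
  then show ?case by (auto simp: action_word)
qed

end

context highest_weight_model begin

subsection \<open>Weights\<close>

text \<open>\<open>stp k\<close> kills the vectors of weight \<open>d + k\<close>.\<close>

definition "stp k X = act F X - scale_pm (of_int (d + k)) X"

lemma stp_simps:
  "stp k (X + Y) = stp k X + stp k Y" "stp k (X - Y) = stp k X - stp k Y"
  "stp k (scale_pm c X) = scale_pm c (stp k X)" "stp k 0 = 0"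
  by (simp_all add: stp_def action_add action_diff action_scale action_zero scale_pm_simps
      algebra_simps mult.commute)

lemma stp_commute: "stp k (stp l X) = stp l (stp k X)"
  by (simp add: stp_def action_diff action_add action_scale scale_pm_simps algebra_simps mult.commute)

lemma stps_simps:
  "foldr stp ks (X + Y) = foldr stp ks X + foldr stp ks Y"
  "foldr stp ks (X - Y) = foldr stp ks X - foldr stp ks Y"
  "foldr stp ks (scale_pm c X) = scale_pm c (foldr stp ks X)"
  by (induction ks) (simp_all add: stp_simps)

lemma stps_stp: "foldr stp ks (stp l X) = stp l (foldr stp ks X)"
  by (induction ks) (simp_all add: stp_commute)

lemma stps_commute: "foldr stp ks (foldr stp ls X) = foldr stp ls (foldr stp ks X)"
  by (induction ks) (simp_all add: stps_stp)

lemma stps_closed: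
  assumes P: "subsp FM P" and i: "\<And>X. X \<in> P \<Longrightarrow> act F X \<in> P"
  shows "X \<in> P \<Longrightarrow> foldr stp ks X \<in> P"
proof (induction ks)
  case (Cons k ks)
  then have Y: "foldr stp ks X \<in> P" (is "?Y \<in> P") by simp
  have "act F ?Y + scale_pm (- of_int (d + k)) ?Y \<in> P"
    using subspD(3,4)[OF P] i Y by simp
  moreover have "scale_pm (- of_int (d + k)) ?Y = - scale_pm (of_int (d + k)) ?Y"
    by (rule poly_mapping_eqI) (simp add: algebra_simps)
  ultimately show ?case by (simp add: stp_def[of k "foldr stp ks X"])
qed simp

lemma stps_R: "X \<in> R \<Longrightarrow> foldr stp ks X \<in> R"
  by (rule stps_closed[OF R_subsp R_act[OF F_carrier]])

lemma F_B: "F \<in> B"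
  by (rule eigen_in_B[of _ 0]) (simp_all add: ad_eigenspace_def F_carrier F_bracket L_facts)

lemma action_F:
  assumes v: "v \<in> carrier M" shows "action M F v = of_int d \<odot>\<^bsub>M\<^esub> v"
  by (rule inj_onD[OF j_inj])
    (simp_all add: j_action[OF F_B v] F_j[OF v] j_smult[OF v] M_action[OF F_B v] M_facts(3)[OF v])

lemma word_vector_smult: "v \<in> carrier M \<Longrightarrow> word [] (c \<odot>\<^bsub>M\<^esub> v) - scale_pm c (word [] v) \<in> R"
  using Rel_R[OF induction_relations.scale_vector[of "[]" L v M c B]] by simp

lemma word_vector_add:
  "u \<in> carrier M \<Longrightarrow> v \<in> carrier M \<Longrightarrow> word [] (u \<oplus>\<^bsub>M\<^esub> v) - word [] u - word [] v \<in> R"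
  using Rel_R[OF induction_relations.add_vector[of "[]" L u M v B]] by simp

lemma word_vector_zero: "word [] \<zero>\<^bsub>M\<^esub> \<in> R"
  using word_vector_smult[of "\<zero>\<^bsub>M\<^esub>" 0] by (simp add: M_facts scale_pm_simps)

lemma stp_word_Nil:
  assumes v: "v \<in> carrier M"
  shows "stp k (word [] v) - scale_pm (- of_int k) (word [] v) \<in> R"
proof -
  have "(word [F] v - word [] (action M F v)) + (word [] (of_int d \<odot>\<^bsub>M\<^esub> v) - scale_pm (of_int d) (word [] v)) \<in> R"
    by (rule R_facts(3)[OF word_balanced[OF F_B v] word_vector_smult[OF v]])
  then show ?thesis
    by (simp add: stp_def action_word action_F[OF v] scale_pm_simps algebra_simps)
      (simp add: poly_mapping_eq_iff fun_eq_iff lookup_add lookup_minus scale_pm_simps algebra_simps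
        flip: scale_pm_simps)
qed

text \<open>A word of weight vectors is a weight vector modulo the relations, and its weight is
  \<open>d\<close> plus the weights of the letters; only the empty word reaches \<open>d\<close>.\<close>

lemma word_weight:
  assumes v: "v \<in> carrier M"
  shows "set ys \<subseteq> Gneg \<Longrightarrow> \<exists>k. (ys = [] \<and> k = 0 \<or> k < 0) \<and> stp k (word ys v) \<in> R"
proof (induction ys)
  case Nil
  then show ?case using stp_word_Nil[OF v, of 0] by (auto simp: scale_pm_simps)
next
  case (Cons y ys)
  then have "set ys \<subseteq> Gneg" by simp
  from Cons.IH[OF this] obtain k where k0: "ys = [] \<and> k = 0 \<or> k < 0" and
    k2: "stp k (word ys v) \<in> R" by blast
  then have k: "k \<le> 0" "stp k (word ys v) \<in> R" by auto
  from Cons.prems obtain p m k1 where y: "y \<in> hom_part L p m" "y \<in> ad_eigenspace L F k1" "k1 < 0"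
    by (auto simp: Gneg_def)
  have yc: "y \<in> carrier L" "bracket L F y = of_int k1 \<odot>\<^bsub>L\<^esub> y" using y by (auto simp: ad_eigenspace_def)
  have ys: "ys \<in> lists (carrier L)" using Cons.prems Gneg_carrier by auto
  have wc: "word ys v \<in> carrier FM" using ys v by (simp add: FMc)
  have r1: "word (F # y # ys) v - word (y # F # ys) v - word (bracket L F y # ys) v \<in> R"
    using act_L_comm_word[OF F_hom y(1) ys v] by (simp add: scale_pm_simps)
  have r2: "word ((of_int k1 \<odot>\<^bsub>L\<^esub> y) # ys) v - scale_pm (of_int k1) (word (y # ys) v) \<in> R"
    using act_L_smult[OF yc(1) wc] by (simp add: action_word)
  have r3: "word (y # F # ys) v - scale_pm (of_int (d + k)) (word (y # ys) v) \<in> R"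
    using R_act[OF yc(1) k(2)] by (simp add: stp_def action_diff action_scale action_word)
  have "stp (k1 + k) (word (y # ys) v) \<in> R"
    using R_facts(3)[OF R_facts(3)[OF r1 r2] r3] yc(2)
    by (simp add: stp_def action_word scale_pm_simps algebra_simps)
  then show ?case using k y by (intro exI[of _ "k1 + k"]) auto
qed

text \<open>The elements that differ from some \<open>m \<in> M\<close> by a sum of weight vectors of
  weights below \<open>d\<close>, expressed without choosing the summands.\<close>

definition "T = {X \<in> carrier FM. \<exists>m\<in>carrier M. \<exists>ks. (\<forall>k\<in>set ks. k < 0) \<and>
    foldr stp ks (X - word [] m) \<in> R}"

lemma T_subsp: "subsp FM T"
  unfolding subsp_def
proof (intro conjI ballI allI)
  show "T \<subseteq> carrier FM" by (auto simp: T_def)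
  have "(0 :: _ \<Rightarrow>\<^sub>0 complex) - word [] \<zero>\<^bsub>M\<^esub> \<in> R" using R_uminus[OF word_vector_zero] by simp
  then have "0 \<in> T" using M_facts(1) FMc(1)
    by (auto simp: T_def intro!: bexI[of _ "\<zero>\<^bsub>M\<^esub>"] exI[of _ "[]"])
  then show "\<zero>\<^bsub>FM\<^esub> \<in> T" by simp
next
  fix X Y assume "X \<in> T" "Y \<in> T"
  then obtain m ks n ls where X: "X \<in> carrier FM" "m \<in> carrier M" "\<forall>k\<in>set ks. k < 0"
      "foldr stp ks (X - word [] m) \<in> R"
    and Y: "Y \<in> carrier FM" "n \<in> carrier M" "\<forall>k\<in>set ls. k < 0"
      "foldr stp ls (Y - word [] n) \<in> R" by (auto simp: T_def)
  have e: "X + Y - word [] (m \<oplus>\<^bsub>M\<^esub> n) =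
     (X - word [] m) + (Y - word [] n) - (word [] (m \<oplus>\<^bsub>M\<^esub> n) - word [] m - word [] n)" by simp
  have "foldr stp (ls @ ks) (X - word [] m) \<in> R" using stps_R[OF X(4)] by simp
  moreover have "foldr stp (ls @ ks) (Y - word [] n) \<in> R"
    using stps_R[OF Y(4), of ks] by (simp add: stps_commute)
  moreover have "foldr stp (ls @ ks) (word [] (m \<oplus>\<^bsub>M\<^esub> n) - word [] m - word [] n) \<in> R"
    by (rule stps_R[OF word_vector_add[OF X(2) Y(2)]])
  ultimately have "foldr stp (ls @ ks) (X + Y - word [] (m \<oplus>\<^bsub>M\<^esub> n)) \<in> R"
    unfolding e stps_simps(2)[of _ "(X - word [] m) + (Y - word [] n)"] stps_simps(1)[of _ "X - word [] m"]
    by (intro R_diff R_facts(3))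
  then show "X \<oplus>\<^bsub>FM\<^esub> Y \<in> T"
    unfolding T_def using X Y FMc(2) M_facts(2)
    by (auto intro!: bexI[of _ "m \<oplus>\<^bsub>M\<^esub> n"] exI[of _ "ls @ ks"] simp del: foldr_append)
next
  fix c X assume "X \<in> T"
  then obtain m ks where X: "X \<in> carrier FM" "m \<in> carrier M" "\<forall>k\<in>set ks. k < 0"
      "foldr stp ks (X - word [] m) \<in> R" by (auto simp: T_def)
  have e: "scale_pm c X - word [] (c \<odot>\<^bsub>M\<^esub> m) =
     scale_pm c (X - word [] m) - (word [] (c \<odot>\<^bsub>M\<^esub> m) - scale_pm c (word [] m))"
    by (simp add: scale_pm_simps)
  have "foldr stp ks (scale_pm c X - word [] (c \<odot>\<^bsub>M\<^esub> m)) \<in> R"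
    unfolding e stps_simps(2)[of _ "scale_pm c (X - word [] m)"]
    by (rule R_diff) (use R_facts(4)[OF X(4)] stps_R[OF word_vector_smult[OF X(2)]] in \<open>simp_all add: stps_simps(3)\<close>)
  then show "c \<odot>\<^bsub>FM\<^esub> X \<in> T"
    unfolding T_def using X FMc(3) M_facts(3) by (auto intro!: bexI[of _ "c \<odot>\<^bsub>M\<^esub> m"] exI[of _ ks])
qed

text \<open>The top component \<open>m\<close> of a word is its vector if the word is empty and zero
  otherwise.\<close>

lemma W_T: "W n \<subseteq> T"
  unfolding W_def
proof (rule lin_span_least[OF FM_module T_subsp], rule subsetI)
  fix X assume X: "X \<in> Wgen n"
  then consider "X \<in> R" | ys v where "X = word ys v" "set ys \<subseteq> Gneg" "v \<in> carrier M"
    by (auto simp: Wgen_def)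
  then show "X \<in> T"
  proof cases
    case 1
    then have "X - word [] \<zero>\<^bsub>M\<^esub> \<in> R" using R_diff word_vector_zero by blast
    then show ?thesis using 1 R_facts(1) M_facts(1)
      by (auto simp: T_def intro!: bexI[of _ "\<zero>\<^bsub>M\<^esub>"] exI[of _ "[]"])
  next
    case 2
    have Xc: "X \<in> carrier FM" using X Wgen_carrier by blast
    show ?thesis
    proof (cases "ys = []")
      case True
      then show ?thesis using 2 Xc R_facts(2) by (auto simp: T_def intro!: bexI[of _ v] exI[of _ "[]"])
    next
      case False
      then obtain k where k: "k < 0" "stp k (word ys v) \<in> R" using word_weight[OF 2(3,2)] by auto
      have "stp k (X - word [] \<zero>\<^bsub>M\<^esub>) \<in> R"
        unfolding stp_simps using R_diff[OF k(2) stps_R[OF word_vector_zero, of "[k]"]] 2(1) by simp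
      then show ?thesis using Xc k(1) M_facts(1)
        by (auto simp: T_def intro!: bexI[of _ "\<zero>\<^bsub>M\<^esub>"] exI[of _ "[k]"])
    qed
  qed
qed

lemma carrier_T: "X \<in> carrier FM \<Longrightarrow> X \<in> T"
proof (induction rule: free_induct)
  case (word xs v) then show ?case using word_in_W W_T by blast
qed (use subspD(2-4)[OF T_subsp] in simp_all)

subsection \<open>Evaluation in the model\<close>

text \<open>The map from the induced module to \<open>N\<close>, on the level of words.\<close>

definition "ev X = (\<Sum>k\<in>Poly_Mapping.keys X.
    Poly_Mapping.lookup X k \<odot>\<^bsub>N\<^esub> foldr (action N) (fst k) (j (snd k)))"

lemma subsp_sum: "subsp N P \<Longrightarrow> (\<And>i. i \<in> A \<Longrightarrow> f i \<in> P) \<Longrightarrow> sum f A \<in> P"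
  by (induction A rule: infinite_finite_induct) (simp_all add: subsp_def N_add N_zero)

lemma foldr_closed: "xs \<in> lists (carrier L) \<Longrightarrow> w \<in> carrier N \<Longrightarrow> foldr (action N) xs w \<in> carrier N"
  by (induction xs) (auto simp: N_act)

lemma foldr_add: "xs \<in> lists (carrier L) \<Longrightarrow> w \<in> carrier N \<Longrightarrow> w' \<in> carrier N \<Longrightarrow>
    foldr (action N) xs (w + w') = foldr (action N) xs w + foldr (action N) xs w'"
  by (induction xs) (auto simp: N_act foldr_closed simp del: in_lists_conv_set)

lemma foldr_smult: "xs \<in> lists (carrier L) \<Longrightarrow> w \<in> carrier N \<Longrightarrow>
    foldr (action N) xs (c \<odot>\<^bsub>N\<^esub> w) = c \<odot>\<^bsub>N\<^esub> foldr (action N) xs w"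
  by (induction xs) (auto simp: N_act foldr_closed simp del: in_lists_conv_set)

lemma key_closed: "X \<in> carrier FM \<Longrightarrow> k \<in> Poly_Mapping.keys X \<Longrightarrow>
    foldr (action N) (fst k) (j (snd k)) \<in> carrier N"
  using foldr_closed j_carrier by (fastforce simp: free_carrier simp del: in_lists_conv_set)

lemma ev_word: "xs \<in> lists (carrier L) \<Longrightarrow> v \<in> carrier M \<Longrightarrow> ev (word xs v) = foldr (action N) xs (j v)"
  using N_facts(5)[OF foldr_closed[OF _ j_carrier]] by (simp add: ev_def word_def)

lemma ev_zero: "ev 0 = 0" by (simp add: ev_def)

lemma ev_add:
  assumes "X \<in> carrier FM" "Y \<in> carrier FM" shows "ev (X + Y) = ev X + ev Y"
proof -
  \<comment> \<open>the case distinction makes the summand vanish at coefficient 0 for every key\<close>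
  define f where "f k c = (if c = 0 then 0 else c \<odot>\<^bsub>N\<^esub> foldr (action N) (fst k) (j (snd k)))" for k c
  have e: "ev Z = (\<Sum>k\<in>Poly_Mapping.keys Z. f k (Poly_Mapping.lookup Z k))" for Z
    unfolding ev_def by (rule sum.cong) (auto simp: f_def in_keys_iff)
  show ?thesis
    unfolding e
  proof (rule Poly_Mapping.setsum_keys_plus_distrib)
    show "f k 0 = 0" for k by (simp add: f_def)
    fix k assume "k \<in> Poly_Mapping.keys X \<union> Poly_Mapping.keys Y"
    then have w: "foldr (action N) (fst k) (j (snd k)) \<in> carrier N" using key_closed assms by blast
    show "f k (Poly_Mapping.lookup X k + Poly_Mapping.lookup Y k) =
        f k (Poly_Mapping.lookup X k) + f k (Poly_Mapping.lookup Y k)"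
      using N_facts(8)[OF w, of "Poly_Mapping.lookup X k" "Poly_Mapping.lookup Y k"] N_facts(4)[OF w]
      by (auto simp: f_def)
  qed
qed

lemma N_smult_sum:
  "(\<And>i. i \<in> A \<Longrightarrow> f i \<in> carrier N) \<Longrightarrow> c \<odot>\<^bsub>N\<^esub> sum f A = (\<Sum>i\<in>A. c \<odot>\<^bsub>N\<^esub> f i)"
proof (induction A rule: infinite_finite_induct)
  case (insert x A)
  then show ?case
    using N_facts(9)[of "f x" "sum f A" c] subsp_sum[OF subsp_carrier[OF smodD(1)[OF N_smod]], of A f] by simp
qed (simp_all add: N_facts)

lemma ev_scale:
  assumes X: "X \<in> carrier FM" shows "ev (scale_pm c X) = c \<odot>\<^bsub>N\<^esub> ev X"
proof -
  have "ev (scale_pm c X) = (\<Sum>k\<in>Poly_Mapping.keys X.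
      (c * Poly_Mapping.lookup X k) \<odot>\<^bsub>N\<^esub> foldr (action N) (fst k) (j (snd k)))"
    unfolding ev_def
    by (rule sum.mono_neutral_cong_left)
      (use keys_scale_pm[of c X] N_facts(4)[OF key_closed[OF X]] in \<open>auto simp: in_keys_iff\<close>)
  also have "\<dots> = (\<Sum>k\<in>Poly_Mapping.keys X.
      c \<odot>\<^bsub>N\<^esub> (Poly_Mapping.lookup X k \<odot>\<^bsub>N\<^esub> foldr (action N) (fst k) (j (snd k))))"
    by (rule sum.cong) (use N_facts(7)[OF key_closed[OF X]] in auto)
  also have "\<dots> = c \<odot>\<^bsub>N\<^esub> ev X"
    unfolding ev_def by (rule N_smult_sum[symmetric]) (use N_facts(3)[OF key_closed[OF X]] in auto)
  finally show ?thesis .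
qed

lemma N_uminus: "w \<in> carrier N \<Longrightarrow> (-1) \<odot>\<^bsub>N\<^esub> w = - w"
  using N_facts(12)[of w] by (simp add: add_eq_0_iff)

lemma ev_diff:
  assumes "X \<in> carrier FM" "Y \<in> carrier FM" shows "ev (X - Y) = ev X - ev Y"
  using ev_add[of "X - Y" Y] assms FMc(4) by (simp add: algebra_simps)

lemma ev_closed: "X \<in> carrier FM \<Longrightarrow> ev X \<in> carrier N"
  unfolding ev_def
  by (rule subsp_sum[OF subsp_carrier[OF smodD(1)[OF N_smod]]]) (use N_facts(3)[OF key_closed] in auto)

lemma ev_act:
  assumes x: "x \<in> carrier L" shows "X \<in> carrier FM \<Longrightarrow> ev (act x X) = action N x (ev X)"
proof (induction rule: free_induct)
  case (word xs v) then show ?case using x by (simp add: action_word ev_word)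
next
  case zero
  then show ?case using N_act(3)[OF x N_facts(1), of 0] N_facts(4)[OF N_act(1)[OF x N_facts(1)]] N_facts(6)
    by (simp add: action_zero ev_zero)
next
  case (add X Y)
  then show ?case using x by (simp add: action_add ev_add action_closed N_act ev_closed)
next
  case (scale c X)
  then show ?case using x by (simp add: action_scale ev_scale action_closed N_act ev_closed)
qed

text \<open>Evaluation in \<open>N\<close> respects the relations because \<open>N\<close> is a module,
  and the balanced relation because \<open>j\<close> is a homomorphism for \<open>B\<close>.\<close>

lemma ev_rel: "X \<in> Rel \<Longrightarrow> ev X = 0"
proof (induction rule: induction_relations.induct)
  case (add_slot xs ys x y v)
  then have "foldr (action N) ys (j v) \<in> carrier N" using foldr_closed j_carrier by blast
  with add_slot show ?case
    by (simp add: ev_diff ev_word FMc L_facts(2) N_act_add foldr_add N_act del: in_lists_conv_set)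
next
  case (scale_slot xs ys x v c)
  then have "foldr (action N) ys (j v) \<in> carrier N" using foldr_closed j_carrier by blast
  with scale_slot show ?case
    by (simp add: ev_diff ev_scale ev_word FMc L_facts(3) N_act_smult foldr_smult N_act del: in_lists_conv_set)
next
  case (add_vector xs v w)
  then show ?case
    by (simp add: ev_diff ev_word FMc M_facts(2) j_add foldr_add j_carrier del: in_lists_conv_set)
next
  case (scale_vector xs v c)
  then show ?case
    by (simp add: ev_diff ev_scale ev_word FMc M_facts(3) j_smult foldr_smult j_carrier del: in_lists_conv_set)
next
  case (commutator xs ys x y p m q n v)
  let ?w = "foldr (action N) ys (j v)"
  have w: "?w \<in> carrier N" using foldr_closed j_carrier commutator by blast
  have b: "bracket L x y \<in> carrier L" using L_bracket commutator by blast
  have "foldr (action N) xs (action N x (action N y ?w)) =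
      (if p \<and> q then -1 else 1) \<odot>\<^bsub>N\<^esub> foldr (action N) xs (action N y (action N x ?w))
      + foldr (action N) xs (action N (bracket L x y) ?w)"
    unfolding N_comm[OF commutator(5,6) w]
    using foldr_add[OF commutator(1)] foldr_smult[OF commutator(1)] N_act(1) w b commutator(3,4) N_facts(3)
    by (simp del: in_lists_conv_set)
  with commutator b show ?case
    by (simp add: ev_diff ev_scale ev_word FMc del: in_lists_conv_set)
next
  case (balanced xs b v)
  then have b: "b \<in> carrier L" using B_carrier by auto
  show ?case using balanced b
    by (simp add: ev_diff ev_word FMc M_action j_action del: in_lists_conv_set)
qed

lemma ev_R: "X \<in> R \<Longrightarrow> ev X = 0"
proof -
  assume "X \<in> R"
  from FM_module this Rel_carrier show ?thesis
    by (induction rule: lin_span_induct) (auto simp: ev_rel ev_zero ev_add ev_scale N_facts)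
qed

lemma ev_hom:
  assumes X: "X \<in> hom_part FM p n" shows "ev X \<in> hom_part N p n"
proof -
  have h: "word_homogeneous L M p n xs v \<Longrightarrow> foldr (action N) xs (j v) \<in> hom_part N p n" for p n xs v
  proof (induction xs arbitrary: p n)
    case Nil then show ?case using j_hom by simp
  next
    case (Cons x xs)
    then obtain q m where q: "x \<in> hom_part L q m" "word_homogeneous L M (p \<noteq> q) (n - m) xs v" by auto
    from N_act_hom[OF q(1) Cons.IH[OF q(2)]] show ?case by (cases p; cases q; simp)
  qed
  show ?thesis
    unfolding ev_def
  proof (rule subsp_sum[OF N_hom])
    fix k assume "k \<in> Poly_Mapping.keys X"
    then have "word_homogeneous L M p n (fst k) (snd k)" using X by (auto simp: free_smodule_def)
    then show "Poly_Mapping.lookup X k \<odot>\<^bsub>N\<^esub> foldr (action N) (fst k) (j (snd k)) \<in> hom_part N p n"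
      using h subspD(4)[OF N_hom] by blast
  qed
qed

lemma ev_image_subsp:
  assumes P: "subsp FM P" shows "subsp N (ev ` P)"
proof -
  note s = subspD[OF P, simplified]
  show ?thesis unfolding subsp_def N_add N_zero
  proof (intro conjI ballI allI)
    show "ev ` P \<subseteq> carrier N" using s(1) ev_closed by auto
    show "0 \<in> ev ` P" using s(2) ev_zero by force
    fix x y assume "x \<in> ev ` P" "y \<in> ev ` P"
    then show "x + y \<in> ev ` P" using s(1,3) ev_add by (auto simp: image_iff) metis
  next
    fix c x assume "x \<in> ev ` P"
    then show "c \<odot>\<^bsub>N\<^esub> x \<in> ev ` P" using s(1,4) ev_scale by (auto simp: image_iff) metis
  qed
qed

text \<open>Surjectivity of evaluation on every homogeneous component; words of length at most one
  suffice here.\<close>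

lemma ev_hom_image: "ev ` hom_part FM p n = hom_part N p n"
proof
  show "ev ` hom_part FM p n \<subseteq> hom_part N p n" using ev_hom by auto
  have "lin_span N (j ` hom_part M p n \<union>
      {action N x (j v) | x v q m. x \<in> hom_part L q m \<and> v \<in> hom_part M (p \<noteq> q) (n - m)}) \<subseteq> ev ` hom_part FM p n"
  proof (rule lin_span_least[OF smodD(1)[OF N_smod] ev_image_subsp[OF free_hom_subsp]], intro Un_least subsetI)
    fix w assume "w \<in> j ` hom_part M p n"
    then obtain v where v: "v \<in> hom_part M p n" "w = j v" by auto
    then have "v \<in> carrier M" using M_hom by blast
    then have "w = ev (word [] v)" "word [] v \<in> hom_part FM p n"
      using v by (auto simp: ev_word free_hom_word)
    then show "w \<in> ev ` hom_part FM p n" by blast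
  next
    fix w assume "w \<in> {action N x (j v) | x v q m. x \<in> hom_part L q m \<and> v \<in> hom_part M (p \<noteq> q) (n - m)}"
    then obtain x v q m where v: "x \<in> hom_part L q m" "v \<in> hom_part M (p \<noteq> q) (n - m)" "w = action N x (j v)"
      by auto
    then have "v \<in> carrier M" "x \<in> carrier L" using M_hom L_hom by blast+
    then have "w = ev (word [x] v)" "word [x] v \<in> hom_part FM p n"
      using v by (auto simp: ev_word free_hom_word)
    then show "w \<in> ev ` hom_part FM p n" by blast
  qed
  then show "hom_part N p n \<subseteq> ev ` hom_part FM p n" using N_hom_gen by blast
qed

lemma ev_epi: "epi L FM N ev"
  unfolding epi_def
proof (intro conjI allI ballI)
  show "ev ` carrier FM = carrier N"
  proof
    show "ev ` carrier FM \<subseteq> carrier N" using ev_closed by auto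
    have "lin_span N (\<Union>p n. hom_part N p n) \<subseteq> ev ` carrier FM"
      by (rule lin_span_least[OF smodD(1)[OF N_smod] ev_image_subsp[OF subsp_carrier[OF FM_module]]])
        (use ev_hom_image smodD(2)[OF free_smod[of L M]] in blast)
    then show "carrier N \<subseteq> ev ` carrier FM" using N_span by blast
  qed
qed (simp_all add: ev_zero N_zero N_add ev_add ev_scale ev_hom_image ev_act)

end

context highest_weight_model begin

subsection \<open>The maximal graded submodule\<close>

abbreviation "I \<equiv> quot_smodule FM R"
abbreviation "q X \<equiv> R +>\<^bsub>FM\<^esub> X"

lemma q_epi: "epi L FM I (\<lambda>X. q X)"
  by (rule quot_epi(1)[OF free_smod R_subsp R_act])

lemma I_smod: "smod L I"
  by (rule epi_smod[OF free_smod q_epi])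

lemma q_eq: "X \<in> carrier FM \<Longrightarrow> Y \<in> carrier FM \<Longrightarrow> q X = q Y \<longleftrightarrow> X - Y \<in> R"
  using quot_epi(2)[OF free_smod[of L M] R_subsp R_act, of X Y] by (simp add: scale_pm_simps)

lemma ev_cong: "X \<in> carrier FM \<Longrightarrow> Y \<in> carrier FM \<Longrightarrow> q X = q Y \<Longrightarrow> ev X = ev Y"
  using ev_R[of "X - Y"] by (simp add: q_eq ev_diff)

definition "Hgen = R \<union> {word xs v | xs v. \<exists>p n. word_homogeneous L M p n xs v}"

lemma homogeneous_closed: "word_homogeneous L M p n xs v \<Longrightarrow> xs \<in> lists (carrier L) \<and> v \<in> carrier M"
  by (rule word_homogeneous_closed[OF L_hom M_hom])

lemma Hgen_carrier: "Hgen \<subseteq> carrier FM"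
  using homogeneous_closed R_facts(1) by (auto simp: Hgen_def FMc(5) simp del: in_lists_conv_set)

lemmas H_facts = subspD[OF subsp_lin_span[OF FM_module Hgen_carrier], simplified]

lemma R_H: "X \<in> R \<Longrightarrow> X \<in> lin_span FM Hgen"
  using lin_span_superset[OF FM_module, of Hgen] by (auto simp: Hgen_def)

lemma H_mod: "X - Y \<in> R \<Longrightarrow> Y \<in> lin_span FM Hgen \<Longrightarrow> X \<in> lin_span FM Hgen"
  using H_facts(3)[OF R_H, of "X - Y" Y] by simp

lemma H_act:
  assumes z: "z \<in> carrier L" and X: "X \<in> lin_span FM Hgen"
  shows "act z X \<in> lin_span FM Hgen"
proof -
  have h: "act x X \<in> lin_span FM Hgen" if x: "x \<in> hom_part L q m" for x q m
    using FM_module X Hgen_carrier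
  proof (induction rule: lin_span_induct)
    case (base X)
    then consider "X \<in> R" | xs v p n where "X = word xs v" "word_homogeneous L M p n xs v"
      by (auto simp: Hgen_def)
    then show ?case
    proof cases
      case 1 then show ?thesis using R_H R_act x L_hom by blast
    next
      case 2
      have "word_homogeneous L M (p \<noteq> q) (n + m) (x # xs) v"
        using 2(2) x by (cases p; cases q) (auto intro!: exI[of _ q] exI[of _ m])
      then have "word (x # xs) v \<in> Hgen" unfolding Hgen_def by blast
      then show ?thesis using lin_span_superset[OF FM_module, of Hgen] 2(1) by (auto simp: action_word)
    qed
  next
    case zero then show ?case using H_facts(2) by (simp add: action_zero)
  next
    case (add X Y) then show ?case using H_facts(3) by (simp add: action_add)
  next
    case (smult c X) then show ?case using H_facts(4) by (simp add: action_scale)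
  qed
  have Xc: "X \<in> carrier FM" by (rule H_facts(1)[OF X])
  have "z \<in> lin_span L (\<Union>p n k. hom_part L p n \<inter> ad_eigenspace L F k)" using z L_span by blast
  from L_module this eigen_hom_UN_carrier show ?thesis
  proof (induction rule: lin_span_induct)
    case (base g) then show ?case using h by blast
  next
    case zero
    have "act (0 \<odot>\<^bsub>L\<^esub> \<zero>\<^bsub>L\<^esub>) X - scale_pm 0 (act \<zero>\<^bsub>L\<^esub> X) \<in> R"
      by (rule act_L_smult[OF L_facts(1) Xc])
    then show ?case using R_H by (simp add: L_facts(6) scale_pm_simps)
  next
    case (add x y)
    have "act (x \<oplus>\<^bsub>L\<^esub> y) X - (act x X + act y X) \<in> R"
      using act_L_add[OF add(1,2) Xc] by (simp add: diff_diff_eq)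
    then show ?case by (rule H_mod) (rule H_facts(3)[OF add(3,4)])
  next
    case (smult c x)
    show ?case by (rule H_mod[OF act_L_smult[OF smult(1) Xc] H_facts(4)[OF smult(2)]])
  qed
qed

lemma M_hom_UN: "(\<Union>p n. hom_part M p n) \<subseteq> carrier M"
  using M_hom by blast

text \<open>Modulo the relations every element is a sum of homogeneous words, since the letters and the
  vector may be split into homogeneous components.\<close>

lemma carrier_H: "X \<in> carrier FM \<Longrightarrow> X \<in> lin_span FM Hgen"
proof (induction rule: free_induct)
  case (word xs v)
  from word(1) show ?case
  proof (induction xs)
    case Nil
    have "v \<in> lin_span M (\<Union>p n. hom_part M p n)" using word(2) M_span by blast
    from M_module this M_hom_UN show ?case
    proof (induction rule: lin_span_induct)
      case (base v)
      then obtain p n where "v \<in> hom_part M p n" by blast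
      then have "word_homogeneous L M p n [] v" by simp
      then have "word [] v \<in> Hgen" unfolding Hgen_def by blast
      then show ?case using lin_span_superset[OF FM_module, of Hgen] by blast
    next
      case zero show ?case by (rule R_H[OF word_vector_zero])
    next
      case (add u v)
      have "word [] (u \<oplus>\<^bsub>M\<^esub> v) - (word [] u + word [] v) \<in> R"
        using word_vector_add[OF add(1,2)] by (simp add: diff_diff_eq)
      then show ?case by (rule H_mod) (rule H_facts(3)[OF add(3,4)])
    next
      case (smult c v)
      show ?case by (rule H_mod[OF word_vector_smult[OF smult(1)] H_facts(4)[OF smult(2)]])
    qed
  next
    case (Cons x xs)
    then show ?case using H_act[of x "word xs v"] by (simp add: action_word)
  qed
qed (use H_facts in simp_all)

lemma homogeneous_decomposition:
  assumes "X \<in> carrier FM"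
  shows "\<exists>J Y. finite J \<and> (\<forall>i. Y i \<in> hom_part FM (fst i) (snd i)) \<and> (\<forall>i. i \<notin> J \<longrightarrow> Y i = 0) \<and>
     X - (\<Sum>i\<in>J. Y i) \<in> R"
  using FM_module carrier_H[OF assms] Hgen_carrier
proof (induction rule: lin_span_induct)
  case (base X)
  have z: "0 \<in> hom_part FM p n" for p n using subspD(2)[OF free_hom_subsp, of L M p n] by simp
  from base consider "X \<in> R" | xs v p n where "X = word xs v" "word_homogeneous L M p n xs v"
    by (auto simp: Hgen_def)
  then show ?case
  proof cases
    case 1
    show ?thesis by (rule exI[of _ "{}"], rule exI[of _ "\<lambda>_. 0"]) (use 1 z in auto)
  next
    case 2
    have "word xs v \<in> hom_part FM p n" using 2(2) homogeneous_closed by (simp add: free_hom_word)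
    then show ?thesis
      by (intro exI[of _ "{(p, n)}"] exI[of _ "\<lambda>i. if i = (p, n) then X else 0"])
        (use 2 z R_facts(2) in auto)
  qed
next
  case zero
  have z: "0 \<in> hom_part FM p n" for p n using subspD(2)[OF free_hom_subsp, of L M p n] by simp
  show ?case by (rule exI[of _ "{}"], rule exI[of _ "\<lambda>_. 0"]) (use z R_facts(2) in auto)
next
  case (add X X')
  then obtain J Y J' Y' where Y: "finite J" "\<forall>i. Y i \<in> hom_part FM (fst i) (snd i)"
      "\<forall>i. i \<notin> J \<longrightarrow> Y i = 0" "X - (\<Sum>i\<in>J. Y i) \<in> R"
    and Y': "finite J'" "\<forall>i. Y' i \<in> hom_part FM (fst i) (snd i)"
      "\<forall>i. i \<notin> J' \<longrightarrow> Y' i = 0" "X' - (\<Sum>i\<in>J'. Y' i) \<in> R" by blast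
  have "(\<Sum>i\<in>J \<union> J'. Y i) = (\<Sum>i\<in>J. Y i)" "(\<Sum>i\<in>J \<union> J'. Y' i) = (\<Sum>i\<in>J'. Y' i)"
    by (rule sum.mono_neutral_right; use Y Y' in auto)+
  then have "X + X' - (\<Sum>i\<in>J \<union> J'. Y i + Y' i) \<in> R"
    using R_facts(3)[OF Y(4) Y'(4)] by (simp add: sum.distrib algebra_simps)
  moreover have "\<forall>i. Y i + Y' i \<in> hom_part FM (fst i) (snd i)"
    using Y(2) Y'(2) subspD(3)[OF free_hom_subsp[of L M]] by simp
  ultimately show ?case
    by (intro exI[of _ "J \<union> J'"] exI[of _ "\<lambda>i. Y i + Y' i"]) (use Y Y' in auto)
next
  case (smult c X)
  then obtain J Y where Y: "finite J" "\<forall>i. Y i \<in> hom_part FM (fst i) (snd i)"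
      "\<forall>i. i \<notin> J \<longrightarrow> Y i = 0" "X - (\<Sum>i\<in>J. Y i) \<in> R" by blast
  have "scale_pm c X - (\<Sum>i\<in>J. scale_pm c (Y i)) \<in> R"
    using R_facts(4)[OF Y(4), of c] by (simp add: scale_pm_simps scale_pm_sum)
  moreover have "\<forall>i. scale_pm c (Y i) \<in> hom_part FM (fst i) (snd i)"
    using Y(2) subspD(4)[OF free_hom_subsp[of L M]] by simp
  ultimately show ?case
    by (intro exI[of _ J] exI[of _ "\<lambda>i. scale_pm c (Y i)"]) (use Y in \<open>auto simp: scale_pm_simps\<close>)
qed

lemma pr_zero: "pr p n 0 = 0"
  using pr_add[of p n 0 0] by simp

lemma pr_sum: "pr p n (sum f A) = (\<Sum>i\<in>A. pr p n (f i))"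
  by (induction A rule: infinite_finite_induct) (simp_all add: pr_zero pr_add)

lemma ev_sum: "(\<And>i. i \<in> A \<Longrightarrow> f i \<in> carrier FM) \<Longrightarrow> ev (sum f A) = (\<Sum>i\<in>A. ev (f i))"
proof -
  have "(\<And>i. i \<in> A \<Longrightarrow> f i \<in> carrier FM) \<Longrightarrow> ev (sum f A) = (\<Sum>i\<in>A. ev (f i)) \<and> sum f A \<in> carrier FM"
    by (induction A rule: infinite_finite_induct) (simp_all add: ev_zero ev_add FMc)
  then show "(\<And>i. i \<in> A \<Longrightarrow> f i \<in> carrier FM) \<Longrightarrow> ev (sum f A) = (\<Sum>i\<in>A. ev (f i))" by blast
qed

lemma hom_FM_carrier: "X \<in> hom_part FM p n \<Longrightarrow> X \<in> carrier FM"
  using smodD(2)[OF free_smod[of L M], of p n] by blast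

text \<open>The projections \<open>pr\<close> separate the homogeneous components of the image, so each
  of them vanishes.\<close>

lemma kernel_homogeneous:
  assumes J: "finite J" and Y: "\<And>i. Y i \<in> hom_part FM (fst i) (snd i)"
    and z: "ev (\<Sum>i\<in>J. Y i) = 0" and i: "i \<in> J"
  shows "ev (Y i) = 0"
proof -
  have "0 = pr (fst i) (snd i) (\<Sum>k\<in>J. ev (Y k))"
    using z pr_zero ev_sum[of J Y] hom_FM_carrier[OF Y] by simp
  also have "\<dots> = (\<Sum>k\<in>J. if k = i then ev (Y i) else 0)"
    unfolding pr_sum
  proof (rule sum.cong[OF refl])
    fix k
    show "pr (fst i) (snd i) (ev (Y k)) = (if k = i then ev (Y i) else 0)"
      using pr_same[OF ev_hom[OF Y[of i]]] pr_other[OF ev_hom[OF Y[of k]], of "fst i" "snd i"]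
      by (cases "k = i") simp_all
  qed
  also have "\<dots> = ev (Y i)" using J i by simp
  finally show ?thesis by simp
qed

text \<open>An operator $\prod_i (F - (d + k_i))$ with all $k_i < 0$ kills the components of
  \<open>X\<close> of lower weight and multiplies its top component by a nonzero scalar. As evaluation is
  injective on the top component, that component is \<open>m0\<close>; so \<open>P\<close> contains
  \<open>m0\<close>, hence \<open>M = B m0\<close>, hence all words.\<close>

lemma top_vector_generates:
  assumes P: "subsp FM P" and RP: "R \<subseteq> P" and i: "\<And>x X. x \<in> carrier L \<Longrightarrow> X \<in> P \<Longrightarrow> act x X \<in> P"
    and X: "X \<in> P" "ev X = j m0"
  shows "P = carrier FM"
proof -
  note s = subspD[OF P, simplified]
  have P_mod: "A \<in> P" if "A - A' \<in> R" "A' \<in> P" for A A'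
    using s(3)[of "A - A'" A'] that RP by auto
  obtain m ks where m: "m \<in> carrier M" "\<forall>k\<in>set ks. k < 0" "foldr stp ks (X - word [] m) \<in> R"
    using carrier_T[OF s(1)[OF X(1)]] by (auto simp: T_def)
  have c: "\<exists>c. c \<noteq> 0 \<and> (\<forall>v\<in>carrier M. foldr stp ks (word [] v) - scale_pm c (word [] v) \<in> R)"
    if "\<forall>k\<in>set ks. k < 0" for ks
    using that
  proof (induction ks)
    case Nil then show ?case using R_facts(2) by (intro exI[of _ 1]) (simp add: scale_pm_simps)
  next
    case (Cons k ks)
    then obtain c where c: "c \<noteq> 0" "\<forall>v\<in>carrier M. foldr stp ks (word [] v) - scale_pm c (word [] v) \<in> R"
      by auto
    have "foldr stp (k # ks) (word [] v) - scale_pm (c * - of_int k) (word [] v) \<in> R"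
      if v: "v \<in> carrier M" for v
    proof -
      have "stp k (foldr stp ks (word [] v) - scale_pm c (word [] v)) \<in> R"
        using stps_R[of _ "[k]"] c(2) v by simp
      then have "stp k (foldr stp ks (word [] v)) - scale_pm c (stp k (word [] v)) \<in> R"
        by (simp add: stp_simps)
      then have "stp k (foldr stp ks (word [] v)) - scale_pm c (stp k (word [] v)) +
          scale_pm c (stp k (word [] v) - scale_pm (- of_int k) (word [] v)) \<in> R"
        by (rule R_facts(3)) (rule R_facts(4)[OF stp_word_Nil[OF v]])
      then show ?thesis by (simp add: scale_pm_simps)
    qed
    then show ?case using c(1) Cons.prems by (intro exI[of _ "c * - of_int k"]) auto
  qed
  then obtain c where c: "c \<noteq> 0" "\<And>v. v \<in> carrier M \<Longrightarrow> foldr stp ks (word [] v) - scale_pm c (word [] v) \<in> R"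
    using m(2) by meson
  have w: "word [] m \<in> carrier FM" "word [] m0 \<in> carrier FM" using m(1) m0 by (simp_all add: FMc)
  have evc: "\<And>Z. Z \<in> carrier FM \<Longrightarrow> foldr stp ks Z \<in> carrier FM"
    by (rule stps_closed[OF subsp_carrier[OF FM_module] action_closed[OF F_carrier]])
  have Xc: "X \<in> carrier FM" by (rule s(1)[OF X(1)])
  \<comment> \<open>comparing evaluations shows that the top component of X is the generator m0 itself\<close>
  have ev_stps: "ev (foldr stp ls Z) = ev (foldr stp ls Z')" if "Z \<in> carrier FM" "Z' \<in> carrier FM" "ev Z = ev Z'" for ls Z Z'
  proof -
    have cl: "foldr stp ls Z \<in> carrier FM" if "Z \<in> carrier FM" for ls Z
      by (rule stps_closed[OF subsp_carrier[OF FM_module] action_closed[OF F_carrier] that])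
    have st: "ev (stp k A) = action N F (ev A) + (-1) \<odot>\<^bsub>N\<^esub> (of_int (d + k) \<odot>\<^bsub>N\<^esub> ev A)"
      if "A \<in> carrier FM" for k A
      using that N_uminus[OF N_facts(3)[OF ev_closed]]
      by (simp add: stp_def ev_diff ev_act[OF F_carrier] ev_scale FMc action_closed[OF F_carrier])
    show ?thesis by (induction ls) (use that st cl in auto)
  qed
  have "ev (foldr stp ks X) = ev (foldr stp ks (word [] m0))"
    by (rule ev_stps[OF Xc w(2)]) (use X(2) m0 ev_word[of "[]" m0] in simp)
  also have "\<dots> = c \<odot>\<^bsub>N\<^esub> j m0"
    using ev_R[OF c(2)[OF m0]] evc[OF w(2)] w(2) ev_word[of "[]" m0] m0 by (simp add: ev_diff ev_scale FMc)
  finally have e1: "ev (foldr stp ks X) = c \<odot>\<^bsub>N\<^esub> j m0" .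
  have e2: "ev (foldr stp ks (word [] m)) = c \<odot>\<^bsub>N\<^esub> j m"
    using ev_R[OF c(2)[OF m(1)]] evc[OF w(1)] w(1) ev_word[of "[]" m] m(1) by (simp add: ev_diff ev_scale FMc)
  have "ev (foldr stp ks X) = ev (foldr stp ks (word [] m))"
    using ev_R[OF m(3)] evc[OF Xc] evc[OF w(1)] by (simp add: stps_simps ev_diff)
  then have "c \<odot>\<^bsub>N\<^esub> j m0 = c \<odot>\<^bsub>N\<^esub> j m" using e1 e2 by simp
  then have "inverse c \<odot>\<^bsub>N\<^esub> (c \<odot>\<^bsub>N\<^esub> j m0) = inverse c \<odot>\<^bsub>N\<^esub> (c \<odot>\<^bsub>N\<^esub> j m)" by simp
  then have "j m0 = j m"
    using c(1) N_facts(5)[OF j_carrier] m(1) m0 by (simp add: N_facts(7)[OF j_carrier, symmetric])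
  then have "m = m0" using inj_onD[OF j_inj] m(1) m0 by metis
  have "foldr stp ks X - foldr stp ks (word [] m0) \<in> R" using m(3) \<open>m = m0\<close> by (simp add: stps_simps)
  then have "foldr stp ks (word [] m0) \<in> P"
    using P_mod[of "foldr stp ks (word [] m0)" "foldr stp ks X"]
      stps_closed[OF P i[OF F_carrier] X(1)] R_uminus by fastforce
  then have "scale_pm c (word [] m0) \<in> P"
    using P_mod[of "scale_pm c (word [] m0)" "foldr stp ks (word [] m0)"] R_uminus[OF c(2)[OF m0]] by simp
  then have "word [] m0 \<in> P" using s(4)[of "scale_pm c (word [] m0)" "inverse c"] c(1)
    by (simp add: scale_pm_simps)
  have all: "word [] v \<in> P" if v: "v \<in> carrier M" for v
  proof -
    obtain b where b: "b \<in> B" "v = action M b m0" using M_gen[OF v] by blast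
    have "word [b] m0 \<in> P" using i[of b "word [] m0"] \<open>word [] m0 \<in> P\<close> b(1) B_carrier
      by (auto simp: action_word)
    then show ?thesis using P_mod[of "word [] v" "word [b] m0"] R_uminus[OF word_balanced[OF b(1) m0]] b(2) by simp
  qed
  have "Z \<in> P" if "Z \<in> carrier FM" for Z
    using that
  proof (induction rule: free_induct)
    case (word xs v)
    from word(1) show ?case
    proof (induction xs)
      case Nil then show ?case using all word(2) by simp
    next
      case (Cons x xs) then show ?case using i[of x "word xs v"] by (simp add: action_word)
    qed
  qed (use s in simp_all)
  then show ?thesis using s(1) by blast
qed

text \<open>The kernel \<open>K\<close> of evaluation is graded, and the quotient by it is
  \<open>N\<close>, which is simple. Let \<open>Q\<close> be another graded submodule with simple
  quotient. If \<open>Q\<close> is not contained in \<open>K\<close>, its image in \<open>N\<close> is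
  everything, so \<open>Q\<close> contains a preimage of the generator of \<open>M\<close> and is the
  whole module by \<open>top_vector_generates\<close>. If \<open>Q \<subseteq> K\<close>, then
  \<open>K/Q\<close> is a graded submodule of the simple quotient, hence zero.\<close>

theorem
  shows highest_quotient_isomorphic: "smodule_isomorphic L (highest_quotient L F M) N"
    and isomorphic_highest_quotient: "smodule_isomorphic L N (highest_quotient L F M)"
proof -
  obtain h where h: "epi L I N h" "\<And>X. X \<in> carrier FM \<Longrightarrow> h (q X) = ev X"
    using epi_factor[OF q_epi ev_epi ev_cong free_smod[of L M]] by blast
  note e = epiD[OF h(1), unfolded N_add N_zero] and eq = epiD[OF q_epi, simplified]
  note IV = smodD(1)[OF I_smod] and If = vs_facts[OF smodD(1)[OF I_smod]]
  define K where "K = {Z \<in> carrier I. h Z = 0}"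
  have K_subsp: "subsp I K"
    using If e N_facts(6) by (auto simp: K_def subsp_def)
  have K_inv: "action I x Z \<in> K" if "x \<in> carrier L" "Z \<in> K" for x Z
    using that e(6) smodD(3)[OF I_smod] N_act(3)[OF that(1) N_facts(1), of 0]
      N_facts(4)[OF N_act(1)[OF that(1) N_facts(1)]] N_facts(6) by (auto simp: K_def)
  have Khc: "(\<Union>p n. K \<inter> hom_part I p n) \<subseteq> carrier I" by (auto simp: K_def)
  note S = subspD[OF subsp_lin_span[OF IV Khc]]
  have K_spanned: "Z \<in> lin_span I (\<Union>p n. K \<inter> hom_part I p n)" if Z: "Z \<in> K" for Z
  proof -
    from Z obtain X where X: "X \<in> carrier FM" "Z = q X" using eq(8) by (auto simp: K_def)
    obtain J Y where Y: "finite J" "\<And>i. Y i \<in> hom_part FM (fst i) (snd i)" "X - (\<Sum>i\<in>J. Y i) \<in> R"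
      using homogeneous_decomposition[OF X(1)] by blast
    have Yc: "Y i \<in> carrier FM" for i by (rule hom_FM_carrier[OF Y(2)])
    have YS: "(\<Sum>i\<in>A. Y i) \<in> carrier FM" for A
      by (induction A rule: infinite_finite_induct) (simp_all add: FMc Yc)
    have Zq: "Z = q (\<Sum>i\<in>J. Y i)" using q_eq[OF X(1) YS] Y(3) X(2) by simp
    have "ev (\<Sum>i\<in>J. Y i) = 0" using Z Zq h(2)[OF YS] by (simp add: K_def)
    then have evY: "ev (Y i) = 0" if "i \<in> J" for i using kernel_homogeneous[OF Y(1,2)] that by blast
    have g: "q (Y i) \<in> lin_span I (\<Union>p n. K \<inter> hom_part I p n)" if "i \<in> J" for i
    proof -
      have "q (Y i) \<in> hom_part I (fst i) (snd i)" using Y(2) eq(3) by blast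
      moreover have "q (Y i) \<in> K" using evY[OF that] h(2)[OF Yc] eq(7)[OF Yc] by (simp add: K_def)
      ultimately show ?thesis using lin_span_superset[OF IV, of "\<Union>p n. K \<inter> hom_part I p n"] by blast
    qed
    have "q (\<Sum>i\<in>A. Y i) \<in> lin_span I (\<Union>p n. K \<inter> hom_part I p n)" if "A \<subseteq> J" for A
      using finite_subset[OF that Y(1)] that
    proof (induction A rule: finite_induct)
      case empty then show ?case using S(2) eq(2) by simp
    next
      case (insert i A)
      then show ?case using S(3) g eq(4)[OF Yc YS] by simp
    qed
    then show ?thesis using Zq by blast
  qed
  have K_graded: "graded_submodule L I K"
  proof (rule graded_submodule_iff[OF I_smod, THEN iffD2], intro conjI)
    show "subsp I K" by (rule K_subsp)
    show "K \<subseteq> lin_span I (\<Union>p n. K \<inter> hom_part I p n)" using K_spanned by (rule subsetI)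
    show "\<forall>x\<in>carrier L. \<forall>v\<in>K. action I x v \<in> K" using K_inv by simp
  qed
  have N_nonzero: "carrier N \<noteq> {0}" using N_simple by (simp add: simple_smodule_def N_zero)
  have quot_smod: "smod L (quot_smodule I Q)" "epi L I (quot_smodule I Q) (\<lambda>v. Q +>\<^bsub>I\<^esub> v)"
    "v \<in> carrier I \<Longrightarrow> w \<in> carrier I \<Longrightarrow> Q +>\<^bsub>I\<^esub> v = Q +>\<^bsub>I\<^esub> w \<longleftrightarrow> v \<oplus>\<^bsub>I\<^esub> (-1) \<odot>\<^bsub>I\<^esub> w \<in> Q"
    if "graded_submodule L I Q" for Q v w
  proof -
    have Q: "subsp I Q" "\<And>x v. x \<in> carrier L \<Longrightarrow> v \<in> Q \<Longrightarrow> action I x v \<in> Q"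
      using that by (simp_all add: graded_submodule_iff[OF I_smod])
    show "epi L I (quot_smodule I Q) (\<lambda>v. Q +>\<^bsub>I\<^esub> v)" by (rule quot_epi(1)[OF I_smod Q])
    then show "smod L (quot_smodule I Q)" by (rule epi_smod[OF I_smod])
    show "v \<in> carrier I \<Longrightarrow> w \<in> carrier I \<Longrightarrow> Q +>\<^bsub>I\<^esub> v = Q +>\<^bsub>I\<^esub> w \<longleftrightarrow> v \<oplus>\<^bsub>I\<^esub> (-1) \<odot>\<^bsub>I\<^esub> w \<in> Q"
      by (rule quot_epi(2)[OF I_smod Q])
  qed
  have quot_K: "\<exists>g. bij_betw g (carrier (quot_smodule I K)) (carrier N) \<and> epi L (quot_smodule I K) N g"
  proof -
    have "(K +>\<^bsub>I\<^esub> v = K +>\<^bsub>I\<^esub> w) = (h v = h w)" if "v \<in> carrier I" "w \<in> carrier I" for v w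
      unfolding quot_smod(3)[OF K_graded that]
      using that If(2)[OF that(1) If(3)[OF that(2)]] e(4)[OF that(1) If(3)[OF that(2)]]
        e(5)[OF that(2)] N_uminus[OF e(7)[OF that(2)]] by (simp add: K_def)
    then show ?thesis using epi_same_kernel[OF quot_smod(2)[OF K_graded] h(1) _ I_smod] by blast
  qed
  then obtain g where g: "bij_betw g (carrier (quot_smodule I K)) (carrier N)" "epi L (quot_smodule I K) N g"
    by blast
  have K_simple: "simple_smodule L (quot_smodule I K)"
    by (rule iso_simple[OF g quot_smod(1)[OF K_graded] N_simple])
  have unique: "Q = K" if Q: "graded_submodule L I Q" and Qs: "simple_smodule L (quot_smodule I Q)" for Q
  proof
    note eQ = epiD[OF quot_smod(2)[OF Q]] and kQ = quot_smod(3)[OF Q]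
    have Qsub: "subsp I Q" and Qinv: "\<And>x v. x \<in> carrier L \<Longrightarrow> v \<in> Q \<Longrightarrow> action I x v \<in> Q"
      using Q by (simp_all add: graded_submodule_iff[OF I_smod])
    note sQ = subspD[OF Qsub]
    show QK: "Q \<subseteq> K"
    proof -
      have "h ` Q = {0} \<or> h ` Q = carrier N"
        using graded_submodule_image[OF I_smod h(1) Q] N_simple by (simp add: simple_smodule_def N_zero)
      then show ?thesis
      proof
        assume "h ` Q = {0}"
        then show ?thesis using sQ(1) by (auto simp: K_def)
      next
        assume "h ` Q = carrier N"
        then obtain Z where Z: "Z \<in> Q" "h Z = j m0" using j_carrier[OF m0] by (metis imageE)
        obtain X where X: "X \<in> carrier FM" "Z = q X" using eq(8)[OF sQ(1)[OF Z(1)]] by blast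
        define P where "P = {X \<in> carrier FM. q X \<in> Q}"
        have "P = carrier FM"
        proof (rule top_vector_generates)
          show "subsp FM P" using sQ eq FMc by (auto simp: subsp_def P_def)
          have "q X \<in> Q" if "X \<in> R" for X
            using q_eq[OF R_facts(1)[OF that] FMc(1)] that eq(2) sQ(2) by simp
          then show "R \<subseteq> P" using R_facts(1) by (auto simp: P_def)
          show "act x X \<in> P" if "x \<in> carrier L" "X \<in> P" for x X
            using that eq(6) Qinv action_closed by (auto simp: P_def)
          show "X \<in> P" using X Z(1) by (simp add: P_def)
          show "ev X = j m0" using X Z(2) h(2) by simp
        qed
        then have IQ: "carrier I \<subseteq> Q" using eq(8) by (auto simp: P_def)
        have "Q +>\<^bsub>I\<^esub> v = Q +>\<^bsub>I\<^esub> \<zero>\<^bsub>I\<^esub>" if v: "v \<in> carrier I" for v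
          unfolding kQ[OF v If(1)] If(6) If(11)[OF v] using IQ v by (rule subsetD)
        then have "carrier (quot_smodule I Q) \<subseteq> {\<zero>\<^bsub>quot_smodule I Q\<^esub>}"
          unfolding eQ(1)[symmetric] eQ(2)[symmetric] by (intro image_subsetI) simp
        then have "carrier (quot_smodule I Q) = {\<zero>\<^bsub>quot_smodule I Q\<^esub>}"
          using vs_facts(1)[OF smodD(1)[OF quot_smod(1)[OF Q]]] by blast
        then show ?thesis using Qs by (simp add: simple_smodule_def)
      qed
    qed
    have "(\<lambda>v. Q +>\<^bsub>I\<^esub> v) ` K = {\<zero>\<^bsub>quot_smodule I Q\<^esub>} \<or> (\<lambda>v. Q +>\<^bsub>I\<^esub> v) ` K = carrier (quot_smodule I Q)"
      using graded_submodule_image[OF I_smod quot_smod(2)[OF Q] K_graded] Qs by (simp add: simple_smodule_def)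
    then show "K \<subseteq> Q"
    proof
      assume a: "(\<lambda>v. Q +>\<^bsub>I\<^esub> v) ` K = {\<zero>\<^bsub>quot_smodule I Q\<^esub>}"
      show ?thesis
      proof
        fix v assume v: "v \<in> K"
        then have vc: "v \<in> carrier I" by (simp add: K_def)
        have "Q +>\<^bsub>I\<^esub> v \<in> {\<zero>\<^bsub>quot_smodule I Q\<^esub>}" unfolding a[symmetric] using v by (rule imageI)
        then have "Q +>\<^bsub>I\<^esub> v = Q +>\<^bsub>I\<^esub> \<zero>\<^bsub>I\<^esub>" using eQ(2) by simp
        then have "v \<oplus>\<^bsub>I\<^esub> (-1) \<odot>\<^bsub>I\<^esub> \<zero>\<^bsub>I\<^esub> \<in> Q" by (simp only: kQ[OF vc If(1)])
        then show "v \<in> Q" by (simp add: If(6) If(11)[OF vc])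
      qed
    next
      assume a: "(\<lambda>v. Q +>\<^bsub>I\<^esub> v) ` K = carrier (quot_smodule I Q)"
      have "h v = 0" if v: "v \<in> carrier I" for v
      proof -
        have "Q +>\<^bsub>I\<^esub> v \<in> (\<lambda>v. Q +>\<^bsub>I\<^esub> v) ` K" unfolding a by (rule eQ(7)[OF v])
        then obtain k where k: "k \<in> K" "Q +>\<^bsub>I\<^esub> v = Q +>\<^bsub>I\<^esub> k" by blast
        have kc: "k \<in> carrier I" "h k = 0" using k(1) by (simp_all add: K_def)
        have "v \<oplus>\<^bsub>I\<^esub> (-1) \<odot>\<^bsub>I\<^esub> k \<in> K" using kQ[OF v kc(1)] k(2) QK by blast
        then show ?thesis
          using e(4)[OF v If(3)[OF kc(1)]] e(5)[OF kc(1)] kc(2) N_facts(6) by (simp add: K_def)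
      qed
      then have "carrier N \<subseteq> {0}" using e(8) by auto
      then show ?thesis using N_nonzero N_facts(1) by blast
    qed
  qed
  have "(THE Q. graded_submodule L I Q \<and> simple_smodule L (quot_smodule I Q)) = K"
    by (rule the_equality) (use K_graded K_simple unique in blast)+
  then have "highest_quotient L F M = quot_smodule I K"
    by (simp add: highest_quotient_def simple_quotient_def Ind_def)
  moreover obtain g' where "bij_betw g' (carrier N) (carrier (quot_smodule I K))" "epi L N (quot_smodule I K) g'"
    by (rule epi_inverse[OF g quot_smod(1)[OF K_graded]])
  then have "smodule_isomorphic L N (quot_smodule I K)" by (rule epi_bij_iso)
  ultimately show "smodule_isomorphic L (highest_quotient L F M) N" "smodule_isomorphic L N (highest_quotient L F M)"
    using epi_bij_iso[OF g] by simp_all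
qed

end

section \<open>Laurent polynomials\<close>

lemma sum_of_monomials:
  fixes f :: "'a \<Rightarrow>\<^sub>0 'b::comm_monoid_add"
  shows "f = (\<Sum>k\<in>Poly_Mapping.keys f. Poly_Mapping.single k (Poly_Mapping.lookup f k))"
proof (rule poly_mapping_eqI)
  fix k
  have "Poly_Mapping.lookup (\<Sum>k\<in>Poly_Mapping.keys f. Poly_Mapping.single k (Poly_Mapping.lookup f k)) k
    = (\<Sum>i\<in>Poly_Mapping.keys f. if i = k then Poly_Mapping.lookup f k else 0)"
    unfolding lookup_sum by (rule sum.cong) (auto simp: lookup_single when_def)
  then show "Poly_Mapping.lookup f k =
    Poly_Mapping.lookup (\<Sum>k\<in>Poly_Mapping.keys f. Poly_Mapping.single k (Poly_Mapping.lookup f k)) k"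
    by (simp add: in_keys_iff)
qed

lemma lookup_lD [simp]: "Poly_Mapping.lookup (lD f) n = of_int n * Poly_Mapping.lookup f n"
  by (simp add: lD_def lookup_mapp when_def in_keys_iff)

lemma lD_simps [simp]:
  "lD 0 = 0" "lD (f + g) = lD f + lD g" "lD (f - g) = lD f - lD g" "lD (- f) = - lD f"
  "lD (Poly_Mapping.single n c) = Poly_Mapping.single n (of_int n * c)"
  "lD (lconst c) = 0"
  by (rule poly_mapping_eqI; simp add: lookup_add lookup_minus lookup_single when_def lconst_def algebra_simps)+

lemma lD_sum [simp]: "lD (sum f A) = (\<Sum>x\<in>A. lD (f x))"
  by (induction A rule: infinite_finite_induct) simp_all

lemma lD_mult [simp]: "lD (f * g) = lD f * g + f * lD g"
proof -
  have 1: "lD (Poly_Mapping.single n a * Poly_Mapping.single m b) =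
     lD (Poly_Mapping.single n a) * Poly_Mapping.single m b + Poly_Mapping.single n a * lD (Poly_Mapping.single m b)"
    for n m a b
    by (simp add: mult_single single_add[symmetric] algebra_simps)
  have 2: "lD (f * Poly_Mapping.single m b) = lD f * Poly_Mapping.single m b + f * lD (Poly_Mapping.single m b)"
    for f m b
    by (subst (1 2 3) sum_of_monomials[of f]) (simp only: sum_distrib_right lD_sum 1 sum.distrib)
  show ?thesis
    by (subst (1 2 3) sum_of_monomials[of g]) (simp only: sum_distrib_left lD_sum 2 sum.distrib)
qed

lemma lconst_simps:
  "lconst (a + b) = lconst a + lconst b" "lconst (a - b) = lconst a - lconst b" "lconst (- a) = - lconst a"
  "lconst (a * b) = lconst a * lconst b" "lconst 0 = 0" "lconst 1 = 1"
  by (simp_all add: lconst_def single_add single_diff single_uminus mult_single)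

lemma lookup_lconst_mult: "Poly_Mapping.lookup (lconst c * f) n = c * Poly_Mapping.lookup f n"
  unfolding lconst_def mult_map_scale_conv_mult[symmetric]
  by (simp add: Poly_Mapping.map.rep_eq when_def)

text \<open>Multiplication by a complex number, kept apart from the ring multiplication so that
  polynomial identities over \<open>laurent\<close> can be reduced to linear identities over the complex
  numbers with monomials as unknowns.\<close>

definition cs :: "complex \<Rightarrow> laurent \<Rightarrow> laurent" where
  "cs c f = lconst c * f"

text \<open>Rewriting \<open>lconst\<close> to \<open>cs\<close> is the first step of the coefficient
  comparisons below.\<close>

lemma lconst_cs: "lconst c = cs c 1" by (simp add: cs_def)

lemma lookup_cs [simp]: "Poly_Mapping.lookup (cs c f) n = c * Poly_Mapping.lookup f n"
  by (simp add: cs_def lookup_lconst_mult)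

lemma cs_simps:
  "cs c f * g = cs c (f * g)" "f * cs c g = cs c (f * g)" "cs c (f + g) = cs c f + cs c g"
  "cs c (f - g) = cs c f - cs c g" "cs c (- f) = - cs c f" "cs c (cs b f) = cs (c * b) f" "cs c 0 = 0"
  "lD (cs c f) = cs c (lD f)" "cs 0 f = 0" "cs 1 f = f" "cs (- c) f = - cs c f"
  by (simp_all add: cs_def algebra_simps lconst_simps)

lemma lookup_numeral_mult: "Poly_Mapping.lookup (numeral k * (f :: laurent)) n = numeral k * Poly_Mapping.lookup f n"
  using lookup_lconst_mult[of "numeral k" f n] by (simp add: lconst_def)

lemmas coeff_simps = lookup_add lookup_minus lookup_uminus lookup_cs lookup_zero lookup_numeral_mult

lemma lhomI: "f \<in> lhom n \<longleftrightarrow> (\<forall>m. m \<noteq> n \<longrightarrow> Poly_Mapping.lookup f m = 0)"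
  by (auto simp: lhom_def in_keys_iff)

lemma lhom_single: "f \<in> lhom n \<longleftrightarrow> f = Poly_Mapping.single n (Poly_Mapping.lookup f n)"
  by (auto simp: lhomI poly_mapping_eq_iff fun_eq_iff lookup_single when_def)

lemma lhom_single_in [simp]: "Poly_Mapping.single n c \<in> lhom n"
  by (simp add: lhom_single)

lemma lhom_simps [simp]:
  "0 \<in> lhom n" "f \<in> lhom n \<Longrightarrow> g \<in> lhom n \<Longrightarrow> f + g \<in> lhom n" "f \<in> lhom n \<Longrightarrow> g \<in> lhom n \<Longrightarrow> f - g \<in> lhom n"
  "f \<in> lhom n \<Longrightarrow> - f \<in> lhom n" "f \<in> lhom n \<Longrightarrow> lD f \<in> lhom n" "f \<in> lhom n \<Longrightarrow> cs c f \<in> lhom n"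
  "f \<in> lhom n \<Longrightarrow> lconst c * f \<in> lhom n" "lconst c \<in> lhom 0"
  by (simp_all add: lhomI lookup_add lookup_minus lookup_lconst_mult) (simp add: lconst_def lookup_single when_def)

lemma lhom_sum: "(\<And>i. i \<in> A \<Longrightarrow> f i \<in> lhom n) \<Longrightarrow> sum f A \<in> lhom n"
  by (induction A rule: infinite_finite_induct) simp_all

lemma lhom_mult:
  assumes "f \<in> lhom n" "g \<in> lhom m" shows "f * g \<in> lhom (n + m)"
proof -
  have "f * g = Poly_Mapping.single (n + m) (Poly_Mapping.lookup f n * Poly_Mapping.lookup g m)"
    using assms by (metis lhom_single mult_single)
  then show ?thesis by simp
qed

definition tt :: "int \<Rightarrow> laurent" where "tt n = Poly_Mapping.single n 1"

lemma tt_simps [simp]: "tt n * tt m = tt (n + m)" "tt 0 = 1" "lD (tt n) = cs (of_int n) (tt n)"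
  by (simp_all add: tt_def mult_single) (rule poly_mapping_eqI, simp add: lookup_single when_def)

section \<open>Vectors and matrices of Laurent polynomials\<close>

definition smat :: "laurent \<Rightarrow> lmat \<Rightarrow> lmat" where "smat f X = (\<chi> i j. f * X $ i $ j)"

lemma smat_nth [simp]: "smat f X $ i $ j = f * X $ i $ j" by (simp add: smat_def)
lemma mat_D_nth [simp]: "mat_D X $ i $ j = lD (X $ i $ j)" by (simp add: mat_D_def)
lemma vec_D_nth [simp]: "vec_D v $ i = lD (v $ i)" by (simp add: vec_D_def)
lemma transpose_nth [simp]: "transpose X $ i $ j = X $ j $ i" by (simp add: transpose_def)
lemma mult_vec_nth: "((X :: lmat) *v v) $ i = (\<Sum>j\<in>UNIV. X $ i $ j * v $ j)"
  by (simp add: matrix_vector_mult_def)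
lemma mult_mat_nth: "((X :: lmat) ** Y) $ i $ j = (\<Sum>k\<in>UNIV. X $ i $ k * Y $ k $ j)"
  by (simp add: matrix_matrix_mult_def)

definition vec_Du :: "complex \<Rightarrow> lvec \<Rightarrow> lvec" where
  "vec_Du u v = vec_D v + lconst u *s v"

lemma mv_simps:
  "(X + Y) *v v = X *v v + (Y :: lmat) *v v" "(X - Y) *v v = X *v v - Y *v v" "(- X) *v v = - (X *v v)"
  "X *v (v + w) = X *v v + X *v w" "X *v (v - w) = X *v v - X *v w" "X *v (- v) = - (X *v v)"
  "smat f X *v v = f *s (X *v v)" "X *v (f *s v) = f *s (X *v v)"
  "(X ** Y) *v v = X *v (Y *v v)" "0 *v v = 0" "X *v 0 = 0"
  "(\<chi> i. - (v $ i)) = - v"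
proof -
  show "(X ** Y) *v v = X *v (Y *v v)" by (simp add: matrix_vector_mul_assoc)
qed (simp_all add: vec_eq_iff mult_vec_nth sum.distrib sum_subtractf sum_negf algebra_simps sum_distrib_left)

lemma vec_Du_simps:
  "vec_Du u (v + w) = vec_Du u v + vec_Du u w" "vec_Du u (v - w) = vec_Du u v - vec_Du u w"
  "vec_Du u (- v) = - vec_Du u v"
  "vec_Du u (f *s v) = lD f *s v + f *s vec_Du u v"
  "vec_Du u (X *v v) = mat_D X *v v + X *v vec_Du u v" "vec_Du u 0 = 0"
  by (simp_all add: vec_Du_def vec_eq_iff mult_vec_nth algebra_simps sum.distrib sum_distrib_left)

lemma mat_D_simps:
  "mat_D (X + Y) = mat_D X + mat_D Y" "mat_D (X - Y) = mat_D X - mat_D Y" "mat_D (- X) = - mat_D X"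
  "mat_D 0 = 0" "mat_D (X ** Y) = mat_D X ** Y + X ** mat_D Y"
  "mat_D (smat f X) = smat (lD f) X + smat f (mat_D X)" "mat_D (transpose X) = transpose (mat_D X)"
  "mat_D (mat f) = mat (lD f)"
  by (simp_all add: vec_eq_iff mult_mat_nth sum.distrib mat_def)

lemma mat_mult_vec: "mat f *v (v :: lvec) = f *s v"
proof -
  have "(if b then f else 0) * x = (if b then f * x else 0)" for b and x :: laurent by simp
  then show ?thesis by (simp add: vec_eq_iff mult_vec_nth mat_def)
qed

lemma transpose_simps:
  "transpose (X + Y) = transpose X + transpose (Y :: lmat)" "transpose (X - Y) = transpose X - transpose Y"
  "transpose (- X) = - transpose X" "transpose (smat f X) = smat f (transpose X)"
  "transpose (X ** Y) = transpose Y ** transpose X" "transpose (mat f) = mat f" "transpose (0 :: lmat) = 0"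
  by (simp_all add: vec_eq_iff mult_mat_nth mat_def mult.commute)

lemma mm_simps:
  "(X + Y) ** Z = X ** Z + Y ** (Z :: lmat)" "(X - Y) ** Z = X ** Z - Y ** Z" "(- X) ** Z = - (X ** Z)"
  "X ** (Y + Z) = X ** Y + X ** Z" "X ** (Y - Z) = X ** Y - X ** Z" "X ** (- Y) = - (X ** Y)"
  "smat f X ** Y = smat f (X ** Y)" "X ** smat f Y = smat f (X ** Y)" "0 ** X = 0" "X ** 0 = 0"
  by (simp_all add: vec_eq_iff mult_mat_nth sum.distrib sum_subtractf sum_negf algebra_simps sum_distrib_left)

lemma phi_simps:
  "ck_phi (X + Y) = ck_phi X + ck_phi (Y :: lmat)" "ck_phi (X - Y) = ck_phi X - ck_phi Y"
  "ck_phi (- X) = - ck_phi X" "ck_phi (smat f X) = smat f (ck_phi X)" "ck_phi (mat_D X) = mat_D (ck_phi X)"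
  "ck_phi (0 :: lmat) = 0"
  by (simp_all add: vec_eq_iff forall_4 ck_phi_def vector_4_nth algebra_simps)

lemma transpose_phi: "transpose (ck_phi (X :: lmat)) = - ck_phi X"
  by (simp add: vec_eq_iff forall_4 ck_phi_def vector_4_nth)

text \<open>Polarization of the Pfaffian form \<open>s \<mapsto> \<phi>(s) s\<close>, that is, the
  bilinear form with \<open>Pol s s = 2 Pf s\<close>.\<close>

definition Pol :: "lmat \<Rightarrow> lmat \<Rightarrow> laurent" where
  "Pol s r = s $ 1 $ 2 * r $ 3 $ 4 - s $ 1 $ 3 * r $ 2 $ 4 + s $ 1 $ 4 * r $ 2 $ 3
     + r $ 1 $ 2 * s $ 3 $ 4 - r $ 1 $ 3 * s $ 2 $ 4 + r $ 1 $ 4 * s $ 2 $ 3"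

lemma skew_entries:
  fixes s :: lmat
  assumes "transpose s = - s"
  shows "s $ 1 $ 1 = 0" "s $ 2 $ 2 = 0" "s $ 3 $ 3 = 0" "s $ 4 $ 4 = 0"
    "s $ 2 $ 1 = - s $ 1 $ 2" "s $ 3 $ 1 = - s $ 1 $ 3" "s $ 4 $ 1 = - s $ 1 $ 4"
    "s $ 3 $ 2 = - s $ 2 $ 3" "s $ 4 $ 2 = - s $ 2 $ 4" "s $ 4 $ 3 = - s $ 3 $ 4"
proof -
  have sk: "s $ i $ k = - s $ k $ i" for i k
    using arg_cong[OF assms, of "\<lambda>m. m $ k $ i"] by simp
  have "s $ i $ i = 0" for i
  proof (rule poly_mapping_eqI)
    fix n show "Poly_Mapping.lookup (s $ i $ i) n = Poly_Mapping.lookup 0 n"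
      using arg_cong[OF sk[of i i], of "\<lambda>f. Poly_Mapping.lookup f n"] by simp
  qed
  then show "s $ 1 $ 1 = 0" "s $ 2 $ 2 = 0" "s $ 3 $ 3 = 0" "s $ 4 $ 4 = 0" by auto
qed (use arg_cong[OF assms, of "\<lambda>m. m $ 1 $ 2"] arg_cong[OF assms, of "\<lambda>m. m $ 1 $ 3"]
    arg_cong[OF assms, of "\<lambda>m. m $ 1 $ 4"] arg_cong[OF assms, of "\<lambda>m. m $ 2 $ 3"]
    arg_cong[OF assms, of "\<lambda>m. m $ 2 $ 4"] arg_cong[OF assms, of "\<lambda>m. m $ 3 $ 4"] in simp_all)

text \<open>Polarization of \<open>\<phi>(s) s = Pf(s) Id\<close>.\<close>

lemma phi_polarized:
  fixes s r :: lmat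
  assumes "transpose s = - s" "transpose r = - r"
  shows "s ** ck_phi r + r ** ck_phi s = mat (Pol s r)" "ck_phi s ** r + ck_phi r ** s = mat (Pol s r)"
  using skew_entries[OF assms(1)] skew_entries[OF assms(2)]
  by (simp_all add: vec_eq_iff forall_4 mult_mat_nth sum_4 mat_def ck_phi_def vector_4_nth Pol_def algebra_simps)

text \<open>\<open>\<phi>\<close> is equivariant for traceless matrices; it is the isomorphism of the
  second exterior power with its dual, which the general linear group preserves up to the
  determinant.\<close>

lemma phi_equivariant:
  fixes s a :: lmat
  assumes "transpose s = - s" "trace a = 0"
  shows "ck_phi (a ** s + s ** transpose a) = - (transpose a ** ck_phi s) - ck_phi s ** a"
proof -
  have t: "a $ 4 $ 4 = - a $ 1 $ 1 - a $ 2 $ 2 - a $ 3 $ 3"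
    using assms(2) by (simp add: trace_def sum_4 algebra_simps eq_neg_iff_add_eq_0)
  show ?thesis
    using skew_entries[OF assms(1)]
    by (simp add: vec_eq_iff forall_4 mult_mat_nth sum_4 ck_phi_def vector_4_nth t algebra_simps)
qed

section \<open>The bracket of \<open>CK(6)\<close> in terms of parameters\<close>

declare transpose_matrix_vector [simp del]

text \<open>The operator \<open>ck_op\<close> with \<open>D\<close> replaced by \<open>D + u\<close> on
  vectors; the derivatives of the coefficients are unchanged.\<close>

definition ck_opu :: "complex \<Rightarrow> laurent \<Rightarrow> lmat \<Rightarrow> lmat \<Rightarrow> lmat \<Rightarrow> ck_operator" where
  "ck_opu u f a B S = (\<lambda>(v, w).
     (a *v v + f *s vec_Du u v + (lconst (1/4) * lD f) *s v + B *v w,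
      S *v v + ck_phi B *v vec_Du u v + lconst (1/2) *s (mat_D (ck_phi B) *v v)
      - transpose a *v w + f *s vec_Du u w + (lconst (3/4) * lD f) *s w))"

lemma ck_op_eq: "ck_op f a B S = ck_opu 0 f a B S"
proof -
  have "vec_Du 0 = vec_D" by (rule ext) (simp add: vec_Du_def lconst_simps)
  then show ?thesis by (simp add: ck_op_def ck_opu_def)
qed

definition psc :: "laurent \<Rightarrow> lvec \<times> lvec \<Rightarrow> lvec \<times> lvec" where
  "psc f x = (f *s fst x, f *s snd x)"

text \<open>The twist by $t^u$ as an operation on operators: \<open>X\<close> is a differential operator
  of order at most one, so $t^{-1} X t - X$ is the coefficient of \<open>D\<close> in it, and $t^{-u} X
  t^u = X + u (t^{-1} X t - X)$.\<close>

definition rho :: "complex \<Rightarrow> ck_operator \<Rightarrow> ck_operator" where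
  "rho u X x = X x + psc (lconst u) (psc (tt (-1)) (X (psc (tt 1) x)) - X x)"

lemma tt_inverse: "tt (-1) * (tt 1 * f) = f" "tt 1 * (tt (-1) * f) = f"
  using tt_simps(1)[of "-1" 1] tt_simps(1)[of 1 "-1"] by (simp_all only: mult.assoc[symmetric]) simp_all

lemma rho_ck_op: "rho u (ck_op f a B S) = ck_opu u f a B S"
proof
  fix x :: "lvec \<times> lvec"
  obtain v w where x: "x = (v, w)" by force
  have e: "vec_Du 0 (tt 1 *s v) = tt 1 *s (v + vec_Du 0 v)" for v
    by (simp add: vec_Du_simps vec_eq_iff cs_simps algebra_simps)
  have u: "vec_Du u v = vec_Du 0 v + lconst u *s v" for v
    by (simp add: vec_Du_def vec_eq_iff lconst_simps)
  have i: "psc (tt (-1)) (psc (tt 1) y) = y" for y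
    by (simp add: psc_def prod_eq_iff vec_eq_iff tt_inverse)
  have e2: "ck_opu 0 f a B S (psc (tt 1) x) =
      psc (tt 1) (ck_opu 0 f a B S x + (f *s v, ck_phi B *v v + f *s w))"
    unfolding x ck_opu_def psc_def
    by (simp add: e mv_simps vec_eq_iff algebra_simps)
  have "rho u (ck_op f a B S) x = ck_opu 0 f a B S x + psc (lconst u) (f *s v, ck_phi B *v v + f *s w)"
    unfolding rho_def ck_op_eq e2 i by simp
  also have "\<dots> = ck_opu u f a B S x"
    unfolding x psc_def ck_opu_def u by (simp add: mv_simps vec_eq_iff algebra_simps)
  finally show "rho u (ck_op f a B S) x = ck_opu u f a B S x" .
qed

lemma ck_opu_add: "ck_opu u f a B S x + ck_opu u g b B' S' x = ck_opu u (f + g) (a + b) (B + B') (S + S') x"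
  unfolding ck_opu_def
  by (cases x) (simp add: mv_simps transpose_simps phi_simps mat_D_simps vec_eq_iff algebra_simps)

lemma ck_opu_diff: "ck_opu u f a B S x - ck_opu u g b B' S' x = ck_opu u (f - g) (a - b) (B - B') (S - S') x"
  unfolding ck_opu_def
  by (cases x) (simp add: mv_simps transpose_simps phi_simps mat_D_simps vec_eq_iff algebra_simps)

lemma ck_opu_smult: "psc (lconst c) (ck_opu u f a B S x) =
    ck_opu u (lconst c * f) (smat (lconst c) a) (smat (lconst c) B) (smat (lconst c) S) x"
proof -
  have z: "smat 0 X = 0" for X by (simp add: vec_eq_iff)
  show ?thesis
  unfolding ck_opu_def psc_def
  by (cases x) (simp add: mv_simps transpose_simps phi_simps mat_D_simps vec_eq_iff z algebra_simps)
qed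

lemma ck_opu_arg:
  "ck_opu u f a B S (x + y) = ck_opu u f a B S x + ck_opu u f a B S y"
  "ck_opu u f a B S (psc (lconst c) x) = psc (lconst c) (ck_opu u f a B S x)"
  unfolding ck_opu_def psc_def
  by (cases x; cases y; simp add: mv_simps vec_Du_simps vec_eq_iff algebra_simps)+

lemma ck_even_even:
  "ck_opu u f a 0 0 (ck_opu u g b 0 0 x) - ck_opu u g b 0 0 (ck_opu u f a 0 0 x) =
   ck_opu u (f * lD g - g * lD f) (a ** b - b ** a + smat f (mat_D b) - smat g (mat_D a)) 0 0 x"
proof -
  obtain v w where x: "x = (v, w)" by force
  show ?thesis
    unfolding x ck_opu_def
    apply (simp add: mv_simps vec_Du_simps mat_D_simps transpose_simps phi_simps)
    apply (simp add: vec_eq_iff lconst_cs cs_simps algebra_simps)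
    done
qed

lemma ck_even_odd:
  assumes B: "transpose B = - B" and S: "transpose S = S" and a: "trace a = 0"
  shows "ck_opu u f a 0 0 (ck_opu u 0 0 B S x) - ck_opu u 0 0 B S (ck_opu u f a 0 0 x) =
   ck_opu u 0 0 (a ** B + B ** transpose a + smat f (mat_D B) - smat (lconst (1/2) * lD f) B)
     (- (transpose a ** S) - S ** a + smat f (mat_D S) + smat (lconst (1/2) * lD f) S
      + smat (lconst (1/2)) (transpose (mat_D a) ** ck_phi B - ck_phi B ** mat_D a)) x"
proof -
  obtain v w where x: "x = (v, w)" by force
  have ph: "ck_phi (a ** B) = - (transpose a ** ck_phi B) - ck_phi B ** a - ck_phi (B ** transpose a)"
    using phi_equivariant[OF B a] by (simp add: phi_simps algebra_simps)
  show ?thesis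
    unfolding x ck_opu_def
    apply (simp add: ph mv_simps vec_Du_simps mat_D_simps transpose_simps phi_simps)
    apply (simp add: vec_eq_iff lconst_cs cs_simps algebra_simps)
    apply (intro conjI allI poly_mapping_eqI; simp add: coeff_simps field_simps)
    done
qed

lemma ck_odd_odd:
  assumes B: "transpose B = - B" and S: "transpose S = S" and B': "transpose B' = - B'" and S': "transpose S' = S'"
  shows "ck_opu u 0 0 B S (ck_opu u 0 0 B' S' x) + ck_opu u 0 0 B' S' (ck_opu u 0 0 B S x) =
   ck_opu u (Pol B B') (B ** S' + B' ** S + smat (lconst (1/2)) (B ** mat_D (ck_phi B') + B' ** mat_D (ck_phi B))
      - mat (lconst (1/4) * lD (Pol B B'))) 0 0 x"
proof -
  obtain v w where x: "x = (v, w)" by force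
  have p1: "B *v (ck_phi B' *v v) + B' *v (ck_phi B *v v) = Pol B B' *s v" for v
    using phi_polarized(1)[OF B B'] by (simp add: mv_simps(9,1)[symmetric] mat_mult_vec)
  have p2: "ck_phi B *v (B' *v v) + ck_phi B' *v (B *v v) = Pol B B' *s v" for v
    using phi_polarized(2)[OF B B'] by (simp add: mv_simps(9,1)[symmetric] mat_mult_vec)
  have p3: "mat_D (ck_phi B) *v (B' *v v) + ck_phi B *v (mat_D B' *v v) + mat_D (ck_phi B') *v (B *v v)
      + ck_phi B' *v (mat_D B *v v) = lD (Pol B B') *s v" for v
    using arg_cong[OF phi_polarized(2)[OF B B'], of "\<lambda>X. mat_D X *v v"]
    by (simp add: mat_D_simps mv_simps mat_mult_vec algebra_simps)
  have t: "transpose (mat_D (ck_phi X)) = - mat_D (ck_phi X)" for X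
    by (simp add: mat_D_simps(7)[symmetric] transpose_phi mat_D_simps)
  note q1 = arg_cong[OF p1, of "\<lambda>x. x $ i" for i, simplified]
  note q2 = arg_cong[OF p2, of "\<lambda>x. x $ i" for i, simplified]
  note q3 = arg_cong[OF p3, of "\<lambda>x. x $ i" for i, simplified]
  have e1: "(B *v (ck_phi B' *v v)) $ i = Pol B B' * v $ i - (B' *v (ck_phi B *v v)) $ i" for v i
    using q1[of v i] by (simp add: algebra_simps)
  have e2: "(ck_phi B *v (B' *v v)) $ i = Pol B B' * v $ i - (ck_phi B' *v (B *v v)) $ i" for v i
    using q2[of v i] by (simp add: algebra_simps)
  have e3: "(ck_phi B *v (mat_D B' *v v)) $ i = lD (Pol B B') * v $ i - (mat_D (ck_phi B) *v (B' *v v)) $ i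
      - (mat_D (ck_phi B') *v (B *v v)) $ i - (ck_phi B' *v (mat_D B *v v)) $ i" for v i
    using q3[of v i] by (simp add: algebra_simps)
  show ?thesis
    unfolding x ck_opu_def
    apply (simp add: mv_simps vec_Du_simps mat_D_simps transpose_simps phi_simps t B B' S S' mat_mult_vec)
    apply (simp add: vec_eq_iff e1 e2 e3 lconst_cs cs_simps algebra_simps)
    apply (intro conjI allI poly_mapping_eqI; simp add: coeff_simps field_simps)
    done
qed


lemma op_part_ck_opu:
  "op_part False (ck_opu u f a B S) = ck_opu u f a 0 0" "op_part True (ck_opu u f a B S) = ck_opu u 0 0 B S"
  by (rule ext; simp add: op_part_def ck_opu_def split_beta mv_simps vec_Du_simps transpose_simps phi_simps mat_D_simps vec_eq_iff)+

text \<open>The components of the bracket of two operators with parameters \<open>(f, a, B, S)\<close>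
  and \<open>(g, b, B', S')\<close>: the contributions that involve an even operator are antisymmetric
  under exchange of the two, those of two odd operators symmetric.\<close>

definition "brf f B g B' = f * lD g - g * lD f + Pol B B'"
definition "bra f a B S g b B' S' = a ** b - b ** a + smat f (mat_D b) - smat g (mat_D a)
   + (B ** S' + B' ** S + smat (lconst (1/2)) (B ** mat_D (ck_phi B') + B' ** mat_D (ck_phi B))
      - mat (lconst (1/4) * lD (Pol B B')))"
definition "brB f a B g b B' =
   (a ** B' + B' ** transpose a + smat f (mat_D B') - smat (lconst (1/2) * lD f) B')
   - (b ** B + B ** transpose b + smat g (mat_D B) - smat (lconst (1/2) * lD g) B)"
definition "brS f a B S g b B' S' =
   (- (transpose a ** S') - S' ** a + smat f (mat_D S') + smat (lconst (1/2) * lD f) S'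
      + smat (lconst (1/2)) (transpose (mat_D a) ** ck_phi B' - ck_phi B' ** mat_D a))
   - (- (transpose b ** S) - S ** b + smat g (mat_D S) + smat (lconst (1/2) * lD g) S
      + smat (lconst (1/2)) (transpose (mat_D b) ** ck_phi B - ck_phi B ** mat_D b))"

text \<open>The anticommutator of two odd operators contains \<open>D\<close> only through \<open>B
  \<phi>(B') + B' \<phi>(B)\<close> on $V$ and \<open>\<phi>(B) B' + \<phi>(B') B\<close> on $V^*$, which
  are the same scalar by polarization; this is what closes the bracket.\<close>

lemma ck_bracket:
  assumes p: "(f, a, B, S) \<in> ck_params" and q: "(g, b, B', S') \<in> ck_params"
  shows "op_bracket (ck_opu u f a B S) (ck_opu u g b B' S') =
    ck_opu u (brf f B g B') (bra f a B S g b B' S') (brB f a B g b B') (brS f a B S g b B' S')"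
proof
  fix x
  have p': "trace a = 0" "transpose B = - B" "transpose S = S" and q': "trace b = 0" "transpose B' = - B'" "transpose S' = S'"
    using p q by (auto simp: ck_params_def)
  let ?X0 = "ck_opu u f a 0 0" and ?X1 = "ck_opu u 0 0 B S" and ?Y0 = "ck_opu u g b 0 0" and ?Y1 = "ck_opu u 0 0 B' S'"
  have "op_bracket (ck_opu u f a B S) (ck_opu u g b B' S') x =
     ((?X0 (?Y0 x) - ?Y0 (?X0 x)) + (?X1 (?Y1 x) + ?Y1 (?X1 x))) +
     ((?X0 (?Y1 x) - ?Y1 (?X0 x)) - (?Y0 (?X1 x) - ?X1 (?Y0 x)))"
    by (simp add: op_bracket_def UNIV_bool op_part_ck_opu)
  also have "\<dots> = ck_opu u (brf f B g B') (bra f a B S g b B' S') (brB f a B g b B') (brS f a B S g b B' S') x"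
    unfolding ck_even_even ck_odd_odd[OF p'(2,3) q'(2,3)] ck_even_odd[OF q'(2,3) p'(1)] ck_even_odd[OF p'(2,3) q'(1)]
      ck_opu_add ck_opu_diff brf_def bra_def brB_def brS_def by simp
  finally show "op_bracket (ck_opu u f a B S) (ck_opu u g b B' S') x =
    ck_opu u (brf f B g B') (bra f a B S g b B' S') (brB f a B g b B') (brS f a B S g b B' S') x" .
qed

lemma ck_bracket_params:
  assumes p: "(f, a, B, S) \<in> ck_params" and q: "(g, b, B', S') \<in> ck_params"
  shows "(brf f B g B', bra f a B S g b B' S', brB f a B g b B', brS f a B S g b B' S') \<in> ck_params"
proof -
  have p': "trace a = 0" "transpose B = - B" "transpose S = S" and q': "trace b = 0" "transpose B' = - B'" "transpose S' = S'"
    using p q by (auto simp: ck_params_def)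
  have ta: "a $ 4 $ 4 = - a $ 1 $ 1 - a $ 2 $ 2 - a $ 3 $ 3" and tb: "b $ 4 $ 4 = - b $ 1 $ 1 - b $ 2 $ 2 - b $ 3 $ 3"
    using p'(1) q'(1) by (simp_all add: trace_def sum_4 algebra_simps eq_neg_iff_add_eq_0)
  have sy: "S $ 2 $ 1 = S $ 1 $ 2" "S $ 3 $ 1 = S $ 1 $ 3" "S $ 4 $ 1 = S $ 1 $ 4" "S $ 3 $ 2 = S $ 2 $ 3"
    "S $ 4 $ 2 = S $ 2 $ 4" "S $ 4 $ 3 = S $ 3 $ 4" if "transpose S = S" for S :: lmat
    using arg_cong[OF that, of "\<lambda>m. m $ 1 $ 2"] arg_cong[OF that, of "\<lambda>m. m $ 1 $ 3"]
    arg_cong[OF that, of "\<lambda>m. m $ 1 $ 4"] arg_cong[OF that, of "\<lambda>m. m $ 2 $ 3"]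
    arg_cong[OF that, of "\<lambda>m. m $ 2 $ 4"] arg_cong[OF that, of "\<lambda>m. m $ 3 $ 4"] by simp_all
  have "trace (bra f a B S g b B' S') = 0"
    using skew_entries[OF p'(2)] skew_entries[OF q'(2)] sy[OF p'(3)] sy[OF q'(3)]
    apply (simp add: bra_def trace_def sum_4 mult_mat_nth ta tb ck_phi_def vector_4_nth mat_def Pol_def)
    apply (simp add: lconst_cs cs_simps algebra_simps)
    apply (intro conjI allI poly_mapping_eqI; simp add: coeff_simps field_simps)
    done
  moreover have "transpose (brB f a B g b B') = - brB f a B g b B'"
    by (simp add: brB_def transpose_simps mat_D_simps(7)[symmetric] p' q' mm_simps mat_D_simps;
      simp add: vec_eq_iff algebra_simps)
  moreover have "transpose (brS f a B S g b B' S') = brS f a B S g b B' S'"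
    by (simp add: brS_def transpose_simps mat_D_simps(7)[symmetric] p' q' mm_simps transpose_phi;
      simp add: vec_eq_iff algebra_simps)
  ultimately show ?thesis by (simp add: ck_params_def)
qed

lemma CK6_carrierE:
  assumes "X \<in> carrier CK6"
  obtains f a B S where "X = ck_opu 0 f a B S" "(f, a, B, S) \<in> ck_params"
  using assms by (auto simp: CK6_def ck_op_eq)

lemma CK6_carrierI: "(f, a, B, S) \<in> ck_params \<Longrightarrow> ck_opu 0 f a B S \<in> carrier CK6"
  by (auto simp: CK6_def ck_op_eq)

lemma rho_ck_opu: "rho u (ck_opu 0 f a B S) = ck_opu u f a B S"
  using rho_ck_op by (simp add: ck_op_eq)

lemma rho_bracket:
  assumes "X \<in> carrier CK6" "Y \<in> carrier CK6"
  shows "rho u (op_bracket X Y) = op_bracket (rho u X) (rho u Y)"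
proof -
  obtain f a B S where X: "X = ck_opu 0 f a B S" "(f, a, B, S) \<in> ck_params" by (rule CK6_carrierE[OF assms(1)])
  obtain g b B' S' where Y: "Y = ck_opu 0 g b B' S'" "(g, b, B', S') \<in> ck_params" by (rule CK6_carrierE[OF assms(2)])
  show ?thesis unfolding X(1) Y(1) rho_ck_opu ck_bracket[OF X(2) Y(2)] ..
qed

lemma CK6_homE:
  assumes "X \<in> hom_part CK6 p n"
  obtains f a B S where "X = ck_opu 0 f a B S" "(f, a, B, S) \<in> ck_params" "f \<in> lhom n" "a \<in> mat_lhom n"
    "B \<in> mat_lhom n" "S \<in> mat_lhom n" "if p then f = 0 \<and> a = 0 else B = 0 \<and> S = 0"
  using assms by (auto simp: CK6_def ck_op_eq)

lemma CK6_homI: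
  assumes "(f, a, B, S) \<in> ck_params" "f \<in> lhom n" "a \<in> mat_lhom n"
    "B \<in> mat_lhom n" "S \<in> mat_lhom n" "if p then f = 0 \<and> a = 0 else B = 0 \<and> S = 0"
  shows "ck_opu 0 f a B S \<in> hom_part CK6 p n"
proof -
  have "\<exists>f' a' B' S'. ck_opu 0 f a B S = ck_opu 0 f' a' B' S' \<and> (f', a', B', S') \<in> ck_params \<and> f' \<in> lhom n \<and>
     a' \<in> mat_lhom n \<and> B' \<in> mat_lhom n \<and> S' \<in> mat_lhom n \<and> (if p then f' = 0 \<and> a' = 0 else B' = 0 \<and> S' = 0)"
    using assms by blast
  then show ?thesis by (simp add: CK6_def ck_op_eq)
qed

lemma CK6_hom_carrier: "hom_part CK6 p n \<subseteq> carrier CK6"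
  by (auto simp: CK6_def)

lemma ck_opu_zero_arg: "ck_opu u f a B S 0 = 0"
  using ck_opu_arg(1)[of u f a B S 0 0] by simp

lemma ck_opu_zero: "ck_opu u 0 0 0 0 x = 0"
  using ck_opu_diff[of u 0 0 0 0 x 0 0 0 0] by simp

text \<open>On an even operator and an arbitrary one the superbracket is the commutator, on two odd
  operators it is the anticommutator.\<close>

lemma op_bracket_even: "op_bracket (ck_opu u f a 0 0) (ck_opu u g b B S) x =
   ck_opu u f a 0 0 (ck_opu u g b B S x) - ck_opu u g b B S (ck_opu u f a 0 0 x)"
proof -
  have s: "ck_opu u g b B S y = ck_opu u g b 0 0 y + ck_opu u 0 0 B S y" for y by (simp add: ck_opu_add)
  show ?thesis
    by (simp add: op_bracket_def UNIV_bool op_part_ck_opu ck_opu_zero ck_opu_zero_arg ck_opu_arg s[of x] s[of "ck_opu u f a 0 0 x"])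
qed

lemma op_bracket_hom:
  assumes "X \<in> hom_part CK6 p m" "Y \<in> hom_part CK6 q n"
  shows "rho u X (rho u Y x) = psc (lconst (if p \<and> q then -1 else 1)) (rho u Y (rho u X x)) + rho u (op_bracket X Y) x"
proof -
  have c: "X \<in> carrier CK6" "Y \<in> carrier CK6" using assms CK6_hom_carrier by blast+
  have one: "psc (lconst (-1)) y = - y" "psc (lconst 1) y = y" for y
    by (simp_all add: psc_def lconst_simps prod_eq_iff vec_eq_iff)
  from assms(1) obtain f a B S where X: "X = ck_opu 0 f a B S" "if p then f = 0 \<and> a = 0 else B = 0 \<and> S = 0"
    by (rule CK6_homE)
  from assms(2) obtain g b B' S' where Y: "Y = ck_opu 0 g b B' S'" "if q then g = 0 \<and> b = 0 else B' = 0 \<and> S' = 0"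
    by (rule CK6_homE)
  show ?thesis
    unfolding rho_bracket[OF c] unfolding X(1) Y(1) rho_ck_opu
    using X(2) Y(2)
    by (cases p; cases q; simp add: one op_bracket_def UNIV_bool op_part_ck_opu ck_opu_zero ck_opu_zero_arg)
qed

lemma mult_axis: "((X :: lmat) *v axis k c) $ i = X $ i $ k * c"
proof -
  have "X $ i $ k' * (axis k c) $ k' = (if k' = k then X $ i $ k * c else 0)" for k'
    by (simp add: axis_def)
  then show ?thesis by (simp add: mult_vec_nth)
qed

lemma ck_opu_eq_zero:
  assumes p: "(f, a, B, S) \<in> ck_params" and z: "\<And>x. ck_opu 0 f a B S x = 0"
  shows "f = 0" "a = 0" "B = 0" "S = 0"
proof -
  show B: "B = 0"
    unfolding vec_eq_iff
  proof (intro allI)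
    fix i k
    show "B $ i $ k = 0 $ i $ k"
      using z[of "(0, axis k 1)"] mult_axis[of B k 1 i]
      by (simp add: ck_opu_def mv_simps vec_Du_simps zero_prod_def vec_eq_iff)
  qed
  show S: "S = 0"
    unfolding vec_eq_iff
  proof (intro allI)
    fix i k
    show "S $ i $ k = 0 $ i $ k"
      using z[of "(axis k 1, 0)"] mult_axis[of S k 1 i]
      by (simp add: ck_opu_def mv_simps vec_Du_simps zero_prod_def B phi_simps mat_D_simps vec_eq_iff)
  qed
  have e: "a *v v + f *s vec_Du 0 v + (lconst (1/4) * lD f) *s v = 0" for v
    using z[of "(v, 0)"] by (simp add: ck_opu_def zero_prod_def mv_simps)
  have "tt 1 *s (f *s v) = 0" for v :: lvec
  proof -
    have "vec_Du 0 (tt 1 *s v) = tt 1 *s (v + vec_Du 0 v)"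
      by (simp add: vec_Du_simps vec_eq_iff cs_simps algebra_simps)
    then have "0 = tt 1 *s (f *s v) + tt 1 *s (a *v v + f *s vec_Du 0 v + (lconst (1/4) * lD f) *s v)"
      using e[of "tt 1 *s v"] by (simp add: mv_simps vec_eq_iff algebra_simps)
    then show ?thesis unfolding e by simp
  qed
  from arg_cong[OF this[of "axis 1 1"], of "\<lambda>v. v $ 1"] have "tt 1 * f = 0"
    by (simp add: axis_def)
  then have "tt (-1) * (tt 1 * f) = tt (-1) * 0" by (simp only:)
  then show f: "f = 0" by (simp only: tt_inverse mult_zero_right)
  show a: "a = 0"
    unfolding vec_eq_iff
  proof (intro allI)
    fix i k
    have "a *v axis k 1 = 0" using e[of "axis k 1"] unfolding f by simp
    from arg_cong[OF this, of "\<lambda>v. v $ i"] show "a $ i $ k = 0 $ i $ k"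
      by (simp add: mult_axis)
  qed
qed

lemma smat_minus: "smat h (- X) = - smat h X"
  by (simp add: vec_eq_iff)

lemma ck_params_diff:
  shows "(f, a, B, S) \<in> ck_params \<Longrightarrow> (g, b, B', S') \<in> ck_params \<Longrightarrow>
    (f - g, a - b, B - B', S - S') \<in> ck_params"
  "(f, a, B, S) \<in> ck_params \<Longrightarrow> (g, b, B', S') \<in> ck_params \<Longrightarrow>
    (f + g, a + b, B + B', S + S') \<in> ck_params"
  "(f, a, B, S) \<in> ck_params \<Longrightarrow> (h * f, smat h a, smat h B, smat h S) \<in> ck_params"
proof -
  have "trace (smat h a) = h * trace a" by (simp add: trace_def sum_distrib_left)
  then show "(f, a, B, S) \<in> ck_params \<Longrightarrow> (h * f, smat h a, smat h B, smat h S) \<in> ck_params"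
    by (simp add: ck_params_def transpose_simps smat_minus)
qed (simp_all add: ck_params_def transpose_simps trace_def sum_subtractf sum.distrib)

text \<open>The parameters are recovered from the values on constant vectors and on \<open>t\<close>
  times constant vectors.\<close>

lemma ck_opu_inject:
  assumes "(f, a, B, S) \<in> ck_params" "(g, b, B', S') \<in> ck_params" "ck_opu 0 f a B S = ck_opu 0 g b B' S'"
  shows "f = g" "a = b" "B = B'" "S = S'"
  using ck_opu_eq_zero[OF ck_params_diff(1)[OF assms(1,2)]] assms(3) ck_opu_diff[of 0 f a B S _ g b B' S']
  by simp_all

subsection \<open>The action of constant diagonal matrices\<close>

text \<open>Constant diagonal matrices as operators; after embedding, the element \<open>F\<close> of
  each of the three algebras is of this form.\<close>

definition Hop :: "(4 \<Rightarrow> complex) \<Rightarrow> ck_operator" where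
  "Hop w = ck_opu 0 0 (diag_mat (\<chi> i. lconst (w i))) 0 0"

definition escale :: "(4 \<Rightarrow> 4 \<Rightarrow> complex) \<Rightarrow> lmat \<Rightarrow> lmat" where
  "escale c X = (\<chi> i k. lconst (c i k) * X $ i $ k)"

lemma escale_nth [simp]: "escale c X $ i $ k = lconst (c i k) * X $ i $ k"
  by (simp add: escale_def)

lemma diag_nth [simp]: "diag_mat h $ i $ k = (if i = k then h $ i else 0)"
  by (simp add: diag_mat_def)

lemma diag_mult: "diag_mat h ** X = (\<chi> i k. h $ i * X $ i $ k)" "X ** diag_mat h = (\<chi> i k. X $ i $ k * h $ k)"
proof -
  have "(if i = k then h $ i else 0) * y = (if i = k then h $ i * y else 0)"
    "y * (if i = k then h $ i else 0) = (if i = k then y * h $ i else 0)" for i k and y :: laurent by simp_all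
  then show "diag_mat h ** X = (\<chi> i k. h $ i * X $ i $ k)" "X ** diag_mat h = (\<chi> i k. X $ i $ k * h $ k)"
    by (simp_all add: vec_eq_iff mult_mat_nth)
qed

lemma transpose_diag: "transpose (diag_mat h) = diag_mat h"
  by (simp add: vec_eq_iff)

lemma mat_D_diag: "mat_D (diag_mat h) = diag_mat (vec_D h)"
  by (simp add: vec_eq_iff)

lemma lconst_sum: "lconst (sum f K) = (\<Sum>i\<in>K. lconst (f i))"
  by (induction K rule: infinite_finite_induct) (simp_all add: lconst_simps)

lemma Hop_params: "(\<Sum>i\<in>UNIV. w i) = 0 \<Longrightarrow> (0, diag_mat (\<chi> i. lconst (w i)), 0, 0) \<in> ck_params"
  by (simp add: ck_params_def trace_def vec_eq_iff lconst_sum[symmetric] lconst_simps(5))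

lemma Hop_bracket:
  assumes w: "(\<Sum>i\<in>UNIV. w i) = 0" and p: "(f, a, B, S) \<in> ck_params"
  shows "op_bracket (Hop w) (ck_opu 0 f a B S) = ck_opu 0 0 (escale (\<lambda>i k. w i - w k) a)
     (escale (\<lambda>i k. w i + w k) B) (escale (\<lambda>i k. - (w i + w k)) S)"
proof -
  have 1: "brf 0 0 f B = 0" by (simp add: brf_def Pol_def)
  have z: "mat 0 = (0 :: lmat)" "smat 0 X = 0" "smat c 0 = 0" "diag_mat 0 = 0" for X c
    by (simp_all add: vec_eq_iff mat_def)
  have v: "vec_D (\<chi> i. lconst (w i)) = 0" by (simp add: vec_eq_iff)
  have t: "transpose 0 = (0 :: lmat)" by (simp add: vec_eq_iff)
  have 2: "bra 0 (diag_mat (\<chi> i. lconst (w i))) 0 0 f a B S = escale (\<lambda>i k. w i - w k) a"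
    by (simp add: bra_def diag_mult mat_D_diag v z mm_simps Pol_def phi_simps mat_D_simps)
      (simp add: vec_eq_iff lconst_simps algebra_simps)
  have 3: "brB 0 (diag_mat (\<chi> i. lconst (w i))) 0 f a B = escale (\<lambda>i k. w i + w k) B"
    by (simp add: brB_def transpose_diag diag_mult mat_D_diag v z mm_simps mat_D_simps)
      (simp add: vec_eq_iff lconst_simps algebra_simps)
  have 4: "brS 0 (diag_mat (\<chi> i. lconst (w i))) 0 0 f a B S = escale (\<lambda>i k. - (w i + w k)) S"
    by (simp add: brS_def transpose_diag diag_mult mat_D_diag v z t mm_simps mat_D_simps phi_simps)
      (simp add: vec_eq_iff lconst_simps algebra_simps)
  show ?thesis unfolding Hop_def ck_bracket[OF Hop_params[OF w] p] 1 2 3 4 ..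
qed

lemma lconst_mult_eq_0: "lconst c * f = 0 \<longleftrightarrow> c = 0 \<or> f = 0"
proof
  assume a: "lconst c * f = 0"
  show "c = 0 \<or> f = 0"
  proof (rule disjCI)
    assume "f \<noteq> 0"
    then obtain n where "Poly_Mapping.lookup f n \<noteq> 0" by (metis poly_mapping_eqI lookup_zero)
    then show "c = 0" using arg_cong[OF a, of "\<lambda>f. Poly_Mapping.lookup f n"] by (simp add: lookup_lconst_mult)
  qed
qed (auto simp: lconst_simps)

lemma lconst_mult_cancel: "lconst c * f = lconst b * f \<longleftrightarrow> c = b \<or> f = 0"
  using lconst_mult_eq_0[of "c - b" f] by (simp add: lconst_simps algebra_simps)

text \<open>For a constant diagonal matrix with entries \<open>w\<close>, the entry \<open>(i,
  k)\<close> of \<open>a\<close>, \<open>B\<close>, \<open>S\<close> has weight \<open>w i - w k\<close>,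
  \<open>w i + w k\<close>, \<open>-(w i + w k)\<close>.\<close>

lemma Hop_eigen:
  assumes w: "(\<Sum>i\<in>UNIV. w i) = 0" and p: "(f, a, B, S) \<in> ck_params"
    and e: "op_bracket (Hop w) (ck_opu 0 f a B S) = (\<lambda>x. psc (lconst c) (ck_opu 0 f a B S x))"
  shows "c \<noteq> 0 \<Longrightarrow> f = 0" "w i - w k \<noteq> c \<Longrightarrow> a $ i $ k = 0" "w i + w k \<noteq> c \<Longrightarrow> B $ i $ k = 0"
    "- (w i + w k) \<noteq> c \<Longrightarrow> S $ i $ k = 0"
proof -
  have p1: "(0, escale (\<lambda>i k. w i - w k) a, escale (\<lambda>i k. w i + w k) B, escale (\<lambda>i k. - (w i + w k)) S) \<in> ck_params"
  proof -
    have t: "transpose B = - B" "transpose S = S" using p by (auto simp: ck_params_def)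
    have "B $ k $ i = - B $ i $ k" "S $ k $ i = S $ i $ k" for i k
      using arg_cong[OF t(1), of "\<lambda>m. m $ i $ k"] arg_cong[OF t(2), of "\<lambda>m. m $ i $ k"] by simp_all
    then have sk: "B $ k $ i = - B $ i $ k" "S $ k $ i = S $ i $ k" for i k by blast+
    have "transpose (escale (\<lambda>i k. w i + w k) B) = - escale (\<lambda>i k. w i + w k) B"
      unfolding vec_eq_iff
    proof (intro allI)
      fix i k
      show "transpose (escale (\<lambda>i k. w i + w k) B) $ i $ k = (- escale (\<lambda>i k. w i + w k) B) $ i $ k"
        using sk(1)[where i = i and k = k] by (simp add: add.commute)
    qed
    moreover have "transpose (escale (\<lambda>i k. - (w i + w k)) S) = escale (\<lambda>i k. - (w i + w k)) S"
      unfolding vec_eq_iff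
    proof (intro allI)
      fix i k
      show "transpose (escale (\<lambda>i k. - (w i + w k)) S) $ i $ k = escale (\<lambda>i k. - (w i + w k)) S $ i $ k"
        using sk(2)[where i = i and k = k] by (simp add: lconst_simps algebra_simps)
    qed
    ultimately show ?thesis by (simp add: ck_params_def trace_def lconst_simps)
  qed
  note p2 = ck_params_diff(3)[OF p, of "lconst c"]
  have "ck_opu 0 0 (escale (\<lambda>i k. w i - w k) a) (escale (\<lambda>i k. w i + w k) B) (escale (\<lambda>i k. - (w i + w k)) S)
      = ck_opu 0 (lconst c * f) (smat (lconst c) a) (smat (lconst c) B) (smat (lconst c) S)"
    using e unfolding Hop_bracket[OF w p] ck_opu_smult .
  note q = ck_opu_inject[OF p1 p2 this]
  show "c \<noteq> 0 \<Longrightarrow> f = 0" using q(1) lconst_mult_eq_0[of c f] by simp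
  show "w i - w k \<noteq> c \<Longrightarrow> a $ i $ k = 0"
    using arg_cong[OF q(2), of "\<lambda>m. m $ i $ k"] lconst_mult_cancel[of "w i - w k" "a $ i $ k" c] by simp
  show "w i + w k \<noteq> c \<Longrightarrow> B $ i $ k = 0"
    using arg_cong[OF q(3), of "\<lambda>m. m $ i $ k"] lconst_mult_cancel[of "w i + w k" "B $ i $ k" c] by simp
  show "- (w i + w k) \<noteq> c \<Longrightarrow> S $ i $ k = 0"
    using arg_cong[OF q(4), of "\<lambda>m. m $ i $ k"] lconst_mult_cancel[of "- (w i + w k)" "S $ i $ k" c] by simp
qed

lemma diag_vec: "diag_mat h *v v = (\<chi> i. h $ i * v $ i)"
proof -
  have "(if i = k then h $ i else 0) * y = (if i = k then h $ i * y else 0)" for i k and y :: laurent by simp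
  then show ?thesis by (simp add: vec_eq_iff mult_vec_nth)
qed

lemma rho_Hop: "rho u (Hop w) x = ((\<chi> i. lconst (w i) * fst x $ i), (\<chi> i. - lconst (w i) * snd x $ i))"
  unfolding Hop_def rho_ck_opu
  by (cases x) (simp add: ck_opu_def diag_vec transpose_diag mv_simps phi_simps mat_D_simps vec_eq_iff)

lemma rho_Hop_eigen:
  assumes "rho u (Hop w) x = psc (lconst c) x"
  shows "w i \<noteq> c \<Longrightarrow> fst x $ i = 0" "- w i \<noteq> c \<Longrightarrow> snd x $ i = 0"
proof -
  have "lconst (w i) * fst x $ i = lconst c * fst x $ i" "lconst (- w i) * snd x $ i = lconst c * snd x $ i"
    using assms by (auto simp: rho_Hop psc_def vec_eq_iff lconst_simps)
  then show "w i \<noteq> c \<Longrightarrow> fst x $ i = 0" "- w i \<noteq> c \<Longrightarrow> snd x $ i = 0"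
    by (simp_all only: lconst_mult_cancel) auto
qed

section \<open>The natural modules\<close>

definition coord :: "4 set \<Rightarrow> 4 set \<Rightarrow> (lvec \<times> lvec) set" where
  "coord A A' = {x. (\<forall>i. i \<notin> A \<longrightarrow> fst x $ i = 0) \<and> (\<forall>i. i \<notin> A' \<longrightarrow> snd x $ i = 0)}"

definition nat_hom :: "bool \<Rightarrow> bool \<Rightarrow> int \<Rightarrow> (lvec \<times> lvec) set" where
  "nat_hom s p n = {x. (if p \<noteq> s then fst x = 0 else snd x = 0) \<and> (\<forall>i. fst x $ i \<in> lhom n \<and> snd x $ i \<in> lhom n)}"

text \<open>The natural module restricted along \<open>\<kappa>\<close> to a coordinate subspace. The
  flag \<open>s\<close> exchanges the parities of $V$ and $V^*$.\<close>

definition natmod :: "('l \<Rightarrow> ck_operator) \<Rightarrow> complex \<Rightarrow> 4 set \<Rightarrow> 4 set \<Rightarrow> bool \<Rightarrow> ('l, lvec \<times> lvec) smodule" where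
  "natmod \<kappa> u A A' s = \<lparr>carrier = coord A A', mult = undefined, one = undefined, zero = 0, add = (+),
     smult = (\<lambda>c. psc (lconst c)), hom_part = (\<lambda>p n. coord A A' \<inter> nat_hom s p n),
     action = (\<lambda>x. rho u (\<kappa> x))\<rparr>"

lemma natmod_simps [simp]:
  "carrier (natmod \<kappa> u A A' s) = coord A A'" "zero (natmod \<kappa> u A A' s) = 0" "add (natmod \<kappa> u A A' s) = (+)"
  "smult (natmod \<kappa> u A A' s) c = psc (lconst c)" "hom_part (natmod \<kappa> u A A' s) p n = coord A A' \<inter> nat_hom s p n"
  "action (natmod \<kappa> u A A' s) x = rho u (\<kappa> x)"
  by (simp_all add: natmod_def)

lemma psc_simps:
  "psc f (x + y) = psc f x + psc f y" "psc (f + g) x = psc f x + psc g x" "psc (f * g) x = psc f (psc g x)"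
  "psc 1 x = x" "psc 0 x = 0" "psc f (x - y) = psc f x - psc f y" "psc f 0 = 0"
  by (simp_all add: psc_def prod_eq_iff vec_eq_iff algebra_simps)

lemma coord_closed: "0 \<in> coord A A'" "x \<in> coord A A' \<Longrightarrow> y \<in> coord A A' \<Longrightarrow> x + y \<in> coord A A'"
  "x \<in> coord A A' \<Longrightarrow> psc f x \<in> coord A A'"
  by (simp_all add: coord_def psc_def)

lemma nat_hom_closed: "0 \<in> nat_hom s p n" "x \<in> nat_hom s p n \<Longrightarrow> y \<in> nat_hom s p n \<Longrightarrow> x + y \<in> nat_hom s p n"
  "x \<in> nat_hom s p n \<Longrightarrow> psc (lconst c) x \<in> nat_hom s p n"
  by (auto simp: nat_hom_def psc_def)

lemma rho_arg:
  assumes "X \<in> carrier CK6"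
  shows "rho u X (x + y) = rho u X x + rho u X y" "rho u X (psc (lconst c) x) = psc (lconst c) (rho u X x)"
    "rho u X 0 = 0"
  by (rule CK6_carrierE[OF assms]; simp add: rho_ck_opu ck_opu_arg ck_opu_zero_arg)+

lemma rho_add: "rho u (\<lambda>v. X v + Y v) x = rho u X x + rho u Y x"
  by (simp add: rho_def psc_simps algebra_simps)

lemma rho_smult: "rho u (\<lambda>v. psc (lconst c) (X v)) x = psc (lconst c) (rho u X x)"
  by (simp add: rho_def psc_def prod_eq_iff vec_eq_iff algebra_simps)

lemma rho_hom:
  assumes X: "X \<in> hom_part CK6 q m" and x: "x \<in> nat_hom s p n"
  shows "rho u X x \<in> nat_hom s (p \<noteq> q) (n + m)"
proof -
  obtain f a B S where X: "X = ck_opu 0 f a B S" "f \<in> lhom m" "a \<in> mat_lhom m"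
    "B \<in> mat_lhom m" "S \<in> mat_lhom m" "if q then f = 0 \<and> a = 0 else B = 0 \<and> S = 0"
    using X by (rule CK6_homE)
  obtain v w where vw: "x = (v, w)" by force
  have v: "v $ i \<in> lhom n" "w $ i \<in> lhom n" for i using x vw by (auto simp: nat_hom_def)
  have mv: "(Y *v z) $ i \<in> lhom (n + m)" if "Y \<in> mat_lhom m" "\<And>i. z $ i \<in> lhom n" for Y z i
    unfolding mult_vec_nth by (rule lhom_sum) (use that lhom_mult[of _ m _ n] in \<open>auto simp: mat_lhom_def add.commute\<close>)
  have fm: "f * g \<in> lhom (n + m)" "lD f * g \<in> lhom (n + m)" if "g \<in> lhom n" for g
    using lhom_mult[OF X(2) that] lhom_mult[OF lhom_simps(5)[OF X(2)] that] by (simp_all add: add.commute)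
  have ph: "ck_phi B \<in> mat_lhom m" "mat_D (ck_phi B) \<in> mat_lhom m" "transpose a \<in> mat_lhom m"
    using X(3,4) by (simp_all add: mat_lhom_def forall_4 ck_phi_def vector_4_nth)
  have d: "vec_Du u z $ i \<in> lhom n" if "\<And>i. z $ i \<in> lhom n" for z i
    using that by (simp add: vec_Du_def)
  have r: "fst (rho u X x) $ i \<in> lhom (n + m)" "snd (rho u X x) $ i \<in> lhom (n + m)" for i
    unfolding X(1) rho_ck_opu unfolding vw ck_opu_def
    using v d mv X(3-5) ph fm by (simp_all add: mult.assoc)
  have "if (p \<noteq> q) \<noteq> s then fst (rho u X x) = 0 else snd (rho u X x) = 0"
    using X(6) x unfolding X(1) rho_ck_opu unfolding vw ck_opu_def
    by (cases p; cases q; cases s)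
      (auto simp: nat_hom_def mv_simps vec_Du_simps phi_simps mat_D_simps transpose_simps)
  then show ?thesis using r by (simp add: nat_hom_def)
qed

definition nat_pr :: "bool \<Rightarrow> bool \<Rightarrow> int \<Rightarrow> lvec \<times> lvec \<Rightarrow> lvec \<times> lvec" where
  "nat_pr s p n x = (if p \<noteq> s then (0, \<chi> i. Poly_Mapping.single n (Poly_Mapping.lookup (snd x $ i) n))
     else (\<chi> i. Poly_Mapping.single n (Poly_Mapping.lookup (fst x $ i) n), 0))"

lemma nat_pr_add: "nat_pr s p n (x + y) = nat_pr s p n x + nat_pr s p n y"
  by (simp add: nat_pr_def prod_eq_iff vec_eq_iff lookup_add single_add)

lemma lhom_single_eq: "f \<in> lhom n \<Longrightarrow> Poly_Mapping.single n (Poly_Mapping.lookup f n) = f"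
  using lhom_single by metis

lemma nat_pr_same: "x \<in> nat_hom s p n \<Longrightarrow> nat_pr s p n x = x"
  by (auto simp: nat_pr_def nat_hom_def prod_eq_iff vec_eq_iff lhom_single_eq)

lemma nat_pr_other: "x \<in> nat_hom s q m \<Longrightarrow> (q, m) \<noteq> (p, n) \<Longrightarrow> nat_pr s p n x = 0"
proof -
  assume x: "x \<in> nat_hom s q m" and ne: "(q, m) \<noteq> (p, n)"
  have "m \<noteq> n \<Longrightarrow> Poly_Mapping.lookup (fst x $ i) n = 0 \<and> Poly_Mapping.lookup (snd x $ i) n = 0" for i
    using x by (auto simp: nat_hom_def lhomI)
  moreover have "m = n \<Longrightarrow> q \<noteq> p" using ne by auto
  ultimately show ?thesis using x
    by (cases "m = n") (auto simp: nat_pr_def prod_eq_iff vec_eq_iff nat_hom_def)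
qed

lemma nat_pr_hom: "nat_pr s p n x \<in> nat_hom s p n" "x \<in> coord A A' \<Longrightarrow> nat_pr s p n x \<in> coord A A'"
  by (auto simp: nat_pr_def nat_hom_def coord_def)

lemma nat_pr_sum:
  assumes "finite K" "\<And>i. Poly_Mapping.keys (fst x $ i) \<subseteq> K" "\<And>i. Poly_Mapping.keys (snd x $ i) \<subseteq> K"
  shows "x = (\<Sum>n\<in>K. nat_pr s s n x + nat_pr s (\<not> s) n x)"
proof -
  have r: "f = (\<Sum>n\<in>K. Poly_Mapping.single n (Poly_Mapping.lookup f n))" if "Poly_Mapping.keys f \<subseteq> K" for f :: laurent
    by (subst sum_of_monomials[of f], rule sum.mono_neutral_left) (use assms(1) that in \<open>auto simp: in_keys_iff\<close>)
  have s: "fst (sum g K) = (\<Sum>n\<in>K. fst (g n))" "snd (sum g K) = (\<Sum>n\<in>K. snd (g n))" for g :: "int \<Rightarrow> lvec \<times> lvec"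
    using fst_sum snd_sum by metis+
  have s2: "(sum g K) $ i = (\<Sum>n\<in>K. g n $ i)" for g :: "int \<Rightarrow> lvec" and i
    by (induction K rule: infinite_finite_induct) simp_all
  show ?thesis
    unfolding prod_eq_iff s vec_eq_iff s2
    using r[OF assms(2)] r[OF assms(3)] by (simp add: nat_pr_def)
qed

lemma CK6_ops: "X \<oplus>\<^bsub>CK6\<^esub> Y = (\<lambda>v. X v + Y v)" "c \<odot>\<^bsub>CK6\<^esub> X = (\<lambda>v. psc (lconst c) (X v))"
  "bracket CK6 = op_bracket" "\<zero>\<^bsub>CK6\<^esub> = (\<lambda>v. 0)"
  by (simp_all add: CK6_def psc_def)

text \<open>A subalgebra of \<open>CK(6)\<close>, given by an embedding \<open>\<kappa>\<close>, that
  preserves a coordinate subspace.\<close>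

locale natural_module =
  fixes L :: "'l slie" and \<kappa> :: "'l \<Rightarrow> ck_operator" and u :: complex and A A' :: "4 set" and s :: bool
  assumes L_module: "module complex_ring L" and L_hom: "hom_part L p n \<subseteq> carrier L"
    and emb: "lie_superalgebra_embedding L CK6 \<kappa>"
    and inv: "x \<in> carrier L \<Longrightarrow> v \<in> coord A A' \<Longrightarrow> rho u (\<kappa> x) v \<in> coord A A'"
begin

abbreviation "N \<equiv> natmod \<kappa> u A A' s"

lemma kappa:
  "x \<in> carrier L \<Longrightarrow> \<kappa> x \<in> carrier CK6"
  "x \<in> carrier L \<Longrightarrow> y \<in> carrier L \<Longrightarrow> \<kappa> (x \<oplus>\<^bsub>L\<^esub> y) = (\<lambda>v. \<kappa> x v + \<kappa> y v)"
  "x \<in> carrier L \<Longrightarrow> \<kappa> (c \<odot>\<^bsub>L\<^esub> x) = (\<lambda>v. psc (lconst c) (\<kappa> x v))"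
  "x \<in> hom_part L p n \<Longrightarrow> \<kappa> x \<in> hom_part CK6 p n"
  "x \<in> carrier L \<Longrightarrow> y \<in> carrier L \<Longrightarrow> \<kappa> (bracket L x y) = op_bracket (\<kappa> x) (\<kappa> y)"
  using emb by (auto simp: lie_superalgebra_embedding_def CK6_ops image_subset_iff)

lemma nat_smod: "smod L N"
  unfolding smod_def
proof (intro conjI allI ballI)
  show "module complex_ring N"
    by (rule vector_spaceI) (auto simp: coord_closed psc_simps lconst_simps algebra_simps)
qed (auto simp: inv rho_arg kappa(1))

lemma nat_hom_subsp: "subsp N (hom_part N p n)"
  by (auto simp: subsp_def coord_closed nat_hom_closed)

lemma nat_act_add: "x \<in> carrier L \<Longrightarrow> y \<in> carrier L \<Longrightarrow> w \<in> carrier N \<Longrightarrow>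
    action N (x \<oplus>\<^bsub>L\<^esub> y) w = action N x w + action N y w"
  by (simp add: kappa(2) rho_add)

lemma nat_act_smult: "x \<in> carrier L \<Longrightarrow> w \<in> carrier N \<Longrightarrow> action N (c \<odot>\<^bsub>L\<^esub> x) w = c \<odot>\<^bsub>N\<^esub> action N x w"
  by (simp add: kappa(3) rho_smult)

lemma nat_comm: "x \<in> hom_part L p m \<Longrightarrow> y \<in> hom_part L q n \<Longrightarrow> w \<in> carrier N \<Longrightarrow>
      action N x (action N y w) =
        (if p \<and> q then -1 else 1) \<odot>\<^bsub>N\<^esub> action N y (action N x w) + action N (bracket L x y) w"
  using op_bracket_hom[OF kappa(4) kappa(4), of x p m y q n u w] kappa(5)[of x y] L_hom by (simp add: subset_iff)

lemma nat_even: "F \<in> hom_part L False 0 \<Longrightarrow> x \<in> carrier L \<Longrightarrow> w \<in> carrier N \<Longrightarrow>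
      action N F (action N x w) = action N x (action N F w) + action N (bracket L F x) w"
proof -
  assume F: "F \<in> hom_part L False 0" and x: "x \<in> carrier L"
  obtain f a B S where k: "\<kappa> F = ck_opu 0 f a 0 0" by (rule CK6_homE[OF kappa(4)[OF F]]) auto
  obtain g b B' S' where k': "\<kappa> x = ck_opu 0 g b B' S'" by (rule CK6_carrierE[OF kappa(1)[OF x]])
  have c: "\<kappa> F \<in> carrier CK6" "\<kappa> x \<in> carrier CK6" "F \<in> carrier L" using kappa(1) x F L_hom by blast+
  show ?thesis
    unfolding natmod_simps kappa(5)[OF c(3) x] rho_bracket[OF c(1,2)] unfolding k k' rho_ck_opu op_bracket_even
    by simp
qed

lemma nat_act_hom: "x \<in> hom_part L q m \<Longrightarrow> w \<in> hom_part N p n \<Longrightarrow> action N x w \<in> hom_part N (p \<noteq> q) (n + m)"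
  using rho_hom[OF kappa(4)] inv L_hom by (auto simp: subset_iff)

lemma nat_span: "carrier N \<subseteq> lin_span N (\<Union>p n. hom_part N p n)"
proof
  fix x assume x: "x \<in> carrier N"
  define K where "K = (\<Union>i. Poly_Mapping.keys (fst x $ i) \<union> Poly_Mapping.keys (snd x $ i))"
  have K: "finite K" by (simp add: K_def)
  note V = smodD(1)[OF nat_smod]
  have c: "(\<Union>p n. hom_part N p n) \<subseteq> carrier N" by auto
  note sp = subspD[OF subsp_lin_span[OF V c], simplified]
  have g: "nat_pr s p n x \<in> lin_span N (\<Union>p n. hom_part N p n)" for p n
  proof -
    have "nat_pr s p n x \<in> hom_part N p n" using nat_pr_hom x by simp
    then show ?thesis using lin_span_superset[OF V, of "\<Union>p n. hom_part N p n"] by blast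
  qed
  have "(\<Sum>n\<in>K. nat_pr s s n x + nat_pr s (\<not> s) n x) \<in> lin_span N (\<Union>p n. hom_part N p n)"
    using K
  proof (induction K rule: finite_induct)
    case empty then show ?case using sp(2) by simp
  next
    case (insert n K) then show ?case using sp(3) g by simp
  qed
  then show "x \<in> lin_span N (\<Union>p n. hom_part N p n)"
    by (subst nat_pr_sum[OF K, of x s]) (auto simp: K_def)
qed

lemma nonzero_homogeneous:
  assumes P: "graded_submodule L N P" and nz: "P \<noteq> {0}"
  obtains p n x where "x \<in> P" "x \<in> hom_part N p n" "x \<noteq> 0"
proof (rule ccontr)
  assume a: "\<not> thesis"
  have P': "subsp N P" "P \<subseteq> lin_span N (\<Union>p n. P \<inter> hom_part N p n)"
    using P by (simp_all add: graded_submodule_iff[OF nat_smod])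
  have "(\<Union>p n. P \<inter> hom_part N p n) \<subseteq> {0}" using a that by blast
  moreover have "subsp N {0}" by (simp add: subsp_def psc_simps coord_closed)
  ultimately have "P \<subseteq> {0}" using P'(2) lin_span_least[OF smodD(1)[OF nat_smod]] by (meson order_trans)
  then show False using nz subspD(2)[OF P'(1)] by auto
qed

end

section \<open>The module \<open>T(u)\<close>\<close>

definition Em :: "4 \<Rightarrow> 4 \<Rightarrow> laurent \<Rightarrow> lmat" where
  "Em i k f = (\<chi> a b. if a = i \<and> b = k then f else 0)"

lemma Em_nth [simp]: "Em i k f $ a $ b = (if a = i \<and> b = k then f else 0)"
  by (simp add: Em_def)

lemma Em_vec: "Em i k f *v v = axis i (f * v $ k)"
proof -
  have "(if a = i \<and> b = k then f else 0) * v $ b = (if b = k then if a = i then f * v $ k else 0 else 0)" for a b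
    by simp
  then show ?thesis by (simp add: vec_eq_iff mult_vec_nth axis_def)
qed

lemma Em_transpose: "transpose (Em i k f) = Em k i f"
  by (simp add: vec_eq_iff)

lemma axis_zero: "axis k (0 :: 'a::zero) = 0"
  by (simp add: vec_eq_iff axis_def)

lemma Em_lhom: "f \<in> lhom n \<Longrightarrow> Em i k f \<in> mat_lhom n"
  by (simp add: mat_lhom_def)

lemma mat_lhom_simps: "0 \<in> mat_lhom n" "X \<in> mat_lhom n \<Longrightarrow> Y \<in> mat_lhom n \<Longrightarrow> X + Y \<in> mat_lhom n"
  "X \<in> mat_lhom n \<Longrightarrow> Y \<in> mat_lhom n \<Longrightarrow> X - Y \<in> mat_lhom n"
  by (simp_all add: mat_lhom_def)

lemma ck_params_even: "trace a = 0 \<Longrightarrow> (f, a, 0, 0) \<in> ck_params"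
  by (simp add: ck_params_def vec_eq_iff)

lemma ck_params_elementary:
  "i \<noteq> k \<Longrightarrow> (0, Em i k f, 0, 0) \<in> ck_params"
  "(0, 0, 0, Em i k f + Em k i f) \<in> ck_params" "(0, 0, Em i k f - Em k i f, 0) \<in> ck_params"
proof -
  have "trace (Em i k f) = 0" if "i \<noteq> k"
    unfolding trace_def by (rule sum.neutral) (use that in auto)
  then show "i \<noteq> k \<Longrightarrow> (0, Em i k f, 0, 0) \<in> ck_params" by (simp add: ck_params_even)
  have "transpose (Em i k f + Em k i f) = Em i k f + Em k i f" "transpose (Em i k f - Em k i f) = - (Em i k f - Em k i f)"
    by (simp_all add: transpose_simps Em_transpose add.commute)
  moreover have "trace (0 :: lmat) = 0" "transpose (0 :: lmat) = 0" by (simp_all add: trace_def transpose_simps)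
  ultimately show "(0, 0, 0, Em i k f + Em k i f) \<in> ck_params" "(0, 0, Em i k f - Em k i f, 0) \<in> ck_params"
    by (simp_all add: ck_params_def)
qed

lemma rho_Em: "rho u (ck_opu 0 0 (Em i k f) 0 0) x = (axis i (f * fst x $ k), - axis k (f * snd x $ i))"
  unfolding rho_ck_opu
  by (cases x) (simp add: ck_opu_def mv_simps Em_vec Em_transpose phi_simps mat_D_simps)

lemma rho_Sym: "rho u (ck_opu 0 0 0 0 (Em i k f + Em k i f)) x = (0, axis i (f * fst x $ k) + axis k (f * fst x $ i))"
  unfolding rho_ck_opu
  by (cases x) (simp add: ck_opu_def mv_simps Em_vec phi_simps mat_D_simps transpose_simps)

lemma rho_Skew: "fst x = 0 \<Longrightarrow>
    rho u (ck_opu 0 0 0 (Em i k f - Em k i f) 0) x = (axis i (f * snd x $ k) - axis k (f * snd x $ i), 0)"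
  unfolding rho_ck_opu
  by (cases x) (simp add: ck_opu_def mv_simps Em_vec vec_Du_simps transpose_simps)

lemma rho_diag: "rho u (ck_opu 0 f (diag_mat h) 0 0) x =
   (\<chi> i. h $ i * fst x $ i + f * vec_Du u (fst x) $ i + lconst (1/4) * lD f * fst x $ i,
    \<chi> i. - (h $ i * snd x $ i) + f * vec_Du u (snd x) $ i + lconst (3/4) * lD f * snd x $ i)"
  unfolding rho_ck_opu
  by (cases x) (simp add: ck_opu_def mv_simps diag_vec transpose_diag phi_simps mat_D_simps vec_eq_iff)

lemma ck_opu_0: "ck_opu u 0 0 0 0 = (\<lambda>v. 0)"
  by (rule ext) (rule ck_opu_zero)

lemma CK6_module: "module complex_ring CK6"
proof (rule vector_spaceI; unfold CK6_ops)
  show "(\<lambda>v. 0) \<in> carrier CK6"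
    using CK6_carrierI[of 0 0 0 0] ck_params_even[of 0 0] by (simp add: ck_opu_0 trace_def)
  fix X Y assume "X \<in> carrier CK6" "Y \<in> carrier CK6"
  then obtain f a B S g b B' S' where X: "X = ck_opu 0 f a B S" "(f, a, B, S) \<in> ck_params"
    and Y: "Y = ck_opu 0 g b B' S'" "(g, b, B', S') \<in> ck_params"
    by (elim CK6_carrierE)
  have "(\<lambda>v. X v + Y v) = ck_opu 0 (f + g) (a + b) (B + B') (S + S')" by (simp add: X Y ck_opu_add)
  then show "(\<lambda>v. X v + Y v) \<in> carrier CK6" using CK6_carrierI[OF ck_params_diff(2)[OF X(2) Y(2)]] by simp
next
  fix X c assume "X \<in> carrier CK6"
  then obtain f a B S where X: "X = ck_opu 0 f a B S" "(f, a, B, S) \<in> ck_params"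
    by (elim CK6_carrierE)
  then show "(\<lambda>v. psc (lconst c) (X v)) \<in> carrier CK6"
    using CK6_carrierI[OF ck_params_diff(3)[OF X(2)]] by (simp add: ck_opu_smult)
qed (auto simp: psc_simps lconst_simps fun_eq_iff algebra_simps)

definition ckw :: "4 \<Rightarrow> int" where "ckw i = (vector [7, 1, -3, -5] :: int ^ 4) $ i"

lemma ckw_simps [simp]: "ckw 1 = 7" "ckw 2 = 1" "ckw 3 = -3" "ckw 4 = -5"
  by (simp_all add: ckw_def vector_4_nth)

lemma ckw_sum: "(\<Sum>i\<in>UNIV. complex_of_int (ckw i)) = 0"
  by (simp add: sum_4)

lemma CK6_F_Hop: "CK6_F = Hop (\<lambda>i. of_int (ckw i))"
proof -
  have "(\<chi> i. lconst (of_int (ckw i))) = (vector [lconst 7, lconst 1, lconst (- 3), lconst (- 5)] :: lvec)"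
    by (simp add: vec_eq_iff forall_4 vector_4_nth)
  then show ?thesis by (simp add: CK6_F_def Hop_def ck_op_eq)
qed

lemma ck_opu_sum:
  assumes P: "subsp CK6 P" and i: "\<And>i. i \<in> K \<Longrightarrow> ck_opu 0 (f i) (a i) (B i) (S i) \<in> P"
  shows "ck_opu 0 (\<Sum>i\<in>K. f i) (\<Sum>i\<in>K. a i) (\<Sum>i\<in>K. B i) (\<Sum>i\<in>K. S i) \<in> P"
  using i
proof (induction K rule: infinite_finite_induct)
  case (insert x K)
  have "(\<lambda>v. ck_opu 0 (f x) (a x) (B x) (S x) v + ck_opu 0 (sum f K) (sum a K) (sum B K) (sum S K) v) \<in> P"
    using subspD(3)[OF P] insert by (simp add: CK6_ops)
  then show ?case using insert by (simp add: ck_opu_add)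
qed (use subspD(2)[OF P] in \<open>simp_all add: CK6_ops ck_opu_0\<close>)

lemma mat_sum_nth: "(\<Sum>i\<in>K. (X i :: lmat)) $ a $ b = (\<Sum>i\<in>K. X i $ a $ b)"
  by (induction K rule: infinite_finite_induct) simp_all

lemma Hop_eigenI:
  assumes w: "(\<Sum>i\<in>UNIV. complex_of_int (w i)) = 0" and p: "(f, a, B, S) \<in> ck_params"
    and e: "c \<noteq> 0 \<Longrightarrow> f = 0" "\<And>i k. w i - w k \<noteq> c \<Longrightarrow> a $ i $ k = 0" "\<And>i k. w i + w k \<noteq> c \<Longrightarrow> B $ i $ k = 0"
    "\<And>i k. - (w i + w k) \<noteq> c \<Longrightarrow> S $ i $ k = 0"
  shows "op_bracket (Hop (\<lambda>i. of_int (w i))) (ck_opu 0 f a B S) = (\<lambda>x. psc (lconst (of_int c)) (ck_opu 0 f a B S x))"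
proof -
  have A: "escale (\<lambda>i k. of_int (w i) - of_int (w k)) a = smat (lconst (of_int c)) a"
    unfolding vec_eq_iff
  proof (intro allI)
    fix i k show "escale (\<lambda>i k. of_int (w i) - of_int (w k)) a $ i $ k = smat (lconst (of_int c)) a $ i $ k"
      using e(2)[of i k] by (cases "w i - w k = c") auto
  qed
  have B: "escale (\<lambda>i k. of_int (w i) + of_int (w k)) B = smat (lconst (of_int c)) B"
    unfolding vec_eq_iff
  proof (intro allI)
    fix i k show "escale (\<lambda>i k. of_int (w i) + of_int (w k)) B $ i $ k = smat (lconst (of_int c)) B $ i $ k"
      using e(3)[of i k] by (cases "w i + w k = c") auto
  qed
  have S: "escale (\<lambda>i k. - (of_int (w i) + of_int (w k))) S = smat (lconst (of_int c)) S"
    unfolding vec_eq_iff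
  proof (intro allI)
    fix i k show "escale (\<lambda>i k. - (of_int (w i) + of_int (w k))) S $ i $ k = smat (lconst (of_int c)) S $ i $ k"
      using e(4)[of i k] by (cases "- (w i + w k) = c") auto
  qed
  have z: "lconst (of_int c) * f = 0" using e(1) by (cases "c = 0") (auto simp: lconst_simps)
  show ?thesis
    unfolding Hop_bracket[OF w p] A B S ck_opu_smult z ..
qed

text \<open>Splitting every matrix entry into monomials, and then collecting the entries of equal
  weight. The weights lie between \<open>-14\<close> and \<open>14\<close>.\<close>

lemma CK6_span: "carrier CK6 \<subseteq> lin_span CK6 (\<Union>p n k. hom_part CK6 p n \<inter> ad_eigenspace CK6 CK6_F k)"
  (is "_ \<subseteq> lin_span CK6 ?G")
proof
  fix X assume "X \<in> carrier CK6"
  then obtain f a B S where X: "X = ck_opu 0 f a B S" "(f, a, B, S) \<in> ck_params" by (elim CK6_carrierE)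
  have tr: "trace a = 0" and sk: "transpose B = - B" and sy: "transpose S = S" using X(2) by (auto simp: ck_params_def)
  have skn: "B $ k $ i = - B $ i $ k" "S $ k $ i = S $ i $ k" for i k
    using arg_cong[OF sk, of "\<lambda>m. m $ i $ k"] arg_cong[OF sy, of "\<lambda>m. m $ i $ k"] by simp_all
  define K where "K = Poly_Mapping.keys f \<union> (\<Union>i k. Poly_Mapping.keys (a $ i $ k) \<union> Poly_Mapping.keys (B $ i $ k) \<union> Poly_Mapping.keys (S $ i $ k))"
  have K: "finite K" by (simp add: K_def)
  have G: "?G \<subseteq> carrier CK6" using CK6_hom_carrier by blast
  have P: "subsp CK6 (lin_span CK6 ?G)" by (rule subsp_lin_span[OF CK6_module G])
  have c: "\<And>i k. ckw i - ckw k \<in> {-14..14}" "\<And>i k. ckw i + ckw k \<in> {-14..14}" "\<And>i k. - (ckw i + ckw k) \<in> {-14..14}"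
    by (simp_all add: forall_4[where P = "\<lambda>i. ckw i \<le> 7 \<and> ckw i \<ge> -5", simplified] atLeastAtMost_iff)
      (use forall_4[where P = "\<lambda>i. ckw i \<le> 7 \<and> ckw i \<ge> -7"] in \<open>simp, smt (verit)\<close>)+
  define pj where "pj n g = Poly_Mapping.single n (Poly_Mapping.lookup g n)" for n :: int and g :: laurent
  have pjl: "pj n g \<in> lhom n" for n g by (simp add: pj_def)
  have pjm: "pj n (- g) = - pj n g" "pj n 0 = 0" for n g by (simp_all add: pj_def single_uminus)
  have pjs: "(\<Sum>n\<in>K. pj n g) = g" if "Poly_Mapping.keys g \<subseteq> K" for g
  proof -
    have "(\<Sum>n\<in>K. pj n g) = (\<Sum>n\<in>Poly_Mapping.keys g. pj n g)"
      by (rule sum.mono_neutral_right) (use K that in \<open>auto simp: in_keys_iff pj_def\<close>)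
    then show ?thesis unfolding pj_def by (simp only: sum_of_monomials[symmetric])
  qed
  define fp where "fp n k = (if k = 0 then pj n f else 0)" for n and k :: int
  define ap where "ap n k = (\<chi> i l. if ckw i - ckw l = k then pj n (a $ i $ l) else 0)" for n k
  define Bp where "Bp n k = (\<chi> i l. if ckw i + ckw l = k then pj n (B $ i $ l) else 0)" for n k
  define Sp where "Sp n k = (\<chi> i l. if - (ckw i + ckw l) = k then pj n (S $ i $ l) else 0)" for n k
  have tra: "trace (ap n k) = 0" for n k
  proof -
    have "trace (ap n k) = (if k = 0 then pj n (trace a) else 0)"
      by (auto simp: trace_def ap_def sum_4 pj_def lookup_add single_add)
    then show ?thesis by (simp add: tr pjm)
  qed
  have par: "(fp n k, ap n k, 0, 0) \<in> ck_params" "(0, 0, Bp n k, Sp n k) \<in> ck_params" for n k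
  proof -
    show "(fp n k, ap n k, 0, 0) \<in> ck_params" by (rule ck_params_even[OF tra])
    have "transpose (Bp n k) $ i $ l = (- Bp n k) $ i $ l" "transpose (Sp n k) $ i $ l = Sp n k $ i $ l" for i l
      using skn(1)[where i = i and k = l] skn(2)[where i = i and k = l] by (simp_all add: Bp_def Sp_def pjm add.commute)
    then have "transpose (Bp n k) = - Bp n k" "transpose (Sp n k) = Sp n k"
      unfolding vec_eq_iff by blast+
    then show "(0, 0, Bp n k, Sp n k) \<in> ck_params" by (simp add: ck_params_def trace_def)
  qed
  have e: "ck_opu 0 (fp n k) (ap n k) 0 0 \<in> ?G" "ck_opu 0 0 0 (Bp n k) (Sp n k) \<in> ?G" for n k
  proof -
    have "ck_opu 0 (fp n k) (ap n k) 0 0 \<in> hom_part CK6 False n"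
      by (rule CK6_homI[OF par(1)]) (auto simp: fp_def ap_def mat_lhom_def pjl)
    moreover have "op_bracket CK6_F (ck_opu 0 (fp n k) (ap n k) 0 0) = (\<lambda>x. psc (lconst (of_int k)) (ck_opu 0 (fp n k) (ap n k) 0 0 x))"
      unfolding CK6_F_Hop by (rule Hop_eigenI[OF ckw_sum par(1)]) (auto simp: fp_def ap_def)
    ultimately show "ck_opu 0 (fp n k) (ap n k) 0 0 \<in> ?G"
      using CK6_carrierI[OF par(1)] by (auto simp: ad_eigenspace_def CK6_ops)
    have "ck_opu 0 0 0 (Bp n k) (Sp n k) \<in> hom_part CK6 True n"
      by (rule CK6_homI[OF par(2)]) (auto simp: Bp_def Sp_def mat_lhom_def pjl)
    moreover have "op_bracket CK6_F (ck_opu 0 0 0 (Bp n k) (Sp n k)) = (\<lambda>x. psc (lconst (of_int k)) (ck_opu 0 0 0 (Bp n k) (Sp n k) x))"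
      unfolding CK6_F_Hop by (rule Hop_eigenI[OF ckw_sum par(2)]) (auto simp: Bp_def Sp_def)
    ultimately show "ck_opu 0 0 0 (Bp n k) (Sp n k) \<in> ?G"
      using CK6_carrierI[OF par(2)] by (auto simp: ad_eigenspace_def CK6_ops)
  qed
  have "ck_opu 0 (fp n k) (ap n k) (Bp n k) (Sp n k) \<in> lin_span CK6 ?G" for n k
  proof -
    have "(\<lambda>v. ck_opu 0 (fp n k) (ap n k) 0 0 v + ck_opu 0 0 0 (Bp n k) (Sp n k) v) \<in> lin_span CK6 ?G"
      using subspD(3)[OF P subsetD[OF lin_span_superset[OF CK6_module] e(1)] subsetD[OF lin_span_superset[OF CK6_module] e(2)]]
      by (simp add: CK6_ops)
    then show ?thesis by (simp add: ck_opu_add)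
  qed
  then have "ck_opu 0 (\<Sum>n\<in>K. \<Sum>k\<in>{-14..14}. fp n k) (\<Sum>n\<in>K. \<Sum>k\<in>{-14..14}. ap n k) (\<Sum>n\<in>K. \<Sum>k\<in>{-14..14}. Bp n k)
     (\<Sum>n\<in>K. \<Sum>k\<in>{-14..14}. Sp n k) \<in> lin_span CK6 ?G"
    by (intro ck_opu_sum[OF P])
  moreover have "(\<Sum>n\<in>K. \<Sum>k\<in>{-14..14}. fp n k) = f"
  proof -
    have "(\<Sum>k\<in>{-14..14}. fp n k) = pj n f" for n unfolding fp_def by (subst sum.delta) simp_all
    moreover have "Poly_Mapping.keys f \<subseteq> K" by (auto simp: K_def)
    ultimately show ?thesis using pjs by simp
  qed
  moreover have "(\<Sum>n\<in>K. \<Sum>k\<in>{-14..14}. ap n k) = a"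
    unfolding vec_eq_iff mat_sum_nth
  proof (intro allI)
    fix i l
    have "(\<Sum>k\<in>{-14..14}. ap n k $ i $ l) = pj n (a $ i $ l)" for n
      unfolding ap_def using c(1)[of i l] by simp
    moreover have "Poly_Mapping.keys (a $ i $ l) \<subseteq> K" by (auto simp: K_def)
    ultimately show "(\<Sum>n\<in>K. \<Sum>k\<in>{-14..14}. ap n k $ i $ l) = a $ i $ l" using pjs by simp
  qed
  moreover have "(\<Sum>n\<in>K. \<Sum>k\<in>{-14..14}. Bp n k) = B"
    unfolding vec_eq_iff mat_sum_nth
  proof (intro allI)
    fix i l
    have "(\<Sum>k\<in>{-14..14}. Bp n k $ i $ l) = pj n (B $ i $ l)" for n
      unfolding Bp_def using c(2)[of i l] by simp
    moreover have "Poly_Mapping.keys (B $ i $ l) \<subseteq> K" by (auto simp: K_def)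
    ultimately show "(\<Sum>n\<in>K. \<Sum>k\<in>{-14..14}. Bp n k $ i $ l) = B $ i $ l" using pjs by simp
  qed
  moreover have "(\<Sum>n\<in>K. \<Sum>k\<in>{-14..14}. Sp n k) = S"
    unfolding vec_eq_iff mat_sum_nth
  proof (intro allI)
    fix i l
    have "(\<Sum>k\<in>{-14..14}. Sp n k $ i $ l) = pj n (S $ i $ l)" for n
      unfolding Sp_def using c(3)[of i l] by simp
    moreover have "Poly_Mapping.keys (S $ i $ l) \<subseteq> K" by (auto simp: K_def)
    ultimately show "(\<Sum>n\<in>K. \<Sum>k\<in>{-14..14}. Sp n k $ i $ l) = S $ i $ l" using pjs by simp
  qed
  ultimately show "X \<in> lin_span CK6 ?G" unfolding X(1) by simp
qed

lemma CK6_centralizer: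
  assumes "x \<in> centralizer CK6 CK6_F"
  obtains f h where "x = ck_op f (diag_mat h) 0 0" "(\<Sum>i\<in>UNIV. h $ i) = 0"
proof -
  obtain f a B S where X: "x = ck_opu 0 f a B S" "(f, a, B, S) \<in> ck_params"
    by (rule CK6_carrierE[of x]) (use assms in \<open>auto simp: centralizer_def\<close>)
  have e: "op_bracket (Hop (\<lambda>i. of_int (ckw i))) (ck_opu 0 f a B S) = (\<lambda>x. psc (lconst 0) (ck_opu 0 f a B S x))"
    using assms X(1) by (simp add: centralizer_def CK6_ops CK6_F_Hop lconst_simps psc_simps)
  note z = Hop_eigen[OF ckw_sum X(2) e]
  have n: "\<forall>i k. i \<noteq> k \<longrightarrow> ckw i - ckw k \<noteq> 0" "\<forall>i k. i \<noteq> k \<longrightarrow> ckw i + ckw k \<noteq> 0" "\<forall>i k. ckw i + ckw k \<noteq> 0"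
    by (simp_all add: forall_4)
  have "a $ i $ k = 0" if "i \<noteq> k" for i k
    using z(2)[of i k] n(1) that by (metis of_int_diff of_int_eq_0_iff)
  then have "a = diag_mat (\<chi> i. a $ i $ i)" by (simp add: vec_eq_iff)
  moreover have "B $ i $ k = 0" "S $ i $ k = 0" for i k
    using z(3)[of i k] z(4)[of i k] n(3) by (metis of_int_add of_int_eq_0_iff of_int_minus neg_equal_0_iff_equal)+
  then have "B = 0" "S = 0" by (simp_all add: vec_eq_iff)
  moreover have "(\<Sum>i\<in>UNIV. (\<chi> i. a $ i $ i) $ i) = 0"
    using X(2) by (simp add: ck_params_def trace_def)
  ultimately show ?thesis using that X(1) by (metis ck_op_eq)
qed


lemma laurent_module_simps [simp]:
  "carrier (laurent_module a) = UNIV" "zero (laurent_module a) = 0" "add (laurent_module a) = (+)"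
  "smult (laurent_module a) c f = lconst c * f" "hom_part (laurent_module a) p n = (if p then {0} else lhom n)"
  "action (laurent_module a) = a"
  by (simp_all add: laurent_module_def)

lemma laurent_module_vs: "module complex_ring (laurent_module a)"
  by (rule vector_spaceI) (auto simp: lconst_simps algebra_simps)

lemma laurent_module_span: "carrier (laurent_module a) \<subseteq> lin_span (laurent_module a) (\<Union>p n. hom_part (laurent_module a) p n)"
proof
  fix f assume "f \<in> carrier (laurent_module a)"
  let ?X = "\<Union>p n. hom_part (laurent_module a) p n"
  note sp = subspD[OF subsp_lin_span[OF laurent_module_vs[of a], of ?X], simplified]
  have g: "Poly_Mapping.single n c \<in> lin_span (laurent_module a) ?X" for n c
  proof -
    have "Poly_Mapping.single n c \<in> hom_part (laurent_module a) False n" by simp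
    then show ?thesis using lin_span_superset[OF laurent_module_vs, of ?X] by blast
  qed
  have "(\<Sum>k\<in>K. Poly_Mapping.single k (Poly_Mapping.lookup f k)) \<in> lin_span (laurent_module a) ?X" if "finite K" for K
    using that
  proof (induction K rule: finite_induct)
    case empty
    show ?case using g[of 0 0] by simp
  next
    case (insert k K)
    then show ?case using subspD(3)[OF subsp_lin_span[OF laurent_module_vs[of a], of ?X] g insert.IH] by simp
  qed
  from this[OF finite_keys[of f]] show "f \<in> lin_span (laurent_module a) ?X"
    by (simp only: sum_of_monomials[symmetric])
qed

lemma axis_simps: "axis k (f + g) = axis k f + axis k (g :: laurent)" "axis k (c * f) = c *s axis k f"
  "axis k f $ i = (if i = k then f else 0)"
  by (simp_all add: axis_def vec_eq_iff)

lemma axis_sum: "v = axis 1 (v $ 1) + axis 2 (v $ 2) + axis 3 (v $ 3) + axis 4 ((v :: lvec) $ 4)"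
  by (simp add: vec_eq_iff forall_4 axis_def)

lemma (in natural_module) span_axes:
  assumes G: "G \<subseteq> carrier N"
    and V: "\<And>i. fst x $ i \<noteq> 0 \<Longrightarrow> (axis i (fst x $ i), 0) \<in> G"
    and W: "\<And>i. snd x $ i \<noteq> 0 \<Longrightarrow> (0, axis i (snd x $ i)) \<in> G"
  shows "x \<in> lin_span N G"
proof -
  note vs = smodD(1)[OF nat_smod]
  note sp = subspD[OF subsp_lin_span[OF vs G], simplified]
  have z: "(0, 0) \<in> lin_span N G" using sp(2) by (simp add: zero_prod_def)
  have e: "(axis i (fst x $ i), 0) \<in> lin_span N G" for i
    using V[of i] lin_span_superset[OF vs, of G] z by (cases "fst x $ i = 0") (auto simp: axis_zero)
  have f: "(0, axis i (snd x $ i)) \<in> lin_span N G" for i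
    using W[of i] lin_span_superset[OF vs, of G] z by (cases "snd x $ i = 0") (auto simp: axis_zero)
  have "((axis 1 (fst x $ 1), 0) + (axis 2 (fst x $ 2), 0) + (axis 3 (fst x $ 3), 0) + (axis 4 (fst x $ 4), 0))
    + ((0, axis 1 (snd x $ 1)) + (0, axis 2 (snd x $ 2)) + (0, axis 3 (snd x $ 3)) + (0, axis 4 (snd x $ 4))) \<in> lin_span N G"
    by (intro sp(3) e f)
  then show ?thesis using axis_sum[of "fst x"] axis_sum[of "snd x"] by (cases x) simp
qed

lemma CK6_bracket_closed:
  assumes "X \<in> carrier CK6" "Y \<in> carrier CK6" shows "bracket CK6 X Y \<in> carrier CK6"
proof -
  obtain f a B S where X: "X = ck_opu 0 f a B S" "(f, a, B, S) \<in> ck_params" by (rule CK6_carrierE[OF assms(1)])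
  obtain g b B' S' where Y: "Y = ck_opu 0 g b B' S'" "(g, b, B', S') \<in> ck_params" by (rule CK6_carrierE[OF assms(2)])
  show ?thesis unfolding CK6_ops X(1) Y(1) ck_bracket[OF X(2) Y(2)] by (rule CK6_carrierI[OF ck_bracket_params[OF X(2) Y(2)]])
qed

lemma CK6_natural: "natural_module CK6 id u UNIV UNIV"
proof (rule natural_module.intro[OF CK6_module CK6_hom_carrier])
  show "lie_superalgebra_embedding CK6 CK6 id" by (simp add: lie_superalgebra_embedding_def)
qed (simp add: coord_def)

abbreviation "Tnat u \<equiv> natmod id u UNIV UNIV False"

lemma lookup_mult_numeral: "Poly_Mapping.lookup ((f :: laurent) * numeral k) n = numeral k * Poly_Mapping.lookup f n"
  by (simp add: mult.commute[of f] lookup_numeral_mult)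

lemma half_half: "lconst (1/2) * g + lconst (1/2) * g = g"
proof -
  have "lconst (1/2) * g + lconst (1/2) * g = lconst (1/2 + 1/2) * g"
    by (simp only: lconst_simps(1) distrib_right)
  then show ?thesis by (simp add: lconst_simps)
qed

lemma lconst_inverse_single:
  fixes g :: laurent
  assumes "c \<noteq> 0" shows "g * Poly_Mapping.single (- n) (1 / c) * Poly_Mapping.single n c = g"
proof -
  have "Poly_Mapping.single (- n) (1 / c) * Poly_Mapping.single n c = 1"
    using assms by (simp add: mult_single)
  then show ?thesis by (simp add: mult.assoc)
qed

text \<open>From a nonzero homogeneous vector, elementary and diagonal matrices and elementary skew
  matrices produce every Laurent polynomial multiple of \<open>x_1\<close>, because nonzero homogeneous
  Laurent polynomials are units; from there everything is reached.\<close>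

lemma Tnat_simple: "simple_smodule CK6 (Tnat u)"
proof -
  interpret natural_module CK6 id u UNIV UNIV False by (rule CK6_natural)
  have full: "P = UNIV" if P: "graded_submodule CK6 (Tnat u) P" and nz: "P \<noteq> {0}" for P
  proof -
    have P': "subsp (Tnat u) P" "\<And>x v. x \<in> carrier CK6 \<Longrightarrow> v \<in> P \<Longrightarrow> rho u x v \<in> P"
      using P by (simp_all add: graded_submodule_iff[OF nat_smod])
    note sP = subspD[OF P'(1), simplified]
    have Emc: "ck_opu 0 0 (Em i k f) 0 0 \<in> carrier CK6" if "i \<noteq> k" for i k f
      by (rule CK6_carrierI) (rule ck_params_elementary(1)[OF that])
    have Sc: "ck_opu 0 0 0 0 (Em i k f + Em k i f) \<in> carrier CK6" for i k f
      by (rule CK6_carrierI) (rule ck_params_elementary(2))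
    have Bc: "ck_opu 0 0 0 (Em i k f - Em k i f) 0 \<in> carrier CK6" for i k f
      by (rule CK6_carrierI) (rule ck_params_elementary(3))
    have even: "(axis 1 g, 0) \<in> P" if y: "y \<in> P" "snd y = 0" "\<And>i. fst y $ i \<in> lhom n" "fst y \<noteq> 0" for y n g
    proof (cases "\<exists>i. i \<noteq> 1 \<and> fst y $ i \<noteq> 0")
      case True
      then obtain i where i: "i \<noteq> 1" "fst y $ i \<noteq> 0" by blast
      obtain c where c: "fst y $ i = Poly_Mapping.single n c" using y(3)[of i] lhom_single by metis
      have "rho u (ck_opu 0 0 (Em 1 i (g * Poly_Mapping.single (- n) (1 / c))) 0 0) y \<in> P"
        by (rule P'(2)[OF Emc y(1)]) (use i in simp)
      moreover have "c \<noteq> 0" using i(2) c by auto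
      ultimately show ?thesis
        by (simp add: rho_Em y(2) c lconst_inverse_single axis_zero)
    next
      case False
      have z: "fst y $ 2 = 0" "fst y $ 3 = 0" "fst y $ 4 = 0" using False by force+
      then have nz1: "fst y $ 1 \<noteq> 0" using y(4) by (auto simp: vec_eq_iff forall_4)
      obtain c where c: "fst y $ 1 = Poly_Mapping.single n c" using y(3)[of 1] lhom_single by metis
      define g' where "g' = g * Poly_Mapping.single (- n) (1 / c)"
      have "c \<noteq> 0" using nz1 c by auto
      then have g': "g' * Poly_Mapping.single n c = g" unfolding g'_def by (rule lconst_inverse_single)
      have "rho u (ck_opu 0 0 (diag_mat (vector [g', - g', 0, 0])) 0 0) y \<in> P"
        by (rule P'(2)[OF CK6_carrierI y(1)]) (simp add: ck_params_even trace_def sum_4 vector_4_nth)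
      moreover have "rho u (ck_opu 0 0 (diag_mat (vector [g', - g', 0, 0])) 0 0) y = (axis 1 g, 0)"
        by (simp add: rho_diag vec_eq_iff forall_4 vector_4_nth z c axis_simps y(2) g')
      ultimately show ?thesis by simp
    qed
    obtain p n x where x: "x \<in> P" "x \<in> hom_part (Tnat u) p n" "x \<noteq> 0" by (rule nonzero_homogeneous[OF P nz])
    have one: "(axis 1 g, 0) \<in> P" for g
    proof (cases p)
      case False
      then show ?thesis using x even[of x n] by (auto simp: nat_hom_def prod_eq_iff)
    next
      case True
      then have x0: "fst x = 0" "\<And>i. snd x $ i \<in> lhom n" "snd x \<noteq> 0" using x by (auto simp: nat_hom_def prod_eq_iff)
      then obtain k where k: "snd x $ k \<noteq> 0" by (auto simp: vec_eq_iff)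
      define i :: 4 where "i = (if k = 1 then 2 else 1)"
      have i: "i \<noteq> k" by (simp add: i_def)
      let ?y = "rho u (ck_opu 0 0 0 (Em i k 1 - Em k i 1) 0) x"
      have y: "?y = (axis i (snd x $ k) - axis k (snd x $ i), 0)" using rho_Skew[OF x0(1), of u i k 1] by simp
      have "?y \<in> P" by (rule P'(2)[OF Bc x(1)])
      moreover have "fst ?y $ i \<noteq> 0" using i k by (simp add: y axis_simps)
      then have "fst ?y \<noteq> 0" by auto
      moreover have "fst ?y $ l \<in> lhom n" for l using x0(2) by (simp add: y axis_simps)
      ultimately show ?thesis using even[of ?y n g] by (simp add: y)
    qed
    have V: "(axis i g, 0) \<in> P" for i g
    proof (cases "i = 1")
      case False
      have "rho u (ck_opu 0 0 (Em i 1 g) 0 0) (axis 1 1, 0) \<in> P" by (rule P'(2)[OF Emc[OF False] one])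
      then show ?thesis by (simp add: rho_Em axis_simps axis_zero)
    qed (use one in simp)
    have W: "(0, axis i g) \<in> P" for i g
    proof -
      have "rho u (ck_opu 0 0 0 0 (Em i 1 g + Em 1 i g)) (axis 1 1, 0) \<in> P" by (rule P'(2)[OF Sc one])
      then have a: "(0, axis i (g * axis (1 :: 4) 1 $ 1) + axis 1 (g * axis (1 :: 4) 1 $ i)) \<in> P" by (simp only: rho_Sym fst_conv)
      show ?thesis
      proof (cases "i = 1")
        case True
        have "psc (lconst (1/2)) (0, axis i (g * axis (1 :: 4) 1 $ 1) + axis 1 (g * axis (1 :: 4) 1 $ i)) \<in> P" by (rule sP(4)[OF a])
        moreover have "lconst (1/2) * g + lconst (1/2) * g = g" by (rule half_half)
        then have "psc (lconst (1/2)) (0, axis i (g * axis (1 :: 4) 1 $ 1) + axis 1 (g * axis (1 :: 4) 1 $ i)) = (0, axis i g)"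
          using True by (simp add: psc_def vec_eq_iff axis_simps(3) distrib_left[symmetric] del: distrib_left_numeral)
        ultimately show ?thesis by simp
      next
        case False
        then have "axis (1 :: 4) 1 $ i = (0 :: laurent)" "axis (1 :: 4) 1 $ 1 = (1 :: laurent)" by (simp_all add: axis_simps(3))
        then show ?thesis using a by (simp add: axis_zero)
      qed
    qed
    have "(v, 0) \<in> P" "(0, v) \<in> P" for v
    proof -
      have "(axis 1 (v $ 1), 0) + (axis 2 (v $ 2), 0) + (axis 3 (v $ 3), 0) + (axis 4 (v $ 4), 0) \<in> P"
        "(0, axis 1 (v $ 1)) + (0, axis 2 (v $ 2)) + (0, axis 3 (v $ 3)) + (0, axis 4 (v $ 4)) \<in> P"
        by (intro sP(3) V W)+
      then show "(v, 0) \<in> P" "(0, v) \<in> P" using axis_sum[of v] by simp_all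
    qed
    then have "(v, 0) + (0, w) \<in> P" for v w by (intro sP(3))
    then show ?thesis by auto
  qed
  have "(axis 1 1, 0) \<noteq> (0 :: lvec \<times> lvec)" by (simp add: zero_prod_def vec_eq_iff axis_def)
  then have "coord UNIV UNIV \<noteq> {0}" by (auto simp: coord_def)
  then show ?thesis using full by (auto simp: simple_smodule_def coord_def)
qed


lemma axis_inj: "axis k f = axis k g \<longleftrightarrow> f = (g :: laurent)"
  by (metis axis_simps(3))

lemma vec_Du_axis: "vec_Du u (axis k f) = axis k (lD f + lconst u * f)"
  by (simp add: vec_eq_iff vec_Du_def axis_simps)

lemma vir_density_alt: "vir_density \<delta> u f g = f * (lD g + lconst u * g) + lconst \<delta> * lD f * g"
  by (simp add: vir_density_def algebra_simps)

section \<open>Highest weight models inside the natural module\<close>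

text \<open>For a diagonal \<open>F\<close> the weights of the natural module are the entries of
  \<open>F\<close> on $V$ and their negatives on $V^*$.\<close>

lemma (in natural_module) weight_settingI:
  fixes w :: "4 \<Rightarrow> int"
  assumes F: "F \<in> hom_part L False 0" "\<kappa> F = Hop (\<lambda>i. of_int (w i))" "bracket L F F = \<zero>\<^bsub>L\<^esub>" "bracket L F \<zero>\<^bsub>L\<^esub> = \<zero>\<^bsub>L\<^esub>"
    and span: "carrier L \<subseteq> lin_span L (\<Union>p n k. hom_part L p n \<inter> ad_eigenspace L F k)"
    and br: "\<And>x y. x \<in> carrier L \<Longrightarrow> y \<in> carrier L \<Longrightarrow> bracket L x y \<in> carrier L"
    and top: "\<And>i. w i \<le> d" "\<And>i. - w i \<le> d"
    and M: "module complex_ring M" "\<And>p n. hom_part M p n \<subseteq> carrier M"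
    and j: "\<And>v v'. v \<in> carrier M \<Longrightarrow> v' \<in> carrier M \<Longrightarrow> j (v \<oplus>\<^bsub>M\<^esub> v') = j v + j v'"
      "\<And>c v. v \<in> carrier M \<Longrightarrow> j (c \<odot>\<^bsub>M\<^esub> v) = psc (lconst c) (j v)"
      "\<And>v. v \<in> carrier M \<Longrightarrow> j v \<in> coord A A'" "inj_on j (carrier M)"
      "\<And>p n v. v \<in> hom_part M p n \<Longrightarrow> j v \<in> nat_hom s p n"
    and jw: "\<And>v i. v \<in> carrier M \<Longrightarrow> fst (j v) $ i \<noteq> 0 \<Longrightarrow> w i = d" "\<And>v i. v \<in> carrier M \<Longrightarrow> snd (j v) $ i \<noteq> 0 \<Longrightarrow> - w i = d"
  shows "weight_setting L F M N j d"
proof (rule weight_setting.intro)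
  show "bracket L x y \<in> carrier L" if "x \<in> hom_part L p m" "y \<in> hom_part L q n" for x y p q m n
    using br that L_hom by blast
  show "v = 0" if v: "action N F v = of_int (d + k) \<odot>\<^bsub>N\<^esub> v" "k \<ge> 1" for v k
  proof -
    have e: "rho u (Hop (\<lambda>i. of_int (w i))) v = psc (lconst (of_int (d + k))) v"
      using v(1) by (simp add: F(2))
    have "w i \<noteq> d + k \<and> - w i \<noteq> d + k" for i using v(2) top[of i] by linarith
    then have "complex_of_int (w i) \<noteq> of_int (d + k)" "- complex_of_int (w i) \<noteq> of_int (d + k)" for i
      by (metis of_int_eq_iff of_int_minus)+
    then show ?thesis using rho_Hop_eigen[OF e] by (simp add: prod_eq_iff vec_eq_iff)
  qed
  show "action N F (j v) = of_int d \<odot>\<^bsub>N\<^esub> j v" if v: "v \<in> carrier M" for v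
  proof -
    have "lconst (of_int (w i)) * fst (j v) $ i = lconst (of_int d) * fst (j v) $ i" for i
      using jw(1)[OF v, of i] by (cases "fst (j v) $ i = 0") auto
    moreover have "- lconst (of_int (w i)) * snd (j v) $ i = lconst (of_int d) * snd (j v) $ i" for i
      using jw(2)[OF v, of i] by (cases "snd (j v) $ i = 0") (auto simp: lconst_simps(3)[symmetric])
    ultimately show ?thesis by (simp add: F(2) rho_Hop psc_def vec_eq_iff)
  qed
  show "j v \<in> hom_part N p n" if "v \<in> hom_part M p n" for v p n
    using j(3)[OF subsetD[OF M(2) that]] j(5)[OF that] by simp
  show "action N x w \<in> hom_part N (p \<noteq> q) (n + m)" if "x \<in> hom_part L q m" "w \<in> hom_part N p n" for x w p q m n
    by (rule nat_act_hom[OF that])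
  show "action N x (action N y w) = (if p \<and> q then -1 else 1) \<odot>\<^bsub>N\<^esub> action N y (action N x w) + action N (bracket L x y) w"
    if "x \<in> hom_part L p m" "y \<in> hom_part L q n" "w \<in> carrier N" for x y w p q m n
    by (rule nat_comm[OF that])
  show "action N F (action N x w) = action N x (action N F w) + action N (bracket L F x) w"
    if "x \<in> carrier L" "w \<in> carrier N" for x w
    by (rule nat_even[OF F(1) that])
  show "action N (x \<oplus>\<^bsub>L\<^esub> y) w = action N x w + action N y w" if "x \<in> carrier L" "y \<in> carrier L" "w \<in> carrier N" for x y w
    by (rule nat_act_add[OF that])
  show "action N (c \<odot>\<^bsub>L\<^esub> x) w = c \<odot>\<^bsub>N\<^esub> action N x w" if "x \<in> carrier L" "w \<in> carrier N" for x w c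
    by (rule nat_act_smult[OF that])
qed (use L_module L_hom F(1,3,4) span M j(1,2,3,4) nat_smod nat_hom_subsp in \<open>simp_all\<close>)

text \<open>The actions on \<open>Tens\<close> are given by definite descriptions. An injective
  homomorphism into a module shows that the described value is unique; in particular it is independent of
  the decomposition into centralizer and positive part.\<close>

lemma the_action:
  assumes "\<And>r. Q r \<Longrightarrow> j r = z" "Q r" "inj j"
  shows "j (THE r. Q r) = z"
proof -
  have "r' = r" if "Q r'" for r' using assms that by (metis injD)
  then have "(THE r. Q r) = r" using assms(2) by (intro the_equality)
  then show ?thesis using assms(1,2) by simp
qed

text \<open>On \<open>x_1\<close> the diagonal matrix \<open>h\<close> acts by its first entry, and
  \<open>h\<^sub>1 = (1/2)((h\<^sub>1 + h\<^sub>4) + (h\<^sub>1 + h\<^sub>3) + (h\<^sub>1 +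
  h\<^sub>2))\<close> because the trace vanishes.\<close>

lemma T_natural: "smodule_isomorphic CK6 (T_CK6 u) (Tnat u)"
proof -
  interpret nm: natural_module CK6 id u UNIV UNIV False by (rule CK6_natural)
  define M where "M = laurent_module (CK6_tens_action (1/2) (1/2) (1/2) (1/4) u)"
  define j where "j f = (axis 1 f :: lvec, 0 :: lvec)" for f
  have Fp: "(0, diag_mat (\<chi> i. lconst (of_int (ckw i))), 0, 0) \<in> ck_params"
    by (rule Hop_params[OF ckw_sum])
  have ps0: "psc (lconst 0) x = 0" for x by (simp add: lconst_simps psc_simps)
  have setting: "weight_setting CK6 CK6_F M (Tnat u) j 7"
  proof (rule nm.weight_settingI[where w = ckw])
    show "CK6_F \<in> hom_part CK6 False 0"
      unfolding CK6_F_Hop Hop_def by (rule CK6_homI[OF Fp]) (auto simp: mat_lhom_def)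
    have "op_bracket CK6_F CK6_F = (\<lambda>x. psc (lconst (of_int 0)) (CK6_F x))"
      unfolding CK6_F_Hop Hop_def[of "\<lambda>i. of_int (ckw i)"]
      by (rule Hop_eigenI[OF ckw_sum Fp, unfolded Hop_def]) auto
    then show "bracket CK6 CK6_F CK6_F = \<zero>\<^bsub>CK6\<^esub>" by (simp add: CK6_ops ps0)
    have "op_bracket CK6_F (ck_opu 0 0 0 0 0) = (\<lambda>x. psc (lconst (of_int 0)) (ck_opu 0 0 0 0 0 x))"
      unfolding CK6_F_Hop by (rule Hop_eigenI[OF ckw_sum ck_params_even]) (auto simp: trace_def)
    then show "bracket CK6 CK6_F \<zero>\<^bsub>CK6\<^esub> = \<zero>\<^bsub>CK6\<^esub>" by (simp add: CK6_ops ps0 ck_opu_0)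
    show "id CK6_F = Hop (\<lambda>i. of_int (ckw i))" by (simp add: CK6_F_Hop)
    show "carrier CK6 \<subseteq> lin_span CK6 (\<Union>p n k. hom_part CK6 p n \<inter> ad_eigenspace CK6 CK6_F k)"
      by (rule CK6_span)
    show "ckw i \<le> 7" "- ckw i \<le> 7" for i
      using forall_4[of "\<lambda>i. ckw i \<le> 7 \<and> - ckw i \<le> 7"] by simp_all
    show "module complex_ring M" unfolding M_def by (rule laurent_module_vs)
    show "inj_on j (carrier M)" by (auto simp: inj_on_def j_def axis_inj)
    show "j v \<in> nat_hom False p n" if "v \<in> hom_part M p n" for v p n
      using that by (auto simp: M_def j_def nat_hom_def axis_simps axis_zero split: if_splits)
  qed (auto simp: M_def j_def psc_def axis_simps coord_def CK6_bracket_closed split: if_splits)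
  interpret W: weight_setting CK6 CK6_F M "Tnat u" j 7 by (rule setting)
  let ?B = "centralizer CK6 CK6_F <+>\<^bsub>CK6\<^esub> pos_part CK6 CK6_F"
  define fm where "fm f h v = vir_density (1/4) u f v
         + (lconst (1/2) * (h $ 1 + h $ 4) + lconst (1/2) * (h $ 1 + h $ 3)
            + lconst (1/2) * (h $ 1 + h $ 2)) * v" for f v and h :: lvec
  have diag: "rho u (ck_op f (diag_mat h) 0 0) (j v) = j (fm f h v)" if h: "(\<Sum>i\<in>UNIV. h $ i) = 0" for f h v
  proof -
    have h4: "h $ 4 = - h $ 1 - h $ 2 - h $ 3"
      using h by (simp add: sum_4 algebra_simps eq_neg_iff_add_eq_0)
    have "lconst (1/2) * (h $ 1 + h $ 4) + lconst (1/2) * (h $ 1 + h $ 3) + lconst (1/2) * (h $ 1 + h $ 2) = h $ 1"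
      unfolding h4 lconst_cs by (rule poly_mapping_eqI) (simp add: cs_simps coeff_simps lookup_mult_numeral field_simps)
    then show ?thesis
      by (simp add: ck_op_eq rho_diag j_def fm_def vir_density_alt vec_Du_axis vec_Du_simps vec_eq_iff axis_simps algebra_simps)
  qed
  have hc: "ck_op f (diag_mat h) 0 0 \<in> carrier CK6" if "(\<Sum>i\<in>UNIV. h $ i) = 0" for f h
    unfolding ck_op_eq by (rule CK6_carrierI[OF ck_params_even]) (use that in \<open>simp add: trace_def\<close>)
  have act: "j (action M x v) = rho u x (j v)" if x: "x \<in> ?B" for x v
  proof -
    define Q where "Q r \<longleftrightarrow> (\<exists>f h. \<exists>y\<in>pos_part CK6 CK6_F. (\<Sum>i\<in>UNIV. h $ i) = 0 \<and>
       x = ck_op f (diag_mat h) 0 0 \<oplus>\<^bsub>CK6\<^esub> y \<and> r = fm f h v)" for r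
    have Q: "j r = rho u x (j v)" if "Q r" for r
    proof -
      from that obtain f h y where y: "y \<in> pos_part CK6 CK6_F" "(\<Sum>i\<in>UNIV. h $ i) = 0"
        "x = ck_op f (diag_mat h) 0 0 \<oplus>\<^bsub>CK6\<^esub> y" "r = fm f h v" by (auto simp: Q_def)
      have "rho u x (j v) = rho u (ck_op f (diag_mat h) 0 0) (j v) + rho u y (j v)"
        unfolding y(3) CK6_ops by (rule rho_add)
      then show ?thesis using W.pos_part_annihilates[OF y(1), of v] diag[OF y(2)] y(4) by (simp add: M_def)
    qed
    obtain c y where c: "c \<in> centralizer CK6 CK6_F" "y \<in> pos_part CK6 CK6_F" "x = c \<oplus>\<^bsub>CK6\<^esub> y"
      using x by (auto simp: set_add_def')
    obtain f h where "c = ck_op f (diag_mat h) 0 0" "(\<Sum>i\<in>UNIV. h $ i) = 0" by (rule CK6_centralizer[OF c(1)])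
    then have Q0: "Q (fm f h v)" unfolding Q_def using c by blast
    moreover have "r = fm f h v" if "Q r" for r
      using trans[OF Q[OF that] Q[OF Q0, symmetric]] by (simp add: j_def axis_inj)
    ultimately have "Q (THE r. Q r)" by (rule theI)
    then have "j (THE r. Q r) = rho u x (j v)" by (rule Q)
    then show ?thesis by (simp add: M_def CK6_tens_action_def Q_def fm_def)
  qed
  have "highest_weight_model CK6 CK6_F M (Tnat u) j 7 (nat_pr False) 1"
  proof (rule highest_weight_model.intro[OF setting], rule highest_weight_model_axioms.intro)
    show "carrier M \<subseteq> lin_span M (\<Union>p n. hom_part M p n)" unfolding M_def by (rule laurent_module_span)
    show "\<exists>b\<in>?B. v = action M b 1" for v
    proof
      \<comment> \<open>a traceless diagonal matrix with first entry \<open>v\<close> takes \<open>x_1\<close> to \<open>v x_1\<close>\<close>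
      let ?h = "vector [v, - v, 0, 0] :: lvec"
      have s: "(\<Sum>i\<in>UNIV. ?h $ i) = 0" by (simp add: sum_4 vector_4_nth)
      have p: "(0, diag_mat ?h, 0, 0) \<in> ck_params" by (rule ck_params_even) (simp add: trace_def s)
      have "op_bracket CK6_F (ck_opu 0 0 (diag_mat ?h) 0 0) = (\<lambda>x. psc (lconst (of_int 0)) (ck_opu 0 0 (diag_mat ?h) 0 0 x))"
        unfolding CK6_F_Hop by (rule Hop_eigenI[OF ckw_sum p]) auto
      then have "ck_op 0 (diag_mat ?h) 0 0 \<in> centralizer CK6 CK6_F"
        using hc[OF s] by (simp add: centralizer_def CK6_ops ps0 ck_op_eq)
      moreover have "\<zero>\<^bsub>CK6\<^esub> \<in> pos_part CK6 CK6_F" by (rule subspD(2)[OF W.subsp_pos_part])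
      ultimately have "ck_op 0 (diag_mat ?h) 0 0 \<oplus>\<^bsub>CK6\<^esub> \<zero>\<^bsub>CK6\<^esub> \<in> ?B" by (auto simp: set_add_def')
      then show b: "ck_op 0 (diag_mat ?h) 0 0 \<in> ?B" using W.L_facts(11)[OF hc[OF s]] by simp
      have "j (action M (ck_op 0 (diag_mat ?h) 0 0) 1) = j v"
        unfolding act[OF b] by (simp add: j_def ck_op_eq rho_diag vec_eq_iff axis_simps vector_4_nth)
      then show "v = action M (ck_op 0 (diag_mat ?h) 0 0) 1" by (simp add: j_def axis_inj)
    qed
    show "simple_smodule CK6 (Tnat u)" by (rule Tnat_simple)
    show "carrier (Tnat u) \<subseteq> lin_span (Tnat u) (\<Union>p n. hom_part (Tnat u) p n)" by (rule nm.nat_span)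
    show "hom_part (Tnat u) p n \<subseteq> lin_span (Tnat u) (j ` hom_part M p n \<union>
      {action (Tnat u) x (j v) |x v q m. x \<in> hom_part CK6 q m \<and> v \<in> hom_part M (p \<noteq> q) (n - m)})" (is "_ \<subseteq> lin_span _ ?G") for p n
    proof
      fix x assume x: "x \<in> hom_part (Tnat u) p n"
      have Gc: "?G \<subseteq> carrier (Tnat u)" by (auto simp: coord_def)
      have l: "fst x $ i \<in> lhom n" "snd x $ i \<in> lhom n" for i using x by (auto simp: nat_hom_def)
      show "x \<in> lin_span (Tnat u) ?G"
      proof (cases p)
        case False
        then have x0: "snd x = 0" using x by (auto simp: nat_hom_def)
        have e: "(axis i (fst x $ i), 0) \<in> ?G" for i
        proof (cases "i = 1")
          case True
          have "(axis i (fst x $ i), 0) = j (fst x $ i)" using True by (simp add: j_def)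
          then show ?thesis using False l(1)[of i] by (simp add: M_def)
        next
          case i: False
          have h: "ck_opu 0 0 (Em i 1 1) 0 0 \<in> hom_part CK6 False 0"
            by (rule CK6_homI[OF ck_params_elementary(1)[OF i]]) (use lhom_simps(8)[of 1] in \<open>auto simp: mat_lhom_def lconst_simps\<close>)
          have "(axis i (fst x $ i), 0) = action (Tnat u) (ck_opu 0 0 (Em i 1 1) 0 0) (j (fst x $ i))"
            by (simp add: j_def rho_Em axis_simps axis_zero)
          moreover have "fst x $ i \<in> hom_part M (p \<noteq> False) (n - 0)" using False l(1) by (simp add: M_def)
          ultimately show ?thesis using h by blast
        qed
        show ?thesis by (rule nm.span_axes[OF Gc]) (rule e, simp add: x0)
      next
        case True
        then have x0: "fst x = 0" using x by (auto simp: nat_hom_def)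
        have e: "(0, axis i (snd x $ i)) \<in> ?G" for i
        proof -
          \<comment> \<open>for \<open>i = 1\<close> the symmetrized elementary matrix is twice a diagonal one\<close>
          define c where "c = (if i = 1 then 1/2 else 1 :: complex)"
          have c: "c + (if i = 1 then c else 0) = 1" by (simp add: c_def)
          have "Em i 1 (lconst c) + Em 1 i (lconst c) \<in> mat_lhom 0" by (intro mat_lhom_simps(2) Em_lhom lhom_simps(8))
          then have h: "ck_opu 0 0 0 0 (Em i 1 (lconst c) + Em 1 i (lconst c)) \<in> hom_part CK6 True 0"
            by (intro CK6_homI[OF ck_params_elementary(2)]) (auto simp: mat_lhom_def)
          have "action (Tnat u) (ck_opu 0 0 0 0 (Em i 1 (lconst c) + Em 1 i (lconst c))) (j (snd x $ i)) =
             (0, axis i (lconst (c + (if i = 1 then c else 0)) * snd x $ i))"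
            by (auto simp: j_def rho_Sym axis_simps axis_zero lconst_simps vec_eq_iff algebra_simps)
          also have "\<dots> = (0, axis i (snd x $ i))" unfolding c by (simp add: lconst_simps)
          finally have "(0, axis i (snd x $ i)) = action (Tnat u) (ck_opu 0 0 0 0 (Em i 1 (lconst c) + Em 1 i (lconst c))) (j (snd x $ i))" ..
          moreover have "snd x $ i \<in> hom_part M (p \<noteq> True) (n - 0)" using True l(2) by (simp add: M_def)
          ultimately show ?thesis using h by blast
        qed
        show ?thesis by (rule nm.span_axes[OF Gc]) (simp add: x0, rule e)
      qed
    qed
  qed (use act nat_pr_same nat_pr_other nat_pr_add in \<open>auto simp: M_def\<close>)
  then interpret H: highest_weight_model CK6 CK6_F M "Tnat u" j 7 "nat_pr False" 1 .
  show ?thesis using H.highest_quotient_isomorphic by (simp add: T_CK6_def CK6_V_def M_def)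
qed

section \<open>Contact brackets in coordinates\<close>

text \<open>The signs of \<open>gmul\<close> and of the two derivations.\<close>

definition sg :: "nat set \<Rightarrow> nat set \<Rightarrow> complex" where
  "sg S T = (-1) ^ card {(i, j). i \<in> S \<and> j \<in> T \<and> j < i}"
definition lts :: "nat \<Rightarrow> nat set \<Rightarrow> complex" where "lts i T = (-1) ^ card {j \<in> T. j < i}"
definition gts :: "nat \<Rightarrow> nat set \<Rightarrow> complex" where "gts i T = (-1) ^ card {j \<in> T. i < j}"

lemma gmul_single:
  assumes "a \<noteq> 0" "b \<noteq> 0"
  shows "gmul (Poly_Mapping.single S a) (Poly_Mapping.single T b) =
    (if S \<inter> T = {} then Poly_Mapping.single (S \<union> T) (sg S T * a * b) else 0)"
  using assms by (simp add: gmul_def sg_def)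

lemma gderiv_right_gmon: "gderiv_right i (gmon S) = (if i \<in> S then Poly_Mapping.single (S - {i}) (gts i S) else 0)"
  by (simp add: gderiv_right_def gmon_def gts_def)

lemma gderiv_left_gmon: "gderiv_left i (gmon S) = (if i \<in> S then Poly_Mapping.single (S - {i}) (lts i S) else 0)"
  by (simp add: gderiv_left_def gmon_def lts_def)

lemma signs_nonzero [simp]: "sg S T \<noteq> 0" "lts i T \<noteq> 0" "gts i T \<noteq> 0"
  by (simp_all add: sg_def lts_def gts_def)

lemma gmul_zero [simp]: "gmul 0 a = 0" "gmul a 0 = 0"
  by (simp_all add: gmul_def)

lemma gmul_gmon: "gmul (gmon S) (gmon T) = (if S \<inter> T = {} then Poly_Mapping.single (S \<union> T) (sg S T) else 0)"
  by (simp add: gmon_def gmul_single)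

lemma poisson_gmon: "poisson N (gmon S) (gmon T) = (\<Sum>i<N. \<Sum>j<N. scale_pm (gen_bracket N i j)
    (if i \<in> S \<and> j \<in> T \<and> (S - {i}) \<inter> (T - {j}) = {}
     then Poly_Mapping.single (S - {i} \<union> (T - {j})) (sg (S - {i}) (T - {j}) * gts i S * lts j T) else 0))"
  unfolding poisson_def by (intro sum.cong refl) (auto simp: gderiv_right_gmon gderiv_left_gmon gmul_single)

lemma lookup_gtens: "Poly_Mapping.lookup (gtens a f) U = lconst (Poly_Mapping.lookup a U) * f"
  by (simp add: gtens_def Poly_Mapping.map.rep_eq when_def lconst_simps)

lemma split_disjoint: "S \<inter> T = {} \<and> S \<union> T = U \<longleftrightarrow> S \<subseteq> U \<and> T = U - S"
  by auto

text \<open>The contributions to the coefficient of \<open>S \<union> T\<close> of the first part of the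
  contact bracket (\<open>kterm\<close>) and of its Poisson part (\<open>pterm\<close>), for disjoint
  \<open>S\<close> and \<open>T\<close>. In the second one the generators \<open>i\<close> and
  \<open>j\<close> are contracted.\<close>

definition kterm :: "laurent grass \<Rightarrow> laurent grass \<Rightarrow> nat set \<Rightarrow> nat set \<Rightarrow> laurent" where
  "kterm x y S T = lconst (sg S T) *
     (lconst ((2 - of_nat (card S)) / 2) * (Poly_Mapping.lookup x S * lD (Poly_Mapping.lookup y T))
      - lconst ((2 - of_nat (card T)) / 2) * (Poly_Mapping.lookup y T * lD (Poly_Mapping.lookup x S)))"

definition pterm :: "laurent grass \<Rightarrow> laurent grass \<Rightarrow> nat \<Rightarrow> nat \<Rightarrow> nat set \<Rightarrow> nat set \<Rightarrow> laurent" where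
  "pterm x y i j S T = (if i \<notin> S \<and> j \<notin> T then
     lconst (sg S T * gts i (insert i S) * lts j (insert j T)) *
       (Poly_Mapping.lookup x (insert i S) * Poly_Mapping.lookup y (insert j T)) else 0)"

lemma sum_pairs_extend:
  assumes "x \<in> K_carrier N" "y \<in> K_carrier N"
    and z: "\<And>S T. Poly_Mapping.lookup x S = 0 \<or> Poly_Mapping.lookup y T = 0 \<Longrightarrow> t S T = 0"
  shows "(\<Sum>S\<in>Poly_Mapping.keys x. \<Sum>T\<in>Poly_Mapping.keys y. t S T) = (\<Sum>S\<in>Pow {..<N}. \<Sum>T\<in>Pow {..<N}. t S T)"
proof -
  have "(\<Sum>S\<in>Poly_Mapping.keys x. \<Sum>T\<in>Poly_Mapping.keys y. t S T) = (\<Sum>S\<in>Poly_Mapping.keys x. \<Sum>T\<in>Pow {..<N}. t S T)"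
    by (rule sum.cong[OF refl], rule sum.mono_neutral_left)
      (use assms(2) z in \<open>auto simp: K_carrier_def in_keys_iff\<close>)
  also have "\<dots> = (\<Sum>S\<in>Pow {..<N}. \<Sum>T\<in>Pow {..<N}. t S T)"
    by (rule sum.mono_neutral_left) (use assms(1) z in \<open>auto simp: K_carrier_def in_keys_iff\<close>)
  finally show ?thesis .
qed

text \<open>Only complementary subsets of \<open>U\<close> contribute to the coefficient of
  \<open>U\<close>.\<close>

lemma sum_split:
  fixes N :: nat
  assumes U: "U \<subseteq> {..<N}"
  shows "(\<Sum>S\<in>Pow {..<N}. \<Sum>T\<in>Pow {..<N}. if S \<inter> T = {} \<and> S \<union> T = U then g S T else 0) = (\<Sum>S\<in>Pow U. g S (U - S))"
    (is "?l = _")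
proof -
  have "?l = (\<Sum>S\<in>Pow {..<N}. if S \<subseteq> U then g S (U - S) else 0)"
  proof (rule sum.cong[OF refl])
    fix S assume "S \<in> Pow {..<N}"
    have "(\<Sum>T\<in>Pow {..<N}. if S \<inter> T = {} \<and> S \<union> T = U then g S T else 0) =
        (\<Sum>T\<in>Pow {..<N}. if T = U - S then (if S \<subseteq> U then g S (U - S) else 0) else 0)"
      by (rule sum.cong[OF refl]) (auto simp: split_disjoint)
    also have "\<dots> = (if S \<subseteq> U then g S (U - S) else 0)"
      using U by (subst sum.delta) auto
    finally show "(\<Sum>T\<in>Pow {..<N}. if S \<inter> T = {} \<and> S \<union> T = U then g S T else 0) = (if S \<subseteq> U then g S (U - S) else 0)" .
  qed
  also have "\<dots> = (\<Sum>S\<in>Pow U. g S (U - S))"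
    by (rule sum.mono_neutral_cong_right) (use U in auto)
  finally show ?thesis .
qed

lemma sum_split_deriv:
  fixes N :: nat
  assumes U: "U \<subseteq> {..<N}" and i: "i < N" and j: "j < N"
  shows "(\<Sum>S\<in>Pow {..<N}. \<Sum>T\<in>Pow {..<N}. if i \<in> S \<and> j \<in> T \<and> (S - {i}) \<inter> (T - {j}) = {} \<and> S - {i} \<union> (T - {j}) = U
       then g S T else 0) = (\<Sum>S\<in>Pow U. if i \<notin> S \<and> j \<notin> U - S then g (insert i S) (insert j (U - S)) else 0)"
    (is "?l = ?r")
proof -
  have disjoint_diff: "A \<inter> C = {} \<Longrightarrow> A \<union> C - A = C" for A C :: "nat set" by auto
  have "?l = (\<Sum>(S, T)\<in>Pow {..<N} \<times> Pow {..<N}. if i \<in> S \<and> j \<in> T \<and> (S - {i}) \<inter> (T - {j}) = {} \<and> S - {i} \<union> (T - {j}) = U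
       then g S T else 0)" by (simp add: sum.cartesian_product)
  also have "\<dots> = (\<Sum>(S, T)\<in>{(S, T). S \<in> Pow {..<N} \<and> T \<in> Pow {..<N} \<and> i \<in> S \<and> j \<in> T \<and> (S - {i}) \<inter> (T - {j}) = {} \<and> S - {i} \<union> (T - {j}) = U}. g S T)"
    by (rule sum.mono_neutral_cong_right)
      (auto intro: finite_subset[of _ "Pow {..<N} \<times> Pow {..<N}"] split: if_splits)
  also have "\<dots> = (\<Sum>S\<in>{S. S \<subseteq> U \<and> i \<notin> S \<and> j \<notin> U - S}. g (insert i S) (insert j (U - S)))"
    by (rule sum.reindex_bij_witness[where i = "\<lambda>S. (insert i S, insert j (U - S))" and j = "\<lambda>(S, T). S - {i}"])
      (use U i j in \<open>auto simp: insert_absorb insert_Diff_if disjoint_diff\<close>)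
  also have "\<dots> = ?r"
    by (rule sum.mono_neutral_cong_left) (use U in \<open>auto intro: finite_subset\<close>)
  finally show ?thesis .
qed

lemma sum_swap4: "(\<Sum>S\<in>A. \<Sum>T\<in>A. \<Sum>i\<in>I. \<Sum>j\<in>I. h S T i j) = (\<Sum>i\<in>I. \<Sum>j\<in>I. \<Sum>S\<in>A. \<Sum>T\<in>A. h S T i j)"
proof -
  have "(\<Sum>S\<in>A. \<Sum>T\<in>A. \<Sum>i\<in>I. \<Sum>j\<in>I. h S T i j) = (\<Sum>S\<in>A. \<Sum>i\<in>I. \<Sum>T\<in>A. \<Sum>j\<in>I. h S T i j)"
    by (rule sum.cong[OF refl], rule sum.swap)
  also have "\<dots> = (\<Sum>i\<in>I. \<Sum>S\<in>A. \<Sum>T\<in>A. \<Sum>j\<in>I. h S T i j)" by (rule sum.swap)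
  also have "\<dots> = (\<Sum>i\<in>I. \<Sum>S\<in>A. \<Sum>j\<in>I. \<Sum>T\<in>A. h S T i j)"
    by (rule sum.cong[OF refl], rule sum.cong[OF refl], rule sum.swap)
  also have "\<dots> = (\<Sum>i\<in>I. \<Sum>j\<in>I. \<Sum>S\<in>A. \<Sum>T\<in>A. h S T i j)"
    by (rule sum.cong[OF refl], rule sum.swap)
  finally show ?thesis .
qed

lemma K_bracket_sum:
  assumes x: "x \<in> K_carrier N" and y: "y \<in> K_carrier N"
  shows "Poly_Mapping.lookup (K_bracket N x y) U = (\<Sum>S\<in>Pow {..<N}. \<Sum>T\<in>Pow {..<N}.
     lconst (Poly_Mapping.lookup (gmul (gmon S) (gmon T)) U) *
       (lconst ((2 - of_nat (card S)) / 2) * (Poly_Mapping.lookup x S * lD (Poly_Mapping.lookup y T))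
      - lconst ((2 - of_nat (card T)) / 2) * (Poly_Mapping.lookup y T * lD (Poly_Mapping.lookup x S)))
     + lconst (Poly_Mapping.lookup (poisson N (gmon S) (gmon T)) U) * (Poly_Mapping.lookup x S * Poly_Mapping.lookup y T))"
  unfolding K_bracket_def Let_def lookup_sum lookup_add lookup_gtens mult.assoc
  by (rule sum_pairs_extend[OF x y]) auto

text \<open>The form in which brackets are computed: each coefficient is a sum over the subsets of
  \<open>U\<close>, which \<open>K_eval\<close> expands for an explicit \<open>U\<close>.\<close>

lemma K_bracket_lookup:
  assumes x: "x \<in> K_carrier N" and y: "y \<in> K_carrier N" and U: "U \<subseteq> {..<N}"
  shows "Poly_Mapping.lookup (K_bracket N x y) U = (\<Sum>S\<in>Pow U. kterm x y S (U - S)) +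
     (\<Sum>i<N. \<Sum>j<N. lconst (gen_bracket N i j) * (\<Sum>S\<in>Pow U. pterm x y i j S (U - S)))"
proof -
  have 1: "lconst (Poly_Mapping.lookup (gmul (gmon S) (gmon T)) U) * c = (if S \<inter> T = {} \<and> S \<union> T = U then lconst (sg S T) * c else 0)" for S T c
    by (auto simp: gmul_gmon lookup_single when_def lconst_simps)
  have 2: "lconst (Poly_Mapping.lookup (poisson N (gmon S) (gmon T)) U) * c = (\<Sum>i<N. \<Sum>j<N. lconst (gen_bracket N i j) *
     (if i \<in> S \<and> j \<in> T \<and> (S - {i}) \<inter> (T - {j}) = {} \<and> S - {i} \<union> (T - {j}) = U
      then lconst (sg (S - {i}) (T - {j}) * gts i S * lts j T) * c else 0))" for S T c
    unfolding poisson_gmon lookup_sum lconst_sum sum_distrib_right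
    by (intro sum.cong refl) (auto simp: lookup_single when_def lconst_simps)
  have "(\<Sum>S\<in>Pow {..<N}. \<Sum>T\<in>Pow {..<N}. lconst (Poly_Mapping.lookup (poisson N (gmon S) (gmon T)) U) *
       (Poly_Mapping.lookup x S * Poly_Mapping.lookup y T)) =
    (\<Sum>i<N. \<Sum>j<N. lconst (gen_bracket N i j) * (\<Sum>S\<in>Pow {..<N}. \<Sum>T\<in>Pow {..<N}.
      (if i \<in> S \<and> j \<in> T \<and> (S - {i}) \<inter> (T - {j}) = {} \<and> S - {i} \<union> (T - {j}) = U
      then lconst (sg (S - {i}) (T - {j}) * gts i S * lts j T) * (Poly_Mapping.lookup x S * Poly_Mapping.lookup y T) else 0)))"
    unfolding 2 sum_distrib_left by (rule sum_swap4)
  also have "\<dots> = (\<Sum>i<N. \<Sum>j<N. lconst (gen_bracket N i j) * (\<Sum>S\<in>Pow U. pterm x y i j S (U - S)))"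
  proof (intro sum.cong refl)
    fix i j assume "i \<in> {..<N}" "j \<in> {..<N}"
    then show "lconst (gen_bracket N i j) * (\<Sum>S\<in>Pow {..<N}. \<Sum>T\<in>Pow {..<N}.
      (if i \<in> S \<and> j \<in> T \<and> (S - {i}) \<inter> (T - {j}) = {} \<and> S - {i} \<union> (T - {j}) = U
      then lconst (sg (S - {i}) (T - {j}) * gts i S * lts j T) * (Poly_Mapping.lookup x S * Poly_Mapping.lookup y T) else 0)) =
      lconst (gen_bracket N i j) * (\<Sum>S\<in>Pow U. pterm x y i j S (U - S))"
      by (subst sum_split_deriv[OF U]) (auto simp: pterm_def intro!: arg_cong2[where f = "(*)"] sum.cong)
  qed
  finally show ?thesis
    unfolding K_bracket_sum[OF x y] sum.distrib 1 sum_split[OF U] kterm_def by simp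
qed

lemma K_bracket_outside:
  assumes x: "x \<in> K_carrier N" and y: "y \<in> K_carrier N" and U: "\<not> U \<subseteq> {..<N}"
  shows "Poly_Mapping.lookup (K_bracket N x y) U = 0"
proof -
  have "Poly_Mapping.lookup (gmul (gmon S) (gmon T)) U = 0" "Poly_Mapping.lookup (poisson N (gmon S) (gmon T)) U = 0"
    if "S \<in> Pow {..<N}" "T \<in> Pow {..<N}" for S T
  proof -
    show "Poly_Mapping.lookup (gmul (gmon S) (gmon T)) U = 0"
      using U that by (auto simp: gmul_gmon lookup_single when_def)
    show "Poly_Mapping.lookup (poisson N (gmon S) (gmon T)) U = 0"
      unfolding poisson_gmon lookup_sum
      by (intro sum.neutral ballI) (use U that in \<open>auto simp: lookup_single when_def\<close>)
  qed
  then show ?thesis unfolding K_bracket_sum[OF x y] by (simp add: lconst_simps)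
qed

lemma K_bracket_carrier:
  "x \<in> K_carrier N \<Longrightarrow> y \<in> K_carrier N \<Longrightarrow> K_bracket N x y \<in> K_carrier N"
proof -
  assume a: "x \<in> K_carrier N" "y \<in> K_carrier N"
  have "U \<subseteq> {..<N}" if "U \<in> Poly_Mapping.keys (K_bracket N x y)" for U
    using K_bracket_outside[OF a, of U] that by (auto simp: in_keys_iff)
  then show ?thesis by (simp add: K_carrier_def[of N])
qed

subsection \<open>Evaluation on explicit sets\<close>

lemma sum_Pow_insert: "finite A \<Longrightarrow> a \<notin> A \<Longrightarrow> sum g (Pow (insert a A)) = sum g (Pow A) + (\<Sum>S\<in>Pow A. g (insert a S))"
proof -
  assume A: "finite A" "a \<notin> A"
  have "sum g (Pow (insert a A)) = sum g (Pow A) + sum g (insert a ` Pow A)"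
    unfolding Pow_insert by (rule sum.union_disjoint) (use A in auto)
  also have "sum g (insert a ` Pow A) = (\<Sum>S\<in>Pow A. g (insert a S))"
    by (rule sum.reindex[unfolded comp_def]) (use A in \<open>auto simp: inj_on_def\<close>)
  finally show ?thesis .
qed

lemma lts_insert: "finite T \<Longrightarrow> j \<notin> T \<Longrightarrow> lts i (insert j T) = (if j < i then - lts i T else lts i T)"
proof -
  assume T: "finite T" "j \<notin> T"
  have "{k \<in> insert j T. k < i} = (if j < i then insert j {k \<in> T. k < i} else {k \<in> T. k < i})" by auto
  then show ?thesis using T by (simp add: lts_def)
qed

lemma gts_insert: "finite T \<Longrightarrow> j \<notin> T \<Longrightarrow> gts i (insert j T) = (if i < j then - gts i T else gts i T)"
proof -
  assume T: "finite T" "j \<notin> T"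
  have "{k \<in> insert j T. i < k} = (if i < j then insert j {k \<in> T. i < k} else {k \<in> T. i < k})" by auto
  then show ?thesis using T by (simp add: gts_def)
qed

lemma sg_insert: "finite S \<Longrightarrow> finite T \<Longrightarrow> i \<notin> S \<Longrightarrow> sg (insert i S) T = lts i T * sg S T"
proof -
  assume S: "finite S" "finite T" "i \<notin> S"
  have "{(a, b). a \<in> insert i S \<and> b \<in> T \<and> b < a} = Pair i ` {b \<in> T. b < i} \<union> {(a, b). a \<in> S \<and> b \<in> T \<and> b < a}" by auto
  moreover have "card (Pair i ` {b \<in> T. b < i} \<union> {(a, b). a \<in> S \<and> b \<in> T \<and> b < a}) =
     card {b \<in> T. b < i} + card {(a, b). a \<in> S \<and> b \<in> T \<and> b < a}"
    by (subst card_Un_disjoint) (use S in \<open>auto simp: card_image inj_on_def intro: finite_subset[of _ "S \<times> T"]\<close>)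
  ultimately show ?thesis by (simp add: sg_def lts_def power_add)
qed

lemma signs_empty: "lts i {} = 1" "gts i {} = 1" "sg {} T = 1"
  by (simp_all add: lts_def gts_def sg_def)

lemma insert_order:
  "insert 1 (insert 0 S) = insert 0 (insert (1 :: nat) S)" "insert 2 (insert 0 S) = insert 0 (insert (2 :: nat) S)"
  "insert 3 (insert 0 S) = insert 0 (insert (3 :: nat) S)" "insert 2 (insert 1 S) = insert 1 (insert (2 :: nat) S)"
  "insert 3 (insert 1 S) = insert 1 (insert (3 :: nat) S)" "insert 3 (insert 2 S) = insert 2 (insert (3 :: nat) S)"
  by auto

lemma sum_lessThan_small:
  "(\<Sum>i<4. g i) = g 0 + g 1 + g 2 + g (3 :: nat)" "(\<Sum>i<3. g i) = g 0 + g 1 + g (2 :: nat)"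
  by (simp_all add: numeral_eq_Suc)

lemma gen_bracket_4:
  "gen_bracket 4 0 0 = 0" "gen_bracket 4 0 1 = 1" "gen_bracket 4 0 2 = 0" "gen_bracket 4 0 3 = 0"
  "gen_bracket 4 1 0 = 1" "gen_bracket 4 1 1 = 0" "gen_bracket 4 1 2 = 0" "gen_bracket 4 1 3 = 0"
  "gen_bracket 4 2 0 = 0" "gen_bracket 4 2 1 = 0" "gen_bracket 4 2 2 = 0" "gen_bracket 4 2 3 = 1"
  "gen_bracket 4 3 0 = 0" "gen_bracket 4 3 1 = 0" "gen_bracket 4 3 2 = 1" "gen_bracket 4 3 3 = 0"
  by (simp_all add: gen_bracket_def)

lemma gen_bracket_3:
  "gen_bracket 3 0 0 = 0" "gen_bracket 3 0 1 = 1" "gen_bracket 3 0 2 = 0"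
  "gen_bracket 3 1 0 = 1" "gen_bracket 3 1 1 = 0" "gen_bracket 3 1 2 = 0"
  "gen_bracket 3 2 0 = 0" "gen_bracket 3 2 1 = 0" "gen_bracket 3 2 2 = 1"
  by (simp_all add: gen_bracket_def)

lemmas K_eval = sum_Pow_insert signs_empty lts_insert gts_insert sg_insert insert_order sum_lessThan_small
  gen_bracket_4 gen_bracket_3 kterm_def pterm_def insert_Diff_if

text \<open>A primitive under \<open>D\<close> of the top coefficient of the bracket; its constant
  coefficient is the cocycle.\<close>

definition KE :: "laurent grass \<Rightarrow> laurent grass \<Rightarrow> laurent" where
  "KE x y = (\<Sum>S\<in>Pow {0, 1, 2, 3}. lconst ((2 - of_nat (card S)) / 2 * sg S ({0, 1, 2, 3} - S)) *
     (Poly_Mapping.lookup x S * Poly_Mapping.lookup y ({0, 1, 2, 3} - S)))"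

lemma lessThan_4: "{..<4} = {0, 1, 2, 3 :: nat}" and lessThan_3: "{..<3} = {0, 1, 2 :: nat}"
  by auto

text \<open>The top coefficient of a bracket is a derivative. Hence its constant term vanishes, and this
  is the only condition that cuts the derived algebra out of \<open>K(4; D)\<close>.\<close>

lemma K_bracket_top:
  assumes "x \<in> K_carrier 4" "y \<in> K_carrier 4"
  shows "Poly_Mapping.lookup (K_bracket 4 x y) {0, 1, 2, 3} = lD (KE x y)"
  apply (simp add: K_bracket_lookup[OF assms] KE_def K_eval lconst_cs cs_simps algebra_simps del: One_nat_def)
  done

lemma K4_cocycle_eq:
  assumes "x \<in> K_carrier 4" "y \<in> K_carrier 4"
  shows "K4_cocycle x y = Poly_Mapping.lookup (KE x y) 0"
proof -
  have g: "(2 - of_nat (card S)) / 2 * gTr (gmul (gmon S) (gmon T)) * c =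
     (if S \<inter> T = {} \<and> S \<union> T = {0, 1, 2, 3} then (2 - of_nat (card S)) / 2 * sg S T * c else 0)" for S T and c :: complex
    by (auto simp: gmul_gmon gTr_def lookup_single when_def)
  have "K4_cocycle x y = (\<Sum>S\<in>Pow {..<4}. \<Sum>T\<in>Pow {..<4}.
     (2 - of_nat (card S)) / 2 * gTr (gmul (gmon S) (gmon T)) * Poly_Mapping.lookup (Poly_Mapping.lookup x S * Poly_Mapping.lookup y T) 0)"
    unfolding K4_cocycle_def by (rule sum_pairs_extend[OF assms]) auto
  also have "\<dots> = (\<Sum>S\<in>Pow {0, 1, 2, 3}. (2 - of_nat (card S)) / 2 * sg S ({0, 1, 2, 3} - S) *
      Poly_Mapping.lookup (Poly_Mapping.lookup x S * Poly_Mapping.lookup y ({0, 1, 2, 3} - S)) 0)"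
    unfolding g by (rule sum_split) (simp add: lessThan_4)
  finally show ?thesis by (simp only: KE_def lookup_sum lookup_lconst_mult)
qed

text \<open>The primitive with zero constant term: the constant coefficient is divided by zero, hence
  dropped.\<close>

definition lI :: "laurent \<Rightarrow> laurent" where "lI f = Poly_Mapping.mapp (\<lambda>n c. c / of_int n) f"

lemma lookup_lI: "Poly_Mapping.lookup (lI f) n = Poly_Mapping.lookup f n / of_int n"
  by (simp add: lI_def lookup_mapp when_def in_keys_iff)

lemma lookup_lconst: "Poly_Mapping.lookup (lconst c) n = (if n = 0 then c else 0)"
  by (simp add: lconst_def lookup_single when_def)

lemma lI_lD: "lI (lD f) + lconst (Poly_Mapping.lookup f 0) = f"
  by (rule poly_mapping_eqI) (simp add: lookup_add lookup_lI lookup_lconst)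

lemma lD_lI: "Poly_Mapping.lookup f 0 = 0 \<Longrightarrow> lD (lI f + lconst a) = f"
  by (rule poly_mapping_eqI) (simp add: lookup_add lookup_lI lookup_lconst)

section \<open>The embedding of the central extension of \<open>K(4)\<close> into \<open>CK(6)\<close>\<close>

text \<open>The coordinate \<open>h\<close> of the element $c(h) = \sum_n h_n c(t^n)$ of
  $\widehat{K(4)}$. It merges the central coordinate with a primitive of the top coefficient.\<close>

definition hh :: "laurent grass \<times> complex \<Rightarrow> laurent" where
  "hh p = lI (Poly_Mapping.lookup (fst p) {0, 1, 2, 3}) + lconst (snd p)"

text \<open>The four parameters of the image in \<open>CK(6)\<close>: degree zero gives
  \<open>f\<close>, degree two and \<open>hh\<close> give \<open>a\<close>, degree one gives
  \<open>B\<close> and degree three gives \<open>S\<close>. The signs are chosen so that the brackets of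
  the odd elements match.\<close>

definition kf :: "laurent grass \<times> complex \<Rightarrow> laurent" where "kf p = Poly_Mapping.lookup (fst p) {}"

definition ka :: "laurent grass \<times> complex \<Rightarrow> lmat" where
  "ka p = (let c = Poly_Mapping.lookup (fst p); x = lconst (1/2) * c {0, 1}; y = lconst (1/2) * c {2, 3}; h = hh p in
     vector [vector [x + y + h, - c {0, 2}, 0, 0],
             vector [c {1, 3}, - x - y + h, 0, 0],
             vector [0, 0, - x + y - h, - c {1, 2}],
             vector [0, 0, c {0, 3}, x - y - h]])"

definition kB :: "laurent grass \<times> complex \<Rightarrow> lmat" where
  "kB p = (let c = Poly_Mapping.lookup (fst p) in
     vector [vector [0, 0, c {2}, c {0}],
             vector [0, 0, c {1}, - c {3}],
             vector [- c {2}, - c {1}, 0, 0],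
             vector [- c {0}, c {3}, 0, 0]])"

definition kS :: "laurent grass \<times> complex \<Rightarrow> lmat" where
  "kS p = (let c = Poly_Mapping.lookup (fst p) in
     vector [vector [0, 0, c {0, 1, 3}, c {1, 2, 3}],
             vector [0, 0, - c {0, 2, 3}, c {0, 1, 2}],
             vector [c {0, 1, 3}, - c {0, 2, 3}, 0, 0],
             vector [c {1, 2, 3}, c {0, 1, 2}, 0, 0]])"

definition kap :: "laurent grass \<times> complex \<Rightarrow> ck_operator" where
  "kap p = ck_opu 0 (kf p) (ka p) (kB p) (kS p)"

lemma kap_params: "(kf p, ka p, kB p, kS p) \<in> ck_params"
  by (simp add: ck_params_def trace_def sum_4 ka_def kB_def kS_def Let_def vector_4_nth vec_eq_iff forall_4)

context
  fixes x y :: "laurent grass" and a b :: complex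
  assumes xc: "x \<in> K_carrier 4" and yc: "y \<in> K_carrier 4"
    and x0: "Poly_Mapping.lookup (Poly_Mapping.lookup x {0, 1, 2, 3}) 0 = 0"
    and y0: "Poly_Mapping.lookup (Poly_Mapping.lookup y {0, 1, 2, 3}) 0 = 0"
begin

abbreviation "kz \<equiv> (K_bracket 4 x y, K4_cocycle x y)"

lemma hh_bracket: "hh kz = KE x y"
  by (simp only: hh_def fst_conv snd_conv K_bracket_top[OF xc yc] K4_cocycle_eq[OF xc yc] lI_lD)

lemma lD_hh: "lD (hh (x, a)) = Poly_Mapping.lookup x {0, 1, 2, 3}" "lD (hh (y, b)) = Poly_Mapping.lookup y {0, 1, 2, 3}"
  by (simp_all only: hh_def fst_conv snd_conv lD_lI[OF x0] lD_lI[OF y0])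

lemmas k_simps = K_bracket_lookup[OF xc yc] K_eval lconst_cs cs_simps vector_4_nth mult_mat_nth sum_4 Pol_def Let_def

lemma kf_bracket: "kf kz = brf (kf (x, a)) (kB (x, a)) (kf (y, b)) (kB (y, b))"
  by (simp add: kf_def kB_def brf_def k_simps algebra_simps del: One_nat_def)

lemma kB_bracket: "kB kz = brB (kf (x, a)) (ka (x, a)) (kB (x, a)) (kf (y, b)) (ka (y, b)) (kB (y, b))"
  apply (simp add: kf_def kB_def ka_def brB_def vec_eq_iff forall_4 k_simps del: One_nat_def)
  apply (intro conjI poly_mapping_eqI; simp add: cs_simps algebra_simps coeff_simps del: One_nat_def)
  done

lemma kS_bracket: "kS kz = brS (kf (x, a)) (ka (x, a)) (kB (x, a)) (kS (x, a)) (kf (y, b)) (ka (y, b)) (kB (y, b)) (kS (y, b))"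
  apply (simp add: kf_def kB_def ka_def kS_def brS_def ck_phi_def vec_eq_iff forall_4 k_simps lD_hh del: One_nat_def)
  apply (intro conjI poly_mapping_eqI; simp add: cs_simps algebra_simps coeff_simps del: One_nat_def)
  done

lemma ka_bracket: "ka kz = bra (kf (x, a)) (ka (x, a)) (kB (x, a)) (kS (x, a)) (kf (y, b)) (ka (y, b)) (kB (y, b)) (kS (y, b))"
  apply (simp add: kf_def kB_def kS_def ka_def hh_bracket KE_def bra_def ck_phi_def mat_def vec_eq_iff forall_4 k_simps lD_hh del: One_nat_def)
  apply (intro conjI poly_mapping_eqI; simp add: cs_simps algebra_simps coeff_simps del: One_nat_def)
  done

end

lemma K_D_simps [simp]:
  "carrier (K_D N) = K_carrier N" "zero (K_D N) = 0" "add (K_D N) = (+)"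
  "smult (K_D N) c = Poly_Mapping.map ((*) (lconst c))" "bracket (K_D N) = K_bracket N"
  "hom_part (K_D N) p n = {x \<in> K_carrier N. \<forall>S\<in>Poly_Mapping.keys x. odd (card S) = p \<and> Poly_Mapping.lookup x S \<in> lhom n}"
  by (simp_all add: K_D_def)

lemma lookup_map_lconst [simp]:
  "Poly_Mapping.lookup (Poly_Mapping.map ((*) (lconst c)) x) S = lconst c * Poly_Mapping.lookup x S"
  by (simp add: Poly_Mapping.map.rep_eq when_def)

lemma K_carrier_iff: "x \<in> K_carrier N \<longleftrightarrow> (\<forall>S. \<not> S \<subseteq> {..<N} \<longrightarrow> Poly_Mapping.lookup x S = 0)"
  by (auto simp: K_carrier_def in_keys_iff)

lemma K_carrier_closed:
  "0 \<in> K_carrier N" "x \<in> K_carrier N \<Longrightarrow> y \<in> K_carrier N \<Longrightarrow> x + y \<in> K_carrier N"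
  "x \<in> K_carrier N \<Longrightarrow> Poly_Mapping.map ((*) (lconst c)) x \<in> K_carrier N"
  "S \<subseteq> {..<N} \<Longrightarrow> Poly_Mapping.single S f \<in> K_carrier N"
  by (auto simp: K_carrier_iff lookup_add lookup_single when_def)

lemma map_lconst_simps:
  "Poly_Mapping.map ((*) (lconst c)) (x + y) = Poly_Mapping.map ((*) (lconst c)) x + Poly_Mapping.map ((*) (lconst c)) (y :: laurent grass)"
  "Poly_Mapping.map ((*) (lconst (c + d))) x = Poly_Mapping.map ((*) (lconst c)) x + Poly_Mapping.map ((*) (lconst d)) (x :: laurent grass)"
  "Poly_Mapping.map ((*) (lconst (c * d))) x = Poly_Mapping.map ((*) (lconst c)) (Poly_Mapping.map ((*) (lconst d)) (x :: laurent grass))"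
  "Poly_Mapping.map ((*) (lconst 1)) x = (x :: laurent grass)" "Poly_Mapping.map ((*) (lconst 0)) x = (0 :: laurent grass)"
  "Poly_Mapping.map ((*) (lconst c)) (Poly_Mapping.single S f) = Poly_Mapping.single S (lconst c * f)"
  by (rule poly_mapping_eqI, simp only: lookup_map_lconst lookup_add lookup_zero lookup_single,
      simp add: lconst_simps when_def algebra_simps)+

lemma K_D_module: "module complex_ring (K_D N)"
  by (rule vector_spaceI) (simp_all add: K_carrier_closed map_lconst_simps algebra_simps)

lemma K_D_hom_carrier: "hom_part (K_D N) p n \<subseteq> carrier (K_D N)"
  by auto

definition K4c :: "laurent grass set" where
  "K4c = {x \<in> K_carrier 4. Poly_Mapping.lookup (Poly_Mapping.lookup x {0, 1, 2, 3}) 0 = 0}"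

text \<open>The element $1(f)$ acts on every monomial by a density action; brackets with such elements
  already span the derived algebra.\<close>

lemma K_bracket_one:
  "K_bracket N (Poly_Mapping.single {} f) (Poly_Mapping.single S g) =
     Poly_Mapping.single S (f * lD g - lconst ((2 - of_nat (card S)) / 2) * (g * lD f))"
proof (cases "f = 0 \<or> g = 0")
  case True
  then show ?thesis by (auto simp: K_bracket_def)
next
  case False
  have "poisson N (gmon {}) (gmon S) = 0"
    by (simp add: poisson_gmon) (simp add: scale_pm_simps)
  moreover have "gmul (gmon {}) (gmon S) = gmon S" by (simp add: gmul_gmon signs_empty) (simp add: gmon_def)
  ultimately have "K_bracket N (Poly_Mapping.single {} f) (Poly_Mapping.single S g) =
     gtens (gmon S) (lconst ((2 - 0) / 2) * f * lD g - lconst ((2 - of_nat (card S)) / 2) * g * lD f) + gtens 0 (f * g)"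
    using False by (simp add: K_bracket_def)
  also have "\<dots> = Poly_Mapping.single S (f * lD g - lconst ((2 - of_nat (card S)) / 2) * (g * lD f))"
    by (rule poly_mapping_eqI) (simp add: lookup_add lookup_gtens gmon_def lookup_single when_def lconst_simps mult.assoc)
  finally show ?thesis .
qed

lemma grass_span:
  assumes P: "subsp (K_D N) P" and x: "x \<in> K_carrier N"
    and m: "\<And>S n. S \<in> Poly_Mapping.keys x \<Longrightarrow> n \<in> Poly_Mapping.keys (Poly_Mapping.lookup x S) \<Longrightarrow>
      Poly_Mapping.single S (Poly_Mapping.single n (Poly_Mapping.lookup (Poly_Mapping.lookup x S) n)) \<in> P"
  shows "x \<in> P"
proof -
  note s = subspD[OF P, simplified]
  have sumP: "sum g K \<in> P" if "\<And>k. k \<in> K \<Longrightarrow> g k \<in> P" for g and K :: "'z set"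
    using that by (induction K rule: infinite_finite_induct) (simp_all add: s)
  have e: "Poly_Mapping.single S (sum g K) = (\<Sum>k\<in>K. Poly_Mapping.single S (g k))" for S and g :: "int \<Rightarrow> laurent" and K
    by (induction K rule: infinite_finite_induct) (simp_all add: single_add)
  have "Poly_Mapping.single S (Poly_Mapping.lookup x S) \<in> P" if "S \<in> Poly_Mapping.keys x" for S
    by (subst sum_of_monomials[of "Poly_Mapping.lookup x S"], subst e, rule sumP) (rule m[OF that])
  then show ?thesis by (subst sum_of_monomials[of x], intro sumP)
qed

text \<open>Monomials $t^n$ with $n \neq 0$ are obtained by bracketing with $1(1)$. For $n = 0$ the
  bracket of $1(t)$ with $a(t^{-1})$ is a nonzero multiple of $a(1)$ unless \<open>a\<close> has degree
  four.\<close>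

lemma K4_carrier: "carrier K4 = K4c"
proof -
  let ?X = "{bracket (K_D 4) x y | x y. x \<in> carrier (K_D 4) \<and> y \<in> carrier (K_D 4)}"
  have c: "carrier K4 = lin_span (K_D 4) ?X" by (simp add: K4_def derived_algebra_def Let_def)
  have Xc: "?X \<subseteq> carrier (K_D 4)" using K_bracket_carrier by auto
  have sub: "subsp (K_D 4) (lin_span (K_D 4) ?X)" by (rule subsp_lin_span[OF K_D_module Xc])
  note s = subspD[OF sub]
  have "lin_span (K_D 4) ?X \<subseteq> K4c"
  proof (rule lin_span_least[OF K_D_module])
    show "subsp (K_D 4) K4c"
      by (auto simp: subsp_def K4c_def K_carrier_closed lookup_add lookup_lconst_mult)
    show "?X \<subseteq> K4c" using K_bracket_carrier K_bracket_top by (auto simp: K4c_def simp del: One_nat_def)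
  qed
  moreover have "K4c \<subseteq> lin_span (K_D 4) ?X"
  proof
    fix x assume x: "x \<in> K4c"
    have xc: "x \<in> K_carrier 4" using x by (simp add: K4c_def)
    show "x \<in> lin_span (K_D 4) ?X"
    proof (rule grass_span[OF sub xc])
      fix S n assume S: "S \<in> Poly_Mapping.keys x" and n: "n \<in> Poly_Mapping.keys (Poly_Mapping.lookup x S)"
      have S4: "S \<subseteq> {..<4}" using S xc by (auto simp: K_carrier_def)
      have bc: "Poly_Mapping.single S (f * lD g - lconst ((2 - of_nat (card S)) / 2) * (g * lD f)) \<in> lin_span (K_D 4) ?X" for f g
      proof -
        have "bracket (K_D 4) (Poly_Mapping.single {} f) (Poly_Mapping.single S g) \<in> ?X"
          using S4 by (auto simp: K_carrier_closed simp del: K_D_simps(5) intro!: exI)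
        then show ?thesis using lin_span_superset[OF K_D_module, of ?X 4] by (auto simp: K_bracket_one)
      qed
      have sc: "Poly_Mapping.single S (lconst c * f) \<in> lin_span (K_D 4) ?X" if "Poly_Mapping.single S f \<in> lin_span (K_D 4) ?X" for c f
        using s(4)[OF that, of c] by (simp add: map_lconst_simps)
      have mono: "lconst c * Poly_Mapping.single n b = Poly_Mapping.single n (c * b)" for c b and n :: int
        by (simp add: lconst_def mult_single)
      let ?c = "Poly_Mapping.lookup (Poly_Mapping.lookup x S) n"
      show "Poly_Mapping.single S (Poly_Mapping.single n ?c) \<in> lin_span (K_D 4) ?X"
      proof (cases "n = 0")
        case False
        have "Poly_Mapping.single S (lconst (?c / of_int n) * (1 * lD (tt n) - lconst ((2 - of_nat (card S)) / 2) * (tt n * lD 1))) \<in> lin_span (K_D 4) ?X"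
          by (rule sc[OF bc])
        moreover have "lconst (?c / of_int n) * (1 * lD (tt n) - lconst ((2 - of_nat (card S)) / 2) * (tt n * lD 1)) = Poly_Mapping.single n ?c"
          using False lD_simps(6)[of 1] by (simp add: lconst_simps tt_def cs_def mono)
        ultimately show ?thesis by simp
      next
        case True
        have card: "card S \<noteq> 4"
        proof
          assume "card S = 4"
          then have "S = {..<4}" using S4 by (intro card_subset_eq) auto
          then show False using x n True by (simp add: K4c_def in_keys_iff lessThan_4 del: One_nat_def)
        qed
        define b where "b = - 1 - (2 - of_nat (card S)) / (2 :: complex)"
        have "b \<noteq> 0"
        proof
          assume "b = 0"
          then have "(of_nat (card S) :: complex) = of_nat 4" by (simp add: b_def field_simps)
          then show False using card by (simp only: of_nat_eq_iff)
        qed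
        have "tt 1 * lD (tt (-1)) - lconst ((2 - of_nat (card S)) / 2) * (tt (-1) * lD (tt 1)) = lconst b"
          by (rule poly_mapping_eqI) (simp add: cs_simps coeff_simps lookup_lconst_mult lookup_lconst lookup_one when_def b_def)
        then have "Poly_Mapping.single S (lconst (?c / b) * lconst b) \<in> lin_span (K_D 4) ?X"
          using sc[OF bc[of "tt 1" "tt (-1)"], of "?c / b"] by simp
        moreover have "lconst (?c / b) * lconst b = Poly_Mapping.single n ?c"
          using \<open>b \<noteq> 0\<close> True by (simp add: lconst_simps(4)[symmetric]) (simp add: lconst_def)
        ultimately show ?thesis by simp
      qed
    qed
  qed
  ultimately show ?thesis using c by blast
qed

lemma K4hat_simps [simp]:
  "carrier K4hat = K4c \<times> UNIV" "zero K4hat = 0" "add K4hat = (+)"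
  "smult K4hat c x = (Poly_Mapping.map ((*) (lconst c)) (fst x), c * snd x)"
  "bracket K4hat x y = (K_bracket 4 (fst x) (fst y), K4_cocycle (fst x) (fst y))"
  "hom_part K4hat p n = (hom_part (K_D 4) p n \<inter> K4c) \<times> (if \<not> p \<and> n = 0 then UNIV else {0})"
proof -
  have c: "carrier K4 = K4c" by (rule K4_carrier)
  have h: "hom_part K4 p n = hom_part (K_D 4) p n \<inter> K4c" for p n
    using c by (simp add: K4_def derived_algebra_def Let_def)
  have s: "smult K4 = smult (K_D 4)" "bracket K4 = bracket (K_D 4)"
    by (simp_all add: K4_def derived_algebra_def Let_def)
  show "carrier K4hat = K4c \<times> UNIV" "zero K4hat = 0" "add K4hat = (+)"
    "smult K4hat c x = (Poly_Mapping.map ((*) (lconst c)) (fst x), c * snd x)"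
    "bracket K4hat x y = (K_bracket 4 (fst x) (fst y), K4_cocycle (fst x) (fst y))"
    "hom_part K4hat p n = (hom_part (K_D 4) p n \<inter> K4c) \<times> (if \<not> p \<and> n = 0 then UNIV else {0})"
    unfolding K4hat_def by (simp_all add: c h s split_beta)
qed

lemma K4c_closed: "0 \<in> K4c" "x \<in> K4c \<Longrightarrow> y \<in> K4c \<Longrightarrow> x + y \<in> K4c"
  "x \<in> K4c \<Longrightarrow> Poly_Mapping.map ((*) (lconst c)) x \<in> K4c"
  "x \<in> K_carrier 4 \<Longrightarrow> y \<in> K_carrier 4 \<Longrightarrow> K_bracket 4 x y \<in> K4c"
  using K_bracket_carrier K_bracket_top
  by (auto simp: K4c_def K_carrier_closed lookup_add lookup_lconst_mult simp del: One_nat_def)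

lemma K4c_carrier: "x \<in> K4c \<Longrightarrow> x \<in> K_carrier 4" "x \<in> K4c \<Longrightarrow> Poly_Mapping.lookup (Poly_Mapping.lookup x {0, 1, 2, 3}) 0 = 0"
  by (simp_all add: K4c_def)

lemma K4hat_module: "module complex_ring K4hat"
  by (rule vector_spaceI) (auto simp: K4c_closed map_lconst_simps algebra_simps prod_eq_iff zero_prod_def)

lemma K4hat_hom_carrier: "hom_part K4hat p n \<subseteq> carrier K4hat"
  by auto

lemma K4_hom_entries:
  assumes "x \<in> hom_part (K_D N) p n"
  shows "Poly_Mapping.lookup x S \<in> lhom n" "odd (card S) \<noteq> p \<Longrightarrow> Poly_Mapping.lookup x S = 0"
proof -
  have "S \<in> Poly_Mapping.keys x \<or> Poly_Mapping.lookup x S = 0" by (auto simp: in_keys_iff)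
  then show "Poly_Mapping.lookup x S \<in> lhom n" "odd (card S) \<noteq> p \<Longrightarrow> Poly_Mapping.lookup x S = 0"
    using assms by auto
qed

lemma lI_simps: "lI (f + g) = lI f + lI g" "lI (lconst c * f) = lconst c * lI f" "f \<in> lhom n \<Longrightarrow> lI f \<in> lhom n" "lI 0 = 0"
  by (rule poly_mapping_eqI, simp add: lookup_lI lookup_add lookup_lconst_mult add_divide_distrib)+
    (simp_all add: lhomI lookup_lI poly_mapping_eq_iff fun_eq_iff)

lemma complex_three:
  fixes x y h :: complex
  assumes "x + y + h = x' + y' + h'" "- x - y + h = - x' - y' + h'" "- x + y - h = - x' + y' - h'"
  shows "x = x'" "y = y'" "h = h'"
proof -
  have "(x + y + h) + (- x - y + h) = (x' + y' + h') + (- x' - y' + h')" unfolding assms(1,2) ..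
  then show h: "h = h'" by (simp add: algebra_simps)
  have "(x + y + h) + (- x + y - h) = (x' + y' + h') + (- x' + y' - h')" unfolding assms(1,3) ..
  then show y: "y = y'" by (simp add: algebra_simps)
  show "x = x'" using assms(1) h y by simp
qed

lemma laurent_three:
  fixes x y h :: laurent
  assumes "x + y + h = x' + y' + h'" "- x - y + h = - x' - y' + h'" "- x + y - h = - x' + y' - h'"
  shows "x = x'" "y = y'" "h = h'"
proof -
  have "Poly_Mapping.lookup x n = Poly_Mapping.lookup x' n \<and> Poly_Mapping.lookup y n = Poly_Mapping.lookup y' n \<and>
    Poly_Mapping.lookup h n = Poly_Mapping.lookup h' n" for n
    using complex_three[of "Poly_Mapping.lookup x n" "Poly_Mapping.lookup y n" "Poly_Mapping.lookup h n"
        "Poly_Mapping.lookup x' n" "Poly_Mapping.lookup y' n" "Poly_Mapping.lookup h' n"]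
      arg_cong[OF assms(1), of "\<lambda>f. Poly_Mapping.lookup f n"] arg_cong[OF assms(2), of "\<lambda>f. Poly_Mapping.lookup f n"]
      arg_cong[OF assms(3), of "\<lambda>f. Poly_Mapping.lookup f n"]
    unfolding lookup_add lookup_minus lookup_uminus by blast
  then show "x = x'" "y = y'" "h = h'" by (auto intro: poly_mapping_eqI)
qed

lemma subsets_4: "S \<subseteq> {..<4 :: nat} \<Longrightarrow> S \<in> {{}, {0}, {1}, {2}, {3}, {0, 1}, {0, 2}, {0, 3}, {1, 2}, {1, 3}, {2, 3},
    {0, 1, 2}, {0, 1, 3}, {0, 2, 3}, {1, 2, 3}, {0, 1, 2, 3}}"
proof -
  assume "S \<subseteq> {..<4 :: nat}"
  then have e: "S = (if 0 \<in> S then {0} else {}) \<union> (if 1 \<in> S then {1} else {}) \<union> (if 2 \<in> S then {2} else {}) \<union> (if 3 \<in> S then {3} else {})"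
    unfolding lessThan_4 by auto
  show ?thesis
    by (subst e, cases "0 \<in> S"; cases "1 \<in> S"; cases "2 \<in> S"; cases "3 \<in> S")
      (simp_all only: if_True if_False Un_insert_left Un_empty_left Un_empty_right insert_iff simp_thms)
qed

text \<open>Injectivity holds because the sixteen coordinates can be read off the entries of the
  parameters; the three coordinates on the diagonal are separated by \<open>laurent_three\<close>.\<close>

lemma kap_embedding: "lie_superalgebra_embedding K4hat CK6 kap"
  unfolding lie_superalgebra_embedding_def
proof (intro conjI ballI allI)
  show "inj_on kap (carrier K4hat)"
  proof (rule inj_onI)
    fix p q assume p: "p \<in> carrier K4hat" and q: "q \<in> carrier K4hat" and e: "kap p = kap q"
    note i = ck_opu_inject[OF kap_params kap_params e[unfolded kap_def]]
    have pc: "fst p \<in> K4c" "fst q \<in> K4c" using p q by auto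
    have a: "ka p $ r $ t = ka q $ r $ t" "kB p $ r $ t = kB q $ r $ t" "kS p $ r $ t = kS q $ r $ t" for r t
      using i by simp_all
    let ?c = "Poly_Mapping.lookup (fst p)" and ?d = "Poly_Mapping.lookup (fst q)"
    have diag: "lconst (1/2) * ?c {0, 1} = lconst (1/2) * ?d {0, 1}" "lconst (1/2) * ?c {2, 3} = lconst (1/2) * ?d {2, 3}" "hh p = hh q"
      using laurent_three[of "lconst (1/2) * ?c {0, 1}" "lconst (1/2) * ?c {2, 3}" "hh p"
          "lconst (1/2) * ?d {0, 1}" "lconst (1/2) * ?d {2, 3}" "hh q"] a(1)[of 1 1] a(1)[of 2 2] a(1)[of 3 3]
      by (simp_all add: ka_def Let_def vector_4_nth)
    have half: "lconst (1/2) * f = lconst (1/2) * g \<Longrightarrow> f = g" for f g using half_half by metis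
    have top: "?c {0, 1, 2, 3} = ?d {0, 1, 2, 3}"
      using arg_cong[OF diag(3), of lD] unfolding hh_def lD_lI[OF K4c_carrier(2)[OF pc(1)]] lD_lI[OF K4c_carrier(2)[OF pc(2)]] .
    have "snd p = snd q"
      using arg_cong[OF diag(3), of "\<lambda>f. Poly_Mapping.lookup f 0"] by (simp add: hh_def lookup_add lookup_lI lookup_lconst)
    moreover have "?c S = ?d S" if "S \<subseteq> {..<4}" for S
      using subsets_4[OF that] i(1) half[OF diag(1)] half[OF diag(2)] top a(1)[of 1 2] a(1)[of 2 1] a(1)[of 3 4] a(1)[of 4 3]
        a(2)[of 1 3] a(2)[of 1 4] a(2)[of 2 3] a(2)[of 2 4] a(3)[of 1 3] a(3)[of 1 4] a(3)[of 2 3] a(3)[of 2 4]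
      by (auto simp: ka_def kB_def kS_def kf_def Let_def vector_4_nth simp del: One_nat_def)
    then have "fst p = fst q"
      using K4c_carrier(1)[OF pc(1)] K4c_carrier(1)[OF pc(2)] by (intro poly_mapping_eqI) (metis K_carrier_iff)
    ultimately show "p = q" by (simp add: prod_eq_iff)
  qed
  show "kap ` carrier K4hat \<subseteq> carrier CK6" using CK6_carrierI[OF kap_params] by (auto simp: kap_def)
  show "kap (p \<oplus>\<^bsub>K4hat\<^esub> q) = kap p \<oplus>\<^bsub>CK6\<^esub> kap q" for p q
  proof -
    have "kf (p + q) = kf p + kf q" "kB (p + q) = kB p + kB q" "kS (p + q) = kS p + kS q"
      by (simp_all add: kf_def kB_def kS_def Let_def vector_4_nth vec_eq_iff forall_4 lookup_add)
    moreover have "hh (p + q) = hh p + hh q" by (simp add: hh_def lookup_add lI_simps lconst_simps)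
    then have "ka (p + q) = ka p + ka q"
      by (simp add: ka_def Let_def vector_4_nth vec_eq_iff forall_4 lookup_add algebra_simps)
    ultimately show ?thesis by (simp add: kap_def CK6_ops fun_eq_iff ck_opu_add)
  qed
  show "kap (c \<odot>\<^bsub>K4hat\<^esub> p) = c \<odot>\<^bsub>CK6\<^esub> kap p" for p c
  proof -
    let ?q = "(Poly_Mapping.map ((*) (lconst c)) (fst p), c * snd p)"
    have "kf ?q = lconst c * kf p" "kB ?q = smat (lconst c) (kB p)" "kS ?q = smat (lconst c) (kS p)"
      by (simp_all add: kf_def kB_def kS_def Let_def vector_4_nth vec_eq_iff forall_4)
    moreover have "hh ?q = lconst c * hh p" by (simp add: hh_def lI_simps lconst_simps algebra_simps)
    then have "ka ?q = smat (lconst c) (ka p)"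
      by (simp add: ka_def Let_def vector_4_nth vec_eq_iff forall_4 algebra_simps)
    ultimately show ?thesis by (simp add: kap_def CK6_ops fun_eq_iff ck_opu_smult)
  qed
  show "kap ` hom_part K4hat p n \<subseteq> hom_part CK6 p n" for p n
  proof
    fix z assume "z \<in> kap ` hom_part K4hat p n"
    then obtain q where q: "z = kap q" "fst q \<in> hom_part (K_D 4) p n" "snd q \<in> (if \<not> p \<and> n = 0 then UNIV else {0})"
      by auto
    note e = K4_hom_entries[OF q(2)]
    have sq: "lconst (snd q) \<in> lhom n" using q(3) by (auto simp: lconst_simps split: if_splits)
    have h: "hh q \<in> lhom n" unfolding hh_def using e(1) sq by (simp add: lI_simps)
    have "if p then kf q = 0 \<and> ka q = 0 else kB q = 0 \<and> kS q = 0"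
    proof (cases p)
      case True
      have "hh q = 0" using True q(3) by (simp add: hh_def e(2) lI_simps lconst_simps)
      then show ?thesis using True
        by (simp add: kf_def ka_def Let_def vec_eq_iff forall_4 vector_4_nth e(2))
    next
      case False
      then show ?thesis by (simp add: kB_def kS_def Let_def vec_eq_iff forall_4 vector_4_nth e(2))
    qed
    then show "z \<in> hom_part CK6 p n"
      unfolding q(1) kap_def
      by (intro CK6_homI[OF kap_params])
        (simp_all add: kf_def ka_def kB_def kS_def Let_def mat_lhom_def forall_4 vector_4_nth e(1) h)
  qed
  show "kap (bracket K4hat p q) = bracket CK6 (kap p) (kap q)" if "p \<in> carrier K4hat" "q \<in> carrier K4hat" for p q
  proof -
    obtain x a y b where pq: "p = (x, a)" "q = (y, b)" by fastforce
    have c: "x \<in> K_carrier 4" "y \<in> K_carrier 4" "Poly_Mapping.lookup (Poly_Mapping.lookup x {0, 1, 2, 3}) 0 = 0"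
      "Poly_Mapping.lookup (Poly_Mapping.lookup y {0, 1, 2, 3}) 0 = 0"
      using that pq K4c_carrier by auto
    show ?thesis
      unfolding CK6_ops kap_def ck_bracket[OF kap_params kap_params] pq K4hat_simps fst_conv
        kf_bracket[OF c, of a b] ka_bracket[OF c, of a b] kB_bracket[OF c, of a b] kS_bracket[OF c, of a b] ..
  qed
qed

section \<open>The embedding of \<open>K(3)\<close> into the central extension of \<open>K(4)\<close>\<close>

text \<open>With $\xi = (\zeta_2 + \eta_2)/\sqrt 2$ one has $[\xi, \xi] = \frac12([\zeta_2, \eta_2] +
  [\eta_2, \zeta_2]) = 1$.\<close>

definition rt :: complex where "rt = complex_of_real (1 / sqrt 2)"

lemma rt_square: "rt * rt = 1/2" "rt * (rt * c) = c / 2"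
proof -
  have "rt * rt = complex_of_real (1 / sqrt 2 * (1 / sqrt 2))" unfolding rt_def of_real_mult ..
  then show "rt * rt = 1/2" by simp
  then show "rt * (rt * c) = c / 2" by (simp add: mult.assoc[symmetric])
qed

lemma rt_nonzero: "rt \<noteq> 0" using rt_square(1) by auto

text \<open>The coefficient of a monomial after $\xi$ (number 2) is replaced by the normalized sum of
  generators 2 and 3. No sign appears since $\xi$ comes last in every monomial.\<close>

definition sub_coord :: "laurent grass \<Rightarrow> nat set \<Rightarrow> laurent" where
  "sub_coord x S = (if 2 \<in> S \<and> 3 \<in> S then 0
     else if 2 \<in> S \<or> 3 \<in> S then lconst rt * Poly_Mapping.lookup x (insert 2 (S - {3})) else Poly_Mapping.lookup x S)"

definition sub :: "laurent grass \<Rightarrow> laurent grass" where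
  "sub x = (\<Sum>S\<in>Pow {..<4}. Poly_Mapping.single S (sub_coord x S))"

definition iota :: "laurent grass \<Rightarrow> laurent grass \<times> complex" where
  "iota x = (sub x, 0)"

lemma lookup_sub: "Poly_Mapping.lookup (sub x) S = (if S \<subseteq> {..<4} then sub_coord x S else 0)"
  by (auto simp: sub_def lookup_sum lookup_single when_def)

lemma lookup_sub_explicit:
  "Poly_Mapping.lookup (sub x) {} = Poly_Mapping.lookup x {}"
  "Poly_Mapping.lookup (sub x) {0} = Poly_Mapping.lookup x {0}"
  "Poly_Mapping.lookup (sub x) {1} = Poly_Mapping.lookup x {1}"
  "Poly_Mapping.lookup (sub x) {2} = lconst rt * Poly_Mapping.lookup x {2}"
  "Poly_Mapping.lookup (sub x) {3} = lconst rt * Poly_Mapping.lookup x {2}"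
  "Poly_Mapping.lookup (sub x) {0, 1} = Poly_Mapping.lookup x {0, 1}"
  "Poly_Mapping.lookup (sub x) {0, 2} = lconst rt * Poly_Mapping.lookup x {0, 2}"
  "Poly_Mapping.lookup (sub x) {0, 3} = lconst rt * Poly_Mapping.lookup x {0, 2}"
  "Poly_Mapping.lookup (sub x) {1, 2} = lconst rt * Poly_Mapping.lookup x {1, 2}"
  "Poly_Mapping.lookup (sub x) {1, 3} = lconst rt * Poly_Mapping.lookup x {1, 2}"
  "Poly_Mapping.lookup (sub x) {2, 3} = 0"
  "Poly_Mapping.lookup (sub x) {0, 1, 2} = lconst rt * Poly_Mapping.lookup x {0, 1, 2}"
  "Poly_Mapping.lookup (sub x) {0, 1, 3} = lconst rt * Poly_Mapping.lookup x {0, 1, 2}"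
  "Poly_Mapping.lookup (sub x) {0, 2, 3} = 0" "Poly_Mapping.lookup (sub x) {1, 2, 3} = 0"
  "Poly_Mapping.lookup (sub x) {0, 1, 2, 3} = 0"
  by (simp_all add: lookup_sub sub_coord_def insert_Diff_if insert_order del: One_nat_def)

lemma sub_carrier: "sub x \<in> K_carrier 4" "sub x \<in> K4c"
  by (simp_all add: K4c_def K_carrier_iff lookup_sub_explicit del: One_nat_def) (simp_all add: lookup_sub)

lemma sub_eqI:
  assumes "z \<in> K_carrier 4" "\<And>U. U \<in> {{}, {0}, {1}, {2}, {3}, {0, 1}, {0, 2}, {0, 3}, {1, 2}, {1, 3}, {2, 3},
    {0, 1, 2}, {0, 1, 3}, {0, 2, 3}, {1, 2, 3}, {0, 1, 2, 3}} \<Longrightarrow> Poly_Mapping.lookup z U = Poly_Mapping.lookup w U"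
    "w \<in> K_carrier 4"
  shows "z = w"
proof (rule poly_mapping_eqI)
  fix U show "Poly_Mapping.lookup z U = Poly_Mapping.lookup w U"
    using assms(2)[OF subsets_4, of U] assms(1,3) by (cases "U \<subseteq> {..<4}") (auto simp: K_carrier_iff)
qed

text \<open>The cocycle vanishes on the image of the substitution, so the central coordinate of the
  embedding is zero.\<close>

lemma sub_bracket:
  assumes x: "x \<in> K_carrier 3" and y: "y \<in> K_carrier 3"
  shows "sub (K_bracket 3 x y) = K_bracket 4 (sub x) (sub y)" "KE (sub x) (sub y) = 0"
proof -
  show "KE (sub x) (sub y) = 0"
    by (rule poly_mapping_eqI)
      (simp add: KE_def K_eval lookup_sub_explicit lconst_cs cs_simps coeff_simps algebra_simps rt_square del: One_nat_def)
  show "sub (K_bracket 3 x y) = K_bracket 4 (sub x) (sub y)"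
  proof (rule sub_eqI)
    show "Poly_Mapping.lookup (sub (K_bracket 3 x y)) U = Poly_Mapping.lookup (K_bracket 4 (sub x) (sub y)) U"
      if "U \<in> {{}, {0}, {1}, {2}, {3}, {0, 1}, {0, 2}, {0, 3}, {1, 2}, {1, 3}, {2, 3},
        {0, 1, 2}, {0, 1, 3}, {0, 2, 3}, {1, 2, 3}, {0, 1, 2, 3}}" for U
      using that
      apply (simp only: insert_iff empty_iff)
      apply (elim disjE FalseE; rule poly_mapping_eqI;
        simp add: K_bracket_lookup[OF x y] K_bracket_lookup[OF sub_carrier(1) sub_carrier(1)] K_eval lookup_sub_explicit
          lconst_cs cs_simps coeff_simps del: One_nat_def)
      apply (simp_all add: algebra_simps rt_square)
      done
  qed (simp_all add: sub_carrier K_bracket_carrier)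
qed

lemma lconst_mult_left_cancel: "c \<noteq> 0 \<Longrightarrow> lconst c * f = lconst c * g \<longleftrightarrow> f = g"
  using lconst_mult_eq_0[of c "f - g"] by (auto simp: right_diff_distrib)

lemma subsets_3: "S \<subseteq> {..<3 :: nat} \<Longrightarrow> S \<in> {{}, {0}, {1}, {2}, {0, 1}, {0, 2}, {1, 2}, {0, 1, 2}}"
proof -
  assume "S \<subseteq> {..<3 :: nat}"
  then have e: "S = (if 0 \<in> S then {0} else {}) \<union> (if 1 \<in> S then {1} else {}) \<union> (if 2 \<in> S then {2} else {})"
    unfolding lessThan_3 by auto
  show ?thesis
    by (subst e, cases "0 \<in> S"; cases "1 \<in> S"; cases "2 \<in> S")
      (simp_all only: if_True if_False Un_insert_left Un_empty_left Un_empty_right insert_iff simp_thms)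
qed

lemma iota_embedding: "lie_superalgebra_embedding K3 K4hat iota"
  unfolding lie_superalgebra_embedding_def
proof (intro conjI ballI allI)
  show "inj_on iota (carrier K3)"
  proof (rule inj_onI)
    fix x y assume c: "x \<in> carrier K3" "y \<in> carrier K3" and e: "iota x = iota y"
    have s: "Poly_Mapping.lookup (sub x) S = Poly_Mapping.lookup (sub y) S" for S
      using e by (simp add: iota_def)
    have e: "Poly_Mapping.lookup x {} = Poly_Mapping.lookup y {}" "Poly_Mapping.lookup x {0} = Poly_Mapping.lookup y {0}" "Poly_Mapping.lookup x {1} = Poly_Mapping.lookup y {1}" "Poly_Mapping.lookup x {2} = Poly_Mapping.lookup y {2}" "Poly_Mapping.lookup x {0, 1} = Poly_Mapping.lookup y {0, 1}" "Poly_Mapping.lookup x {0, 2} = Poly_Mapping.lookup y {0, 2}" "Poly_Mapping.lookup x {1, 2} = Poly_Mapping.lookup y {1, 2}" "Poly_Mapping.lookup x {0, 1, 2} = Poly_Mapping.lookup y {0, 1, 2}"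
      using s[of "{}"] s[of "{0}"] s[of "{1}"] s[of "{2}"] s[of "{0, 1}"] s[of "{0, 2}"] s[of "{1, 2}"] s[of "{0, 1, 2}"]
      by (simp_all only: lookup_sub_explicit lconst_mult_left_cancel[OF rt_nonzero])
    have "Poly_Mapping.lookup x S = Poly_Mapping.lookup y S" if "S \<subseteq> {..<3}" for S
      using subsets_3[OF that] by (simp only: insert_iff empty_iff) (elim disjE FalseE; simp only: e)
    then show "x = y" using c by (intro poly_mapping_eqI) (metis K3_def K_D_simps(1) K_carrier_iff)
  qed
  show "iota ` carrier K3 \<subseteq> carrier K4hat" using sub_carrier by (auto simp: iota_def)
  show "iota (x \<oplus>\<^bsub>K3\<^esub> y) = iota x \<oplus>\<^bsub>K4hat\<^esub> iota y" for x y
  proof -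
    have "sub (x + y) = sub x + sub y"
      by (rule poly_mapping_eqI) (simp add: lookup_sub lookup_add sub_coord_def distrib_left)
    then show ?thesis by (simp add: iota_def K3_def)
  qed
  show "iota (c \<odot>\<^bsub>K3\<^esub> x) = c \<odot>\<^bsub>K4hat\<^esub> iota x" for c x
  proof -
    have "sub (Poly_Mapping.map ((*) (lconst c)) x) = Poly_Mapping.map ((*) (lconst c)) (sub x)"
      by (rule poly_mapping_eqI) (simp add: lookup_sub sub_coord_def mult.left_commute)
    then show ?thesis by (simp add: iota_def K3_def)
  qed
  show "iota ` hom_part K3 p n \<subseteq> hom_part K4hat p n" for p n
  proof
    fix z assume "z \<in> iota ` hom_part K3 p n"
    then obtain x where x: "x \<in> hom_part (K_D 3) p n" "z = iota x" by (auto simp: K3_def simp del: K_D_simps)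
    note e = K4_hom_entries[OF x(1)]
    have "odd (card S) = p \<and> Poly_Mapping.lookup (sub x) S \<in> lhom n" if "S \<in> Poly_Mapping.keys (sub x)" for S
    proof -
      have S: "S \<subseteq> {..<4}" "Poly_Mapping.lookup (sub x) S \<noteq> 0"
        using that sub_carrier(1)[of x] by (auto simp: K_carrier_def in_keys_iff)
      have "Poly_Mapping.lookup (sub x) S \<noteq> 0 \<longrightarrow> odd (card S) = p \<and> Poly_Mapping.lookup (sub x) S \<in> lhom n"
        using subsets_4[OF S(1)]
        apply (simp only: insert_iff empty_iff)
        apply (elim disjE FalseE; cases p)
        apply (simp_all add: lookup_sub_explicit e del: One_nat_def)
        done
      then show ?thesis using S(2) by blast
    qed
    then show "z \<in> hom_part K4hat p n" using sub_carrier[of x] by (simp add: x(2) iota_def)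
  qed
  show "iota (bracket K3 x y) = bracket K4hat (iota x) (iota y)" if "x \<in> carrier K3" "y \<in> carrier K3" for x y
    using sub_bracket[of x y] that K4_cocycle_eq[OF sub_carrier(1) sub_carrier(1), of x y]
    by (simp add: iota_def K3_def)
qed

lemma embedding_comp:
  assumes "lie_superalgebra_embedding K L f" "lie_superalgebra_embedding L M g"
  shows "lie_superalgebra_embedding K M (g \<circ> f)"
  using assms unfolding lie_superalgebra_embedding_def image_subset_iff
  by (auto intro: comp_inj_on inj_on_subset)

section \<open>The adjoint action of \<open>F\<close>\<close>

text \<open>The \<open>ad F\<close>-weight of a monomial, for $F = a\,\zeta_1\eta_1 +
  b\,\zeta_2\eta_2$.\<close>

definition gw :: "int \<Rightarrow> int \<Rightarrow> nat set \<Rightarrow> int" where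
  "gw a b S = a * (of_bool (0 \<in> S) - of_bool (1 \<in> S)) + b * (of_bool (2 \<in> S) - of_bool (3 \<in> S))"

definition hF :: "int \<Rightarrow> int \<Rightarrow> laurent grass" where
  "hF a b = gtens (gmon {0, 1}) (lconst (of_int a)) + gtens (gmon {2, 3}) (lconst (of_int b))"

lemma lookup_gmon: "Poly_Mapping.lookup (gtens (gmon S) f) U = (if S = U then f else 0)"
  by (simp add: lookup_gtens gmon_def lookup_single when_def lconst_simps)

lemma gtens_gmon: "gtens (gmon S) f = Poly_Mapping.single S f"
  by (rule poly_mapping_eqI) (simp add: lookup_gmon lookup_single when_def)

lemma hF_carrier: "hF a b \<in> K_carrier 4" "hF a 0 \<in> K_carrier 3"
  unfolding hF_def gtens_gmon lconst_simps of_int_0 single_zero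
  by (intro K_carrier_closed; simp)+

lemma small_set_eq_iff:
  assumes "U \<subseteq> {0, 1, 2, 3 :: nat}" "V \<subseteq> {0, 1, 2, 3}"
  shows "U = V \<longleftrightarrow> (\<forall>k\<in>{0, 1, 2, 3}. k \<in> U \<longleftrightarrow> k \<in> V)"
  using assms by blast

lemma lookup_hF:
  "Poly_Mapping.lookup (hF a b) {} = 0" "Poly_Mapping.lookup (hF a b) {0} = 0" "Poly_Mapping.lookup (hF a b) {1} = 0"
  "Poly_Mapping.lookup (hF a b) {2} = 0" "Poly_Mapping.lookup (hF a b) {3} = 0"
  "Poly_Mapping.lookup (hF a b) {0, 1} = lconst (of_int a)"
  "Poly_Mapping.lookup (hF a b) {0, 2} = 0" "Poly_Mapping.lookup (hF a b) {0, 3} = 0"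
  "Poly_Mapping.lookup (hF a b) {1, 2} = 0" "Poly_Mapping.lookup (hF a b) {1, 3} = 0"
  "Poly_Mapping.lookup (hF a b) {2, 3} = lconst (of_int b)"
  "Poly_Mapping.lookup (hF a b) {0, 1, 2} = 0" "Poly_Mapping.lookup (hF a b) {0, 1, 3} = 0"
  "Poly_Mapping.lookup (hF a b) {0, 2, 3} = 0" "Poly_Mapping.lookup (hF a b) {1, 2, 3} = 0"
  "Poly_Mapping.lookup (hF a b) {0, 1, 2, 3} = 0"
proof -
  have l: "Poly_Mapping.lookup (hF a b) U = (if 0 \<in> U \<and> 1 \<in> U \<and> 2 \<notin> U \<and> 3 \<notin> U then lconst (of_int a) else 0) +
      (if 0 \<notin> U \<and> 1 \<notin> U \<and> 2 \<in> U \<and> 3 \<in> U then lconst (of_int b) else 0)" if "U \<subseteq> {0, 1, 2, 3}" for U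
  proof -
    have "{0, 1} = U \<longleftrightarrow> 0 \<in> U \<and> 1 \<in> U \<and> 2 \<notin> U \<and> 3 \<notin> U" "{2, 3} = U \<longleftrightarrow> 0 \<notin> U \<and> 1 \<notin> U \<and> 2 \<in> U \<and> 3 \<in> U"
      using small_set_eq_iff[OF _ that, of "{0, 1}"] small_set_eq_iff[OF _ that, of "{2, 3}"] by (simp_all del: One_nat_def)
    then show ?thesis by (simp only: hF_def lookup_add lookup_gmon)
  qed
  show "Poly_Mapping.lookup (hF a b) {} = 0" "Poly_Mapping.lookup (hF a b) {0} = 0" "Poly_Mapping.lookup (hF a b) {1} = 0"
  "Poly_Mapping.lookup (hF a b) {2} = 0" "Poly_Mapping.lookup (hF a b) {3} = 0"
  "Poly_Mapping.lookup (hF a b) {0, 1} = lconst (of_int a)"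
  "Poly_Mapping.lookup (hF a b) {0, 2} = 0" "Poly_Mapping.lookup (hF a b) {0, 3} = 0"
  "Poly_Mapping.lookup (hF a b) {1, 2} = 0" "Poly_Mapping.lookup (hF a b) {1, 3} = 0"
  "Poly_Mapping.lookup (hF a b) {2, 3} = lconst (of_int b)"
  "Poly_Mapping.lookup (hF a b) {0, 1, 2} = 0" "Poly_Mapping.lookup (hF a b) {0, 1, 3} = 0"
  "Poly_Mapping.lookup (hF a b) {0, 2, 3} = 0" "Poly_Mapping.lookup (hF a b) {1, 2, 3} = 0"
  "Poly_Mapping.lookup (hF a b) {0, 1, 2, 3} = 0"
    by (simp_all add: l del: One_nat_def)
qed

lemma lD_one: "lD 1 = 0" using lD_simps(6)[of 1] by (simp add: lconst_simps)

lemma grass_eq_iff: "x = y \<longleftrightarrow> (\<forall>S. Poly_Mapping.lookup x S = Poly_Mapping.lookup (y :: laurent grass) S)"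
  by (metis poly_mapping_eqI)

text \<open>$\zeta_i\eta_i$ counts the number of $\zeta_i$ minus the number of $\eta_i$, and elements of
  Grassmann degree two do not contribute to the cocycle.\<close>

lemma ad_hF:
  assumes x: "x \<in> K_carrier 4"
  shows "KE (hF a b) x = 0"
    "Poly_Mapping.lookup (K_bracket 4 (hF a b) x) U = lconst (of_int (gw a b U)) * Poly_Mapping.lookup x U"
proof -
  show "KE (hF a b) x = 0"
    by (simp add: KE_def K_eval lookup_hF lconst_simps del: One_nat_def)
  show "Poly_Mapping.lookup (K_bracket 4 (hF a b) x) U = lconst (of_int (gw a b U)) * Poly_Mapping.lookup x U"
  proof (cases "U \<subseteq> {..<4}")
    case True
    show ?thesis using subsets_4[OF True]
      apply (simp only: insert_iff empty_iff)
      apply (elim disjE FalseE; rule poly_mapping_eqI;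
          simp add: K_bracket_lookup[OF hF_carrier(1) x] K_eval lookup_hF gw_def
          lconst_cs cs_simps coeff_simps del: One_nat_def)
      apply (simp_all add: algebra_simps lD_one)
      done
  next
    case False
    then show ?thesis using x K_bracket_outside[OF hF_carrier(1) x, of U a b] by (simp add: K_carrier_iff)
  qed
qed

lemma ad_hF_3:
  assumes x: "x \<in> K_carrier 3"
  shows "Poly_Mapping.lookup (K_bracket 3 (hF a 0) x) U = lconst (of_int (gw a 0 U)) * Poly_Mapping.lookup x U"
proof (cases "U \<subseteq> {..<3}")
  case True
  show ?thesis using subsets_3[OF True]
    apply (simp only: insert_iff empty_iff)
    apply (elim disjE FalseE; rule poly_mapping_eqI;
        simp add: K_bracket_lookup[OF hF_carrier(2) x] K_eval lookup_hF gw_def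
        lconst_cs cs_simps coeff_simps del: One_nat_def)
    apply (simp_all add: algebra_simps lD_one)
    done
next
  case False
  then show ?thesis using x K_bracket_outside[OF hF_carrier(2) x, of U a] by (simp add: K_carrier_iff)
qed

lemma F_hF: "K4hat_F = (hF 2 4, 0)" "K3_F = hF 2 0"
proof -
  have "gtens (gmon {2, 3}) (lconst 0) = 0" by (rule poly_mapping_eqI) (simp add: lookup_gmon lconst_simps)
  then show "K4hat_F = (hF 2 4, 0)" "K3_F = hF 2 0"
    by (simp_all add: K4hat_F_def K3_F_def hF_def)
qed

lemma ad_eigen_K4hat:
  "(x, c) \<in> ad_eigenspace K4hat K4hat_F k \<longleftrightarrow>
     x \<in> K4c \<and> (\<forall>U. gw 2 4 U \<noteq> k \<longrightarrow> Poly_Mapping.lookup x U = 0) \<and> (k \<noteq> 0 \<longrightarrow> c = 0)"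
proof -
  have "K_bracket 4 (hF 2 4) x = Poly_Mapping.map ((*) (lconst (of_int k))) x \<longleftrightarrow>
      (\<forall>U. gw 2 4 U \<noteq> k \<longrightarrow> Poly_Mapping.lookup x U = 0)" "K4_cocycle (hF 2 4) x = 0" if "x \<in> K4c"
  proof -
    have x: "x \<in> K_carrier 4" using that by (rule K4c_carrier)
    show "K_bracket 4 (hF 2 4) x = Poly_Mapping.map ((*) (lconst (of_int k))) x \<longleftrightarrow>
      (\<forall>U. gw 2 4 U \<noteq> k \<longrightarrow> Poly_Mapping.lookup x U = 0)"
      unfolding grass_eq_iff ad_hF(2)[OF x] lookup_map_lconst lconst_mult_cancel of_int_eq_iff by auto
    show "K4_cocycle (hF 2 4) x = 0" by (simp add: K4_cocycle_eq[OF hF_carrier(1) x] ad_hF(1)[OF x])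
  qed
  then show ?thesis by (auto simp: ad_eigenspace_def F_hF)
qed

lemma ad_eigen_K3:
  "x \<in> ad_eigenspace K3 K3_F k \<longleftrightarrow> x \<in> K_carrier 3 \<and> (\<forall>U. gw 2 0 U \<noteq> k \<longrightarrow> Poly_Mapping.lookup x U = 0)"
proof -
  have "K_bracket 3 (hF 2 0) x = Poly_Mapping.map ((*) (lconst (of_int k))) x \<longleftrightarrow>
      (\<forall>U. gw 2 0 U \<noteq> k \<longrightarrow> Poly_Mapping.lookup x U = 0)" if x: "x \<in> K_carrier 3"
    unfolding grass_eq_iff ad_hF_3[OF x] lookup_map_lconst lconst_mult_cancel of_int_eq_iff by auto
  then show ?thesis by (auto simp: ad_eigenspace_def F_hF K3_def)
qed

lemma centralizer_eigen:
  assumes "module complex_ring L"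
  shows "centralizer L F = ad_eigenspace L F 0"
  using vs_facts(4)[OF assms] by (auto simp: centralizer_def ad_eigenspace_def)

lemma K3_module: "module complex_ring K3" unfolding K3_def by (rule K_D_module)
lemma K3_hom_carrier: "hom_part K3 p n \<subseteq> carrier K3" unfolding K3_def by (rule K_D_hom_carrier)

text \<open>Monomials are weight vectors, and so is the centre.\<close>

lemma K4hat_span: "carrier K4hat \<subseteq> lin_span K4hat (\<Union>p n k. hom_part K4hat p n \<inter> ad_eigenspace K4hat K4hat_F k)"
  (is "_ \<subseteq> lin_span _ ?G")
proof
  fix z assume "z \<in> carrier K4hat"
  then obtain x c where z: "z = (x, c)" and x: "x \<in> K4c" by auto
  have G: "?G \<subseteq> carrier K4hat" by (auto simp: ad_eigenspace_def)
  note s = subspD[OF subsp_lin_span[OF K4hat_module G], unfolded K4hat_simps(2-4)]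
  have xc: "x \<in> K_carrier 4" using x by (rule K4c_carrier)
  have "x \<in> {y \<in> K_carrier 4. (y, 0) \<in> lin_span K4hat ?G}"
  proof (rule grass_span[OF _ xc])
    show "subsp (K_D 4) {y \<in> K_carrier 4. (y, 0) \<in> lin_span K4hat ?G}"
      unfolding subsp_def
    proof (intro conjI ballI allI)
      show "x \<oplus>\<^bsub>K_D 4\<^esub> y \<in> {y \<in> K_carrier 4. (y, 0) \<in> lin_span K4hat ?G}"
        if "x \<in> {y \<in> K_carrier 4. (y, 0) \<in> lin_span K4hat ?G}" "y \<in> {y \<in> K_carrier 4. (y, 0) \<in> lin_span K4hat ?G}" for x y
        using that s(3)[of "(x, 0)" "(y, 0)"] by (simp add: K_carrier_closed del: K4hat_simps)
      show "c \<odot>\<^bsub>K_D 4\<^esub> x \<in> {y \<in> K_carrier 4. (y, 0) \<in> lin_span K4hat ?G}"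
        if "x \<in> {y \<in> K_carrier 4. (y, 0) \<in> lin_span K4hat ?G}" for c x
        using that s(4)[of "(x, 0)" c] by (simp add: K_carrier_closed del: K4hat_simps)
    qed (use s(2) in \<open>simp_all add: K_carrier_closed zero_prod_def subset_iff del: K4hat_simps\<close>)
    fix S n assume S: "S \<in> Poly_Mapping.keys x" and n: "n \<in> Poly_Mapping.keys (Poly_Mapping.lookup x S)"
    let ?y = "Poly_Mapping.single S (Poly_Mapping.single n (Poly_Mapping.lookup (Poly_Mapping.lookup x S) n))"
    have S4: "S \<subseteq> {..<4}" using S xc by (auto simp: K_carrier_def)
    have "?y \<in> K4c" using K_carrier_closed(4)[OF S4] x n
      by (auto simp: K4c_def lookup_single when_def in_keys_iff)
    then have "(?y, 0) \<in> hom_part K4hat (odd (card S)) n" "(?y, 0) \<in> ad_eigenspace K4hat K4hat_F (gw 2 4 S)"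
      unfolding ad_eigen_K4hat K4hat_simps by (auto simp: K4c_def lookup_single when_def split: if_splits)
    then have "(?y, 0) \<in> lin_span K4hat ?G" using lin_span_superset[OF K4hat_module, of ?G] by blast
    then show "?y \<in> {y \<in> K_carrier 4. (y, 0) \<in> lin_span K4hat ?G}" using K_carrier_closed(4)[OF S4] by simp
  qed
  moreover have "(0, c) \<in> hom_part K4hat False 0" "(0, c) \<in> ad_eigenspace K4hat K4hat_F 0"
    unfolding ad_eigen_K4hat by (auto simp: K4c_closed K_carrier_closed)
  then have "(0, c) \<in> lin_span K4hat ?G" using lin_span_superset[OF K4hat_module, of ?G] by blast
  ultimately have "(x, 0) + (0, c) \<in> lin_span K4hat ?G" using s(3) by blast
  then show "z \<in> lin_span K4hat ?G" by (simp add: z)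
qed

lemma K3_span: "carrier K3 \<subseteq> lin_span K3 (\<Union>p n k. hom_part K3 p n \<inter> ad_eigenspace K3 K3_F k)"
  (is "_ \<subseteq> lin_span _ ?G")
proof
  fix x assume "x \<in> carrier K3"
  then have xc: "x \<in> K_carrier 3" by (simp add: K3_def)
  have G: "?G \<subseteq> carrier K3" by (auto simp: ad_eigenspace_def)
  show "x \<in> lin_span K3 ?G"
  proof (rule grass_span[OF _ xc])
    show "subsp (K_D 3) (lin_span K3 ?G)" using subsp_lin_span[OF K3_module G] by (simp add: K3_def)
    fix S n assume S: "S \<in> Poly_Mapping.keys x"
    let ?y = "Poly_Mapping.single S (Poly_Mapping.single n (Poly_Mapping.lookup (Poly_Mapping.lookup x S) n))"
    have S4: "S \<subseteq> {..<3}" using S xc by (auto simp: K_carrier_def)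
    then have "?y \<in> hom_part K3 (odd (card S)) n" "?y \<in> ad_eigenspace K3 K3_F (gw 2 0 S)"
      unfolding ad_eigen_K3 using K_carrier_closed(4)[OF S4] by (auto simp: K3_def lookup_single when_def split: if_splits)
    then show "?y \<in> lin_span K3 ?G" using lin_span_superset[OF K3_module, of ?G] by blast
  qed
qed

text \<open>Under the embedding $F$ becomes a constant diagonal matrix with integral entries whenever
  \<open>a\<close> and \<open>b\<close> have the same parity.\<close>

lemma kap_F: "kap (hF a b, 0) = Hop (\<lambda>i. of_int ((vector [a + b, - a - b, b - a, a - b] :: int ^ 4) $ i) / 2)"
proof -
  have "kf (hF a b, 0) = 0" "kB (hF a b, 0) = 0" "kS (hF a b, 0) = 0"
    by (simp_all add: kf_def kB_def kS_def Let_def lookup_hF vec_eq_iff forall_4 vector_4_nth del: One_nat_def)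
  moreover have "ka (hF a b, 0) = diag_mat (\<chi> i. lconst (of_int ((vector [a + b, - a - b, b - a, a - b] :: int ^ 4) $ i) / 2))"
    by (simp add: ka_def Let_def lookup_hF vec_eq_iff forall_4 vector_4_nth hh_def lI_simps lconst_simps(5) lconst_simps(1-4)[symmetric] add_divide_distrib diff_divide_distrib del: One_nat_def)
  ultimately show ?thesis by (simp add: kap_def Hop_def)
qed

section \<open>Restriction, parity change and isomorphisms\<close>

lemma restrict_simps [simp]:
  "carrier (restrict_along \<phi> M) = carrier M" "zero (restrict_along \<phi> M) = zero M" "add (restrict_along \<phi> M) = add M"
  "smult (restrict_along \<phi> M) = smult M" "hom_part (restrict_along \<phi> M) = hom_part M"
  "action (restrict_along \<phi> M) x = action M (\<phi> x)"
  by (simp_all add: restrict_along_def)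

lemma shift_simps [simp]:
  "carrier (parity_shift s M) = carrier M" "zero (parity_shift s M) = zero M" "add (parity_shift s M) = add M"
  "smult (parity_shift s M) = smult M" "hom_part (parity_shift s M) p n = hom_part M (p \<noteq> s) n"
  "action (parity_shift s M) = action M"
  by (simp_all add: parity_shift_def)

lemma restrict_spans:
  assumes M: "module complex_ring M"
  shows "lin_span (restrict_along \<phi> M) X = lin_span M X"
    "submodule N complex_ring (restrict_along \<phi> M) \<longleftrightarrow> submodule N complex_ring M"
proof -
  have R: "module complex_ring (restrict_along \<phi> M)"
    proof (rule vector_spaceI, unfold restrict_simps)
  qed (use vs_facts[OF M] in \<open>simp_all only:\<close>)
  show "submodule N complex_ring (restrict_along \<phi> M) \<longleftrightarrow> submodule N complex_ring M"
    by (simp add: submodule_iff_subsp M R subsp_def)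
  show "lin_span (restrict_along \<phi> M) X = lin_span M X"
    by (simp add: lin_span_eq M R subsp_def)
qed

text \<open>A graded submodule for the larger algebra is one for the smaller.\<close>

lemma simple_restrict:
  assumes M: "module complex_ring M" and s: "simple_smodule K (restrict_along \<phi> M)" and \<phi>: "\<phi> ` carrier K \<subseteq> carrier L"
  shows "simple_smodule L M"
proof -
  have "graded_submodule K (restrict_along \<phi> M) N" if "graded_submodule L M N" for N
    using that \<phi> unfolding graded_submodule_def restrict_spans[OF M] by auto
  then show ?thesis using s by (simp add: simple_smodule_def)
qed

definition iso_via :: "'l slie \<Rightarrow> ('l, 'v) smodule \<Rightarrow> ('l, 'w) smodule \<Rightarrow> ('v \<Rightarrow> 'w) \<Rightarrow> bool" where
  "iso_via L M N h \<longleftrightarrow> bij_betw h (carrier M) (carrier N) \<and>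
        (\<forall>v\<in>carrier M. \<forall>w\<in>carrier M. h (v \<oplus>\<^bsub>M\<^esub> w) = h v \<oplus>\<^bsub>N\<^esub> h w) \<and>
        (\<forall>c. \<forall>v\<in>carrier M. h (c \<odot>\<^bsub>M\<^esub> v) = c \<odot>\<^bsub>N\<^esub> h v) \<and>
        (\<forall>p n. h ` hom_part M p n = hom_part N p n) \<and>
        (\<forall>x\<in>carrier L. \<forall>v\<in>carrier M. h (action M x v) = action N x (h v))"

lemma smodule_isomorphic_via: "smodule_isomorphic L M N \<longleftrightarrow> (\<exists>h. iso_via L M N h)"
  by (simp only: smodule_isomorphic_def iso_via_def)

lemma iso_viaD:
  assumes "iso_via L M N h"
  shows "bij_betw h (carrier M) (carrier N)"
    "v \<in> carrier M \<Longrightarrow> w \<in> carrier M \<Longrightarrow> h (v \<oplus>\<^bsub>M\<^esub> w) = h v \<oplus>\<^bsub>N\<^esub> h w"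
    "v \<in> carrier M \<Longrightarrow> h (c \<odot>\<^bsub>M\<^esub> v) = c \<odot>\<^bsub>N\<^esub> h v" "h ` hom_part M p n = hom_part N p n"
    "x \<in> carrier L \<Longrightarrow> v \<in> carrier M \<Longrightarrow> h (action M x v) = action N x (h v)"
    "v \<in> carrier M \<Longrightarrow> h v \<in> carrier N"
  using assms by (auto simp: iso_via_def bij_betw_def)

lemma iso_restrict:
  assumes "smodule_isomorphic L M N" "\<phi> ` carrier K \<subseteq> carrier L"
  shows "smodule_isomorphic K (restrict_along \<phi> M) (restrict_along \<phi> N)"
proof -
  obtain h where h: "iso_via L M N h" using assms(1) by (auto simp: smodule_isomorphic_via)
  then have "iso_via K (restrict_along \<phi> M) (restrict_along \<phi> N) h"
    using assms(2) by (auto simp: iso_via_def)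
  then show ?thesis by (auto simp: smodule_isomorphic_via)
qed

lemma iso_shift:
  assumes "smodule_isomorphic L M N"
  shows "smodule_isomorphic L (parity_shift s M) (parity_shift s N)"
proof -
  obtain h where h: "iso_via L M N h" using assms(1) by (auto simp: smodule_isomorphic_via)
  then have "iso_via L (parity_shift s M) (parity_shift s N) h" by (simp add: iso_via_def)
  then show ?thesis by (auto simp: smodule_isomorphic_via)
qed

lemma iso_trans:
  assumes "smodule_isomorphic L M N" "smodule_isomorphic L N K" shows "smodule_isomorphic L M K"
proof -
  obtain h k where h: "iso_via L M N h" and k: "iso_via L N K k" using assms by (auto simp: smodule_isomorphic_via)
  note h = iso_viaD[OF h] and k = iso_viaD[OF k]
  have "(k \<circ> h) ` hom_part M p n = hom_part K p n" for p n by (simp only: image_comp[symmetric] h(4) k(4))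
  then have "iso_via L M K (k \<circ> h)"
    using bij_betw_trans[OF h(1) k(1)] h(2,3,5,6) k(2,3,5) by (simp add: iso_via_def)
  then show ?thesis by (auto simp: smodule_isomorphic_via)
qed

lemma iso_direct_sum:
  assumes "smodule_isomorphic L M M'" "smodule_isomorphic L N N'"
  shows "smodule_isomorphic L (direct_sum M N) (direct_sum M' N')"
proof -
  obtain h k where h: "iso_via L M M' h" and k: "iso_via L N N' k" using assms by (auto simp: smodule_isomorphic_via)
  note h = iso_viaD[OF h] and k = iso_viaD[OF k]
  have "bij_betw (map_prod h k) (carrier M \<times> carrier N) (carrier M' \<times> carrier N')"
    by (rule bij_betw_map_prod[OF h(1) k(1)])
  moreover have "map_prod h k ` (hom_part M p n \<times> hom_part N p n) = hom_part M' p n \<times> hom_part N' p n" for p n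
    by (rule map_prod_surj_on[OF h(4) k(4)])
  ultimately have "iso_via L (direct_sum M N) (direct_sum M' N') (map_prod h k)"
    using h(2,3,5) k(2,3,5) by (auto simp: iso_via_def direct_sum_def)
  then show ?thesis by (auto simp: smodule_isomorphic_via)
qed

lemma natmod_restrict: "restrict_along \<iota> (natmod \<kappa> u A A' s) = natmod (\<lambda>x. \<kappa> (\<iota> x)) u A A' s"
  by (simp add: restrict_along_def natmod_def)

lemma natmod_shift: "parity_shift b (natmod \<kappa> u A A' s) = natmod \<kappa> u A A' (s \<noteq> b)"
proof -
  have "nat_hom s (p \<noteq> b) n = nat_hom (s \<noteq> b) p n" for p n
    by (cases s; cases b; cases p) (simp_all add: nat_hom_def)
  then show ?thesis by (simp add: parity_shift_def natmod_def)
qed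

section \<open>The two halves of the natural module\<close>

text \<open>The action of the embedded $\widehat{K(4)}$ in coordinates; the equations for the first two
  coordinates of $V$ and the last two of $V^*$ do not involve the other four coordinates, and
  conversely.\<close>

lemma rho_kap:
  fixes p u v w
  defines "c \<equiv> Poly_Mapping.lookup (fst p)" and "h \<equiv> hh p" and "Du \<equiv> \<lambda>g. lD g + lconst u * g"
  shows
    "fst (rho u (kap p) (v, w)) $ 1 = (lconst (1/2) * c {0, 1} + lconst (1/2) * c {2, 3} + h) * v $ 1 - c {0, 2} * v $ 2
       + c {} * Du (v $ 1) + lconst (1/4) * lD (c {}) * v $ 1 + c {2} * w $ 3 + c {0} * w $ 4"
    "fst (rho u (kap p) (v, w)) $ 2 = c {1, 3} * v $ 1 + (- lconst (1/2) * c {0, 1} - lconst (1/2) * c {2, 3} + h) * v $ 2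
       + c {} * Du (v $ 2) + lconst (1/4) * lD (c {}) * v $ 2 + c {1} * w $ 3 - c {3} * w $ 4"
    "fst (rho u (kap p) (v, w)) $ 3 = (- lconst (1/2) * c {0, 1} + lconst (1/2) * c {2, 3} - h) * v $ 3 - c {1, 2} * v $ 4
       + c {} * Du (v $ 3) + lconst (1/4) * lD (c {}) * v $ 3 - c {2} * w $ 1 - c {1} * w $ 2"
    "fst (rho u (kap p) (v, w)) $ 4 = c {0, 3} * v $ 3 + (lconst (1/2) * c {0, 1} - lconst (1/2) * c {2, 3} - h) * v $ 4
       + c {} * Du (v $ 4) + lconst (1/4) * lD (c {}) * v $ 4 - c {0} * w $ 1 + c {3} * w $ 2"
    "snd (rho u (kap p) (v, w)) $ 1 = c {0, 1, 3} * v $ 3 + c {1, 2, 3} * v $ 4 - c {3} * Du (v $ 3) - c {1} * Du (v $ 4)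
       - lconst (1/2) * (lD (c {3}) * v $ 3 + lD (c {1}) * v $ 4)
       - (lconst (1/2) * c {0, 1} + lconst (1/2) * c {2, 3} + h) * w $ 1 - c {1, 3} * w $ 2
       + c {} * Du (w $ 1) + lconst (3/4) * lD (c {}) * w $ 1"
    "snd (rho u (kap p) (v, w)) $ 2 = - c {0, 2, 3} * v $ 3 + c {0, 1, 2} * v $ 4 - c {0} * Du (v $ 3) + c {2} * Du (v $ 4)
       + lconst (1/2) * (lD (c {2}) * v $ 4 - lD (c {0}) * v $ 3)
       + c {0, 2} * w $ 1 - (- lconst (1/2) * c {0, 1} - lconst (1/2) * c {2, 3} + h) * w $ 2
       + c {} * Du (w $ 2) + lconst (3/4) * lD (c {}) * w $ 2"
    "snd (rho u (kap p) (v, w)) $ 3 = c {0, 1, 3} * v $ 1 - c {0, 2, 3} * v $ 2 + c {3} * Du (v $ 1) + c {0} * Du (v $ 2)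
       + lconst (1/2) * (lD (c {3}) * v $ 1 + lD (c {0}) * v $ 2)
       - (- lconst (1/2) * c {0, 1} + lconst (1/2) * c {2, 3} - h) * w $ 3 - c {0, 3} * w $ 4
       + c {} * Du (w $ 3) + lconst (3/4) * lD (c {}) * w $ 3"
    "snd (rho u (kap p) (v, w)) $ 4 = c {1, 2, 3} * v $ 1 + c {0, 1, 2} * v $ 2 + c {1} * Du (v $ 1) - c {2} * Du (v $ 2)
       + lconst (1/2) * (lD (c {1}) * v $ 1 - lD (c {2}) * v $ 2)
       + c {1, 2} * w $ 3 - (lconst (1/2) * c {0, 1} - lconst (1/2) * c {2, 3} - h) * w $ 4
       + c {} * Du (w $ 4) + lconst (3/4) * lD (c {}) * w $ 4"
  unfolding c_def h_def Du_def kap_def rho_ck_opu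
  by (simp_all add: ck_opu_def kf_def ka_def kB_def kS_def ck_phi_def Let_def mult_vec_nth sum_4 vector_4_nth vec_Du_def algebra_simps del: One_nat_def)

lemma coord_4: "x \<in> coord A A' \<longleftrightarrow> (1 \<notin> A \<longrightarrow> fst x $ 1 = 0) \<and> (2 \<notin> A \<longrightarrow> fst x $ 2 = 0) \<and> (3 \<notin> A \<longrightarrow> fst x $ 3 = 0) \<and> (4 \<notin> A \<longrightarrow> fst x $ 4 = 0)
    \<and> (1 \<notin> A' \<longrightarrow> snd x $ 1 = 0) \<and> (2 \<notin> A' \<longrightarrow> snd x $ 2 = 0) \<and> (3 \<notin> A' \<longrightarrow> snd x $ 3 = 0) \<and> (4 \<notin> A' \<longrightarrow> snd x $ 4 = 0)"
  by (simp add: coord_def forall_4)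

lemma halves_invariant:
  "x \<in> coord {1, 2} {3, 4} \<Longrightarrow> rho u (kap p) x \<in> coord {1, 2} {3, 4}"
  "x \<in> coord {3, 4} {1, 2} \<Longrightarrow> rho u (kap p) x \<in> coord {3, 4} {1, 2}"
  by (cases x; simp add: coord_4 rho_kap)+

lemma K4hat_natural: "natural_module K4hat kap u {1, 2} {3, 4}" "natural_module K4hat kap u {3, 4} {1, 2}"
  by (rule natural_module.intro[OF K4hat_module K4hat_hom_carrier kap_embedding], rule halves_invariant, simp)+

lemma K3_natural: "natural_module K3 (\<lambda>x. kap (iota x)) u {1, 2} {3, 4}" "natural_module K3 (\<lambda>x. kap (iota x)) u {3, 4} {1, 2}"
  by (rule natural_module.intro[OF K3_module K3_hom_carrier embedding_comp[OF iota_embedding kap_embedding, unfolded comp_def]],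
      rule halves_invariant, simp)+


lemma hh_iota: "hh (iota x) = 0"
  by (simp add: hh_def iota_def lookup_sub_explicit lI_simps lconst_simps del: One_nat_def)

lemma fst_iota: "fst (iota x) = sub x" by (simp add: iota_def)

lemma lconst_cancel: "c * d = 1 \<Longrightarrow> lconst c * (lconst d * f) = f"
  by (simp add: lconst_simps(6) lconst_simps(4)[symmetric] mult.assoc[symmetric])

lemmas K3_action_simps = rho_kap hh_iota fst_iota lookup_sub_explicit

lemmas K3_monomial_simps = K3_action_simps lookup_single when_def small_set_eq_iff

text \<open>The argument of \<open>Tnat_simple\<close> with the few operators available in
  \<open>K(3)\<close>: $\zeta_1\xi$ moves \<open>x_2\<close> to \<open>x_1\<close>, $\xi$ turns odd
  vectors into even ones, and $\eta_1\xi$ and $\zeta_1\eta_1\xi$ lead from \<open>x_1\<close> to the other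
  coordinates.\<close>

lemma V_plus_simple: "simple_smodule K3 (natmod (\<lambda>x. kap (iota x)) u {1, 2} {3, 4} s)"
proof -
  interpret natural_module K3 "\<lambda>x. kap (iota x)" u "{1, 2}" "{3, 4}" s by (rule K3_natural)
  have full: "P = coord {1, 2} {3, 4}" if P: "graded_submodule K3 N P" and nz: "P \<noteq> {0}" for P
  proof -
    have P': "subsp N P" "\<And>x v. x \<in> carrier K3 \<Longrightarrow> v \<in> P \<Longrightarrow> rho u (kap (iota x)) v \<in> P"
      using P by (simp_all add: graded_submodule_iff[OF nat_smod])
    note sP = subspD[OF P'(1), unfolded natmod_simps]
    have op: "rho u (kap (iota (Poly_Mapping.single S f))) v \<in> P" if "S \<subseteq> {..<3}" "v \<in> P" for S f v
      by (rule P'(2)[OF _ that(2)]) (simp add: K3_def K_carrier_closed that(1))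
    have i: "lconst (1 / rt) * (lconst rt * f) = f" "lconst rt * (lconst (1 / rt) * f) = f" "lconst (1/2) * (2 * f) = f" for f
    proof -
      show "lconst (1 / rt) * (lconst rt * f) = f" "lconst rt * (lconst (1 / rt) * f) = f"
        by (rule lconst_cancel, simp add: rt_nonzero)+
      have "lconst (1/2) * (2 * f) = lconst (1/2) * f + lconst (1/2) * f" by (simp only: mult_2 distrib_left)
      then show "lconst (1/2) * (2 * f) = f" by (simp only: half_half)
    qed
    have div: "\<exists>h. h * f = g" if f: "f \<in> lhom n" "f \<noteq> 0" for f g n
    proof -
      obtain c where c: "f = Poly_Mapping.single n c" using f(1) lhom_single by metis
      then have "c \<noteq> 0" using f(2) by auto
      then show ?thesis using lconst_inverse_single[of c g n] c by blast
    qed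
    have even: "(axis 1 g, 0) \<in> P" if y: "(v, 0) \<in> P" "\<And>i. v $ i \<in> lhom n" "v \<noteq> 0" for v n g
    proof -
      have vc: "v $ 3 = 0" "v $ 4 = 0" using sP(1)[OF y(1)] by (simp_all add: coord_4)
      show ?thesis
      proof (cases "v $ 2 = 0")
        case False
        obtain h where h: "h * v $ 2 = g" using div[OF y(2) False] by blast
        have "rho u (kap (iota (Poly_Mapping.single {0, 2} (lconst (- 1 / rt) * h)))) (v, 0) = (axis 1 g, 0)"
          by (simp add: K3_monomial_simps prod_eq_iff vec_eq_iff forall_4 axis_simps vc mult.assoc h i lconst_simps(3) del: One_nat_def)
        then show ?thesis using op[of "{0, 2}" "(v, 0)" "lconst (- 1 / rt) * h"] y(1) by simp
      next
        case True
        then have "v $ 1 \<noteq> 0" using y(3) vc by (auto simp: vec_eq_iff forall_4)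
        then obtain h where h: "h * v $ 1 = g" using div[OF y(2)] by blast
        have "rho u (kap (iota (Poly_Mapping.single {0, 1} (2 * h)))) (v, 0) = (axis 1 g, 0)"
          using h by (simp add: K3_monomial_simps prod_eq_iff vec_eq_iff forall_4 axis_simps vc True mult.assoc i del: One_nat_def)
        then show ?thesis using op[of "{0, 1}" "(v, 0)" "2 * h"] y(1) by (simp del: One_nat_def)
      qed
    qed
    obtain p n x where x: "x \<in> P" "x \<in> hom_part N p n" "x \<noteq> 0" by (rule nonzero_homogeneous[OF P nz])
    have one: "(axis 1 g, 0) \<in> P" for g
    proof (cases "p = s")
      case True
      then have "snd x = 0" "\<And>i. fst x $ i \<in> lhom n" "fst x \<noteq> 0" using x by (auto simp: nat_hom_def prod_eq_iff)
      then show ?thesis using even[of "fst x" n g] x(1) by (cases x) simp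
    next
      case False
      then have x0: "fst x = 0" "\<And>i. snd x $ i \<in> lhom n" "snd x \<noteq> 0" using x by (auto simp: nat_hom_def prod_eq_iff)
      obtain w where w: "x = (0, w)" using x0(1) by (cases x) auto
      have wc: "w $ 1 = 0" "w $ 2 = 0" using sP(1)[OF x(1)] by (simp_all add: coord_4 w)
      define y :: lvec where "y = (\<chi> i. if i = 1 then lconst rt * w $ 3 else if i = 2 then - (lconst rt * w $ 4) else 0)"
      have y: "rho u (kap (iota (Poly_Mapping.single {2} 1))) x = (y, 0)"
        by (simp add: w y_def K3_monomial_simps prod_eq_iff vec_eq_iff forall_4 wc del: One_nat_def)
      have "y \<noteq> 0"
      proof
        assume "y = 0"
        then have "y $ 1 = 0" "y $ 2 = 0" by simp_all
        moreover have "lconst rt \<noteq> 0" using rt_nonzero lconst_mult_eq_0[of rt 1] by simp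
        ultimately have "w $ 3 = 0" "w $ 4 = 0" by (auto simp: y_def lconst_mult_eq_0)
        then show False using x0(3) wc by (simp add: w vec_eq_iff forall_4)
      qed
      moreover have "y $ i \<in> lhom n" for i using x0(2) by (simp add: y_def w)
      ultimately show ?thesis using even[of y n g] op[of "{2}" x 1] x(1) y by simp
    qed
    have two: "(axis 2 g, 0) \<in> P" and three: "(0, axis 3 g) \<in> P" for g
    proof -
      have "rho u (kap (iota (Poly_Mapping.single {1, 2} (lconst (1 / rt) * g)))) (axis 1 1, 0) = (axis 2 g, 0)"
        "rho u (kap (iota (Poly_Mapping.single {0, 1, 2} (lconst (1 / rt) * g)))) (axis 1 1, 0) = (0, axis 3 g)"
        by (simp_all add: K3_monomial_simps prod_eq_iff vec_eq_iff forall_4 axis_simps i del: One_nat_def)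
      then show "(axis 2 g, 0) \<in> P" "(0, axis 3 g) \<in> P"
        using op[OF _ one, of "{1, 2}" "lconst (1 / rt) * g" 1] op[OF _ one, of "{0, 1, 2}" "lconst (1 / rt) * g" 1]
        by (simp_all add: lessThan_3 del: One_nat_def)
    qed
    have four: "(0, axis 4 g) \<in> P" for g
    proof -
      have "rho u (kap (iota (Poly_Mapping.single {1, 2} (lconst (1 / rt) * g)))) (0, axis 3 1) = (0, axis 4 g)"
        by (simp_all add: K3_monomial_simps prod_eq_iff vec_eq_iff forall_4 axis_simps i del: One_nat_def)
      then show ?thesis using op[OF _ three, of "{1, 2}" "lconst (1 / rt) * g" 1] by (simp add: lessThan_3 del: One_nat_def)
    qed
    have "y \<in> P" if "y \<in> coord {1, 2} {3, 4}" for y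
    proof -
      have "(axis 1 (fst y $ 1), 0) + (axis 2 (fst y $ 2), 0) + ((0, axis 3 (snd y $ 3)) + (0, axis 4 (snd y $ 4))) \<in> P"
        by (intro sP(3) one two three four)
      moreover have "fst y = axis 1 (fst y $ 1) + axis 2 (fst y $ 2)" "snd y = axis 3 (snd y $ 3) + axis 4 (snd y $ 4)"
        using that axis_sum[of "fst y"] axis_sum[of "snd y"] by (simp_all add: coord_4 axis_zero)
      ultimately show ?thesis by (cases y) simp
    qed
    then show ?thesis using sP(1) by auto
  qed
  have "(axis 1 1, 0) \<in> coord {1, 2} {3, 4}" by (simp add: coord_4 axis_simps)
  moreover have "(axis 1 1, 0) \<noteq> (0 :: lvec \<times> lvec)" by (simp add: zero_prod_def vec_eq_iff axis_def)
  ultimately have "coord {1, 2} {3, 4} \<noteq> {0}" by auto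
  then show ?thesis using full by (auto simp: simple_smodule_def)
qed

text \<open>The signed permutation of coordinates induced by $\zeta_2 \leftrightarrow \eta_2$.\<close>

definition theta :: "lvec \<times> lvec \<Rightarrow> lvec \<times> lvec" where
  "theta x = (vector [0, 0, - fst x $ 2, fst x $ 1], vector [- snd x $ 4, snd x $ 3, 0, 0])"

definition theta' :: "lvec \<times> lvec \<Rightarrow> lvec \<times> lvec" where
  "theta' x = (vector [fst x $ 4, - fst x $ 3, 0, 0], vector [0, 0, snd x $ 2, - snd x $ 1])"

text \<open>On the image of \<open>K(3)\<close> the coefficients of \<open>S\<close> with
  \<open>2\<close> and \<open>3\<close> exchanged agree and \<open>hh\<close> vanishes, so the formulas
  for the two halves in \<open>rho_kap\<close> coincide up to signs.\<close>

lemma halves_isomorphic: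
  "smodule_isomorphic K3 (natmod (\<lambda>x. kap (iota x)) u {1, 2} {3, 4} s) (natmod (\<lambda>x. kap (iota x)) u {3, 4} {1, 2} s)"
    (is "smodule_isomorphic K3 ?M ?N")
    "smodule_isomorphic K3 (natmod (\<lambda>x. kap (iota x)) u {3, 4} {1, 2} s) (natmod (\<lambda>x. kap (iota x)) u {1, 2} {3, 4} s)"
proof -
  have t: "theta x \<in> coord {3, 4} {1, 2}" "theta' x \<in> coord {1, 2} {3, 4}" for x
    by (simp_all add: theta_def theta'_def coord_4 vector_4_nth)
  have inv: "x \<in> coord {1, 2} {3, 4} \<Longrightarrow> theta' (theta x) = x" "x \<in> coord {3, 4} {1, 2} \<Longrightarrow> theta (theta' x) = x" for x
    by (simp_all add: theta_def theta'_def coord_4 vector_4_nth prod_eq_iff vec_eq_iff forall_4)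
  have h: "x \<in> nat_hom s p n \<Longrightarrow> theta x \<in> nat_hom s p n" "x \<in> nat_hom s p n \<Longrightarrow> theta' x \<in> nat_hom s p n" for x p n
    by (auto simp: theta_def theta'_def nat_hom_def vector_4_nth vec_eq_iff forall_4)
  have lin: "theta (x + y) = theta x + theta y" "theta' (x + y) = theta' x + theta' y"
    "theta (psc c x) = psc c (theta x)" "theta' (psc c x) = psc c (theta' x)" for x y c
    by (simp_all add: theta_def theta'_def psc_def vector_4_nth prod_eq_iff vec_eq_iff forall_4)
  have act: "theta (rho u (kap (iota x)) y) = rho u (kap (iota x)) (theta y)" if "y \<in> coord {1, 2} {3, 4}" for x y
  proof -
    obtain v w where y: "y = (v, w)" by force
    show ?thesis using that unfolding y by (simp add: theta_def coord_4 K3_action_simps vector_4_nth prod_eq_iff vec_eq_iff forall_4 algebra_simps del: One_nat_def)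
  qed
  have act': "theta' (rho u (kap (iota x)) y) = rho u (kap (iota x)) (theta' y)" if "y \<in> coord {3, 4} {1, 2}" for x y
  proof -
    have "theta' (rho u (kap (iota x)) (theta (theta' y))) = rho u (kap (iota x)) (theta' y)"
      unfolding act[OF t(2), symmetric] by (rule inv(1)[OF halves_invariant(1)[OF t(2)]])
    then show ?thesis by (simp only: inv(2)[OF that])
  qed
  have "bij_betw theta (coord {1, 2} {3, 4}) (coord {3, 4} {1, 2})" "bij_betw theta' (coord {3, 4} {1, 2}) (coord {1, 2} {3, 4})"
    using bij_betw_byWitness[of "coord {1, 2} {3, 4}" theta' theta "coord {3, 4} {1, 2}"]
      bij_betw_byWitness[of "coord {3, 4} {1, 2}" theta theta' "coord {1, 2} {3, 4}"] inv t by blast+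
  moreover have "theta ` (coord {1, 2} {3, 4} \<inter> nat_hom s p n) = coord {3, 4} {1, 2} \<inter> nat_hom s p n"
    "theta' ` (coord {3, 4} {1, 2} \<inter> nat_hom s p n) = coord {1, 2} {3, 4} \<inter> nat_hom s p n" for p n
  proof -
    have image_eq: "f ` A = B" if "\<And>x. x \<in> A \<Longrightarrow> f x \<in> B" "\<And>x. x \<in> B \<Longrightarrow> g x \<in> A \<and> f (g x) = x"
      for f g :: "lvec \<times> lvec \<Rightarrow> lvec \<times> lvec" and A B
    proof
      show "B \<subseteq> f ` A" by (rule subsetI) (metis that(2) rev_image_eqI)
    qed (use that(1) in blast)
    show "theta ` (coord {1, 2} {3, 4} \<inter> nat_hom s p n) = coord {3, 4} {1, 2} \<inter> nat_hom s p n"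
      by (rule image_eq[where g = theta']) (simp_all add: t h inv)
    show "theta' ` (coord {3, 4} {1, 2} \<inter> nat_hom s p n) = coord {1, 2} {3, 4} \<inter> nat_hom s p n"
      by (rule image_eq[where g = theta]) (simp_all add: t h inv)
  qed
  ultimately have "iso_via K3 ?M ?N theta" "iso_via K3 ?N ?M theta'"
    using lin act act' by (simp_all add: iso_via_def)
  then show "smodule_isomorphic K3 ?M ?N" "smodule_isomorphic K3 ?N ?M" by (auto simp: smodule_isomorphic_via)
qed

lemma half_two: "lconst (1/2) * 2 = 1"
  unfolding mult_2_right using half_half[of 1] by simp

section \<open>The modules \<open>S\<^sup>+(u)\<close> and \<open>S\<^sup>-(u)\<close>\<close>

lemma K4hat_F_facts:
  "K4hat_F \<in> hom_part K4hat False 0" "bracket K4hat K4hat_F K4hat_F = \<zero>\<^bsub>K4hat\<^esub>" "bracket K4hat K4hat_F \<zero>\<^bsub>K4hat\<^esub> = \<zero>\<^bsub>K4hat\<^esub>"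
  "kap K4hat_F = Hop (\<lambda>i. of_int ((vector [3, -3, 1, -1] :: int ^ 4) $ i))"
proof -
  have n: "S = {0, 1} \<or> S = {2, 3}" if "Poly_Mapping.lookup (hF a b) S \<noteq> 0" for S a b
    using that by (auto simp: hF_def lookup_add lookup_gmon split: if_splits)
  have c: "hF 2 4 \<in> K4c" using hF_carrier(1) by (simp add: K4c_def lookup_hF del: One_nat_def)
  moreover have "odd (card S) = False \<and> Poly_Mapping.lookup (hF 2 4) S \<in> lhom 0" if "S \<in> Poly_Mapping.keys (hF 2 4)" for S
  proof -
    have "S = {0, 1} \<or> S = {2, 3}" using n that by (simp only: in_keys_iff)
    then show ?thesis by (elim disjE) (simp_all add: lookup_hF del: One_nat_def)
  qed
  ultimately show "K4hat_F \<in> hom_part K4hat False 0" using hF_carrier(1) by (simp add: F_hF)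
  have z: "gw 2 4 U \<noteq> 0 \<longrightarrow> Poly_Mapping.lookup (hF 2 4) U = 0" for U
    using n[of 2 4 U] by (cases "Poly_Mapping.lookup (hF 2 4) U = 0") (auto simp: gw_def)
  have "K4hat_F \<in> ad_eigenspace K4hat K4hat_F 0" "\<zero>\<^bsub>K4hat\<^esub> \<in> ad_eigenspace K4hat K4hat_F 0"
    using c z K4c_closed(1) unfolding F_hF(1) K4hat_simps zero_prod_def by (simp_all add: ad_eigen_K4hat[unfolded F_hF(1)])
  then show "bracket K4hat K4hat_F K4hat_F = \<zero>\<^bsub>K4hat\<^esub>" "bracket K4hat K4hat_F \<zero>\<^bsub>K4hat\<^esub> = \<zero>\<^bsub>K4hat\<^esub>"
    unfolding centralizer_eigen[OF K4hat_module, symmetric] by (simp_all add: centralizer_def del: K4hat_simps)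
  show "kap K4hat_F = Hop (\<lambda>i. of_int ((vector [3, -3, 1, -1] :: int ^ 4) $ i))"
    unfolding F_hF(1) kap_F
    by (rule arg_cong[where f = Hop]) (simp add: fun_eq_iff forall_4 vector_4_nth)
qed

lemma K4hat_bracket_closed: "x \<in> carrier K4hat \<Longrightarrow> y \<in> carrier K4hat \<Longrightarrow> bracket K4hat x y \<in> carrier K4hat"
  using K4c_closed(4) K4c_carrier(1) by auto

text \<open>The general element of the centralizer of $F$.\<close>

definition z4 :: "laurent \<Rightarrow> laurent \<Rightarrow> laurent \<Rightarrow> laurent \<Rightarrow> laurent grass \<times> complex" where
  "z4 f h1 h2 h3 = (gtens (gmon {}) f + gtens (gmon {0, 1}) h1 + gtens (gmon {2, 3}) h2, 0) + K4hat_c h3"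

lemma lookup_z4: "U \<subseteq> {0, 1, 2, 3} \<Longrightarrow> Poly_Mapping.lookup (fst (z4 f h1 h2 h3)) U =
   (if U = {} then f else 0) + (if U = {0, 1} then h1 else 0) + (if U = {2, 3} then h2 else 0) + (if U = {0, 1, 2, 3} then lD h3 else 0)"
  by (simp add: z4_def K4hat_c_def lookup_add lookup_gmon eq_commute[of U])

lemma z4_carrier: "z4 f h1 h2 h3 \<in> carrier K4hat"
proof -
  have "fst (z4 f h1 h2 h3) \<in> K_carrier 4"
    unfolding z4_def K4hat_c_def fst_add fst_conv gtens_gmon by (intro K_carrier_closed; simp)
  moreover have "Poly_Mapping.lookup (fst (z4 f h1 h2 h3)) {0, 1, 2, 3} = lD h3"
    by (simp add: lookup_z4 small_set_eq_iff del: One_nat_def)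
  ultimately show ?thesis unfolding K4hat_simps mem_Times_iff by (simp add: K4c_def)
qed

lemma hh_z4: "hh (z4 f h1 h2 h3) = h3"
proof -
  have "Poly_Mapping.lookup (fst (z4 f h1 h2 h3)) {0, 1, 2, 3} = lD h3"
    by (simp add: lookup_z4 small_set_eq_iff del: One_nat_def)
  moreover have "snd (z4 f h1 h2 h3) = Poly_Mapping.lookup h3 0" by (simp add: z4_def K4hat_c_def)
  ultimately show ?thesis by (simp only: hh_def lI_lD)
qed

text \<open>The monomials of weight zero are \<open>1\<close>, $\zeta_1\eta_1$, $\zeta_2\eta_2$ and
  their product; the last one together with the centre is parametrized by \<open>K4hat_c\<close>.\<close>

lemma K4hat_centralizer: "centralizer K4hat K4hat_F = {z4 f h1 h2 h3 | f h1 h2 h3. True}"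
proof (intro equalityI subsetI)
  fix z assume "z \<in> centralizer K4hat K4hat_F"
  then have z: "fst z \<in> K4c" "\<And>U. gw 2 4 U \<noteq> 0 \<Longrightarrow> Poly_Mapping.lookup (fst z) U = 0"
    unfolding centralizer_eigen[OF K4hat_module] by (cases z, simp add: ad_eigen_K4hat)+
  let ?c = "Poly_Mapping.lookup (fst z)"
  have h: "lD (hh z) = ?c {0, 1, 2, 3}" "Poly_Mapping.lookup (hh z) 0 = snd z"
    using lD_lI[OF K4c_carrier(2)[OF z(1)]] by (simp_all add: hh_def lookup_add lookup_lI lookup_lconst)
  have "fst z = fst (z4 (?c {}) (?c {0, 1}) (?c {2, 3}) (hh z))"
  proof (rule sub_eqI)
    show "fst (z4 (?c {}) (?c {0, 1}) (?c {2, 3}) (hh z)) \<in> K_carrier 4" "fst z \<in> K_carrier 4"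
      using z4_carrier K4c_carrier(1) z(1) by (auto simp: mem_Times_iff)
    show "?c U = Poly_Mapping.lookup (fst (z4 (?c {}) (?c {0, 1}) (?c {2, 3}) (hh z))) U"
      if "U \<in> {{}, {0}, {1}, {2}, {3}, {0, 1}, {0, 2}, {0, 3}, {1, 2}, {1, 3}, {2, 3},
        {0, 1, 2}, {0, 1, 3}, {0, 2, 3}, {1, 2, 3}, {0, 1, 2, 3}}" for U
      using that
      apply (simp only: insert_iff empty_iff)
      apply (elim disjE FalseE; simp add: lookup_z4 h z(2) gw_def small_set_eq_iff del: One_nat_def)
      done
  qed
  moreover have "snd z = snd (z4 (?c {}) (?c {0, 1}) (?c {2, 3}) (hh z))" using h(2) by (simp add: z4_def K4hat_c_def)
  ultimately have "z = z4 (?c {}) (?c {0, 1}) (?c {2, 3}) (hh z)" by (rule prod_eqI)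
  then show "z \<in> {z4 f h1 h2 h3 | f h1 h2 h3. True}" by blast
next
  fix z assume "z \<in> {z4 f h1 h2 h3 | f h1 h2 h3. True}"
  then obtain f h1 h2 h3 where z: "z = z4 f h1 h2 h3" by blast
  have c: "fst z \<in> K4c" using z4_carrier z by (auto simp: mem_Times_iff)
  have "Poly_Mapping.lookup (fst z) U = 0" if "gw 2 4 U \<noteq> 0" for U
  proof (cases "U \<subseteq> {0, 1, 2, 3}")
    case True
    have "gw 2 4 {} = 0" "gw 2 4 {0, 1} = 0" "gw 2 4 {2, 3} = 0" "gw 2 4 {0, 1, 2, 3} = 0"
      by (simp_all add: gw_def del: One_nat_def)
    then have "U \<noteq> {}" "U \<noteq> {0, 1}" "U \<noteq> {2, 3}" "U \<noteq> {0, 1, 2, 3}" using that by metis+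
    then show ?thesis unfolding z by (simp only: lookup_z4[OF True] if_False add_0_left)
  next
    case False
    then show ?thesis using K4c_carrier(1)[OF c] by (simp add: K_carrier_iff lessThan_4 del: One_nat_def)
  qed
  then show "z \<in> centralizer K4hat K4hat_F"
    unfolding centralizer_eigen[OF K4hat_module] using c by (cases z) (simp add: ad_eigen_K4hat)
qed

lemma K4hat_pos_carrier: "pos_part K4hat K4hat_F \<subseteq> carrier K4hat"
  using subspD(1)[OF subsp_lin_span[OF K4hat_module, of "\<Union>k\<in>{1..}. ad_eigenspace K4hat K4hat_F k"]]
  unfolding pos_part_def by (auto simp: ad_eigenspace_def)

lemma K4hat_monomial: "S \<subseteq> {..<4} \<Longrightarrow> S \<noteq> {0, 1, 2, 3} \<Longrightarrow> (Poly_Mapping.single S (lconst c), 0) \<in> hom_part K4hat (odd (card S)) 0"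
  using K_carrier_closed(4)[of S 4 "lconst c"]
  by (auto simp: K4c_def lookup_single when_def lconst_simps split: if_splits)

text \<open>Simplicity is inherited from \<open>K(3)\<close>.\<close>

lemma halves_simple: "simple_smodule K4hat (natmod kap u {1, 2} {3, 4} s)" "simple_smodule K4hat (natmod kap u {3, 4} {1, 2} s)"
proof -
  interpret P: natural_module K4hat kap u "{1, 2}" "{3, 4}" s by (rule K4hat_natural)
  interpret Q: natural_module K4hat kap u "{3, 4}" "{1, 2}" s by (rule K4hat_natural)
  interpret R: natural_module K3 "\<lambda>x. kap (iota x)" u "{3, 4}" "{1, 2}" s by (rule K3_natural)
  interpret T: natural_module K3 "\<lambda>x. kap (iota x)" u "{1, 2}" "{3, 4}" s by (rule K3_natural)
  have i: "iota ` carrier K3 \<subseteq> carrier K4hat" using iota_embedding by (simp add: lie_superalgebra_embedding_def)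
  show "simple_smodule K4hat P.N"
    by (rule simple_restrict[OF smodD(1)[OF P.nat_smod] _ i]) (simp only: natmod_restrict V_plus_simple)
  obtain h where "bij_betw h (carrier R.N) (carrier T.N)" "epi K3 R.N T.N h"
    by (rule iso_epi[OF halves_isomorphic(2) R.nat_smod T.nat_smod])
  then have "simple_smodule K3 R.N" by (rule iso_simple[OF _ _ R.nat_smod V_plus_simple])
  then show "simple_smodule K4hat Q.N"
    by (intro simple_restrict[OF smodD(1)[OF Q.nat_smod] _ i]) (simp only: natmod_restrict)
qed


lemma z4_pos: "x \<in> centralizer K4hat K4hat_F <+>\<^bsub>K4hat\<^esub> pos_part K4hat K4hat_F \<longleftrightarrow>
   (\<exists>f h1 h2 h3. \<exists>y\<in>pos_part K4hat K4hat_F. x = z4 f h1 h2 h3 + y)"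
  unfolding set_add_def' K4hat_centralizer K4hat_simps(3) by blast

lemma K4hat_act_def': "K4hat_tens_action l1 l2 lc \<delta> u x v = (THE r. \<exists>f h1 h2 h3. \<exists>y\<in>pos_part K4hat K4hat_F. x = z4 f h1 h2 h3 + y \<and>
     r = vir_density \<delta> u f v + (lconst l1 * h1 + lconst l2 * h2 + lconst lc * h3) * v)"
  by (simp add: K4hat_tens_action_def z4_def)

text \<open>The two modules differ only in the top vector and the density, so both are treated at once.\<close>

lemma K4hat_model:
  fixes u :: complex and j :: "laurent \<Rightarrow> lvec \<times> lvec" and A A' :: "4 set" and s :: bool
  defines "N \<equiv> natmod kap u A A' s"
  assumes nat: "natural_module K4hat kap u A A'" and simple: "simple_smodule K4hat N"
    and j: "\<And>f g. j (f + g) = j f + j g" "\<And>c f. j (lconst c * f) = psc (lconst c) (j f)" "\<And>f. j f \<in> coord A A'" "inj j"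
      "\<And>f n. f \<in> lhom n \<Longrightarrow> j f \<in> nat_hom s False n"
      "\<And>f i. fst (j f) $ i \<noteq> 0 \<Longrightarrow> i = 1" "\<And>f i. snd (j f) $ i \<noteq> 0 \<Longrightarrow> i = 2"
    and act: "\<And>f h1 h2 h3 v. rho u (kap (z4 f h1 h2 h3)) (j v) =
      j (vir_density \<delta> u f v + (lconst (1/2) * h1 + lconst (1/2) * h2 + lconst lc * h3) * v)"
    and gen: "\<And>p n x. x \<in> coord A A' \<inter> nat_hom s p n \<Longrightarrow> x \<in> lin_span N ({j f | f. \<not> p \<and> f \<in> lhom n} \<union>
      {rho u (kap (Poly_Mapping.single S (lconst c), 0)) (j f) | S c f. S \<subseteq> {..<4} \<and> S \<noteq> {0, 1, 2, 3} \<and> odd (card S) = p \<and> f \<in> lhom n})"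
  shows "smodule_isomorphic K4hat (K4hat_V (1/2) (1/2) lc \<delta> u) N \<and> smodule_isomorphic K4hat N (K4hat_V (1/2) (1/2) lc \<delta> u)"
proof -
  interpret nm: natural_module K4hat kap u A A' s by (rule nat)
  define M where "M = laurent_module (K4hat_tens_action (1/2) (1/2) lc \<delta> u)"
  have w: "(vector [3, -3, 1, -1] :: int ^ 4) $ i \<le> 3" "- (vector [3, -3, 1, -1] :: int ^ 4) $ i \<le> 3" for i
    using forall_4[of "\<lambda>i. (vector [3, -3, 1, -1] :: int ^ 4) $ i \<le> 3 \<and> - (vector [3, -3, 1, -1] :: int ^ 4) $ i \<le> 3"]
    by (simp_all add: vector_4_nth)
  have Mc: "carrier M = UNIV" by (simp add: M_def)
  have setting: "weight_setting K4hat K4hat_F M nm.N j 3"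
  proof (rule nm.weight_settingI[OF K4hat_F_facts(1,4,2,3) K4hat_span])
    show "j v \<in> nat_hom s p n" if "v \<in> hom_part M p n" for v p n
      using that j(5) j(2)[of 0 0] by (auto simp: M_def lconst_simps psc_simps nat_hom_closed split: if_splits)
    show "(vector [3, -3, 1, -1] :: int ^ 4) $ i = 3" if "fst (j v) $ i \<noteq> 0" for v i
      using j(6)[OF that] by (simp add: vector_4_nth)
    show "- (vector [3, -3, 1, -1] :: int ^ 4) $ i = 3" if "snd (j v) $ i \<noteq> 0" for v i
      using j(7)[OF that] by (simp add: vector_4_nth)
  qed (use K4hat_bracket_closed j(1-4) laurent_module_vs w in \<open>simp_all add: M_def\<close>)
  interpret W: weight_setting K4hat K4hat_F M nm.N j 3 by (rule setting)
  let ?B = "centralizer K4hat K4hat_F <+>\<^bsub>K4hat\<^esub> pos_part K4hat K4hat_F"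
  have kpos: "rho u (kap (z4 f h1 h2 h3 + y)) (j v) = rho u (kap (z4 f h1 h2 h3)) (j v)"
    if y: "y \<in> pos_part K4hat K4hat_F" for f h1 h2 h3 y v
  proof -
    have "action nm.N (z4 f h1 h2 h3 \<oplus>\<^bsub>K4hat\<^esub> y) (j v) = action nm.N (z4 f h1 h2 h3) (j v) + action nm.N y (j v)"
      by (rule nm.nat_act_add[OF z4_carrier]) (use K4hat_pos_carrier y j(3) in auto)
    then show ?thesis using W.pos_part_annihilates[OF y, of v] by (simp add: Mc)
  qed
  have act': "j (action M x v) = action nm.N x (j v)" if x: "x \<in> ?B" for x v
  proof -
    obtain f h1 h2 h3 y where x': "y \<in> pos_part K4hat K4hat_F" "x = z4 f h1 h2 h3 + y" using x unfolding z4_pos by blast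
    define fm where "fm f h1 h2 h3 = vir_density \<delta> u f v + (lconst (1/2) * h1 + lconst (1/2) * h2 + lconst lc * h3) * v" for f h1 h2 h3
    define Q where "Q r \<longleftrightarrow> (\<exists>f h1 h2 h3. \<exists>y\<in>pos_part K4hat K4hat_F. x = z4 f h1 h2 h3 + y \<and> r = fm f h1 h2 h3)" for r
    have "j r = rho u (kap x) (j v)" if Q: "Q r" for r
    proof -
      obtain f h1 h2 h3 y where q: "y \<in> pos_part K4hat K4hat_F" "x = z4 f h1 h2 h3 + y" "r = fm f h1 h2 h3"
        using Q unfolding Q_def by blast
      show ?thesis unfolding q(2,3) kpos[OF q(1)] act fm_def ..
    qed
    moreover have "Q (fm f h1 h2 h3)" unfolding Q_def using x' by blast
    ultimately have "j (THE r. Q r) = rho u (kap x) (j v)" by (rule the_action[OF _ _ j(4)])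
    then show ?thesis by (simp only: M_def laurent_module_simps K4hat_act_def' natmod_simps Q_def fm_def)
  qed
  have model: "highest_weight_model K4hat K4hat_F M nm.N j 3 (nat_pr s) 1"
  proof (rule highest_weight_model.intro[OF setting], rule highest_weight_model_axioms.intro)
    show "carrier M \<subseteq> lin_span M (\<Union>p n. hom_part M p n)" unfolding M_def by (rule laurent_module_span)
    show "\<exists>b\<in>?B. v = action M b 1" for v
    proof
      \<comment> \<open>$\zeta_1\eta_1$ has weight $1/2$, so $\zeta_1\eta_1(2v)$ takes \<open>1\<close> to \<open>v\<close>\<close>
      have "z4 0 (v + v) 0 0 + 0 = z4 0 (v + v) 0 0" "0 \<in> pos_part K4hat K4hat_F"
        using subspD(2)[OF W.subsp_pos_part] by simp_all
      then show b: "z4 0 (v + v) 0 0 \<in> ?B" unfolding z4_pos by metis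
      have "j (action M (z4 0 (v + v) 0 0) 1) = j v"
        unfolding act'[OF b] natmod_simps act by (simp add: vir_density_def mult.assoc[symmetric] half_two)
      then show "v = action M (z4 0 (v + v) 0 0) 1" using j(4) by (simp add: inj_eq)
    qed
    show "simple_smodule K4hat nm.N" using simple by (simp add: N_def)
    show "carrier nm.N \<subseteq> lin_span nm.N (\<Union>p n. hom_part nm.N p n)" by (rule nm.nat_span)
    show "hom_part nm.N p n \<subseteq> lin_span nm.N (j ` hom_part M p n \<union>
      {action nm.N x (j v) |x v q m. x \<in> hom_part K4hat q m \<and> v \<in> hom_part M (p \<noteq> q) (n - m)})" (is "_ \<subseteq> lin_span _ ?G") for p n
    proof
      fix x assume "x \<in> hom_part nm.N p n"
      then have "x \<in> coord A A' \<inter> nat_hom s p n" by simp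
      note g = gen[OF this, unfolded N_def]
      have "{j f | f. \<not> p \<and> f \<in> lhom n} \<subseteq> ?G" by (auto simp: M_def)
      moreover have "rho u (kap (Poly_Mapping.single S (lconst c), 0)) (j f) \<in> ?G"
        if "S \<subseteq> {..<4}" "S \<noteq> {0, 1, 2, 3}" "odd (card S) = p" "f \<in> lhom n" for S c f
      proof -
        have "(Poly_Mapping.single S (lconst c), 0) \<in> hom_part K4hat p 0" using K4hat_monomial[OF that(1,2), of c] that(3) by simp
        moreover have "f \<in> hom_part M (p \<noteq> p) (n - 0)" using that(4) by (simp add: M_def)
        moreover have "rho u (kap (Poly_Mapping.single S (lconst c), 0)) (j f) = action nm.N (Poly_Mapping.single S (lconst c), 0) (j f)" by simp
        ultimately show ?thesis by blast
      qed
      ultimately have "{j f | f. \<not> p \<and> f \<in> lhom n} \<union>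
        {rho u (kap (Poly_Mapping.single S (lconst c), 0)) (j f) | S c f. S \<subseteq> {..<4} \<and> S \<noteq> {0, 1, 2, 3} \<and> odd (card S) = p \<and> f \<in> lhom n} \<subseteq> ?G"
        by blast
      moreover have "action nm.N y (j v) \<in> carrier nm.N" if "y \<in> hom_part K4hat q m" for y q m v
        using nm.inv[OF subsetD[OF K4hat_hom_carrier that] j(3)] by simp
      then have "?G \<subseteq> carrier nm.N" using j(3) by (auto simp del: K4hat_simps natmod_simps(6))
      ultimately show "x \<in> lin_span nm.N ?G"
        using g lin_span_mono[OF smodD(1)[OF nm.nat_smod]] lin_span_superset[OF smodD(1)[OF nm.nat_smod], of ?G]
        by (meson order_trans subsetD)
    qed
  qed (use act' nat_pr_same nat_pr_other nat_pr_add in \<open>auto simp: M_def\<close>)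
  then interpret H: highest_weight_model K4hat K4hat_F M nm.N j 3 "nat_pr s" 1 .
  show ?thesis
    using H.highest_quotient_isomorphic H.isomorphic_highest_quotient by (simp_all add: K4hat_V_def M_def N_def)
qed


lemmas K4hat_monomial_simps = rho_kap hh_def lI_simps lookup_single when_def small_set_eq_iff lconst_simps(5,6)

lemma span_axes_halves:
  assumes nat: "natural_module L \<kappa> u A A'" and x: "x \<in> coord A A'" and G: "G \<subseteq> coord A A'"
    and V: "\<And>i. i \<in> A \<Longrightarrow> fst x \<noteq> 0 \<Longrightarrow> (axis i (fst x $ i), 0) \<in> G" and W: "\<And>i. i \<in> A' \<Longrightarrow> snd x \<noteq> 0 \<Longrightarrow> (0, axis i (snd x $ i)) \<in> G"
  shows "x \<in> lin_span (natmod \<kappa> u A A' s) G"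
proof -
  interpret natural_module L \<kappa> u A A' s by (rule nat)
  show ?thesis
  proof (rule span_axes)
    show "(axis i (fst x $ i), 0) \<in> G" if nz: "fst x $ i \<noteq> 0" for i
    proof (rule V)
      show "i \<in> A" using x nz by (auto simp: coord_def)
      show "fst x \<noteq> 0" using nz by auto
    qed
    show "(0, axis i (snd x $ i)) \<in> G" if nz: "snd x $ i \<noteq> 0" for i
    proof (rule W)
      show "i \<in> A'" using x nz by (auto simp: coord_def)
      show "snd x \<noteq> 0" using nz by auto
    qed
  qed (use G in simp)
qed

lemma kap_monomial_inv:
  assumes nat: "natural_module K4hat kap u A A'" and "S \<subseteq> {..<4}" "S \<noteq> {0, 1, 2, 3}" "v \<in> coord A A'"
  shows "rho u (kap (Poly_Mapping.single S (lconst c), 0)) v \<in> coord A A'"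
proof -
  interpret natural_module K4hat kap u A A' False by (rule nat)
  show ?thesis using inv[OF subsetD[OF L_hom K4hat_monomial[OF assms(2,3), of c]] assms(4)] .
qed

text \<open>The top vectors are multiples of \<open>x_1\<close>; $\eta_1\eta_2$, $\zeta_1\eta_1\eta_2$
  and $\eta_1\zeta_2\eta_2$ lead from it to the other three coordinates.\<close>

lemma S_plus_natural:
  "smodule_isomorphic K4hat (S_plus u) (natmod kap u {1, 2} {3, 4} False)"
  "smodule_isomorphic K4hat (natmod kap u {1, 2} {3, 4} False) (S_plus u)"
proof -
  let ?j = "\<lambda>f :: laurent. (axis 1 f :: lvec, 0 :: lvec)"
  note nat = K4hat_natural(1)[of u]
  have jc: "?j f \<in> coord {1, 2} {3, 4}" for f by (simp add: coord_4 axis_simps)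
  have "smodule_isomorphic K4hat (K4hat_V (1/2) (1/2) 1 (1/4) u) (natmod kap u {1, 2} {3, 4} False) \<and>
    smodule_isomorphic K4hat (natmod kap u {1, 2} {3, 4} False) (K4hat_V (1/2) (1/2) 1 (1/4) u)"
  proof (rule K4hat_model[OF nat halves_simple(1), where j = ?j])
    show "rho u (kap (z4 f h1 h2 h3)) (?j v) =
        ?j (vir_density (1/4) u f v + (lconst (1/2) * h1 + lconst (1/2) * h2 + lconst 1 * h3) * v)" for f h1 h2 h3 v
      by (simp add: rho_kap hh_z4 lookup_z4 small_set_eq_iff axis_simps vir_density_alt prod_eq_iff vec_eq_iff forall_4 lconst_simps(6) algebra_simps del: One_nat_def)
    show "x \<in> lin_span (natmod kap u {1, 2} {3, 4} False) ({?j f | f. \<not> p \<and> f \<in> lhom n} \<union>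
      {rho u (kap (Poly_Mapping.single S (lconst c), 0)) (?j f) | S c f. S \<subseteq> {..<4} \<and> S \<noteq> {0, 1, 2, 3} \<and> odd (card S) = p \<and> f \<in> lhom n})"
      (is "_ \<in> lin_span _ ?G") if x: "x \<in> coord {1, 2} {3, 4} \<inter> nat_hom False p n" for p n x
    proof (rule span_axes_halves[OF nat])
      show "?G \<subseteq> coord {1, 2} {3, 4}" using jc kap_monomial_inv[OF nat _ _ jc] by blast
      have mono: "rho u (kap (Poly_Mapping.single S (lconst c), 0)) (?j f) \<in> ?G"
        if "S \<subseteq> {..<4}" "S \<noteq> {0, 1, 2, 3}" "odd (card S) = p" "f \<in> lhom n" for S c f using that by blast
      have l: "fst x $ i \<in> lhom n" "snd x $ i \<in> lhom n" for i using x by (auto simp: nat_hom_def)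
      show "(axis i (fst x $ i), 0) \<in> ?G" if i: "i \<in> {1, 2}" and nz: "fst x \<noteq> 0" for i
      proof -
        have p: "\<not> p" using x nz by (auto simp: nat_hom_def)
        show ?thesis
        proof (cases "i = 1")
          case True then show ?thesis using p l(1) by blast
        next
          case False
          then have i2: "i = 2" using i by simp
          have "rho u (kap (Poly_Mapping.single {1, 3} (lconst 1), 0)) (?j (fst x $ i)) = (axis i (fst x $ i), 0)"
            unfolding i2 by (simp add: K4hat_monomial_simps axis_simps prod_eq_iff vec_eq_iff forall_4 del: One_nat_def)
          then show ?thesis using mono[of "{1, 3}" "fst x $ i" 1] p l(1) by (simp add: small_set_eq_iff lessThan_4 del: One_nat_def)
        qed
      qed
      show "(0, axis i (snd x $ i)) \<in> ?G" if i: "i \<in> {3, 4}" and nz: "snd x \<noteq> 0" for i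
      proof -
        have p: "p" using x nz by (auto simp: nat_hom_def split: if_splits)
        show ?thesis
        proof (cases "i = 3")
          case True
          have "rho u (kap (Poly_Mapping.single {0, 1, 3} (lconst 1), 0)) (?j (snd x $ i)) = (0, axis i (snd x $ i))"
            unfolding True by (simp add: K4hat_monomial_simps axis_simps prod_eq_iff vec_eq_iff forall_4 del: One_nat_def)
          then show ?thesis using mono[of "{0, 1, 3}" "snd x $ i" 1] p l(2) by (simp add: small_set_eq_iff lessThan_4 del: One_nat_def)
        next
          case False
          then have i2: "i = 4" using i by simp
          have "rho u (kap (Poly_Mapping.single {1, 2, 3} (lconst 1), 0)) (?j (snd x $ i)) = (0, axis i (snd x $ i))"
            unfolding i2 by (simp add: K4hat_monomial_simps axis_simps prod_eq_iff vec_eq_iff forall_4 del: One_nat_def)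
          then show ?thesis using mono[of "{1, 2, 3}" "snd x $ i" 1] p l(2) by (simp add: small_set_eq_iff lessThan_4 del: One_nat_def)
        qed
      qed
    qed (use x in simp)
  qed (auto simp: axis_simps psc_def jc inj_def axis_inj nat_hom_def axis_zero split: if_splits)
  then show "smodule_isomorphic K4hat (S_plus u) (natmod kap u {1, 2} {3, 4} False)"
    "smodule_isomorphic K4hat (natmod kap u {1, 2} {3, 4} False) (S_plus u)" by (simp_all add: S_plus_def)
qed

text \<open>The top vectors are the multiples of $x_2^*$, on which the centre acts by $-1$ and
  \<open>Vir\<close> with density $3/4$; this half is taken with exchanged parities, so that the top
  becomes even. One letter, $\eta_1\eta_2$, $\eta_1$ or $\eta_2$, leads to each other coordinate.\<close>

lemma S_minus_natural:
  "smodule_isomorphic K4hat (S_minus u) (natmod kap u {3, 4} {1, 2} True)"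
  "smodule_isomorphic K4hat (natmod kap u {3, 4} {1, 2} True) (S_minus u)"
proof -
  let ?j = "\<lambda>f :: laurent. (0 :: lvec, axis 2 f :: lvec)"
  note nat = K4hat_natural(2)[of u]
  have jc: "?j f \<in> coord {3, 4} {1, 2}" for f by (simp add: coord_4 axis_simps)
  have "smodule_isomorphic K4hat (K4hat_V (1/2) (1/2) (- 1) (3/4) u) (natmod kap u {3, 4} {1, 2} True) \<and>
    smodule_isomorphic K4hat (natmod kap u {3, 4} {1, 2} True) (K4hat_V (1/2) (1/2) (- 1) (3/4) u)"
  proof (rule K4hat_model[OF nat halves_simple(2), where j = ?j])
    show "rho u (kap (z4 f h1 h2 h3)) (?j v) =
        ?j (vir_density (3/4) u f v + (lconst (1/2) * h1 + lconst (1/2) * h2 + lconst (- 1) * h3) * v)" for f h1 h2 h3 v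
      by (simp add: rho_kap hh_z4 lookup_z4 small_set_eq_iff axis_simps vir_density_alt prod_eq_iff vec_eq_iff forall_4 lconst_simps(3,6) algebra_simps del: One_nat_def)
    show "x \<in> lin_span (natmod kap u {3, 4} {1, 2} True) ({?j f | f. \<not> p \<and> f \<in> lhom n} \<union>
      {rho u (kap (Poly_Mapping.single S (lconst c), 0)) (?j f) | S c f. S \<subseteq> {..<4} \<and> S \<noteq> {0, 1, 2, 3} \<and> odd (card S) = p \<and> f \<in> lhom n})"
      (is "_ \<in> lin_span _ ?G") if x: "x \<in> coord {3, 4} {1, 2} \<inter> nat_hom True p n" for p n x
    proof (rule span_axes_halves[OF nat])
      show "?G \<subseteq> coord {3, 4} {1, 2}" using jc kap_monomial_inv[OF nat _ _ jc] by blast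
      have mono: "rho u (kap (Poly_Mapping.single S (lconst c), 0)) (?j f) \<in> ?G"
        if "S \<subseteq> {..<4}" "S \<noteq> {0, 1, 2, 3}" "odd (card S) = p" "f \<in> lhom n" for S c f using that by blast
      have l: "fst x $ i \<in> lhom n" "snd x $ i \<in> lhom n" for i using x by (auto simp: nat_hom_def)
      show "(axis i (fst x $ i), 0) \<in> ?G" if i: "i \<in> {3, 4}" and nz: "fst x \<noteq> 0" for i
      proof -
        have p: "p" using x nz by (auto simp: nat_hom_def split: if_splits)
        show ?thesis
        proof (cases "i = 3")
          case True
          have "rho u (kap (Poly_Mapping.single {1} (lconst (- 1)), 0)) (?j (fst x $ i)) = (axis i (fst x $ i), 0)"
            unfolding True by (simp add: K4hat_monomial_simps axis_simps prod_eq_iff vec_eq_iff forall_4 lconst_simps(3) del: One_nat_def)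
          then show ?thesis using mono[of "{1}" "fst x $ i" "- 1"] p l(1) by (simp add: small_set_eq_iff lessThan_4 del: One_nat_def)
        next
          case False
          then have i4: "i = 4" using i by simp
          have "rho u (kap (Poly_Mapping.single {3} (lconst (1)), 0)) (?j (fst x $ i)) = (axis i (fst x $ i), 0)"
            unfolding i4 by (simp add: K4hat_monomial_simps axis_simps prod_eq_iff vec_eq_iff forall_4 lconst_simps(3) del: One_nat_def)
          then show ?thesis using mono[of "{3}" "fst x $ i" "1"] p l(1) by (simp add: small_set_eq_iff lessThan_4 del: One_nat_def)
        qed
      qed
      show "(0, axis i (snd x $ i)) \<in> ?G" if i: "i \<in> {1, 2}" and nz: "snd x \<noteq> 0" for i
      proof -
        have p: "\<not> p" using x nz by (auto simp: nat_hom_def split: if_splits)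
        show ?thesis
        proof (cases "i = 2")
          case True then show ?thesis using p l(2) by blast
        next
          case False
          then have i1: "i = 1" using i by simp
          have "rho u (kap (Poly_Mapping.single {1, 3} (lconst (- 1)), 0)) (?j (snd x $ i)) = (0, axis i (snd x $ i))"
            unfolding i1 by (simp add: K4hat_monomial_simps axis_simps prod_eq_iff vec_eq_iff forall_4 lconst_simps(3) del: One_nat_def)
          then show ?thesis using mono[of "{1, 3}" "snd x $ i" "- 1"] p l(2) by (simp add: small_set_eq_iff lessThan_4 del: One_nat_def)
        qed
      qed
    qed (use x in simp)
  qed (auto simp: axis_simps psc_def jc inj_def axis_inj nat_hom_def axis_zero split: if_splits)
  then show "smodule_isomorphic K4hat (S_minus u) (natmod kap u {3, 4} {1, 2} True)"
    "smodule_isomorphic K4hat (natmod kap u {3, 4} {1, 2} True) (S_minus u)" by (simp_all add: S_minus_def)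
qed

section \<open>The module \<open>S(u)\<close>\<close>

abbreviation "kio \<equiv> \<lambda>x. kap (iota x)"

lemma K3_F_facts:
  "K3_F \<in> hom_part K3 False 0" "bracket K3 K3_F K3_F = \<zero>\<^bsub>K3\<^esub>" "bracket K3 K3_F \<zero>\<^bsub>K3\<^esub> = \<zero>\<^bsub>K3\<^esub>"
  "kap (iota K3_F) = Hop (\<lambda>i. of_int ((vector [1, -1, -1, 1] :: int ^ 4) $ i))"
proof -
  have s: "hF 2 0 = Poly_Mapping.single {0, 1} (lconst 2)"
    unfolding hF_def gtens_gmon by (simp add: lconst_simps)
  show "K3_F \<in> hom_part K3 False 0" using hF_carrier(2)[of 2] unfolding F_hF s K3_def by simp
  have z: "gw 2 0 U \<noteq> 0 \<longrightarrow> Poly_Mapping.lookup (hF 2 0) U = 0" for U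
    unfolding s by (auto simp: lookup_single when_def gw_def)
  have "K3_F \<in> ad_eigenspace K3 K3_F 0" "\<zero>\<^bsub>K3\<^esub> \<in> ad_eigenspace K3 K3_F 0"
    using hF_carrier(2) z unfolding ad_eigen_K3 by (simp_all add: F_hF K3_def K_carrier_closed)
  then show "bracket K3 K3_F K3_F = \<zero>\<^bsub>K3\<^esub>" "bracket K3 K3_F \<zero>\<^bsub>K3\<^esub> = \<zero>\<^bsub>K3\<^esub>"
    unfolding centralizer_eigen[OF K3_module, symmetric] by (simp_all add: centralizer_def)
  have "sub (hF 2 0) = hF 2 0"
  proof (rule sub_eqI[OF sub_carrier(1) _ hF_carrier(1)])
    show "Poly_Mapping.lookup (sub (hF 2 0)) U = Poly_Mapping.lookup (hF 2 0) U"
      if "U \<in> {{}, {0}, {1}, {2}, {3}, {0, 1}, {0, 2}, {0, 3}, {1, 2}, {1, 3}, {2, 3},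
        {0, 1, 2}, {0, 1, 3}, {0, 2, 3}, {1, 2, 3}, {0, 1, 2, 3}}" for U
      using that
      apply (simp only: insert_iff empty_iff)
      apply (elim disjE FalseE; simp add: lookup_sub_explicit lookup_hF lconst_simps(5) del: One_nat_def)
      done
  qed
  then have "kap (iota K3_F) = kap (hF 2 0, 0)" by (simp add: iota_def F_hF)
  also have "\<dots> = Hop (\<lambda>i. of_int ((vector [1, -1, -1, 1] :: int ^ 4) $ i))"
    unfolding kap_F by (rule arg_cong[where f = Hop]) (simp add: fun_eq_iff forall_4 vector_4_nth)
  finally show "kap (iota K3_F) = Hop (\<lambda>i. of_int ((vector [1, -1, -1, 1] :: int ^ 4) $ i))" .
qed

lemma K3_bracket_closed: "x \<in> carrier K3 \<Longrightarrow> y \<in> carrier K3 \<Longrightarrow> bracket K3 x y \<in> carrier K3"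
  by (simp add: K3_def K_bracket_carrier)

text \<open>The general element of the centralizer of $F$, with \<open>h\<close> as in
  \<open>K3_tens_formula\<close>.\<close>

definition z3 :: "laurent \<Rightarrow> laurent \<Rightarrow> slaurent \<Rightarrow> laurent grass" where
  "z3 f g h = gtens (gmon {}) f + gtens (gmon {2}) g + gtens (gmon {0, 1}) (fst h) + gtens (gmon {0, 1, 2}) (snd h)"

lemma lookup_z3: "Poly_Mapping.lookup (z3 f g h) U =
   (if U = {} then f else 0) + (if U = {2} then g else 0) + (if U = {0, 1} then fst h else 0) + (if U = {0, 1, 2} then snd h else 0)"
  by (simp add: z3_def lookup_add lookup_gmon eq_commute[of U])

lemma z3_carrier: "z3 f g h \<in> K_carrier 3"
  unfolding z3_def gtens_gmon by (intro K_carrier_closed; simp)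

lemma K3_centralizer: "centralizer K3 K3_F = {z3 f g h | f g h. True}"
proof (intro equalityI subsetI)
  fix x assume "x \<in> centralizer K3 K3_F"
  then have x: "x \<in> K_carrier 3" "\<And>U. gw 2 0 U \<noteq> 0 \<Longrightarrow> Poly_Mapping.lookup x U = 0"
    unfolding centralizer_eigen[OF K3_module] ad_eigen_K3 by auto
  let ?c = "Poly_Mapping.lookup x"
  have "x = z3 (?c {}) (?c {2}) (?c {0, 1}, ?c {0, 1, 2})"
  proof (rule poly_mapping_eqI)
    fix U
    show "?c U = Poly_Mapping.lookup (z3 (?c {}) (?c {2}) (?c {0, 1}, ?c {0, 1, 2})) U"
    proof (cases "U \<subseteq> {..<3}")
      case True
      show ?thesis using subsets_3[OF True]
        apply (simp only: insert_iff empty_iff)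
        apply (elim disjE FalseE; simp add: lookup_z3 x(2) gw_def small_set_eq_iff del: One_nat_def)
        done
    next
      case False
      then show ?thesis using x(1) z3_carrier unfolding K_carrier_iff by metis
    qed
  qed
  then show "x \<in> {z3 f g h | f g h. True}" by blast
next
  fix x assume "x \<in> {z3 f g h | f g h. True}"
  then obtain f g h where x: "x = z3 f g h" by blast
  have "Poly_Mapping.lookup x U = 0" if "gw 2 0 U \<noteq> 0" for U
  proof -
    have "gw 2 0 {} = 0" "gw 2 0 {2} = 0" "gw 2 0 {0, 1} = 0" "gw 2 0 {0, 1, 2} = 0"
      by (simp_all add: gw_def del: One_nat_def)
    then have "U \<noteq> {}" "U \<noteq> {2}" "U \<noteq> {0, 1}" "U \<noteq> {0, 1, 2}" using that by metis+
    then show ?thesis unfolding x by (simp only: lookup_z3 if_False add_0_left)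
  qed
  then show "x \<in> centralizer K3 K3_F"
    unfolding centralizer_eigen[OF K3_module] ad_eigen_K3 using z3_carrier x by simp
qed

lemma z3_pos: "x \<in> centralizer K3 K3_F <+>\<^bsub>K3\<^esub> pos_part K3 K3_F \<longleftrightarrow> (\<exists>f g h. \<exists>y\<in>pos_part K3 K3_F. x = z3 f g h + y)"
proof -
  have a: "add K3 = (+)" by (simp add: K3_def)
  show ?thesis unfolding set_add_def' K3_centralizer a by blast
qed

lemma K3_pos_carrier: "pos_part K3 K3_F \<subseteq> carrier K3"
  using subspD(1)[OF subsp_lin_span[OF K3_module, of "\<Union>k\<in>{1..}. ad_eigenspace K3 K3_F k"]]
  unfolding pos_part_def by (auto simp: ad_eigenspace_def)

lemma K3_act_def': "K3_tens_action l \<delta> u x v = (THE r. \<exists>f g h. \<exists>y\<in>pos_part K3 K3_F. x = z3 f g h + y \<and> r = K3_tens_formula l \<delta> u f g h v)"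
  by (simp add: K3_tens_action_def z3_def)

lemma K3_tens_simps [simp]:
  "carrier (K3_tens l \<delta> u) = UNIV" "zero (K3_tens l \<delta> u) = 0" "add (K3_tens l \<delta> u) = (+)"
  "smult (K3_tens l \<delta> u) c v = (lconst c * fst v, lconst c * snd v)"
  "hom_part (K3_tens l \<delta> u) p n = (if p then {0} \<times> lhom n else lhom n \<times> {0})"
  "action (K3_tens l \<delta> u) = K3_tens_action l \<delta> u"
  by (simp_all add: K3_tens_def)

lemma K3_tens_vs: "module complex_ring (K3_tens l \<delta> u)"
  by (rule vector_spaceI) (auto simp: lconst_simps algebra_simps prod_eq_iff)

lemma K3_tens_span: "carrier (K3_tens l \<delta> u) \<subseteq> lin_span (K3_tens l \<delta> u) (\<Union>p n. hom_part (K3_tens l \<delta> u) p n)"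
proof
  fix v :: slaurent
  let ?X = "\<Union>p n. hom_part (K3_tens l \<delta> u) p n"
  have X: "?X \<subseteq> carrier (K3_tens l \<delta> u)" by simp
  note sp = subspD[OF subsp_lin_span[OF K3_tens_vs X], unfolded K3_tens_simps(2-4)]
  have g: "(Poly_Mapping.single n c, 0) \<in> lin_span (K3_tens l \<delta> u) ?X" "(0, Poly_Mapping.single n c) \<in> lin_span (K3_tens l \<delta> u) ?X" for n c
  proof -
    have "(Poly_Mapping.single n c, 0) \<in> hom_part (K3_tens l \<delta> u) False n" "(0, Poly_Mapping.single n c) \<in> hom_part (K3_tens l \<delta> u) True n"
      by simp_all
    then show "(Poly_Mapping.single n c, 0) \<in> lin_span (K3_tens l \<delta> u) ?X" "(0, Poly_Mapping.single n c) \<in> lin_span (K3_tens l \<delta> u) ?X"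
      using lin_span_superset[OF K3_tens_vs, of ?X] by blast+
  qed
  have "(\<Sum>k\<in>K. Poly_Mapping.single k (Poly_Mapping.lookup f k), 0) \<in> lin_span (K3_tens l \<delta> u) ?X"
    "(0, \<Sum>k\<in>K. Poly_Mapping.single k (Poly_Mapping.lookup f k)) \<in> lin_span (K3_tens l \<delta> u) ?X" if "finite K" for K f
    using that
  proof (induction K rule: finite_induct)
    case empty
    show "(\<Sum>k\<in>{}. Poly_Mapping.single k (Poly_Mapping.lookup f k), 0) \<in> lin_span (K3_tens l \<delta> u) ?X"
      "(0, \<Sum>k\<in>{}. Poly_Mapping.single k (Poly_Mapping.lookup f k)) \<in> lin_span (K3_tens l \<delta> u) ?X" using g[of 0 0] by simp_all
  next
    case (insert k K)
    show "(\<Sum>k\<in>insert k K. Poly_Mapping.single k (Poly_Mapping.lookup f k), 0) \<in> lin_span (K3_tens l \<delta> u) ?X"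
      "(0, \<Sum>k\<in>insert k K. Poly_Mapping.single k (Poly_Mapping.lookup f k)) \<in> lin_span (K3_tens l \<delta> u) ?X"
      using sp(3)[OF g(1)[of k "Poly_Mapping.lookup f k"] insert.IH(1)] sp(3)[OF g(2)[of k "Poly_Mapping.lookup f k"] insert.IH(2)] insert(1,2)
      by simp_all
  qed
  note part = this
  have "(f, 0) \<in> lin_span (K3_tens l \<delta> u) ?X" "(0, f) \<in> lin_span (K3_tens l \<delta> u) ?X" for f
    using part[OF finite_keys[of f], of f] by (simp_all only: sum_of_monomials[symmetric])
  from sp(3)[OF this(1)[of "fst v"] this(2)[of "snd v"]] show "v \<in> lin_span (K3_tens l \<delta> u) ?X" by simp
qed

lemma K3_monomial: "S \<subseteq> {..<3} \<Longrightarrow> Poly_Mapping.single S (lconst c) \<in> hom_part K3 (odd (card S)) 0"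
  using K_carrier_closed(4)[of S 3 "lconst c"]
  by (auto simp: K3_def lookup_single when_def split: if_splits)

lemma rt_cancel: "lconst rt * (lconst (2 * rt) * f) = f" "lconst (2 * rt) * (lconst rt * f) = f" "lconst rt * (lconst (1 / rt) * f) = f"
proof -
  have "rt * (2 * rt) = 2 * (rt * rt)" by (simp only: mult.left_commute)
  then have "rt * (2 * rt) = 1" by (simp only: rt_square(1)) simp
  then have e: "rt * (2 * rt) = 1" "2 * rt * rt = 1" by (simp_all only: mult.commute)
  show "lconst rt * (lconst (2 * rt) * f) = f" "lconst (2 * rt) * (lconst rt * f) = f"
    by (rule lconst_cancel[OF e(1)], rule lconst_cancel[OF e(2)])
  show "lconst rt * (lconst (1 / rt) * f) = f" by (rule lconst_cancel) (simp add: rt_nonzero)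
qed

text \<open>The top eigenspace for \<open>K(3)\<close> is free of rank two over Laurent polynomials,
  spanned by $x_1$ and $x_3^*$. The factor $2/\sqrt 2 = \sqrt 2$ makes \<open>\<xi>(g)\<close> act on it
  as on \<open>Tens\<close>: it maps $x_3^*$ to $x_1$ with the coefficient $1/\sqrt 2$, and $\xi$ to $1$
  with the coefficient $1$.\<close>

definition j3 :: "slaurent \<Rightarrow> lvec \<times> lvec" where
  "j3 v = (axis 1 (fst v), axis 3 (lconst (2 * rt) * snd v))"

lemma j3_action: "rho u (kap (iota (z3 f g h))) (j3 v) = j3 (K3_tens_formula (1/2) (1/4) u f g h v)"
proof -
  have "fst (rho u (kap (iota (z3 f g h))) (j3 v)) $ i = fst (j3 (K3_tens_formula (1/2) (1/4) u f g h v)) $ i \<and>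
     snd (rho u (kap (iota (z3 f g h))) (j3 v)) $ i = snd (j3 (K3_tens_formula (1/2) (1/4) u f g h v)) $ i" for i
    apply (cases v, cases h)
    apply (rule forall_4[THEN iffD2, rule_format, of "\<lambda>i. fst (rho u (kap (iota (z3 f g h))) (j3 v)) $ i = fst (j3 (K3_tens_formula (1/2) (1/4) u f g h v)) $ i \<and>
     snd (rho u (kap (iota (z3 f g h))) (j3 v)) $ i = snd (j3 (K3_tens_formula (1/2) (1/4) u f g h v)) $ i"])
    apply (simp add: j3_def K3_action_simps lookup_z3 small_set_eq_iff axis_simps K3_tens_formula_def smul_def sD_def s_dxi_def plus_prod_def del: One_nat_def)
    apply (intro conjI poly_mapping_eqI; simp add: lconst_cs cs_simps coeff_simps rt_square algebra_simps)
    done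
  then show ?thesis by (simp add: prod_eq_iff vec_eq_iff)
qed


text \<open>Besides the two top coordinates only one letter, $\eta_1\xi$, is needed to reach the
  remaining coordinates.\<close>

lemma S_K3_natural: "smodule_isomorphic K3 (natmod kio u {1, 2} {3, 4} False) (S_K3 u)"
proof -
  interpret nm: natural_module K3 kio u "{1, 2}" "{3, 4}" False by (rule K3_natural)
  define M where "M = K3_tens (1/2) (1/4) u"
  have Mc: "carrier M = UNIV" by (simp add: M_def)
  have w: "(vector [1, -1, -1, 1] :: int ^ 4) $ i \<le> 1" "- (vector [1, -1, -1, 1] :: int ^ 4) $ i \<le> 1" for i
    using forall_4[of "\<lambda>i. (vector [1, -1, -1, 1] :: int ^ 4) $ i \<le> 1 \<and> - (vector [1, -1, -1, 1] :: int ^ 4) $ i \<le> 1"]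
    by (simp_all add: vector_4_nth)
  have rt2: "lconst (2 * rt) \<noteq> 0" using rt_nonzero lconst_mult_eq_0[of "2 * rt" 1] by simp
  have inj: "inj j3" by (rule injI) (simp add: j3_def axis_inj rt2 prod_eq_iff)
  have jc: "j3 v \<in> coord {1, 2} {3, 4}" for v by (simp add: j3_def coord_4 axis_simps)
  have setting: "weight_setting K3 K3_F M nm.N j3 1"
  proof (rule nm.weight_settingI[OF K3_F_facts(1,4,2,3) K3_span])
    show "(vector [1, -1, -1, 1] :: int ^ 4) $ i = 1" if "fst (j3 v) $ i \<noteq> 0" for v i
      using that by (auto simp: j3_def axis_simps vector_4_nth split: if_splits)
    show "- (vector [1, -1, -1, 1] :: int ^ 4) $ i = 1" if "snd (j3 v) $ i \<noteq> 0" for v i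
      using that by (auto simp: j3_def axis_simps vector_4_nth split: if_splits)
    show "j3 (v \<oplus>\<^bsub>M\<^esub> v') = j3 v + j3 v'" for v v' by (simp add: M_def j3_def axis_simps distrib_left)
    show "j3 (c \<odot>\<^bsub>M\<^esub> v) = psc (lconst c) (j3 v)" for c v
      by (simp add: M_def j3_def axis_simps psc_def mult.left_commute[of _ "lconst c"])
    show "j3 v \<in> nat_hom False p n" if "v \<in> hom_part M p n" for v p n
      using that by (cases p) (auto simp: M_def j3_def axis_simps nat_hom_def axis_zero)
  qed (use K3_bracket_closed K3_tens_vs w jc inj in \<open>simp_all add: M_def\<close>)
  interpret W: weight_setting K3 K3_F M nm.N j3 1 by (rule setting)
  let ?B = "centralizer K3 K3_F <+>\<^bsub>K3\<^esub> pos_part K3 K3_F"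
  have z3c: "z3 f g h \<in> carrier K3" for f g h using z3_carrier by (simp add: K3_def)
  have kpos: "rho u (kap (iota (z3 f g h + y))) (j3 v) = rho u (kap (iota (z3 f g h))) (j3 v)"
    if y: "y \<in> pos_part K3 K3_F" for f g h y v
  proof -
    have "action nm.N (z3 f g h \<oplus>\<^bsub>K3\<^esub> y) (j3 v) = action nm.N (z3 f g h) (j3 v) + action nm.N y (j3 v)"
      by (rule nm.nat_act_add[OF z3c]) (use K3_pos_carrier y jc in auto)
    then show ?thesis using W.pos_part_annihilates[OF y, of v] by (simp add: Mc) (simp add: K3_def)
  qed
  have act': "j3 (action M x v) = action nm.N x (j3 v)" if x: "x \<in> ?B" for x v
  proof -
    obtain f g h y where x': "y \<in> pos_part K3 K3_F" "x = z3 f g h + y" using x unfolding z3_pos by blast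
    define fm where "fm f g h = K3_tens_formula (1/2) (1/4) u f g h v" for f g h
    define Q where "Q r \<longleftrightarrow> (\<exists>f g h. \<exists>y\<in>pos_part K3 K3_F. x = z3 f g h + y \<and> r = fm f g h)" for r
    have "j3 r = rho u (kap (iota x)) (j3 v)" if Q: "Q r" for r
    proof -
      obtain f g h y where q: "y \<in> pos_part K3 K3_F" "x = z3 f g h + y" "r = fm f g h"
        using Q unfolding Q_def by blast
      show ?thesis unfolding q(2,3) kpos[OF q(1)] j3_action fm_def ..
    qed
    moreover have "Q (fm f g h)" unfolding Q_def using x' by blast
    ultimately have "j3 (THE r. Q r) = rho u (kap (iota x)) (j3 v)" by (rule the_action[OF _ _ inj])
    then show ?thesis by (simp only: M_def K3_tens_simps K3_act_def' natmod_simps Q_def fm_def)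
  qed
  have "highest_weight_model K3 K3_F M nm.N j3 1 (nat_pr False) (1, 0)"
  proof (rule highest_weight_model.intro[OF setting], rule highest_weight_model_axioms.intro)
    show "carrier M \<subseteq> lin_span M (\<Union>p n. hom_part M p n)" unfolding M_def by (rule K3_tens_span)
    show "\<exists>b\<in>?B. v = action M b (1, 0)" for v
    proof
      \<comment> \<open>$\zeta_1\eta_1$ has weight $1/2$, so multiplication by \<open>v\<close> comes from $2v$\<close>
      let ?h = "(fst v + fst v, snd v + snd v)"
      have "z3 0 0 ?h + 0 = z3 0 0 ?h" "0 \<in> pos_part K3 K3_F"
        using subspD(2)[OF W.subsp_pos_part] by (simp_all add: K3_def)
      then show b: "z3 0 0 ?h \<in> ?B" unfolding z3_pos by metis
      have "K3_tens_formula (1/2) (1/4) u 0 0 ?h (1, 0) = v"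
        by (simp add: K3_tens_formula_def smul_def s_dxi_def prod_eq_iff mult.assoc[symmetric] half_two)
      then have "j3 (action M (z3 0 0 ?h) (1, 0)) = j3 v"
        unfolding act'[OF b] natmod_simps j3_action by simp
      then show "v = action M (z3 0 0 ?h) (1, 0)" using inj by (simp add: inj_eq)
    qed
    show "simple_smodule K3 nm.N" by (rule V_plus_simple)
    show "carrier nm.N \<subseteq> lin_span nm.N (\<Union>p n. hom_part nm.N p n)" by (rule nm.nat_span)
    show "hom_part nm.N p n \<subseteq> lin_span nm.N (j3 ` hom_part M p n \<union>
      {action nm.N x (j3 v) |x v q m. x \<in> hom_part K3 q m \<and> v \<in> hom_part M (p \<noteq> q) (n - m)})" (is "_ \<subseteq> lin_span _ ?G") for p n
    proof
      fix x assume x: "x \<in> hom_part nm.N p n"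
      have op: "action nm.N y (j3 v) \<in> carrier nm.N" if "y \<in> hom_part K3 q m" for y q m v
        using nm.inv[OF subsetD[OF K3_hom_carrier that] jc] by simp
      have top: "j3 v \<in> ?G" if "v \<in> hom_part M p n" for v using that by blast
      have low: "rho u (kap (iota (Poly_Mapping.single {1, 2} (lconst (1 / rt))))) (j3 v) \<in> ?G" if v: "v \<in> hom_part M p n" for v
      proof -
        have "Poly_Mapping.single {1, 2} (lconst (1 / rt)) \<in> hom_part K3 False 0"
          using K3_monomial[of "{1, 2}" "1 / rt"] by (simp add: lessThan_3 del: One_nat_def)
        moreover have "v \<in> hom_part M (p \<noteq> False) (n - 0)" using v by simp
        moreover have "rho u (kap (iota (Poly_Mapping.single {1, 2} (lconst (1 / rt))))) (j3 v) =
          action nm.N (Poly_Mapping.single {1, 2} (lconst (1 / rt))) (j3 v)" by simp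
        ultimately show ?thesis by blast
      qed
      have l: "fst x $ i \<in> lhom n" "snd x $ i \<in> lhom n" for i using x by (auto simp: nat_hom_def)
      show "x \<in> lin_span nm.N ?G"
      proof (rule span_axes_halves[OF K3_natural(1)])
        show "?G \<subseteq> coord {1, 2} {3, 4}" using jc op unfolding natmod_simps(1) by blast
        show "(axis i (fst x $ i), 0) \<in> ?G" if i: "i \<in> {1, 2}" and nz: "fst x \<noteq> 0" for i
        proof -
          have "\<not> p" using x nz by (auto simp: nat_hom_def)
          then have m: "(fst x $ i, 0) \<in> hom_part M p n" using l(1) by (simp add: M_def)
          show ?thesis
          proof (cases "i = 1")
            case True
            then show ?thesis using top[OF m] by (simp add: j3_def axis_zero)
          next
            case False
            then have i2: "i = 2" using i by simp
            have "rho u (kap (iota (Poly_Mapping.single {1, 2} (lconst (1 / rt))))) (j3 (fst x $ i, 0)) = (axis i (fst x $ i), 0)"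
              unfolding i2 by (simp add: j3_def K3_monomial_simps axis_simps axis_zero prod_eq_iff vec_eq_iff forall_4 rt_cancel mult.assoc del: One_nat_def)
            then show ?thesis using low[OF m] by simp
          qed
        qed
        show "(0, axis i (snd x $ i)) \<in> ?G" if i: "i \<in> {3, 4}" and nz: "snd x \<noteq> 0" for i
        proof -
          have "p" using x nz by (auto simp: nat_hom_def split: if_splits)
          then have m: "(0, lconst rt * snd x $ i) \<in> hom_part M p n" using l(2) by (simp add: M_def)
          show ?thesis
          proof (cases "i = 3")
            case True
            then show ?thesis using top[OF m] by (simp add: j3_def axis_zero rt_cancel)
          next
            case False
            then have i2: "i = 4" using i by simp
            have "rho u (kap (iota (Poly_Mapping.single {1, 2} (lconst (1 / rt))))) (j3 (0, lconst rt * snd x $ i)) = (0, axis i (snd x $ i))"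
              unfolding i2 by (simp add: j3_def K3_monomial_simps axis_simps axis_zero prod_eq_iff vec_eq_iff forall_4 rt_cancel mult.assoc del: One_nat_def)
            then show ?thesis using low[OF m] by simp
          qed
        qed
      qed (use x in simp)
    qed
  qed (use act' nat_pr_same nat_pr_other nat_pr_add in \<open>auto simp: M_def\<close>)
  then interpret H: highest_weight_model K3 K3_F M nm.N j3 1 "nat_pr False" "(1, 0)" .
  show ?thesis using H.isomorphic_highest_quotient by (simp add: S_K3_def K3_V_def M_def)
qed

section \<open>The decomposition\<close>

definition pj :: "4 set \<Rightarrow> 4 set \<Rightarrow> lvec \<times> lvec \<Rightarrow> lvec \<times> lvec" where
  "pj A A' x = (\<chi> i. if i \<in> A then fst x $ i else 0, \<chi> i. if i \<in> A' then snd x $ i else 0)"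

text \<open>The two projections commute with the action because both halves are invariant and sum to the
  whole module.\<close>

lemma natural_decomposition:
  "smodule_isomorphic K4hat (natmod kap u UNIV UNIV s) (direct_sum (natmod kap u {1, 2} {3, 4} s) (natmod kap u {3, 4} {1, 2} s))"
proof -
  let ?P = "pj {1, 2} {3, 4}" and ?Q = "pj {3, 4} {1, 2}"
  define h where "h x = (?P x, ?Q x)" for x
  have pc: "?P x \<in> coord {1, 2} {3, 4}" "?Q x \<in> coord {3, 4} {1, 2}" for x by (simp_all add: pj_def coord_4)
  have sum: "?P x + ?Q x = x" for x by (simp add: pj_def prod_eq_iff vec_eq_iff forall_4)
  have split: "?P (a + b) = a" "?Q (a + b) = b" if "a \<in> coord {1, 2} {3, 4}" "b \<in> coord {3, 4} {1, 2}" for a b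
    using that by (simp_all add: pj_def coord_4 prod_eq_iff vec_eq_iff forall_4)
  have act: "h (rho u (kap x) v) = (rho u (kap x) (?P v), rho u (kap x) (?Q v))" if x: "x \<in> carrier K4hat" for x v
  proof -
    have c: "kap x \<in> carrier CK6" using CK6_carrierI[OF kap_params] by (simp add: kap_def)
    have "rho u (kap x) v = rho u (kap x) (?P v) + rho u (kap x) (?Q v)"
      unfolding rho_arg(1)[OF c, symmetric] sum ..
    then show ?thesis using split[OF halves_invariant(1)[OF pc(1)] halves_invariant(2)[OF pc(2)]] by (simp add: h_def)
  qed
  have hom: "?P x \<in> nat_hom s p n" "?Q x \<in> nat_hom s p n" if "x \<in> nat_hom s p n" for x p n
    using that by (auto simp: pj_def nat_hom_def vec_eq_iff)
  have "bij_betw h (coord UNIV UNIV) (coord {1, 2} {3, 4} \<times> coord {3, 4} {1, 2})"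
    by (rule bij_betw_byWitness[where f' = "\<lambda>(a, b). a + b"]) (use pc sum split in \<open>auto simp: h_def coord_def\<close>)
  moreover have "h ` (coord UNIV UNIV \<inter> nat_hom s p n) =
    (coord {1, 2} {3, 4} \<inter> nat_hom s p n) \<times> (coord {3, 4} {1, 2} \<inter> nat_hom s p n)" for p n
  proof
    show "h ` (coord UNIV UNIV \<inter> nat_hom s p n) \<subseteq>
      (coord {1, 2} {3, 4} \<inter> nat_hom s p n) \<times> (coord {3, 4} {1, 2} \<inter> nat_hom s p n)"
      using pc hom by (auto simp: h_def)
    show "(coord {1, 2} {3, 4} \<inter> nat_hom s p n) \<times> (coord {3, 4} {1, 2} \<inter> nat_hom s p n) \<subseteq>
      h ` (coord UNIV UNIV \<inter> nat_hom s p n)"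
    proof
      fix z assume z: "z \<in> (coord {1, 2} {3, 4} \<inter> nat_hom s p n) \<times> (coord {3, 4} {1, 2} \<inter> nat_hom s p n)"
      then have "z = h (fst z + snd z)" using split[of "fst z" "snd z"] by (auto simp: h_def prod_eq_iff)
      moreover have "fst z + snd z \<in> coord UNIV UNIV \<inter> nat_hom s p n"
        using z nat_hom_closed(2)[of "fst z" s p n "snd z"] by (auto simp: coord_def)
      ultimately show "z \<in> h ` (coord UNIV UNIV \<inter> nat_hom s p n)" by (rule image_eqI)
    qed
  qed
  moreover have "h (v + w) = (?P v + ?P w, ?Q v + ?Q w)" "h (psc c v) = (psc c (?P v), psc c (?Q v))" for v w c
    by (simp_all add: h_def pj_def psc_def prod_eq_iff vec_eq_iff forall_4)
  ultimately have "iso_via K4hat (natmod kap u UNIV UNIV s) (direct_sum (natmod kap u {1, 2} {3, 4} s) (natmod kap u {3, 4} {1, 2} s)) h"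
    using act by (simp add: iso_via_def direct_sum_def) (simp add: h_def)
  then show ?thesis by (auto simp: smodule_isomorphic_via)
qed

text \<open>The parities: the even half of $\mathrm{Nat}(u)$ is $V$, and the top of $S^-(u)$ lies in
  $V^*$, so exactly the modules involving $S^-(u)$ are shifted.\<close>

theorem theoremE:
  shows "\<exists>\<iota> \<kappa>.
    lie_superalgebra_embedding K3 K4hat \<iota> \<and>
    lie_superalgebra_embedding K4hat CK6 \<kappa> \<and>
    (\<forall>u :: complex.
      (\<exists>p q. smodule_isomorphic K4hat (restrict_along \<kappa> (T_CK6 u))
         (direct_sum (parity_shift p (S_plus u)) (parity_shift q (S_minus u)))) \<and>
      (\<exists>p. smodule_isomorphic K3 (restrict_along \<iota> (S_plus u)) (parity_shift p (S_K3 u))) \<and>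
      (\<exists>p. smodule_isomorphic K3 (restrict_along \<iota> (S_minus u)) (parity_shift p (S_K3 u))))"
proof (intro exI[of _ iota] exI[of _ kap] conjI allI)
  show "lie_superalgebra_embedding K3 K4hat iota" "lie_superalgebra_embedding K4hat CK6 kap"
    by (rule iota_embedding kap_embedding)+
  have i: "iota ` carrier K3 \<subseteq> carrier K4hat" and k: "kap ` carrier K4hat \<subseteq> carrier CK6"
    using iota_embedding kap_embedding by (simp_all add: lie_superalgebra_embedding_def)
  fix u
  note shift_K3 = iso_shift[OF S_K3_natural[of u], unfolded natmod_shift]
  have "smodule_isomorphic K4hat (restrict_along kap (T_CK6 u)) (natmod kap u UNIV UNIV False)"
    using iso_restrict[OF T_natural k] by (simp add: natmod_restrict)
  from iso_trans[OF this natural_decomposition]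
  have "smodule_isomorphic K4hat (restrict_along kap (T_CK6 u))
      (direct_sum (natmod kap u {1, 2} {3, 4} False) (natmod kap u {3, 4} {1, 2} False))" .
  moreover have "smodule_isomorphic K4hat (direct_sum (natmod kap u {1, 2} {3, 4} False) (natmod kap u {3, 4} {1, 2} False))
      (direct_sum (parity_shift False (S_plus u)) (parity_shift True (S_minus u)))"
    using iso_direct_sum[OF iso_shift[OF S_plus_natural(2), of False] iso_shift[OF S_minus_natural(2), of True]]
    by (simp add: natmod_shift)
  ultimately have "smodule_isomorphic K4hat (restrict_along kap (T_CK6 u))
      (direct_sum (parity_shift False (S_plus u)) (parity_shift True (S_minus u)))"
    by (rule iso_trans)
  then show "\<exists>p q. smodule_isomorphic K4hat (restrict_along kap (T_CK6 u))
         (direct_sum (parity_shift p (S_plus u)) (parity_shift q (S_minus u)))" by blast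
  have "smodule_isomorphic K3 (restrict_along iota (S_plus u)) (natmod kio u {1, 2} {3, 4} False)"
    using iso_restrict[OF S_plus_natural(1) i] by (simp add: natmod_restrict)
  then have "smodule_isomorphic K3 (restrict_along iota (S_plus u)) (parity_shift False (S_K3 u))"
    using iso_trans shift_K3[of False] by simp blast
  then show "\<exists>p. smodule_isomorphic K3 (restrict_along iota (S_plus u)) (parity_shift p (S_K3 u))" ..
  have "smodule_isomorphic K3 (restrict_along iota (S_minus u)) (natmod kio u {3, 4} {1, 2} True)"
    using iso_restrict[OF S_minus_natural(1) i] by (simp add: natmod_restrict)
  then have "smodule_isomorphic K3 (restrict_along iota (S_minus u)) (natmod kio u {1, 2} {3, 4} True)"
    using halves_isomorphic(2) by (rule iso_trans)
  then have "smodule_isomorphic K3 (restrict_along iota (S_minus u)) (parity_shift True (S_K3 u))"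
    using iso_trans shift_K3[of True] by simp blast
  then show "\<exists>p. smodule_isomorphic K3 (restrict_along iota (S_minus u)) (parity_shift p (S_K3 u))" ..
qed

end
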